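(* The algebra $\mathcal B$ (the virtual group algebra of $S(\infty)$) is isomorphic, as an associative algebra over $\mathbb C$, to the algebra $\mathcal A$ defined by the centralizer construction.
   Context: **Symmetric groups.** $\mathbb N=\{1,2,\dots\}$, $\mathbb N_n=\{1,\dots,n\}$. $S(n)$ is the group of permutations of $\mathbb N_n$, realized by permutation matrices ($g_{ij}=1$ if $g(j)=i$, and $g_{ij}=0$ otherwise); $S(n)\subset S(n+1)$ in the natural way, and $S(\infty)=\bigcup_n S(n)$ is the group of finitary permutations of $\mathbb N$. For $0\le m\le n$, $S_m(n)\subseteq S(n)$ is the pointwise stabilizer of $1,\dots,m$. For $g\in S(\infty)$, $\deg g$ is the number of points of $\mathbb N$ not fixed by $g$; for an element of $\mathbb C[S(\infty)]$, $\deg(\sum\alpha(g)g)=\max\{\deg g:\alpha(g)\neq0\}$. **Representations $T^\lambda$.** $\mathbb Y$ is the set of all Young diagrams (partitions), including the empty one $\varnothing$; $|\lambda|$ is the number of boxes; $\pi^\lambda$ is the irreducible unitary representation of $S(|\lambda|)$ indexed by $\lambda$ in the standard way, with space $H(\pi^\lambda)$. For $\lambda=\varnothing$, $T^\varnothing$ is the trivial one-dimensional representation of $S(\infty)$. For $|\lambda|=\ell\ge1$, let $\Omega(\ell,\infty)$ be the set of $\{0,1\}$-matrices of format $\mathbb N_\ell\times\mathbb N$ with exactly one $1$ in each row and at most one $1$ in each column. $H(T^\lambda)$ is the Hilbert space of functions $\phi:\Omega(\ell,\infty)\to H(\pi^\lambda)$ with $\sum_\omega\|\phi(\omega)\|^2<\infty$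 and $\phi(s\omega)=\pi^\lambda(s)\phi(\omega)$ for $s\in S(\ell)$, and $(T^\lambda(g)\phi)(\omega)=\phi(\omega g)$ for $g\in S(\infty)$. (The $T^\lambda$, $\lambda\in\mathbb Y$, are exactly the irreducible tame representations of $S(\infty)$.) **The algebra $\mathcal B$.** For $0\le m\le n$, $\mathcal B_m(n)$ is the centralizer of $S_m(n)$ in $\mathbb C[S(n)]$. A sequence $\alpha=(\alpha_1,\alpha_2,\dots)$ in $\mathbb C[S(\infty)]$ with $\alpha_n\in\mathbb C[S(n)]$ for all large $n$ is called convergent if: (1) for every $\lambda\in\mathbb Y$ the operators $T^\lambda(\alpha_n)$ have a limit $\overline T^\lambda(\alpha)$ in the strong operator topology; (2) there is $m$ such that $\alpha_n\in\mathcal B_m(n)$ for all large $n$; (3) $\sup_n\deg\alpha_n<\infty$. Convergent sequences $\alpha,\beta$ are equivalent if $\overline T^\lambda(\alpha)=\overline T^\lambda(\beta)$ for all $\lambda\in\mathbb Y$. $\mathcal B$ is the set of equivalence classes of convergent sequences; it is an associative algebra under component-wise operations. **The algebra $\mathcal A$ (centralizer construction).** $\Gamma(n)$ is the semigroup of $n\times n$ $\{0,1\}$-matrices with at most one $1$ in each row and each column, under matrix multiplication ($\Gamma(0)$ is the one-element semigroup). For $\gamma\in\Gamma(n)$, $\deg\gamma$ is the number of zeros on the diagonal; for elements of $\mathcal A(n):=\mathbb C[\Gamma(n)]$, the degree is the maximum of degrees of semigroup elements occurring with nonzero coefficient. $\theta_{n,n-1}:\mathcal A(n)\to\mathcal A(n-1)$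 is the linear extension of the map $\Gamma(n)\to\Gamma(n-1)$ deleting the last row and column. For $0\le m\le n$, $\Gamma_m(n)\subseteq\Gamma(n)$ is the subsemigroup of matrices whose first $m$ diagonal entries equal $1$, and $\mathcal A_m(n)$ is the centralizer of $\Gamma_m(n)$ in $\mathcal A(n)$. The map $\theta_{n,n-1}$ restricts to unital algebra morphisms $\mathcal A_m(n)\to\mathcal A_m(n-1)$ for $0\le m\le n-1$. $\mathcal A_m$ is the algebra of sequences $a=(a_n)_{n\ge m}$ with $a_n\in\mathcal A_m(n)$, $a_{n-1}=\theta_{n,n-1}(a_n)$ for $n>m$, and $\sup_n\deg a_n<\infty$, with component-wise operations. Forgetting the first term embeds $\mathcal A_m\subset\mathcal A_{m+1}$, and $\mathcal A:=\bigcup_m\mathcal A_m$. *)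

theory Defs
  imports
    "HOL-Analysis.Infinite_Sum"
    "HOL-Library.Poly_Mapping"
    "HOL-Combinatorics.Perm"
    "HOL-Combinatorics.Permutations"
    "HOL-Algebra.QuotRing"
    "HOL-Algebra.Module"
    "Jordan_Normal_Form.Matrix"
begin

unbundle permutation_syntax

text \<open>
  Points and matrix indices start at 0, so that \<open>{..<n}\<close> plays the role of \<open>{1, \<dots>, n}\<close> and
  the type \<^typ>\<open>nat perm\<close> of finitely supported permutations of \<^typ>\<open>nat\<close> is the whole
  group \<open>S(\<infinity>)\<close>. Its multiplication is composition, i.e. the product of permutation matrices.
\<close>

section \<open>Semigroup algebras\<close>

text \<open>The multiplication that theory Poly_Mapping puts on \<open>'g \<Rightarrow>\<^sub>0 complex\<close> is the one of an
  additively written monoid \<open>'g\<close>; here \<open>'g\<close> is written multiplicatively. Only \<open>times\<close> is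
  required because matrices of all sizes share one type.\<close>

definition conv :: "('g::times \<Rightarrow>\<^sub>0 complex) \<Rightarrow> ('g \<Rightarrow>\<^sub>0 complex) \<Rightarrow> ('g \<Rightarrow>\<^sub>0 complex)" (infixl "\<star>" 70)
  where "a \<star> b = (\<Sum>u\<in>Poly_Mapping.keys a. \<Sum>v\<in>Poly_Mapping.keys b.
           Poly_Mapping.single (u * v) (Poly_Mapping.lookup a u * Poly_Mapping.lookup b v))"

definition scale :: "complex \<Rightarrow> ('g \<Rightarrow>\<^sub>0 complex) \<Rightarrow> ('g \<Rightarrow>\<^sub>0 complex)"
  where "scale c a = Poly_Mapping.map ((*) c) a"

abbreviation delta :: "'g \<Rightarrow> ('g \<Rightarrow>\<^sub>0 complex)"
  where "delta g \<equiv> Poly_Mapping.single g 1"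

definition span_of :: "'g set \<Rightarrow> ('g \<Rightarrow>\<^sub>0 complex) set"
  where "span_of G = {a. Poly_Mapping.keys a \<subseteq> G}"

definition centralizer :: "'g::times set \<Rightarrow> 'g set \<Rightarrow> ('g \<Rightarrow>\<^sub>0 complex) set"
  where "centralizer H G = {a \<in> span_of G. \<forall>h\<in>H. delta h \<star> a = a \<star> delta h}"

definition lin_ext :: "('g \<Rightarrow> 'h) \<Rightarrow> ('g \<Rightarrow>\<^sub>0 complex) \<Rightarrow> ('h \<Rightarrow>\<^sub>0 complex)"
  where "lin_ext f a = (\<Sum>g\<in>Poly_Mapping.keys a. Poly_Mapping.single (f g) (Poly_Mapping.lookup a g))"

text \<open>The zero element gets degree 0.\<close>

definition alg_deg :: "('g \<Rightarrow> nat) \<Rightarrow> ('g \<Rightarrow>\<^sub>0 complex) \<Rightarrow> nat"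
  where "alg_deg d a = Max (insert 0 (d ` Poly_Mapping.keys a))"

section \<open>Symmetric groups\<close>

definition Sn :: "nat \<Rightarrow> nat perm set"
  where "Sn n = {g. \<forall>i\<ge>n. g \<langle>$\<rangle> i = i}"

definition Sn_stab :: "nat \<Rightarrow> nat \<Rightarrow> nat perm set"
  where "Sn_stab m n = {g \<in> Sn n. \<forall>i<m. g \<langle>$\<rangle> i = i}"

definition perm_deg :: "nat perm \<Rightarrow> nat"
  where "perm_deg g = card (affected g)"

section \<open>The irreducible representations of the finite symmetric groups\<close>

definition young_diagrams :: "nat list set"
  where "young_diagrams = {lam. sorted_wrt (\<ge>) lam \<and> 0 \<notin> set lam}"

text \<open>The boxes of the diagram are numbered \<open>0, 1, \<dots>\<close> row by row, from left to right;
  \<open>box_row\<close> and \<open>box_col\<close> give the position of the box with number \<open>k\<close>.\<close>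

definition box_row :: "nat list \<Rightarrow> nat \<Rightarrow> nat"
  where "box_row lam k = (LEAST r. k < sum_list (take (Suc r) lam))"

definition box_col :: "nat list \<Rightarrow> nat \<Rightarrow> nat"
  where "box_col lam k = k - sum_list (take (box_row lam k) lam)"

definition row_group :: "nat list \<Rightarrow> nat perm set"
  where "row_group lam =
    {g \<in> Sn (sum_list lam). \<forall>k<sum_list lam. box_row lam (g \<langle>$\<rangle> k) = box_row lam k}"

definition col_group :: "nat list \<Rightarrow> nat perm set"
  where "col_group lam =
    {g \<in> Sn (sum_list lam). \<forall>k<sum_list lam. box_col lam (g \<langle>$\<rangle> k) = box_col lam k}"

definition young_symmetrizer :: "nat list \<Rightarrow> (nat perm \<Rightarrow>\<^sub>0 complex)"
  where "young_symmetrizer lam =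
    (\<Sum>p\<in>row_group lam. delta p) \<star>
    (\<Sum>q\<in>col_group lam. Poly_Mapping.single q (of_int (sign (apply q))))"

text \<open>
  \<open>\<pi>\<^sup>\<lambda>\<close> is realized on the left ideal generated by the Young symmetrizer, on which the group acts
  by left multiplication; with respect to the inner product in which the group elements are
  orthonormal this is a unitary representation. In this labelling a one-row diagram gives the
  trivial and a one-column diagram the sign representation.
\<close>

definition H_pi :: "nat list \<Rightarrow> (nat perm \<Rightarrow>\<^sub>0 complex) set"
  where "H_pi lam = {x \<star> young_symmetrizer lam | x. x \<in> span_of (Sn (sum_list lam))}"

definition pi_rep :: "nat perm \<Rightarrow> (nat perm \<Rightarrow>\<^sub>0 complex) \<Rightarrow> (nat perm \<Rightarrow>\<^sub>0 complex)"
  where "pi_rep s x = delta s \<star> x"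

definition norm_pi :: "(nat perm \<Rightarrow>\<^sub>0 complex) \<Rightarrow> real"
  where "norm_pi x = sqrt (\<Sum>g\<in>Poly_Mapping.keys x. (cmod (Poly_Mapping.lookup x g))\<^sup>2)"

section \<open>The representations \<open>T\<^sup>\<lambda>\<close>\<close>

text \<open>Infinite matrices; all products formed below have finitely supported sums as entries, which
  is what \<^const>\<open>Sum_any\<close> requires.\<close>

type_synonym inf_mat = "nat \<Rightarrow> nat \<Rightarrow> nat"

definition perm_mat :: "nat perm \<Rightarrow> inf_mat"
  where "perm_mat g = (\<lambda>i j. if g \<langle>$\<rangle> j = i then 1 else 0)"

definition mat_prod :: "inf_mat \<Rightarrow> inf_mat \<Rightarrow> inf_mat"
  where "mat_prod A B = (\<lambda>i j. Sum_any (\<lambda>k. A i k * B k j))"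

text \<open>Matrices with rows indexed by \<open>{..<l}\<close> are padded with zero rows.\<close>

definition Omega :: "nat \<Rightarrow> inf_mat set"
  where "Omega l = {w. (\<forall>i j. w i j \<in> {0, 1}) \<and> (\<forall>i\<ge>l. \<forall>j. w i j = 0) \<and>
                       (\<forall>i<l. \<exists>!j. w i j = 1) \<and>
                       (\<forall>j. \<forall>i i'. w i j = 1 \<and> w i' j = 1 \<longrightarrow> i = i')}"

text \<open>Elements of \<open>H(T\<^sup>\<lambda>)\<close> are extended by zero outside \<open>\<Omega>(\<ell>, \<infinity>)\<close>. For the empty diagram
  \<open>\<Omega>(0, \<infinity>)\<close> is a single point fixed by \<open>S(\<infinity>)\<close> and \<open>H_pi [] = \<complex> \<cdot> 1\<close>, so that this is
  the trivial one-dimensional representation.\<close>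

type_synonym T_vec = "inf_mat \<Rightarrow> (nat perm \<Rightarrow>\<^sub>0 complex)"

definition H_T :: "nat list \<Rightarrow> T_vec set"
  where "H_T lam = {\<phi>. (\<forall>w. w \<notin> Omega (sum_list lam) \<longrightarrow> \<phi> w = 0) \<and>
     (\<forall>w\<in>Omega (sum_list lam). \<phi> w \<in> H_pi lam) \<and>
     (\<lambda>w. (norm_pi (\<phi> w))\<^sup>2) summable_on Omega (sum_list lam) \<and>
     (\<forall>s\<in>Sn (sum_list lam). \<forall>w\<in>Omega (sum_list lam).
        \<phi> (mat_prod (perm_mat s) w) = pi_rep s (\<phi> w))}"

definition norm_T :: "nat list \<Rightarrow> T_vec \<Rightarrow> real"
  where "norm_T lam \<phi> = sqrt (\<Sum>\<^sub>\<infinity>w\<in>Omega (sum_list lam). (norm_pi (\<phi> w))\<^sup>2)"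

text \<open>The formula for the action does not involve \<open>\<lambda>\<close>; only the space does.\<close>

definition T_rep :: "nat perm \<Rightarrow> T_vec \<Rightarrow> T_vec"
  where "T_rep g \<phi> = (\<lambda>w. \<phi> (mat_prod w (perm_mat g)))"

definition T_alg :: "(nat perm \<Rightarrow>\<^sub>0 complex) \<Rightarrow> T_vec \<Rightarrow> T_vec"
  where "T_alg a \<phi> =
    (\<lambda>w. \<Sum>g\<in>Poly_Mapping.keys a. scale (Poly_Mapping.lookup a g) (T_rep g \<phi> w))"

text \<open>Operators are functions on \<open>H(T\<^sup>\<lambda>)\<close> in the extensional sense, so that equality of operators
  is equality of HOL functions.\<close>

definition bounded_ops :: "nat list \<Rightarrow> (T_vec \<Rightarrow> T_vec) set"
  where "bounded_ops lam = {A \<in> H_T lam \<rightarrow>\<^sub>E H_T lam.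
     (\<forall>\<phi>\<in>H_T lam. \<forall>\<psi>\<in>H_T lam. A (\<lambda>w. \<phi> w + \<psi> w) = (\<lambda>w. A \<phi> w + A \<psi> w)) \<and>
     (\<forall>c. \<forall>\<phi>\<in>H_T lam. A (\<lambda>w. scale c (\<phi> w)) = (\<lambda>w. scale c (A \<phi> w))) \<and>
     (\<exists>K. \<forall>\<phi>\<in>H_T lam. norm_T lam (A \<phi>) \<le> K * norm_T lam \<phi>)}"

definition sot_limit ::
    "nat list \<Rightarrow> (nat \<Rightarrow> (nat perm \<Rightarrow>\<^sub>0 complex)) \<Rightarrow> (T_vec \<Rightarrow> T_vec) \<Rightarrow> bool"
  where "sot_limit lam \<alpha> A \<longleftrightarrow> A \<in> bounded_ops lam \<and>
     (\<forall>\<phi>\<in>H_T lam. (\<lambda>n. norm_T lam (\<lambda>w. T_alg (\<alpha> n) \<phi> w - A \<phi> w)) \<longlonglongrightarrow> 0)"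

definition T_bar :: "nat list \<Rightarrow> (nat \<Rightarrow> (nat perm \<Rightarrow>\<^sub>0 complex)) \<Rightarrow> (T_vec \<Rightarrow> T_vec)"
  where "T_bar lam \<alpha> = (THE A. sot_limit lam \<alpha> A)"

section \<open>Algebras of sequences modulo an equivalence\<close>

text \<open>The quotient of a set of sequences by an equivalence relation \<open>R\<close>, with the operations
  induced by the component-wise ones; \<open>u n\<close> is the unit of the \<open>n\<close>-th semigroup.\<close>

definition seq_algebra ::
    "(nat \<Rightarrow> ('g::times \<Rightarrow>\<^sub>0 complex)) set \<Rightarrow>
     ((nat \<Rightarrow> ('g \<Rightarrow>\<^sub>0 complex)) \<times> (nat \<Rightarrow> ('g \<Rightarrow>\<^sub>0 complex))) set \<Rightarrow> (nat \<Rightarrow> 'g) \<Rightarrow>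
     (complex, (nat \<Rightarrow> ('g \<Rightarrow>\<^sub>0 complex)) set) module"
  where "seq_algebra C R u =
    \<lparr>carrier = C // R,
     monoid.mult = (\<lambda>X Y. \<Union>a\<in>X. \<Union>b\<in>Y. R `` {\<lambda>n. a n \<star> b n}),
     one = R `` {\<lambda>n. delta (u n)},
     zero = R `` {\<lambda>n. 0},
     add = (\<lambda>X Y. \<Union>a\<in>X. \<Union>b\<in>Y. R `` {\<lambda>n. a n + b n}),
     smult = (\<lambda>c X. \<Union>a\<in>X. R `` {\<lambda>n. scale c (a n)})\<rparr>"

definition complex_field :: "complex ring"
  where "complex_field =
    \<lparr>carrier = UNIV, monoid.mult = (*), one = 1, zero = 0, add = (+)\<rparr>"

text \<open>The library locale \<open>algebra\<close> is restricted to commutative algebras.\<close>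

definition assoc_algebra :: "(complex, 'a) module \<Rightarrow> bool"
  where "assoc_algebra M \<longleftrightarrow> ring M \<and> module complex_field M \<and>
    (\<forall>c. \<forall>x\<in>carrier M. \<forall>y\<in>carrier M.
       (c \<odot>\<^bsub>M\<^esub> x) \<otimes>\<^bsub>M\<^esub> y = c \<odot>\<^bsub>M\<^esub> (x \<otimes>\<^bsub>M\<^esub> y) \<and>
       x \<otimes>\<^bsub>M\<^esub> (c \<odot>\<^bsub>M\<^esub> y) = c \<odot>\<^bsub>M\<^esub> (x \<otimes>\<^bsub>M\<^esub> y))"

definition algebra_iso :: "(complex, 'a) module \<Rightarrow> (complex, 'b) module \<Rightarrow> ('a \<Rightarrow> 'b) set"
  where "algebra_iso M N =
    {h \<in> ring_iso M N. \<forall>c. \<forall>x\<in>carrier M. h (c \<odot>\<^bsub>M\<^esub> x) = c \<odot>\<^bsub>N\<^esub> h x}"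

section \<open>The algebra \<open>\<B>\<close>\<close>

definition B_cent :: "nat \<Rightarrow> nat \<Rightarrow> (nat perm \<Rightarrow>\<^sub>0 complex) set"
  where "B_cent m n = centralizer (Sn_stab m n) (Sn n)"

text \<open>Sequences carry a term with index 0, which none of the conditions sees.\<close>

definition convergent_seqs :: "(nat \<Rightarrow> (nat perm \<Rightarrow>\<^sub>0 complex)) set"
  where "convergent_seqs = {\<alpha>.
     (\<forall>\<^sub>F n in sequentially. \<alpha> n \<in> span_of (Sn n)) \<and>
     (\<forall>lam\<in>young_diagrams. \<exists>A. sot_limit lam \<alpha> A) \<and>
     (\<exists>m. \<forall>\<^sub>F n in sequentially. \<alpha> n \<in> B_cent m n) \<and>
     bdd_above ((\<lambda>n. alg_deg perm_deg (\<alpha> n)) ` {1..})}"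

definition convergent_equiv ::
    "((nat \<Rightarrow> (nat perm \<Rightarrow>\<^sub>0 complex)) \<times> (nat \<Rightarrow> (nat perm \<Rightarrow>\<^sub>0 complex))) set"
  where "convergent_equiv = {(\<alpha>, \<beta>). \<alpha> \<in> convergent_seqs \<and> \<beta> \<in> convergent_seqs \<and>
     (\<forall>lam\<in>young_diagrams. T_bar lam \<alpha> = T_bar lam \<beta>)}"

definition virtual_group_algebra ::
    "(complex, (nat \<Rightarrow> (nat perm \<Rightarrow>\<^sub>0 complex)) set) module"
  where "virtual_group_algebra = seq_algebra convergent_seqs convergent_equiv (\<lambda>n. 1)"

section \<open>The algebra \<open>\<A>\<close>\<close>

definition Gamma :: "nat \<Rightarrow> nat mat set"
  where "Gamma n = {A \<in> carrier_mat n n. (\<forall>i<n. \<forall>j<n. A $$ (i, j) \<in> {0, 1}) \<and>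
     (\<forall>i<n. \<forall>j<n. \<forall>j'<n. A $$ (i, j) = 1 \<and> A $$ (i, j') = 1 \<longrightarrow> j = j') \<and>
     (\<forall>j<n. \<forall>i<n. \<forall>i'<n. A $$ (i, j) = 1 \<and> A $$ (i', j) = 1 \<longrightarrow> i = i')}"

definition Gamma_sub :: "nat \<Rightarrow> nat \<Rightarrow> nat mat set"
  where "Gamma_sub m n = {A \<in> Gamma n. \<forall>i<m. A $$ (i, i) = 1}"

definition mat_deg :: "nat mat \<Rightarrow> nat"
  where "mat_deg A = card {i. i < dim_row A \<and> A $$ (i, i) = 0}"

definition delete_last :: "nat mat \<Rightarrow> nat mat"
  where "delete_last A = mat (dim_row A - 1) (dim_col A - 1) (\<lambda>(i, j). A $$ (i, j))"

definition theta :: "(nat mat \<Rightarrow>\<^sub>0 complex) \<Rightarrow> (nat mat \<Rightarrow>\<^sub>0 complex)"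
  where "theta = lin_ext delete_last"

definition A_cent :: "nat \<Rightarrow> nat \<Rightarrow> (nat mat \<Rightarrow>\<^sub>0 complex) set"
  where "A_cent m n = centralizer (Gamma_sub m n) (Gamma n)"

text \<open>
  A sequence \<open>(a\<^sub>n)\<close>, \<open>n \<ge> m\<close>, is represented by any function on \<^typ>\<open>nat\<close> that agrees with it from
  \<open>m\<close> on, so forgetting the first term does not change the function. Two functions, belonging to
  \<open>A_seqs m\<close> and \<open>A_seqs k\<close> say, represent the same element of \<open>\<Union>\<^sub>m \<A>\<^sub>m\<close> iff they agree for all
  \<open>n \<ge> max m k\<close>; by compatibility with \<open>\<theta>\<close> it is enough that they agree for all large \<open>n\<close>.
\<close>

definition A_seqs :: "nat \<Rightarrow> (nat \<Rightarrow> (nat mat \<Rightarrow>\<^sub>0 complex)) set"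
  where "A_seqs m = {a. (\<forall>n\<ge>m. a n \<in> A_cent m n) \<and>
     (\<forall>n>m. a (n - 1) = theta (a n)) \<and>
     bdd_above ((\<lambda>n. alg_deg mat_deg (a n)) ` {m..})}"

definition A_equiv ::
    "((nat \<Rightarrow> (nat mat \<Rightarrow>\<^sub>0 complex)) \<times> (nat \<Rightarrow> (nat mat \<Rightarrow>\<^sub>0 complex))) set"
  where "A_equiv = {(a, b). a \<in> (\<Union>m. A_seqs m) \<and> b \<in> (\<Union>m. A_seqs m) \<and>
     (\<forall>\<^sub>F n in sequentially. a n = b n)}"

definition centralizer_algebra :: "(complex, (nat \<Rightarrow> (nat mat \<Rightarrow>\<^sub>0 complex)) set) module"
  where "centralizer_algebra = seq_algebra (\<Union>m. A_seqs m) A_equiv (\<lambda>n. 1\<^sub>m n)"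

end

theory Submission
  imports Defs
begin

text \<open>
  An element \<open>a\<close> of the group algebra or of the semigroup algebra is encoded by its zeta transform:
  the value at a finite partial injection \<open>r\<close> is the sum of the coefficients of \<open>a\<close> at all elements
  that extend \<open>r\<close>. Both algebras turn out to be the algebra of the limits of zeta transforms.

  On the side of \<open>\<A>\<close> the maps \<open>\<theta>\<close> do not change zeta transforms, so the limit of a sequence is
  eventually attained, and Moebius inversion recovers the sequence from the limit. On the side of
  \<open>\<B>\<close>, the value of the zeta transform of an element of \<open>\<B>\<^sub>m(n)\<close> of bounded degree at \<open>r\<close> is
  \<open>O(n\<^sup>-\<^sup>k)\<close>, where \<open>k\<close> is the number of points \<open>\<ge> m\<close> of the domain of \<open>r\<close> outside of its range; by
  the Schur test this turns pointwise convergence of zeta transforms into strong convergence in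
  every \<open>T\<^sup>\<lambda>\<close>, and it makes limits multiplicative. Conversely, expanding the unit of \<open>\<complex>[S(\<ell>)]\<close> in
  conjugates of Young symmetrizers writes each value of a zeta transform as a combination of matrix
  coefficients of the \<open>T\<^sup>\<lambda>\<close> with \<open>|\<lambda>| = \<ell>\<close>. Finally, every limit function that occurs on
  the side of \<open>\<A>\<close> is the limit of a sequence built from finitely many elements by averaging over
  transpositions and by summing over the positions of a point.
\<close>

text \<open>Coefficients are the wrong coordinates: those of an averaged transposition tend to 0,
  although its operators converge to a nonzero projection. Matrix coefficients do converge. An
  element \<open>g\<close> carries the point \<open>w\<close> of \<open>Omega l\<close> to
  \<open>v\<close> exactly if its graph extends the partial injection \<open>link w v\<close>, so
  the operator of \<open>a\<close> has the kernel \<open>Z a (link w v)\<close>; and deleting rows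
  and columns of a matrix does not affect which relations it contains inside of the remaining
  square. This is why one transform fits both sides.

  The obstacle is multiplication. The convolution formula sums over intermediate relations, and
  about \<open>n ^ k\<close> of them pass through \<open>k\<close> points that leave every finite
  set. Both factors of such a term decay; one decay balances the number of terms, and the other
  makes them disappear in the limit.

  The two algebras are not mapped to each other directly. Both are compared with the functions
  \<open>f\<close> that occur in \<open>zconv m \<alpha> f\<close>, with the product
  \<open>mul\<close>, whose laws are inherited from the group algebra. The predicate
  \<open>admissible\<close> describes these functions without sequences, so that limits of matrix
  sequences can be tested for it.\<close>

lemma lookup_scale [simp]: "Poly_Mapping.lookup (scale c a) x = c * Poly_Mapping.lookup a x"
  by (simp add: scale_def Poly_Mapping.map.rep_eq when_def)

lemma scale_single: "scale c (Poly_Mapping.single g x) = Poly_Mapping.single g (c * x)"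
  by (rule poly_mapping_eqI) (simp add: lookup_single when_def)

lemma scale_add_right: "scale c (a + b) = scale c a + scale c b"
  by (rule poly_mapping_eqI) (simp add: lookup_add algebra_simps)

lemma scale_add_left: "scale (c + d) a = scale c a + scale d a"
  by (rule poly_mapping_eqI) (simp add: lookup_add algebra_simps)

lemma scale_scale [simp]: "scale c (scale d a) = scale (c * d) a"
  by (rule poly_mapping_eqI) simp

lemma scale_one [simp]: "scale 1 a = a"
  by (rule poly_mapping_eqI) simp

lemma scale_zero_left [simp]: "scale 0 a = 0"
  by (rule poly_mapping_eqI) simp

lemma scale_zero_right [simp]: "scale c 0 = 0"
  by (rule poly_mapping_eqI) simp

lemma scale_sum: "scale c (sum f I) = (\<Sum>i\<in>I. scale c (f i))"
  by (induction I rule: infinite_finite_induct) (simp_all add: scale_add_right)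

lemma keys_scale: "Poly_Mapping.keys (scale c a) \<subseteq> Poly_Mapping.keys a"
  by (auto simp: in_keys_iff)

global_interpretation alg: vector_space "scale :: complex \<Rightarrow> ('g \<Rightarrow>\<^sub>0 complex) \<Rightarrow> _"
  by unfold_locales (simp_all add: scale_add_left scale_add_right)

lemma lookup_sum': "Poly_Mapping.lookup (sum f I) x = (\<Sum>i\<in>I. Poly_Mapping.lookup (f i) x)"
  by (induction I rule: infinite_finite_induct) (simp_all add: lookup_add)

lemma span_of_add: "a \<in> span_of G \<Longrightarrow> b \<in> span_of G \<Longrightarrow> a + b \<in> span_of G"
  using keys_add[of a b] by (auto simp: span_of_def)

lemma span_of_scale: "a \<in> span_of G \<Longrightarrow> scale c a \<in> span_of G"
  using keys_scale[of c a] by (auto simp: span_of_def)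

lemma span_of_0: "0 \<in> span_of G"
  by (simp add: span_of_def)

lemma span_of_sum: "(\<And>i. i \<in> I \<Longrightarrow> f i \<in> span_of G) \<Longrightarrow> sum f I \<in> span_of G"
  by (induction I rule: infinite_finite_induct) (simp_all add: span_of_add span_of_0)

lemma span_of_single: "g \<in> G \<Longrightarrow> Poly_Mapping.single g c \<in> span_of G"
  by (simp add: span_of_def)

lemma sum_single_lookup:
  assumes "finite A" "Poly_Mapping.keys a \<subseteq> A"
  shows "(\<Sum>g\<in>A. Poly_Mapping.single g (Poly_Mapping.lookup a g)) = (a :: 'g \<Rightarrow>\<^sub>0 complex)"
proof (rule poly_mapping_eqI)
  fix x
  show "Poly_Mapping.lookup (\<Sum>g\<in>A. Poly_Mapping.single g (Poly_Mapping.lookup a g)) x = Poly_Mapping.lookup a x"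
    using assms by (auto simp: lookup_sum' lookup_single when_def in_keys_iff)
qed

lemma sum_scale_delta:
  assumes "finite A" "Poly_Mapping.keys a \<subseteq> A"
  shows "(\<Sum>g\<in>A. scale (Poly_Mapping.lookup a g) (delta g)) = a"
  using sum_single_lookup[OF assms] by (simp add: scale_single)

section \<open>Convolution\<close>

lemma conv_superset:
  assumes "finite A" "finite B" "Poly_Mapping.keys a \<subseteq> A" "Poly_Mapping.keys b \<subseteq> B"
  shows "a \<star> b = (\<Sum>u\<in>A. \<Sum>v\<in>B.
           Poly_Mapping.single (u * v) (Poly_Mapping.lookup a u * Poly_Mapping.lookup b v))"
proof -
  have "(\<Sum>v\<in>B. Poly_Mapping.single (u * v) (Poly_Mapping.lookup a u * Poly_Mapping.lookup b v)) =
      (\<Sum>v\<in>Poly_Mapping.keys b. Poly_Mapping.single (u * v) (Poly_Mapping.lookup a u * Poly_Mapping.lookup b v))" for u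
    using assms by (intro sum.mono_neutral_right) (auto simp: in_keys_iff)
  moreover have "(\<Sum>u\<in>A. \<Sum>v\<in>Poly_Mapping.keys b.
      Poly_Mapping.single (u * v) (Poly_Mapping.lookup a u * Poly_Mapping.lookup b v)) = a \<star> b"
    unfolding conv_def using assms by (intro sum.mono_neutral_right) (auto simp: in_keys_iff)
  ultimately show ?thesis by simp
qed

lemma conv_add_left: "(a + b) \<star> c = a \<star> c + b \<star> c"
  using keys_add[of a b]
  by (simp add: conv_superset[of "Poly_Mapping.keys a \<union> Poly_Mapping.keys b" "Poly_Mapping.keys c"]
      lookup_add algebra_simps single_add sum.distrib)

lemma conv_add_right: "c \<star> (a + b) = c \<star> a + c \<star> b"
  using keys_add[of a b]
  by (simp add: conv_superset[of "Poly_Mapping.keys c" "Poly_Mapping.keys a \<union> Poly_Mapping.keys b"]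
      lookup_add algebra_simps single_add sum.distrib)

lemma conv_scale_left: "scale c a \<star> b = scale c (a \<star> b)"
  using keys_scale[of c a]
  by (simp add: conv_superset[of "Poly_Mapping.keys a" "Poly_Mapping.keys b"] scale_sum scale_single mult.assoc)

lemma conv_scale_right: "a \<star> scale c b = scale c (a \<star> b)"
  using keys_scale[of c b]
  by (simp add: conv_superset[of "Poly_Mapping.keys a" "Poly_Mapping.keys b"] scale_sum scale_single algebra_simps)

lemma conv_0_left [simp]: "0 \<star> a = 0" and conv_0_right [simp]: "a \<star> 0 = 0"
  by (simp_all add: conv_def)

lemma conv_sum_left: "sum f I \<star> b = (\<Sum>i\<in>I. f i \<star> b)"
  by (induction I rule: infinite_finite_induct) (simp_all add: conv_add_left)

lemma conv_sum_right: "b \<star> sum f I = (\<Sum>i\<in>I. b \<star> f i)"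
  by (induction I rule: infinite_finite_induct) (simp_all add: conv_add_right)

lemma conv_uminus_left: "(- a) \<star> b = - (a \<star> b)" and conv_uminus_right: "a \<star> (- b) = - (a \<star> b)"
  using conv_scale_left[of "-1" a b] conv_scale_right[of a "-1" b] by simp_all

lemma conv_single_single [simp]:
  "Poly_Mapping.single u c \<star> Poly_Mapping.single v d = Poly_Mapping.single (u * v) (c * d)"
  by (subst conv_superset[of "{u}" "{v}"]) (auto simp: keys_single)

lemma keys_conv: "Poly_Mapping.keys (a \<star> b) \<subseteq> (\<lambda>(u, v). u * v) ` (Poly_Mapping.keys a \<times> Poly_Mapping.keys b)"
proof
  fix x assume "x \<in> Poly_Mapping.keys (a \<star> b)"
  then have "(\<Sum>u\<in>Poly_Mapping.keys a. \<Sum>v\<in>Poly_Mapping.keys b.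
     Poly_Mapping.lookup (Poly_Mapping.single (u * v) (Poly_Mapping.lookup a u * Poly_Mapping.lookup b v)) x) \<noteq> 0"
    by (simp add: in_keys_iff conv_def lookup_sum')
  then obtain u v where "u \<in> Poly_Mapping.keys a" "v \<in> Poly_Mapping.keys b" "x = u * v"
    by (auto elim!: sum.not_neutral_contains_not_neutral simp: lookup_single when_def split: if_splits)
  then show "x \<in> (\<lambda>(u, v). u * v) ` (Poly_Mapping.keys a \<times> Poly_Mapping.keys b)"
    by force
qed

lemma span_of_conv:
  assumes "a \<in> span_of G" "b \<in> span_of G" "\<And>u v. u \<in> G \<Longrightarrow> v \<in> G \<Longrightarrow> u * v \<in> G"
  shows "a \<star> b \<in> span_of G"
  using assms keys_conv[of a b] by (force simp: span_of_def)

lemma conv_eq_left: "a \<star> b = (\<Sum>u\<in>Poly_Mapping.keys a. scale (Poly_Mapping.lookup a u) (delta u \<star> b))"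
proof -
  have "a \<star> b = (\<Sum>u\<in>Poly_Mapping.keys a. scale (Poly_Mapping.lookup a u) (delta u)) \<star> b"
    by (simp only: sum_scale_delta[OF finite_keys order_refl])
  then show ?thesis by (simp only: conv_sum_left conv_scale_left)
qed

lemma conv_eq_right: "a \<star> b = (\<Sum>v\<in>Poly_Mapping.keys b. scale (Poly_Mapping.lookup b v) (a \<star> delta v))"
proof -
  have "a \<star> b = a \<star> (\<Sum>u\<in>Poly_Mapping.keys b. scale (Poly_Mapping.lookup b u) (delta u))"
    by (simp only: sum_scale_delta[OF finite_keys order_refl])
  then show ?thesis by (simp only: conv_sum_right conv_scale_right)
qed

text \<open>The factors are reduced to single elements by bilinearity. The class
  \<open>monoid_mult\<close> excludes \<open>nat mat\<close>; for sequences of matrices,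
  associativity modulo the equivalence is later obtained from \<open>mul_laws\<close>.\<close>

lemma conv_assoc:
  fixes a b c :: "'g::monoid_mult \<Rightarrow>\<^sub>0 complex"
  shows "(a \<star> b) \<star> c = a \<star> (b \<star> c)"
proof -
  have *: "(delta u \<star> b) \<star> delta w = delta u \<star> (b \<star> delta w)" for u w :: 'g
    by (simp add: conv_eq_right[of "delta u" b] conv_eq_left[of b "delta w"] conv_sum_left conv_sum_right
        conv_scale_left conv_scale_right mult.assoc)
  have **: "(delta u \<star> b) \<star> c = delta u \<star> (b \<star> c)" for u :: 'g
    unfolding conv_eq_right[of "delta u \<star> b" c] conv_eq_right[of b c] conv_sum_right conv_scale_right * ..
  show ?thesis
    unfolding conv_eq_left[of a b] conv_eq_left[of a "b \<star> c"] conv_sum_left conv_scale_left ** ..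
qed

lemma conv_one_left [simp]: "delta 1 \<star> a = (a :: 'g::monoid_mult \<Rightarrow>\<^sub>0 complex)"
  unfolding conv_eq_right[of _ a] by (simp add: sum_scale_delta)

lemma conv_one_right [simp]: "a \<star> delta 1 = (a :: 'g::monoid_mult \<Rightarrow>\<^sub>0 complex)"
  unfolding conv_eq_left[of a] by (simp add: sum_scale_delta)

lemma lookup_conv_delta_left:
  fixes a :: "'a perm \<Rightarrow>\<^sub>0 complex"
  shows "Poly_Mapping.lookup (delta g \<star> a) x = Poly_Mapping.lookup a (inverse g * x)"
proof -
  have "g * v = x \<longleftrightarrow> v = inverse g * x" for v
    by (metis perm.left_inverse perm.right_inverse mult.assoc mult_1_left)
  then show ?thesis
    by (subst conv_superset[of "{g}" "Poly_Mapping.keys a"])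
       (auto simp: lookup_sum' lookup_single when_def in_keys_iff)
qed

lemma lookup_conv_delta_right:
  fixes a :: "'a perm \<Rightarrow>\<^sub>0 complex"
  shows "Poly_Mapping.lookup (a \<star> delta g) x = Poly_Mapping.lookup a (x * inverse g)"
proof -
  have "v * g = x \<longleftrightarrow> v = x * inverse g" for v
    by (metis perm.left_inverse perm.right_inverse mult.assoc mult_1_right)
  then show ?thesis
    by (subst conv_superset[of "Poly_Mapping.keys a" "{g}"])
       (auto simp: lookup_sum' lookup_single when_def in_keys_iff)
qed

lemma alg_deg_le_iff: "alg_deg d a \<le> D \<longleftrightarrow> (\<forall>u\<in>Poly_Mapping.keys a. d u \<le> D)"
  by (simp add: alg_deg_def)

lemma lookup_lin_ext:
  "Poly_Mapping.lookup (lin_ext f a) x = (\<Sum>g | g \<in> Poly_Mapping.keys a \<and> f g = x. Poly_Mapping.lookup a g)"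
  by (auto simp: lin_ext_def lookup_sum' lookup_single when_def sum.If_cases Int_def
           intro!: sum.cong)

lemma keys_lin_ext: "Poly_Mapping.keys (lin_ext f a) \<subseteq> f ` Poly_Mapping.keys a"
proof
  fix x assume "x \<in> Poly_Mapping.keys (lin_ext f a)"
  then have "(\<Sum>g | g \<in> Poly_Mapping.keys a \<and> f g = x. Poly_Mapping.lookup a g) \<noteq> 0"
    by (simp add: in_keys_iff lookup_lin_ext)
  then have "{g. g \<in> Poly_Mapping.keys a \<and> f g = x} \<noteq> {}"
    by (metis sum.empty)
  then show "x \<in> f ` Poly_Mapping.keys a" by auto
qed

section \<open>The zeta transform\<close>

type_synonym rel2 = "(nat \<times> nat) set"

text \<open>The graph map \<open>rel\<close> is a parameter, so that one set of lemmas serves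
  permutations and partial permutation matrices.\<close>

definition zeta :: "('g \<Rightarrow> rel2) \<Rightarrow> ('g \<Rightarrow>\<^sub>0 complex) \<Rightarrow> rel2 \<Rightarrow> complex"
  where "zeta rel a r = (\<Sum>u | u \<in> Poly_Mapping.keys a \<and> r \<subseteq> rel u. Poly_Mapping.lookup a u)"

lemma zeta_superset:
  assumes "finite A" "Poly_Mapping.keys a \<subseteq> A"
  shows "zeta rel a r = (\<Sum>u\<in>A. if r \<subseteq> rel u then Poly_Mapping.lookup a u else 0)"
proof -
  have "(\<Sum>u\<in>A. if r \<subseteq> rel u then Poly_Mapping.lookup a u else 0) =
        (\<Sum>u\<in>Poly_Mapping.keys a. if r \<subseteq> rel u then Poly_Mapping.lookup a u else 0)"
    using assms by (intro sum.mono_neutral_right) (auto simp: in_keys_iff)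
  also have "\<dots> = zeta rel a r"
    by (simp add: zeta_def sum.If_cases Int_def)
  finally show ?thesis by simp
qed

lemma zeta_add: "zeta rel (a + b) r = zeta rel a r + zeta rel b r"
  using keys_add[of a b]
  by (simp add: zeta_superset[of "Poly_Mapping.keys a \<union> Poly_Mapping.keys b"] lookup_add
      flip: sum.distrib) (rule sum.cong, auto simp: lookup_add)

lemma zeta_scale: "zeta rel (scale c a) r = c * zeta rel a r"
  using keys_scale[of c a]
  by (simp add: zeta_superset[of "Poly_Mapping.keys a"] sum_distrib_left) (rule sum.cong, auto)

lemma zeta_0 [simp]: "zeta rel 0 r = 0"
  by (simp add: zeta_def)

lemma zeta_sum: "zeta rel (sum f I) r = (\<Sum>i\<in>I. zeta rel (f i) r)"
  by (induction I rule: infinite_finite_induct) (simp_all add: zeta_add)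

lemma zeta_uminus: "zeta rel (- a) r = - zeta rel a r"
  using zeta_scale[of rel "-1" a r] by simp

lemma zeta_diff: "zeta rel (a - b) r = zeta rel a r - zeta rel b r"
  using zeta_add[of rel a "- b" r] by (simp add: zeta_uminus)

lemma zeta_single: "zeta rel (Poly_Mapping.single u c) r = (if r \<subseteq> rel u then c else 0)"
  by (subst zeta_superset[of "{u}"]) auto

lemma zeta_lin_ext:
  "zeta rel (lin_ext f a) r = zeta (\<lambda>u. rel (f u)) a r"
  unfolding lin_ext_def zeta_sum zeta_single
  by (subst zeta_superset[of "Poly_Mapping.keys a"]) auto

lemma zeta_cong:
  assumes "\<And>u. u \<in> Poly_Mapping.keys a \<Longrightarrow> r \<subseteq> rel u \<longleftrightarrow> s \<subseteq> rel' u"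
  shows "zeta rel a r = zeta rel' a s"
  unfolding zeta_def using assms by (intro sum.cong) auto

lemma zeta_eq_0:
  assumes "\<And>u. u \<in> Poly_Mapping.keys a \<Longrightarrow> \<not> r \<subseteq> rel u"
  shows "zeta rel a r = 0"
  unfolding zeta_def using assms by (intro sum.neutral) auto

text \<open>A relation \<open>r \<subseteq> u O v\<close> factors uniquely as \<open>d O e\<close> with \<open>d \<subseteq> u\<close>, \<open>e \<subseteq> v\<close> and
  \<open>Domain d = Domain r\<close>.\<close>

lemma zeta_conv:
  assumes rel: "\<And>u v. u \<in> Poly_Mapping.keys a \<Longrightarrow> v \<in> Poly_Mapping.keys b \<Longrightarrow> rel (u * v) = rel u O rel v"
    and sv: "\<And>u. u \<in> Poly_Mapping.keys a \<Longrightarrow> single_valued (rel u)"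
    and D: "finite D" "\<And>d. d \<in> D \<Longrightarrow> Domain d = Domain r"
      "\<And>u. u \<in> Poly_Mapping.keys a \<Longrightarrow> Domain r \<subseteq> Domain (rel u) \<Longrightarrow> rel u \<inter> (Domain r \<times> UNIV) \<in> D"
  shows "zeta rel (a \<star> b) r = (\<Sum>d\<in>D. zeta rel a d * zeta rel b (d\<inverse> O r))"
proof -
  let ?A = "Poly_Mapping.keys a" and ?B = "Poly_Mapping.keys b"
  have key: "(if r \<subseteq> rel u O rel v then 1 else 0) =
      (\<Sum>d\<in>D. (if d \<subseteq> rel u then 1 else 0) * (if d\<inverse> O r \<subseteq> rel v then (1::complex) else 0))"
    if u: "u \<in> ?A" for u v
  proof (cases "Domain r \<subseteq> Domain (rel u)")
    case False
    then have "\<not> r \<subseteq> rel u O rel v" by auto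
    moreover have "\<not> d \<subseteq> rel u" if "d \<in> D" for d
      using False D(2)[OF that] by (metis Domain_mono)
    ultimately show ?thesis by (simp add: sum.neutral)
  next
    case True
    define d0 where "d0 = rel u \<inter> (Domain r \<times> UNIV)"
    have d0: "d0 \<in> D" using D(3)[OF u True] by (simp add: d0_def)
    have iff: "d \<subseteq> rel u \<longleftrightarrow> d = d0" if "d \<in> D" for d
    proof
      assume *: "d \<subseteq> rel u"
      have "d0 \<subseteq> d"
      proof
        fix p assume p: "p \<in> d0"
        then obtain i j where ij: "p = (i, j)" "(i, j) \<in> rel u" "i \<in> Domain r" by (auto simp: d0_def)
        then obtain j' where "(i, j') \<in> d" using D(2)[OF \<open>d \<in> D\<close>] by blast
        with * sv[OF u] ij show "p \<in> d" by (metis single_valuedD subsetD)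
      qed
      moreover have "d \<subseteq> d0" using * D(2)[OF that] by (auto simp: d0_def)
      ultimately show "d = d0" by simp
    qed (simp add: d0_def)
    have *: "r \<subseteq> rel u O rel v \<longleftrightarrow> d0\<inverse> O r \<subseteq> rel v"
    proof
      assume h: "r \<subseteq> rel u O rel v"
      show "d0\<inverse> O r \<subseteq> rel v"
      proof
        fix p assume "p \<in> d0\<inverse> O r"
        then obtain i j k where p: "p = (j, k)" "(i, j) \<in> d0" "(i, k) \<in> r" by auto
        with h obtain j' where "(i, j') \<in> rel u" "(j', k) \<in> rel v" by auto
        with p sv[OF u] show "p \<in> rel v" by (auto simp: d0_def dest: single_valuedD)
      qed
    next
      assume h: "d0\<inverse> O r \<subseteq> rel v"
      show "r \<subseteq> rel u O rel v"
      proof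
        fix p assume p: "p \<in> r"
        then obtain i k where ik: "p = (i, k)" by force
        with p True obtain j where "(i, j) \<in> rel u" by blast
        then have "(i, j) \<in> d0" using p ik by (auto simp: d0_def)
        then show "p \<in> rel u O rel v" using h p ik \<open>(i, j) \<in> rel u\<close> by auto
      qed
    qed
    have "(\<Sum>d\<in>D. (if d \<subseteq> rel u then 1 else 0) * (if d\<inverse> O r \<subseteq> rel v then (1::complex) else 0)) =
          (\<Sum>d\<in>D. if d = d0 then (if d0\<inverse> O r \<subseteq> rel v then (1::complex) else 0) else 0)"
      by (intro sum.cong) (auto simp: iff)
    also have "\<dots> = (if d0\<inverse> O r \<subseteq> rel v then 1 else 0)"
      using D(1) d0 by simp
    finally show ?thesis using * by simp
  qed
  have "zeta rel (a \<star> b) r = (\<Sum>u\<in>?A. \<Sum>v\<in>?B. Poly_Mapping.lookup a u * Poly_Mapping.lookup b v *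
      (if r \<subseteq> rel u O rel v then 1 else 0))"
    unfolding conv_def zeta_sum zeta_single by (intro sum.cong) (auto simp: rel)
  also have "\<dots> = (\<Sum>u\<in>?A. \<Sum>v\<in>?B. \<Sum>d\<in>D. (Poly_Mapping.lookup a u * (if d \<subseteq> rel u then 1 else 0)) *
       (Poly_Mapping.lookup b v * (if d\<inverse> O r \<subseteq> rel v then 1 else 0)))"
    by (intro sum.cong refl) (simp add: key sum_distrib_left mult_ac)
  also have "\<dots> = (\<Sum>u\<in>?A. \<Sum>d\<in>D. \<Sum>v\<in>?B. (Poly_Mapping.lookup a u * (if d \<subseteq> rel u then 1 else 0)) *
       (Poly_Mapping.lookup b v * (if d\<inverse> O r \<subseteq> rel v then 1 else 0)))"
    by (intro sum.cong refl sum.swap)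
  also have "\<dots> = (\<Sum>d\<in>D. \<Sum>u\<in>?A. \<Sum>v\<in>?B. (Poly_Mapping.lookup a u * (if d \<subseteq> rel u then 1 else 0)) *
       (Poly_Mapping.lookup b v * (if d\<inverse> O r \<subseteq> rel v then 1 else 0)))"
    by (rule sum.swap)
  also have "\<dots> = (\<Sum>d\<in>D. zeta rel a d * zeta rel b (d\<inverse> O r))"
    by (simp add: zeta_superset[of ?A a] zeta_superset[of ?B b] sum_product if_distrib cong: if_cong)
  finally show ?thesis .
qed

lemma zeta_delta_left: "zeta rel (delta h \<star> a) r = zeta (\<lambda>v. rel (h * v)) a r"
proof -
  have "delta h \<star> a = lin_ext (\<lambda>v. h * v) a"
    unfolding conv_eq_right[of "delta h" a] lin_ext_def by (simp add: scale_single)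
  then show ?thesis by (simp add: zeta_lin_ext)
qed

lemma zeta_delta_right: "zeta rel (a \<star> delta h) r = zeta (\<lambda>v. rel (v * h)) a r"
proof -
  have "a \<star> delta h = lin_ext (\<lambda>v. v * h) a"
    unfolding conv_eq_left[of a "delta h"] lin_ext_def by (simp add: scale_single)
  then show ?thesis by (simp add: zeta_lin_ext)
qed

section \<open>Partial injections and permutations\<close>

definition one_one :: "rel2 \<Rightarrow> bool"
  where "one_one r \<longleftrightarrow> single_valued r \<and> single_valued (r\<inverse>)"

lemma one_one_subset: "one_one s \<Longrightarrow> r \<subseteq> s \<Longrightarrow> one_one r"
  unfolding one_one_def by (meson converse_mono single_valued_subset)

lemma one_one_converse [simp]: "one_one (r\<inverse>) \<longleftrightarrow> one_one r"
  by (auto simp: one_one_def)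

lemma one_one_eq1: "one_one r \<Longrightarrow> (i, j) \<in> r \<Longrightarrow> (i, j') \<in> r \<Longrightarrow> j = j'"
  by (auto simp: one_one_def dest: single_valuedD)

lemma one_one_eq2: "one_one r \<Longrightarrow> (i, j) \<in> r \<Longrightarrow> (i', j) \<in> r \<Longrightarrow> i = i'"
  by (auto simp: one_one_def single_valued_def)

lemma one_oneI: "(\<And>i j j'. (i, j) \<in> r \<Longrightarrow> (i, j') \<in> r \<Longrightarrow> j = j') \<Longrightarrow>
    (\<And>i i' j. (i, j) \<in> r \<Longrightarrow> (i', j) \<in> r \<Longrightarrow> i = i') \<Longrightarrow> one_one r"
  by (auto simp: one_one_def single_valued_def)

lemma one_one_relcomp: "one_one r \<Longrightarrow> one_one s \<Longrightarrow> one_one (r O s)"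
  unfolding one_one_def by (simp add: single_valued_relcomp converse_relcomp)

lemma card_Domain: "one_one r \<Longrightarrow> card (Domain r) = card r"
  unfolding Domain_fst by (rule card_image) (auto simp: inj_on_def dest: one_one_eq1)

lemma card_Range: "one_one r \<Longrightarrow> card (Range r) = card r"
  unfolding Range_snd by (rule card_image) (auto simp: inj_on_def dest: one_one_eq2)

lemma card_Domain_le: "finite r \<Longrightarrow> card (Domain r) \<le> card r"
  unfolding Domain_fst by (rule card_image_le)

lemma card_Range_le: "finite r \<Longrightarrow> card (Range r) \<le> card r"
  unfolding Range_snd by (rule card_image_le)

text \<open>Pairs are the positions of the ones in the permutation matrix, with the image first;
  this makes \<open>prel\<close> multiplicative without reversing the factors.\<close>

definition prel :: "nat perm \<Rightarrow> rel2"
  where "prel g = {(i, j). i = g \<langle>$\<rangle> j}"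

lemma in_prel [simp]: "(i, j) \<in> prel g \<longleftrightarrow> i = g \<langle>$\<rangle> j"
  by (simp add: prel_def)

lemma prel_times: "prel (g * h) = prel g O prel h"
  by (auto simp: apply_times)

lemma prel_one: "prel 1 = Id"
  by (auto simp: apply_one)

lemma apply_inverse_apply [simp]: "inverse g \<langle>$\<rangle> (g \<langle>$\<rangle> i) = i" "g \<langle>$\<rangle> (inverse g \<langle>$\<rangle> i) = i"
  by (simp_all add: apply_sequence)

lemma apply_eq_iff_inverse': "g \<langle>$\<rangle> j = i \<longleftrightarrow> j = inverse g \<langle>$\<rangle> i"
  by auto

lemma one_one_prel [simp]: "one_one (prel g)"
  by (rule one_oneI) (auto simp: apply_inj)

lemma single_valued_prel [simp]: "single_valued (prel g)"
  using one_one_prel[of g] by (simp only: one_one_def)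

lemma Domain_prel [simp]: "Domain (prel g) = UNIV"
  using apply_inverse_apply(2)[of g] by (metis Domain.DomainI UNIV_eq_I in_prel)

lemma prel_inverse: "prel (inverse g) = (prel g)\<inverse>"
  by auto

text \<open>The two-sided action \<open>h * g * inverse k\<close> on permutations \<open>g\<close>,
  transported to subsets of their graphs.\<close>

definition mv :: "nat perm \<Rightarrow> nat perm \<Rightarrow> rel2 \<Rightarrow> rel2"
  where "mv h k r = (\<lambda>(i, j). (h \<langle>$\<rangle> i, k \<langle>$\<rangle> j)) ` r"

lemma mv_one [simp]: "mv 1 1 r = r"
  by (auto simp: mv_def apply_one)

lemma mv_mv: "mv h k (mv h' k' r) = mv (h * h') (k * k') r"
  unfolding mv_def image_image by (intro image_cong refl) (auto simp: apply_times)

lemma in_mv: "(i, j) \<in> mv h k r \<longleftrightarrow> (inverse h \<langle>$\<rangle> i, inverse k \<langle>$\<rangle> j) \<in> r"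
  by (force simp: mv_def)

lemma in_mv_apply [simp]: "(h \<langle>$\<rangle> i, k \<langle>$\<rangle> j) \<in> mv h k r \<longleftrightarrow> (i, j) \<in> r"
  by (simp add: in_mv)

lemma Domain_mv: "Domain (mv h k r) = apply h ` Domain r"
  by (force simp: mv_def)

lemma Range_mv: "Range (mv h k r) = apply k ` Range r"
  by (force simp: mv_def)

lemma finite_mv [simp]: "finite (mv h k r) \<longleftrightarrow> finite r"
proof
  assume "finite (mv h k r)"
  then have "finite (mv (inverse h) (inverse k) (mv h k r))" by (simp add: mv_def)
  then show "finite r" by (simp add: mv_mv)
qed (simp add: mv_def)

lemma one_one_mv [simp]: "one_one (mv h k r) \<longleftrightarrow> one_one r"
proof -
  have *: "one_one (mv h k r)" if "one_one r" for h k r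
  proof (rule one_oneI)
    show "j = j'" if "(i, j) \<in> mv h k r" "(i, j') \<in> mv h k r" for i j j'
      using one_one_eq1[OF \<open>one_one r\<close> that[unfolded in_mv]] by (metis apply_inverse_apply(2))
    show "i = i'" if "(i, j) \<in> mv h k r" "(i', j) \<in> mv h k r" for i i' j
      using one_one_eq2[OF \<open>one_one r\<close> that[unfolded in_mv]] by (metis apply_inverse_apply(2))
  qed
  show ?thesis using *[of r h k] *[of "mv h k r" "inverse h" "inverse k"] by (auto simp: mv_mv)
qed

lemma mv_subset_prel: "mv h k r \<subseteq> prel g \<longleftrightarrow> r \<subseteq> prel (inverse h * g * k)"
proof -
  have "mv h k r \<subseteq> prel g \<longleftrightarrow> (\<forall>(i, j)\<in>r. h \<langle>$\<rangle> i = g \<langle>$\<rangle> (k \<langle>$\<rangle> j))"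
    by (auto simp: mv_def)
  also have "\<dots> \<longleftrightarrow> (\<forall>(i, j)\<in>r. i = inverse h \<langle>$\<rangle> (g \<langle>$\<rangle> (k \<langle>$\<rangle> j)))"
    by (simp only: apply_eq_iff_inverse')
  also have "\<dots> \<longleftrightarrow> r \<subseteq> prel (inverse h * g * k)"
    by (auto simp: apply_times)
  finally show ?thesis .
qed

lemma mv_converse: "(mv h k r)\<inverse> = mv k h (r\<inverse>)"
  by (auto simp: in_mv)

abbreviation Z :: "(nat perm \<Rightarrow>\<^sub>0 complex) \<Rightarrow> rel2 \<Rightarrow> complex"
  where "Z \<equiv> zeta prel"

lemma Z_delta_left: "Z (delta h \<star> a) r = Z a (mv (inverse h) 1 r)"
  unfolding zeta_delta_left by (rule zeta_cong) (simp add: mv_subset_prel)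

lemma Z_delta_right: "Z (a \<star> delta k) r = Z a (mv 1 k r)"
  unfolding zeta_delta_right by (rule zeta_cong) (simp add: mv_subset_prel)

lemma Z_not_one_one: "\<not> one_one r \<Longrightarrow> Z a r = 0"
  using one_one_subset one_one_prel by (intro zeta_eq_0) blast

lemma Z_conv:
  assumes "finite D" "\<And>d. d \<in> D \<Longrightarrow> Domain d = Domain r"
    and "\<And>u. u \<in> Poly_Mapping.keys a \<Longrightarrow> prel u \<inter> (Domain r \<times> UNIV) \<in> D"
  shows "Z (a \<star> b) r = (\<Sum>d\<in>D. Z a d * Z b (d\<inverse> O r))"
  by (rule zeta_conv) (use assms in \<open>auto simp: prel_times\<close>)

section \<open>The finite groups \<open>Sn n\<close> and extension of finite injections\<close>

lemma Sn_mult: "g \<in> Sn n \<Longrightarrow> h \<in> Sn n \<Longrightarrow> g * h \<in> Sn n"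
  by (auto simp: Sn_def apply_times)

lemma Sn_one [simp]: "1 \<in> Sn n"
  by (auto simp: Sn_def apply_one)

lemma Sn_inverse [simp]: "inverse g \<in> Sn n \<longleftrightarrow> g \<in> Sn n"
  by (auto simp: Sn_def) (metis apply_inverse_apply)+

lemma Sn_stab_inverse [simp]: "inverse g \<in> Sn_stab m n \<longleftrightarrow> g \<in> Sn_stab m n"
  by (auto simp: Sn_stab_def) (metis apply_inverse_apply)+

lemma Sn_stab_mono: "m \<le> m' \<Longrightarrow> Sn_stab m' n \<subseteq> Sn_stab m n"
  by (auto simp: Sn_stab_def)

lemma SnD: "g \<in> Sn n \<Longrightarrow> n \<le> i \<Longrightarrow> g \<langle>$\<rangle> i = i"
  by (simp add: Sn_def)

lemma Sn_less: "g \<in> Sn n \<Longrightarrow> g \<langle>$\<rangle> i < n \<longleftrightarrow> i < n"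
  using SnD[of g n i] SnD[of "inverse g" n "g \<langle>$\<rangle> i"] by (metis Sn_inverse apply_inverse_apply(1) not_le)

lemma finite_Sn: "finite (Sn n)"
proof -
  have "inj_on apply (Sn n)" by (auto simp: inj_on_def intro: perm_eqI)
  moreover have "apply ` Sn n \<subseteq> {p. p permutes {..<n}}"
    by (auto simp: permutes_def Sn_def) (metis apply_inverse_apply apply_inj)+
  ultimately show ?thesis
    by (metis (no_types) finite_imageD finite_lessThan finite_permutations finite_subset)
qed

lemma ex_Sn: "\<exists>n0. \<forall>n\<ge>n0. (g :: nat perm) \<in> Sn n"
proof -
  obtain n0 where "affected g \<subseteq> {..<n0}"
    using finite_affected finite_nat_iff_bounded by blast
  then have "g \<langle>$\<rangle> i = i" if "n \<ge> n0" "i \<ge> n" for n i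
    using that by (metis in_affected lessThan_iff not_le order_trans subsetD)
  then show ?thesis by (auto simp: Sn_def)
qed

lemma swap_in_Sn: "i < n \<Longrightarrow> j < n \<Longrightarrow> \<langle>i \<leftrightarrow> j\<rangle> \<in> Sn n"
  by (auto simp: Sn_def)

lemma swap_in_Sn_stab: "i < n \<Longrightarrow> j < n \<Longrightarrow> m \<le> i \<Longrightarrow> m \<le> j \<Longrightarrow> \<langle>i \<leftrightarrow> j\<rangle> \<in> Sn_stab m n"
  by (auto simp: Sn_stab_def swap_in_Sn)

text \<open>For the image \<open>Y\<close> of \<open>X\<close>, the sets \<open>X - Y\<close> and
  \<open>Y - X\<close> have equally many points, so the points of \<open>Y\<close> that have no
  value yet can be sent back bijectively; everything else stays fixed.\<close>

lemma perm_extend: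
  fixes f :: "nat \<Rightarrow> nat"
  assumes X: "finite X" and f: "inj_on f X"
  obtains h where "\<And>x. x \<in> X \<Longrightarrow> h \<langle>$\<rangle> x = f x" "affected h \<subseteq> X \<union> f ` X"
proof -
  define Y where "Y = f ` X"
  have "card (Y - X) = card (X - Y)"
    using X card_image[OF f] by (simp add: Y_def card_Diff_subset_Int Int_commute)
  then obtain g where g: "bij_betw g (Y - X) (X - Y)"
    using X by (metis Y_def bij_betw_iff_card finite_Diff finite_imageI)
  define h where "h x = (if x \<in> X then f x else if x \<in> Y - X then g x else x)" for x
  have "bij_betw h X Y"
    using f by (simp add: bij_betw_def Y_def h_def cong: inj_on_cong)
  moreover have "bij_betw h (Y - X) (X - Y)"
    using g by (rule bij_betw_cong[THEN iffD1, rotated]) (simp add: h_def)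
  moreover have "bij_betw h (- (X \<union> Y)) (- (X \<union> Y))"
    by (rule bij_betw_cong[THEN iffD1, OF _ bij_betw_id]) (auto simp: h_def)
  ultimately have "bij_betw h (X \<union> (Y - X) \<union> - (X \<union> Y)) (Y \<union> (X - Y) \<union> - (X \<union> Y))"
    by (intro bij_betw_combine) auto
  then have "bij h"
    by (metis Compl_partition Un_Diff_cancel Un_commute)
  moreover have fin: "{x. h x \<noteq> x} \<subseteq> X \<union> Y" by (auto simp: h_def)
  then have "finite {x. h x \<noteq> x}" using X by (auto simp: Y_def intro: finite_subset)
  ultimately have ap: "apply (Perm h) = h" by (simp add: Perm_inverse)
  show ?thesis
  proof (rule that[of "Perm h"])
    show "affected (Perm h) \<subseteq> X \<union> f ` X"
      using fin by (auto simp: in_affected ap Y_def)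
  qed (simp add: ap h_def)
qed

section \<open>Centralizers in the group algebra\<close>

lemma B_cent_iff:
  "a \<in> B_cent m n \<longleftrightarrow> Poly_Mapping.keys a \<subseteq> Sn n \<and> (\<forall>h\<in>Sn_stab m n. delta h \<star> a = a \<star> delta h)"
  by (simp add: B_cent_def centralizer_def span_of_def)

lemma B_cent_mono: "m \<le> m' \<Longrightarrow> B_cent m n \<subseteq> B_cent m' n"
  using Sn_stab_mono[of m m' n] unfolding B_cent_iff subset_iff by blast

lemma Z_conj: "a \<in> B_cent m n \<Longrightarrow> h \<in> Sn_stab m n \<Longrightarrow> Z a (mv h h r) = Z a r"
  using Z_delta_left[of h a "mv h 1 r"] Z_delta_right[of a h "mv h 1 r"]
  by (simp add: B_cent_iff mv_mv)

lemma B_cent_add: "a \<in> B_cent m n \<Longrightarrow> b \<in> B_cent m n \<Longrightarrow> a + b \<in> B_cent m n"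
  using keys_add[of a b] by (auto simp: B_cent_iff conv_add_left conv_add_right)

lemma B_cent_scale: "a \<in> B_cent m n \<Longrightarrow> scale c a \<in> B_cent m n"
  using keys_scale[of c a] by (auto simp: B_cent_iff conv_scale_left conv_scale_right)

lemma B_cent_0: "0 \<in> B_cent m n"
  by (auto simp: B_cent_iff)

lemma B_cent_conv: "a \<in> B_cent m n \<Longrightarrow> b \<in> B_cent m n \<Longrightarrow> a \<star> b \<in> B_cent m n"
  using span_of_conv[of a "Sn n" b] by (auto simp: B_cent_iff span_of_def Sn_mult) (metis conv_assoc)

lemma B_cent_keys: "a \<in> B_cent m n \<Longrightarrow> u \<in> Poly_Mapping.keys a \<Longrightarrow> u \<in> Sn n"
  by (auto simp: B_cent_iff)

text \<open>The linear anti-automorphism that inverts group elements. It preserves the centralizers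
  and exchanges rows and columns, so that estimates in terms of \<open>exits m r\<close> carry over
  to \<open>exits m (r\<inverse>)\<close>.\<close>

definition flip :: "(nat perm \<Rightarrow>\<^sub>0 complex) \<Rightarrow> (nat perm \<Rightarrow>\<^sub>0 complex)"
  where "flip a = lin_ext inverse a"

lemma Z_flip: "Z (flip a) r = Z a (r\<inverse>)"
  unfolding flip_def zeta_lin_ext by (rule zeta_cong) (auto simp: prel_inverse)

lemma lookup_flip: "Poly_Mapping.lookup (flip a) x = Poly_Mapping.lookup a (inverse x)"
proof -
  have "{g \<in> Poly_Mapping.keys a. inverse g = x} = (if inverse x \<in> Poly_Mapping.keys a then {inverse x} else {})"
    by auto
  then show ?thesis by (simp add: flip_def lookup_lin_ext in_keys_iff)
qed

lemma B_cent_flip: "a \<in> B_cent m n \<Longrightarrow> flip a \<in> B_cent m n"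
proof -
  assume a: "a \<in> B_cent m n"
  have "Poly_Mapping.keys (flip a) \<subseteq> Sn n"
    using a keys_lin_ext[of inverse a] by (fastforce simp: B_cent_iff flip_def)
  moreover have "delta h \<star> flip a = flip a \<star> delta h" if h: "h \<in> Sn_stab m n" for h
  proof (rule poly_mapping_eqI)
    fix x
    have "delta (inverse h) \<star> a = a \<star> delta (inverse h)"
      using a h by (auto simp: B_cent_iff)
    then have "Poly_Mapping.lookup (delta (inverse h) \<star> a) (inverse x) =
        Poly_Mapping.lookup (a \<star> delta (inverse h)) (inverse x)"
      by simp
    then show "Poly_Mapping.lookup (delta h \<star> flip a) x = Poly_Mapping.lookup (flip a \<star> delta h) x"
      by (simp add: lookup_conv_delta_left lookup_conv_delta_right lookup_flip)
  qed
  ultimately show ?thesis by (simp add: B_cent_iff)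
qed

section \<open>Decay of zeta transforms\<close>

definition exits :: "nat \<Rightarrow> rel2 \<Rightarrow> nat set"
  where "exits m r = Domain r - Range r - {..<m}"

lemma finite_exits: "finite r \<Longrightarrow> finite (exits m r)"
  by (simp add: exits_def finite_Domain)

lemma card_exits_le: "finite r \<Longrightarrow> card (exits m r) \<le> card r"
  unfolding exits_def by (meson Diff_subset card_Domain_le card_mono finite_Domain order_trans)

text \<open>Elements of \<open>Sn n\<close> fix all points from \<open>n\<close> on: a pair outside
  of the square is never contained in the graph if it is off the diagonal, and always if it is on
  the diagonal.\<close>

lemma Z_restrict_square:
  assumes "Poly_Mapping.keys a \<subseteq> Sn n"
  shows "Z a r = 0 \<or> Z a r = Z a (r \<inter> ({..<n} \<times> {..<n}))"
proof (cases "\<exists>i j. (i, j) \<in> r \<and> i \<noteq> j \<and> (i \<ge> n \<or> j \<ge> n)")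
  case True
  then obtain i j where ij: "(i, j) \<in> r" "i \<noteq> j" "i \<ge> n \<or> j \<ge> n" by blast
  have "\<not> r \<subseteq> prel u" if "u \<in> Poly_Mapping.keys a" for u
  proof
    assume "r \<subseteq> prel u"
    with ij have "u \<langle>$\<rangle> j = i" by auto
    moreover have "u \<in> Sn n" using assms that by auto
    ultimately show False using ij SnD[of u n j] SnD[of u n i] Sn_less[of u n j] by (metis apply_inj)
  qed
  then show ?thesis by (simp add: zeta_eq_0)
next
  case False
  have "r \<subseteq> prel u \<longleftrightarrow> r \<inter> ({..<n} \<times> {..<n}) \<subseteq> prel u" if "u \<in> Poly_Mapping.keys a" for u
  proof (intro iffI subsetI)
    fix p assume *: "r \<inter> ({..<n} \<times> {..<n}) \<subseteq> prel u" "p \<in> r"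
    obtain i j where p: "p = (i, j)" by force
    have "u \<in> Sn n" using assms that by auto
    moreover have "i = j \<and> \<not> j < n \<or> i < n \<and> j < n" using False *(2) p by (metis not_le)
    ultimately show "p \<in> prel u" using * p SnD[of u n j] by auto
  qed auto
  then have "Z a r = Z a (r \<inter> ({..<n} \<times> {..<n}))" by (rule zeta_cong)
  then show ?thesis by simp
qed

lemma inj_into_interval:
  fixes X :: "nat set"
  assumes "finite X" "card X \<le> q"
  obtains f where "inj_on f X" "f ` X \<subseteq> {m..<m + q}"
proof -
  obtain f where "inj_on f X" "f ` X \<subseteq> {m..<m + q}"
    using inj_on_iff_card_le[OF assms(1), of "{m..<m + q}"] assms(2) by auto
  then show ?thesis by (rule that)
qed

text \<open>The field of \<open>r\<close> has at most \<open>2 * l\<close> points. Conjugation by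
  \<open>Sn_stab m n\<close> moves those from \<open>m\<close> on into the interval that follows
  \<open>m\<close>. The resulting square does not depend on \<open>n\<close>, which is what makes
  pointwise bounds uniform.\<close>

lemma Z_orbit_representative:
  assumes a: "a \<in> B_cent m n" and r: "finite r" "card r \<le> l"
  shows "Z a r = 0 \<or> (\<exists>s\<subseteq>{..<m + 2 * l} \<times> {..<m + 2 * l}. Z a r = Z a s)"
proof -
  define s where "s = r \<inter> ({..<n} \<times> {..<n})"
  have keys: "Poly_Mapping.keys a \<subseteq> Sn n" using a by (auto simp: B_cent_iff)
  have s: "finite s" "card s \<le> l" using r card_mono[OF r(1), of s] by (auto simp: s_def)
  consider "Z a r = 0" | "Z a r = Z a s" using Z_restrict_square[OF keys, of r] by (auto simp: s_def)
  then show ?thesis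
  proof cases
    case 2
    show ?thesis
    proof (cases "n \<le> m + 2 * l")
      case True
      then have "s \<subseteq> {..<m + 2 * l} \<times> {..<m + 2 * l}" by (auto simp: s_def)
      then show ?thesis using 2 by blast
    next
      case False
      define X where "X = Field s - {..<m}"
      have "card (Field s) \<le> 2 * l"
        unfolding Field_def using card_Un_le[of "Domain s"
            "Range s"] card_Domain_le[OF s(1)] card_Range_le[OF s(1)] s(2)
        by linarith
      then have X: "finite X" "card X \<le> 2 * l"
        using s(1) card_mono[of "Field s" X] by (auto simp: X_def finite_Field)
      obtain f where f: "inj_on f X" "f ` X \<subseteq> {m..<m + 2 * l}"
        using inj_into_interval[OF X] by blast
      define g where "g x = (if x < m then x else f x)" for x
      have gm: "g x = x" if "x < m" for x using that by (simp add: g_def)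
      have gX: "g x = f x" if "x \<in> X" for x using that by (simp add: g_def X_def)
      have inj: "inj_on g ({..<m} \<union> X)"
      proof (rule inj_onI)
        fix x y assume xy: "x \<in> {..<m} \<union> X" "y \<in> {..<m} \<union> X" "g x = g y"
        have "f z \<ge> m" if "z \<in> X" for z using f(2) that by auto
        then show "x = y"
          using xy gX gm f(1) by (metis UnE inj_on_def lessThan_iff not_le)
      qed
      obtain h where h: "\<And>x. x \<in> {..<m} \<union> X \<Longrightarrow> h \<langle>$\<rangle> x = g x" "affected h \<subseteq> ({..<m} \<union> X) \<union> g ` ({..<m} \<union> X)"
        using perm_extend[OF _ inj] X(1) by auto
      have "X \<subseteq> {..<n}" by (auto simp: X_def s_def Field_def)
      moreover have img: "g ` ({..<m} \<union> X) \<subseteq> {..<m + 2 * l}" using f(2) gX gm by fastforce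
      ultimately have "affected h \<subseteq> {..<n}" using h(2) False by fastforce
      then have "h \<in> Sn_stab m n"
        using h(1) gm by (auto simp: Sn_stab_def Sn_def in_affected subset_iff)
      then have "Z a s = Z a (mv h h s)" using Z_conj[OF a] by simp
      moreover have "mv h h s \<subseteq> {..<m + 2 * l} \<times> {..<m + 2 * l}"
      proof -
        have "h \<langle>$\<rangle> x < m + 2 * l" if "x \<in> Field s" for x
        proof -
          have "x \<in> {..<m} \<union> X" using that by (auto simp: X_def)
          then show ?thesis using h(1) img by fastforce
        qed
        then show ?thesis by (auto simp: mv_def Field_def)
      qed
      ultimately show ?thesis using 2 by metis
    qed
  qed simp
qed

text \<open>Finitely many orbit representatives serve all \<open>n\<close> at once, so the bounds at
  these relations may be added up.\<close>

lemma Z_uniform_bound: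
  assumes a: "\<And>n. n \<ge> n0 \<Longrightarrow> \<alpha> n \<in> B_cent m n"
    and bd: "\<And>r. finite r \<Longrightarrow> Bseq (\<lambda>n. Z (\<alpha> n) r)"
  obtains C where "C \<ge> 0" "\<And>n r. n \<ge> n0 \<Longrightarrow> finite r \<Longrightarrow> card r \<le> l \<Longrightarrow> cmod (Z (\<alpha> n) r) \<le> C"
proof -
  let ?S = "Pow ({..<m + 2 * l} \<times> {..<m + 2 * l})"
  have "\<exists>K\<ge>0. \<forall>n. cmod (Z (\<alpha> n) s) \<le> K" if "s \<in> ?S" for s
  proof -
    have "finite s" using that by (meson PowD finite_SigmaI finite_lessThan finite_subset)
    then obtain K where "\<forall>n. cmod (Z (\<alpha> n) s) \<le> K" using bd[of s] by (auto simp: Bseq_def)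
    then show ?thesis by (meson norm_ge_zero order_trans)
  qed
  then obtain K where K: "\<And>s. s \<in> ?S \<Longrightarrow> K s \<ge> 0" "\<And>s n. s \<in> ?S \<Longrightarrow> cmod (Z (\<alpha> n) s) \<le> K s"
    by metis
  show ?thesis
  proof (rule that)
    show "sum K ?S \<ge> 0" using K(1) by (rule sum_nonneg)
    fix n and r :: rel2 assume n: "n \<ge> n0" and r: "finite r" "card r \<le> l"
    show "cmod (Z (\<alpha> n) r) \<le> sum K ?S"
    proof (cases "Z (\<alpha> n) r = 0")
      case True
      then show ?thesis using \<open>sum K ?S \<ge> 0\<close> by simp
    next
      case False
      then obtain s where s: "s \<in> ?S" "Z (\<alpha> n) r = Z (\<alpha> n) s"
        using Z_orbit_representative[OF a[OF n] r] by auto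
      have "K s \<le> sum K ?S" by (rule member_le_sum) (use s K(1) in auto)
      then show ?thesis using s K(2)[OF s(1)] by (metis order_trans)
    qed
  qed
qed

text \<open>The value at \<open>r - {(i, j)}\<close> is the sum over all possible images
  \<open>p\<close> of \<open>j\<close>. If \<open>p\<close> is not in \<open>P\<close>, the
  transposition of \<open>i\<close> and \<open>p\<close> lies in \<open>Sn_stab m n\<close> and
  turns \<open>r\<close> into \<open>insert (p, j) (r - {(i, j)})\<close>, so all these summands
  equal the value at \<open>r\<close>; here it matters that \<open>i\<close> occurs in no other pair
  of \<open>r\<close>.\<close>

lemma Z_exit_step:
  assumes a: "a \<in> B_cent m n" and oo: "one_one r"
    and i: "i \<in> exits m r" "(i, j) \<in> r" and nz: "Z a r \<noteq> 0"
  defines "P \<equiv> {p. p < n \<and> p \<in> Domain r \<union> Range r \<union> {..<m}}"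
  shows "of_nat (n - card P) * Z a r =
         Z a (r - {(i, j)}) - (\<Sum>p\<in>P. Z a (insert (p, j) (r - {(i, j)})))"
proof -
  let ?r0 = "r - {(i, j)}"
  have iR: "i \<notin> Range r" "i \<ge> m" using i(1) by (auto simp: exits_def)
  have ij: "i \<noteq> j" using iR i(2) by auto
  have keys: "\<And>u. u \<in> Poly_Mapping.keys a \<Longrightarrow> u \<in> Sn n" using a B_cent_keys by blast
  obtain u where u: "u \<in> Sn n" "r \<subseteq> prel u"
    using nz keys zeta_eq_0[of a r prel] by blast
  then have "i = u \<langle>$\<rangle> j" using i(2) by auto
  then have lt: "i < n" "j < n" using Sn_less[OF u(1), of j] SnD[OF u(1), of j] ij
      by (auto simp: not_less[symmetric])
  \<comment> \<open>Every element of \<open>Sn n\<close> sends \<open>j\<close> to exactly one point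
    below \<open>n\<close>, because \<open>j < n\<close>.\<close>
  have split: "Z a ?r0 = (\<Sum>p<n. Z a (insert (p, j) ?r0))"
  proof -
    have "(\<Sum>p<n. Z a (insert (p, j) ?r0)) =
       (\<Sum>p<n. \<Sum>u\<in>Poly_Mapping.keys a. if insert (p, j) ?r0 \<subseteq> prel u then Poly_Mapping.lookup a u else 0)"
      by (simp add: zeta_superset[of "Poly_Mapping.keys a"])
    also have "\<dots> = (\<Sum>u\<in>Poly_Mapping.keys a. \<Sum>p<n. if insert (p,
        j) ?r0 \<subseteq> prel u then Poly_Mapping.lookup a u else 0)"
      by (rule sum.swap)
    also have "\<dots> = (\<Sum>u\<in>Poly_Mapping.keys a. if ?r0 \<subseteq> prel u then Poly_Mapping.lookup a u else 0)"
    proof (rule sum.cong[OF refl])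
      fix u assume "u \<in> Poly_Mapping.keys a"
      then have "u \<langle>$\<rangle> j < n" using keys Sn_less lt by blast
      then show "(\<Sum>p<n. if insert (p, j) ?r0 \<subseteq> prel u then Poly_Mapping.lookup a u else 0) =
            (if ?r0 \<subseteq> prel u then Poly_Mapping.lookup a u else 0)"
        by simp
    qed
    also have "\<dots> = Z a ?r0" by (simp add: zeta_superset[of "Poly_Mapping.keys a"])
    finally show ?thesis by simp
  qed
  have fresh: "Z a (insert (p, j) ?r0) = Z a r" if p: "p \<in> {..<n} - P" for p
  proof -
    let ?h = "\<langle>i \<leftrightarrow> p\<rangle>"
    have p': "p < n" "p \<notin> Domain r" "p \<notin> Range r" "p \<ge> m" using p by (auto simp: P_def)
    have "mv ?h ?h r = insert (p, j) ?r0"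
    proof -
      have "mv ?h ?h r = insert (p, j) (mv ?h ?h ?r0)"
      proof -
        have "r = insert (i, j) ?r0" using i(2) by auto
        moreover have "?h \<langle>$\<rangle> j = j" using ij i(2) p' by (auto intro: apply_swap_same)
        moreover have "mv ?h ?h (insert (i, j) s) = insert (?h \<langle>$\<rangle> i, ?h \<langle>$\<rangle> j) (mv ?h ?h s)" for s
          by (simp add: mv_def)
        ultimately show ?thesis by (metis apply_swap_simp(1))
      qed
      also have "mv ?h ?h ?r0 = ?r0"
      proof -
        have "(case q of (x, y) \<Rightarrow> (?h \<langle>$\<rangle> x, ?h \<langle>$\<rangle> y)) = q" if q: "q \<in> ?r0" for q
        proof -
          obtain x y where xy: "q = (x, y)" by force
          have "x \<noteq> i" using q xy i(2) one_one_eq1[OF oo] by auto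
          moreover have "y \<noteq> i" "x \<noteq> p" "y \<noteq> p" using q xy iR p' by auto
          ultimately show ?thesis using xy by simp
        qed
        then show ?thesis unfolding mv_def by (simp add: image_cong[of ?r0 ?r0 _ "\<lambda>q. q"])
      qed
      finally show ?thesis .
    qed
    moreover have "?h \<in> Sn_stab m n" using lt p' iR by (intro swap_in_Sn_stab) auto
    ultimately show ?thesis using Z_conj[OF a, of ?h r] by simp
  qed
  have P: "P \<subseteq> {..<n}" by (auto simp: P_def)
  then have finP: "finite P" by (rule finite_subset) simp
  have "Z a ?r0 = (\<Sum>p\<in>P. Z a (insert (p, j) ?r0)) + (\<Sum>p\<in>{..<n} - P. Z a (insert (p, j) ?r0))"
    unfolding split using sum.subset_diff[OF P, of "\<lambda>p. Z a (insert (p, j) ?r0)"] by (simp add: add.commute)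
  also have "(\<Sum>p\<in>{..<n} - P. Z a (insert (p, j) ?r0)) = of_nat (n - card P) * Z a r"
    using fresh P finP by (simp add: card_Diff_subset)
  finally show ?thesis by simp
qed

text \<open>A point of \<open>exits m r\<close> may be moved to about \<open>n\<close> other positions without changing the
  value, while the sum of all these values telescopes to a bounded quantity.\<close>

lemma Z_decay_aux:
  assumes a: "\<And>n. n \<ge> n0 \<Longrightarrow> \<alpha> n \<in> B_cent m n"
    and bd: "\<And>r. finite r \<Longrightarrow> Bseq (\<lambda>n. Z (\<alpha> n) r)"
  shows "\<exists>C\<ge>0. \<forall>n\<ge>n0. \<forall>r. finite r \<longrightarrow> card r \<le> l \<longrightarrow> k \<le> card (exits m r) \<longrightarrow>
           real n ^ k * cmod (Z (\<alpha> n) r) \<le> C"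
proof (induction k)
  case 0
  obtain C where "C \<ge> 0" "\<And>n r. n \<ge> n0 \<Longrightarrow> finite r \<Longrightarrow> card r \<le> l \<Longrightarrow> cmod (Z (\<alpha> n) r) \<le> C"
    using Z_uniform_bound[OF a bd, where l = l] by blast
  then show ?case by (auto intro!: exI[of _ C])
next
  case (Suc k)
  then obtain C where C: "C \<ge> 0" "\<And>n r. n \<ge> n0 \<Longrightarrow> finite r \<Longrightarrow> card r \<le> l \<Longrightarrow> k \<le> card (exits m r) \<Longrightarrow>
     real n ^ k * cmod (Z (\<alpha> n) r) \<le> C" by blast
  \<comment> \<open>This bounds \<open>card P\<close> below: the field of \<open>r\<close> has at
    most \<open>2 * l\<close> points, and \<open>{..<m}\<close> has \<open>m\<close>.\<close>
  define q where "q = 2 * l + m"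
  show ?case
  proof (intro exI[of _ "2 * C * (1 + real q)"] conjI allI impI)
    show "0 \<le> 2 * C * (1 + real q)" using C(1) by simp
    fix n and r :: rel2 assume n: "n \<ge> n0" and r: "finite r" "card r \<le> l" and ex: "Suc k \<le> card (exits m r)"
    have Ck: "real n ^ k * cmod (Z (\<alpha> n) r) \<le> C" using C(2)[OF n r] ex by simp
    show "real n ^ Suc k * cmod (Z (\<alpha> n) r) \<le> 2 * C * (1 + real q)"
    proof (cases "Z (\<alpha> n) r = 0")
      case True
      then show ?thesis using C(1) by simp
    next
      case nz: False
      then have oo: "one_one r" using Z_not_one_one by blast
      show ?thesis
      \<comment> \<open>For small \<open>n\<close> the extra factor \<open>n\<close> is absorbed by
        the constant; otherwise at least half of the \<open>n\<close> positions lie outside of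
        \<open>P\<close>.\<close>
      proof (cases "n < 2 * q")
        case True
        have "real n ^ Suc k * cmod (Z (\<alpha> n) r) = real n * (real n ^ k * cmod (Z (\<alpha> n) r))" by simp
        also have "\<dots> \<le> (2 * real q) * C" using True Ck C(1) by (intro mult_mono) auto
        also have "\<dots> \<le> 2 * C * (1 + real q)" using C(1) by (simp add: algebra_simps)
        finally show ?thesis .
      next
        case False
        have "exits m r \<noteq> {}" using ex by auto
        then obtain i j where i: "i \<in> exits m r" "(i, j) \<in> r" by (auto simp: exits_def)
        define P where "P = {p. p < n \<and> p \<in> Domain r \<union> Range r \<union> {..<m}}"
        let ?r0 = "r - {(i, j)}"
        have fr: "finite (exits m r)" using r(1) by (rule finite_exits)
        have cP: "card P \<le> q"
        proof -
          have "card P \<le> card (Domain r \<union> Range r \<union> {..<m})"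
            by (rule card_mono) (auto simp: P_def r finite_Domain finite_Range)
          also have "\<dots> \<le> card (Domain r \<union> Range r) + card {..<m}" by (rule card_Un_le)
          also have "\<dots> \<le> (card (Domain r) + card (Range r)) + m" using card_Un_le[of "Domain r" "Range r"] by simp
          also have "\<dots> \<le> q" using card_Domain_le[OF r(1)] card_Range_le[OF r(1)] r(2) by (simp add: q_def)
          finally show ?thesis .
        qed
        \<comment> \<open>All relations on the right-hand side of \<open>Z_exit_step\<close> keep
          every exit of \<open>r\<close> except \<open>i\<close>, so the induction hypothesis
          applies to them with exponent \<open>k\<close>.\<close>
        have B: "real n ^ k * cmod (Z (\<alpha> n) s) \<le> C" if "finite s" "card s \<le> card r"
            "exits m r - {i} \<subseteq> exits m s" for s
        proof (rule C(2)[OF n])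
          have "card (exits m r - {i}) \<le> card (exits m s)"
            using that by (intro card_mono finite_exits)
          then show "k \<le> card (exits m s)" using ex i(1) fr by simp
        qed (use that r in auto)
        have "real n / 2 \<le> real (n - card P)" using False cP by linarith
        then have "real n ^ Suc k * cmod (Z (\<alpha> n) r) \<le> 2 * (real n ^ k * (real (n - card P) * cmod (Z (\<alpha> n) r)))"
        proof -
          assume h: "real n / 2 \<le> real (n - card P)"
          have "(real n / 2) * (real n ^ k * cmod (Z (\<alpha> n) r)) \<le> real (n - card P) * (real n ^ k * cmod (Z (\<alpha> n) r))"
            using h by (intro mult_right_mono) auto
          then show ?thesis by (simp add: algebra_simps)
        qed
        also have "real (n - card P) * cmod (Z (\<alpha> n) r) = cmod (of_nat (n - card P) * Z (\<alpha> n) r)"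
          by (simp add: norm_mult)
        also have "of_nat (n - card P) * Z (\<alpha> n) r = Z (\<alpha> n) ?r0 - (\<Sum>p\<in>P. Z (\<alpha> n) (insert (p, j) ?r0))"
          unfolding P_def by (rule Z_exit_step[OF a[OF n] oo i nz])
        also have "cmod \<dots> \<le> cmod (Z (\<alpha> n) ?r0) + (\<Sum>p\<in>P. cmod (Z (\<alpha> n) (insert (p, j) ?r0)))"
          by (rule order_trans[OF norm_triangle_ineq4]) (simp add: norm_sum)
        also have "2 * (real n ^ k * (cmod (Z (\<alpha> n) ?r0) + (\<Sum>p\<in>P. cmod (Z (\<alpha> n) (insert (p, j) ?r0))))) =
            2 * (real n ^ k * cmod (Z (\<alpha> n) ?r0) + (\<Sum>p\<in>P. real n ^ k * cmod (Z (\<alpha> n) (insert (p, j) ?r0))))"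
          by (simp add: algebra_simps sum_distrib_left)
        also have "\<dots> \<le> 2 * (C + (\<Sum>p\<in>P. C))"
        proof (intro mult_left_mono add_mono sum_mono)
          show "real n ^ k * cmod (Z (\<alpha> n) ?r0) \<le> C"
            using i by (intro B) (auto simp: r card_Diff1_le exits_def dest: one_one_eq2[OF oo])
          fix p assume "p \<in> P"
          show "real n ^ k * cmod (Z (\<alpha> n) (insert (p, j) ?r0)) \<le> C"
          proof (rule B)
            have "card (insert (p, j) ?r0) \<le> Suc (card ?r0)" by (rule card_insert_le_m1) (use r in auto)
            then show "card (insert (p, j) ?r0) \<le> card r" using i r card_Suc_Diff1[of r "(i, j)"] by simp
            show "exits m r - {i} \<subseteq> exits m (insert (p, j) ?r0)" using i by (auto simp: exits_def)
          qed (use r in auto)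
        qed simp
        also have "\<dots> = 2 * C * (1 + real (card P))" by (simp add: algebra_simps)
        also have "\<dots> \<le> 2 * C * (1 + real q)" using cP C(1) by (intro mult_left_mono) auto
        finally show ?thesis by (simp add: mult_left_mono)
      qed
    qed
  qed
qed

text \<open>At most \<open>l\<close> points can be exits, so it is enough to add up finitely many of
  the constants from \<open>Z_decay_aux\<close>.\<close>

lemma Z_decay1:
  assumes a: "\<And>n. n \<ge> n0 \<Longrightarrow> \<alpha> n \<in> B_cent m n"
    and bd: "\<And>r. finite r \<Longrightarrow> Bseq (\<lambda>n. Z (\<alpha> n) r)"
  shows "\<exists>C\<ge>0. \<forall>n\<ge>n0. \<forall>r. finite r \<longrightarrow> card r \<le> l \<longrightarrow>
           real n ^ card (exits m r) * cmod (Z (\<alpha> n) r) \<le> C"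
proof -
  have "\<forall>k. \<exists>C\<ge>0. \<forall>n\<ge>n0. \<forall>r. finite r \<longrightarrow> card r \<le> l \<longrightarrow> k \<le> card (exits m r) \<longrightarrow>
           real n ^ k * cmod (Z (\<alpha> n) r) \<le> C"
    using Z_decay_aux[OF a bd] by blast
  then obtain C where C: "\<And>k. C k \<ge> 0" "\<And>k n r. n \<ge> n0 \<Longrightarrow> finite r \<Longrightarrow> card r \<le> l \<Longrightarrow> k \<le> card (exits m r) \<Longrightarrow>
           real n ^ k * cmod (Z (\<alpha> n) r) \<le> C k" by metis
  show ?thesis
  proof (intro exI[of _ "\<Sum>k\<le>l. C k"] conjI allI impI)
    show "0 \<le> (\<Sum>k\<le>l. C k)" using C(1) by (simp add: sum_nonneg)
    fix n and r :: rel2 assume h: "n0 \<le> n" "finite r" "card r \<le> (l::nat)"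
    have "C (card (exits m r)) \<le> (\<Sum>k\<le>l. C k)"
      by (rule member_le_sum) (use card_exits_le[of r m] h C(1) in auto)
    then show "real n ^ card (exits m r) * cmod (Z (\<alpha> n) r) \<le> (\<Sum>k\<le>l. C k)"
      using C(2)[OF h order_refl] by linarith
  qed
qed

text \<open>The second estimate is the first one for the sequence of the elements
  \<open>flip (\<alpha> n)\<close>.\<close>

lemma Z_decay:
  assumes a: "\<And>n. n \<ge> n0 \<Longrightarrow> \<alpha> n \<in> B_cent m n"
    and bd: "\<And>r. finite r \<Longrightarrow> Bseq (\<lambda>n. Z (\<alpha> n) r)"
  shows "\<exists>C\<ge>0. \<forall>n\<ge>n0. \<forall>r. finite r \<longrightarrow> card r \<le> l \<longrightarrow>
           real n ^ card (exits m r) * cmod (Z (\<alpha> n) r) \<le> C \<and>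
           real n ^ card (exits m (r\<inverse>)) * cmod (Z (\<alpha> n) r) \<le> C"
proof -
  have "\<exists>C\<ge>0. \<forall>n\<ge>n0. \<forall>r. finite r \<longrightarrow> card r \<le> l \<longrightarrow>
           real n ^ card (exits m r) * cmod (Z (\<alpha> n) r) \<le> C"
    by (rule Z_decay1) (use a bd in auto)
  then obtain C1 where C1: "C1 \<ge> 0" "\<And>n r. n \<ge> n0 \<Longrightarrow> finite r \<Longrightarrow> card r \<le> l \<Longrightarrow>
      real n ^ card (exits m r) * cmod (Z (\<alpha> n) r) \<le> C1"
    by blast
  have "\<exists>C\<ge>0. \<forall>n\<ge>n0. \<forall>r. finite r \<longrightarrow> card r \<le> l \<longrightarrow>
           real n ^ card (exits m r) * cmod (Z (flip (\<alpha> n)) r) \<le> C"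
    by (rule Z_decay1) (use a bd in \<open>auto simp: B_cent_flip Z_flip\<close>)
  then obtain C2 where C2: "C2 \<ge> 0" "\<And>n r. n \<ge> n0 \<Longrightarrow> finite r \<Longrightarrow> card r \<le> l \<Longrightarrow>
      real n ^ card (exits m r) * cmod (Z (flip (\<alpha> n)) r) \<le> C2"
    by blast
  have C2': "real n ^ card (exits m (r\<inverse>)) * cmod (Z (\<alpha> n) r) \<le> C2"
    if "n \<ge> n0" "finite r" "card r \<le> l" for n r
    using C2(2)[of n "r\<inverse>"] that by (simp add: Z_flip)
  show ?thesis
  proof (intro exI[of _ "max C1 C2"] conjI allI impI)
    fix n and r :: rel2 assume h: "n \<ge> n0" "finite r" "card r \<le> l"
    show "real n ^ card (exits m r) * cmod (Z (\<alpha> n) r) \<le> max C1 C2"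
      by (rule max.coboundedI1) (rule C1(2)[OF h])
    show "real n ^ card (exits m (r\<inverse>)) * cmod (Z (\<alpha> n) r) \<le> max C1 C2"
      by (rule max.coboundedI2) (rule C2'[OF h])
  qed (use C1 in simp)
qed

section \<open>Convergence of zeta transforms\<close>

text \<open>The centralizer and degree conditions on convergent sequences, with pointwise
  convergence of zeta transforms in place of strong convergence of operators; that this is the same
  notion is \<open>convergent_seqs_iff\<close>. Setting \<open>f\<close> to 0 at infinite relations
  makes \<open>f\<close> a function of the sequence.\<close>

definition zconv :: "nat \<Rightarrow> (nat \<Rightarrow> (nat perm \<Rightarrow>\<^sub>0 complex)) \<Rightarrow> (rel2 \<Rightarrow> complex) \<Rightarrow> bool"
  where "zconv m \<alpha> f \<longleftrightarrow> (\<forall>\<^sub>F n in sequentially. \<alpha> n \<in> B_cent m n) \<and>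
     (\<exists>d. \<forall>n\<ge>1. \<forall>u\<in>Poly_Mapping.keys (\<alpha> n). perm_deg u \<le> d) \<and>
     (\<forall>r. finite r \<longrightarrow> (\<lambda>n. Z (\<alpha> n) r) \<longlonglongrightarrow> f r) \<and> (\<forall>r. infinite r \<longrightarrow> f r = 0)"

lemma zconv_lim: "zconv m \<alpha> f \<Longrightarrow> finite r \<Longrightarrow> (\<lambda>n. Z (\<alpha> n) r) \<longlonglongrightarrow> f r"
  by (simp add: zconv_def)

lemma zconvI:
  assumes "\<forall>\<^sub>F n in sequentially. \<alpha> n \<in> B_cent m n"
    and "\<And>n u. n \<ge> 1 \<Longrightarrow> u \<in> Poly_Mapping.keys (\<alpha> n) \<Longrightarrow> perm_deg u \<le> d"
    and "\<And>r. finite r \<Longrightarrow> (\<lambda>n. Z (\<alpha> n) r) \<longlonglongrightarrow> f r"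
    and "\<And>r. infinite r \<Longrightarrow> f r = 0"
  shows "zconv m \<alpha> f"
  unfolding zconv_def using assms(1,3,4) by (intro conjI exI[of _ d] allI impI ballI assms(2))

lemma zconv_cent: "zconv m \<alpha> f \<Longrightarrow> \<forall>\<^sub>F n in sequentially. \<alpha> n \<in> B_cent m n"
  by (simp add: zconv_def)

lemma zconv_infinite: "zconv m \<alpha> f \<Longrightarrow> infinite r \<Longrightarrow> f r = 0"
  by (simp add: zconv_def)

lemma zconv_deg:
  "zconv m \<alpha> f \<Longrightarrow> \<exists>d. \<forall>n\<ge>1. \<forall>u\<in>Poly_Mapping.keys (\<alpha> n). perm_deg u \<le> d"
  by (simp add: zconv_def)

lemma tendsto_0_norm_le:
  fixes f :: "nat \<Rightarrow> 'a::real_normed_vector"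
  assumes "\<forall>\<^sub>F n in sequentially. norm (f n) \<le> g n" "g \<longlonglongrightarrow> 0"
  shows "f \<longlonglongrightarrow> 0"
  by (rule tendsto_norm_zero_cancel, rule tendsto_sandwich[OF _ assms(1) tendsto_const assms(2)]) simp

lemma zconv_mono: "m \<le> m' \<Longrightarrow> zconv m \<alpha> f \<Longrightarrow> zconv m' \<alpha> f"
proof -
  assume h: "m \<le> m'" "zconv m \<alpha> f"
  have "\<forall>\<^sub>F n in sequentially. \<alpha> n \<in> B_cent m' n"
    using zconv_cent[OF h(2)] by eventually_elim (use B_cent_mono[OF h(1)] in blast)
  then show ?thesis using h(2) by (simp add: zconv_def)
qed

lemma zconv_add:
  assumes "zconv m \<alpha> f" "zconv m \<beta> g"
  shows "zconv m (\<lambda>n. \<alpha> n + \<beta> n) (\<lambda>r. f r + g r)"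
proof -
  obtain d1 where d1: "\<And>n u. n \<ge> 1 \<Longrightarrow> u \<in> Poly_Mapping.keys (\<alpha> n) \<Longrightarrow> perm_deg u \<le> d1"
    using zconv_deg[OF assms(1)] by blast
  obtain d2 where d2: "\<And>n u. n \<ge> 1 \<Longrightarrow> u \<in> Poly_Mapping.keys (\<beta> n) \<Longrightarrow> perm_deg u \<le> d2"
    using zconv_deg[OF assms(2)] by blast
  show ?thesis
  proof (rule zconvI)
    show "\<forall>\<^sub>F n in sequentially. \<alpha> n + \<beta> n \<in> B_cent m n"
      using zconv_cent[OF assms(1)] zconv_cent[OF assms(2)] by eventually_elim (rule B_cent_add)
    show "perm_deg u \<le> max d1 d2" if "1 \<le> n" "u \<in> Poly_Mapping.keys (\<alpha> n + \<beta> n)" for n u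
      using keys_add[of "\<alpha> n" "\<beta> n"] d1[of n u] d2[of n u] that by fastforce
    show "(\<lambda>n. Z (\<alpha> n + \<beta> n) r) \<longlonglongrightarrow> f r + g r" if "finite r" for r
      unfolding zeta_add using assms that by (intro tendsto_add zconv_lim)
    show "f r + g r = 0" if "infinite r" for r
      using assms[THEN zconv_infinite, OF that] by simp
  qed
qed

lemma zconv_scale:
  assumes "zconv m \<alpha> f"
  shows "zconv m (\<lambda>n. scale c (\<alpha> n)) (\<lambda>r. c * f r)"
proof -
  obtain d where d: "\<And>n u. n \<ge> 1 \<Longrightarrow> u \<in> Poly_Mapping.keys (\<alpha> n) \<Longrightarrow> perm_deg u \<le> d"
    using zconv_deg[OF assms] by blast
  show ?thesis
  proof (rule zconvI)
    show "\<forall>\<^sub>F n in sequentially. scale c (\<alpha> n) \<in> B_cent m n"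
      using zconv_cent[OF assms] by eventually_elim (rule B_cent_scale)
    show "perm_deg u \<le> d" if "1 \<le> n" "u \<in> Poly_Mapping.keys (scale c (\<alpha> n))" for n u
      using keys_scale[of c "\<alpha> n"] d[of n u] that by fast
    show "(\<lambda>n. Z (scale c (\<alpha> n)) r) \<longlonglongrightarrow> c * f r" if "finite r" for r
      unfolding zeta_scale using assms that by (intro tendsto_mult_left zconv_lim)
    show "c * f r = 0" if "infinite r" for r
      using zconv_infinite[OF assms that] by simp
  qed
qed

lemma zconv_diff:
  assumes "zconv m \<alpha> f" "zconv m \<beta> g"
  shows "zconv m (\<lambda>n. \<alpha> n - \<beta> n) (\<lambda>r. f r - g r)"
  using zconv_add[OF assms(1) zconv_scale[OF assms(2), of "-1"]] by simp

lemma zconv_zero: "zconv m (\<lambda>n. 0) (\<lambda>r. 0)"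
  by (simp add: zconv_def B_cent_0)

lemma B_cent_delta:
  assumes "g \<in> Sn m" "m \<le> n"
  shows "delta g \<in> B_cent m n"
proof -
  have "h * g = g * h" if h: "h \<in> Sn_stab m n" for h
  proof (rule perm_eqI)
    fix i
    have hi: "h \<langle>$\<rangle> i = i" if "i < m" for i using h that by (simp add: Sn_stab_def)
    show "(h * g) \<langle>$\<rangle> i = (g * h) \<langle>$\<rangle> i"
    proof (cases "i < m")
      case True
      then show ?thesis using hi Sn_less[OF assms(1), of i] by (simp add: apply_times)
    next
      case False
      then have "\<not> h \<langle>$\<rangle> i < m" using hi[of "h \<langle>$\<rangle> i"] by (auto simp: apply_inj)
      then show ?thesis using False SnD[OF assms(1)] by (simp add: apply_times)
    qed
  qed
  moreover have "g \<in> Sn n" using assms by (simp add: Sn_def)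
  ultimately show ?thesis by (simp add: B_cent_iff)
qed

lemma zconv_delta:
  assumes "g \<in> Sn m"
  shows "zconv m (\<lambda>n. delta g) (\<lambda>r. if finite r \<and> r \<subseteq> prel g then 1 else 0)"
proof (rule zconvI)
  show "\<forall>\<^sub>F n in sequentially. delta g \<in> B_cent m n"
    using B_cent_delta[OF assms] by (rule eventually_sequentiallyI)
qed (auto simp: zeta_single)

lemma zconv_Bseq:
  assumes "zconv m \<alpha> f"
  shows "finite r \<Longrightarrow> Bseq (\<lambda>n. Z (\<alpha> n) r)"
  using zconv_lim[OF assms] by (meson convergentI convergent_imp_Bseq)

lemma zconv_decay:
  assumes "zconv m \<alpha> f"
  obtains n0 C where "C \<ge> 0" "n0 \<ge> 1" "n0 \<ge> m" "\<And>n. n \<ge> n0 \<Longrightarrow> \<alpha> n \<in> B_cent m n"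
    "\<And>n r. n \<ge> n0 \<Longrightarrow> finite r \<Longrightarrow> card r \<le> l \<Longrightarrow> real n ^ card (exits m r) * cmod (Z (\<alpha> n) r) \<le> C"
    "\<And>n r. n \<ge> n0 \<Longrightarrow> finite r \<Longrightarrow> card r \<le> l \<Longrightarrow> real n ^ card (exits m (r\<inverse>)) * cmod (Z (\<alpha> n) r) \<le> C"
proof -
  obtain n1 where n1: "\<And>n. n \<ge> n1 \<Longrightarrow> \<alpha> n \<in> B_cent m n"
    using zconv_cent[OF assms] unfolding eventually_sequentially by blast
  define n0 where "n0 = max n1 (max m 1)"
  have "\<exists>C\<ge>0. \<forall>n\<ge>n0. \<forall>r. finite r \<longrightarrow> card r \<le> l \<longrightarrow>
           real n ^ card (exits m r) * cmod (Z (\<alpha> n) r) \<le> C \<and>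
           real n ^ card (exits m (r\<inverse>)) * cmod (Z (\<alpha> n) r) \<le> C"
    using zconv_Bseq[OF assms] n1 by (intro Z_decay) (auto simp: n0_def)
  then obtain C where "C \<ge> 0" "\<forall>n\<ge>n0. \<forall>r. finite r \<longrightarrow> card r \<le> l \<longrightarrow>
           real n ^ card (exits m r) * cmod (Z (\<alpha> n) r) \<le> C \<and>
           real n ^ card (exits m (r\<inverse>)) * cmod (Z (\<alpha> n) r) \<le> C" by blast
  then show ?thesis using n1 by (intro that[of C n0]) (auto simp: n0_def)
qed

lemma zconv_finite: "zconv m \<alpha> f \<Longrightarrow> f r \<noteq> 0 \<Longrightarrow> finite r"
  by (auto simp: zconv_def)

lemma zconv_one_one:
  assumes "zconv m \<alpha> f" "f r \<noteq> 0"
  shows "one_one r"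
proof (rule ccontr)
  assume "\<not> one_one r"
  then have "(\<lambda>n. Z (\<alpha> n) r) = (\<lambda>n. 0)" by (simp add: Z_not_one_one)
  then show False using zconv_lim[OF assms(1) zconv_finite[OF assms]] assms(2)
    by (simp add: LIMSEQ_const_iff)
qed

text \<open>A finitary permutation that fixes the points below \<open>m\<close> lies in
  \<open>Sn_stab m n\<close> for all large \<open>n\<close>.\<close>

lemma zconv_conj:
  assumes "zconv m \<alpha> f" "\<And>i. i < m \<Longrightarrow> h \<langle>$\<rangle> i = i" "finite r"
  shows "f (mv h h r) = f r"
proof -
  obtain n0 where "\<forall>n\<ge>n0. h \<in> Sn n" using ex_Sn by blast
  then have "\<forall>\<^sub>F n in sequentially. h \<in> Sn_stab m n"
    using assms(2) by (auto simp: eventually_sequentially Sn_stab_def)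
  moreover note zconv_cent[OF assms(1)]
  ultimately have "\<forall>\<^sub>F n in sequentially. Z (\<alpha> n) (mv h h r) = Z (\<alpha> n) r"
    by eventually_elim (rule Z_conj)
  then have "(\<lambda>n. Z (\<alpha> n) r) \<longlonglongrightarrow> f (mv h h r)"
    using zconv_lim[OF assms(1), of "mv h h r"] assms(3) by (simp add: Lim_transform_eventually)
  then show ?thesis using zconv_lim[OF assms(1,3)] LIMSEQ_unique by blast
qed

lemma tendsto_zero_of_decay:
  fixes z :: "nat \<Rightarrow> complex"
  assumes "\<And>n. n \<ge> n0 \<Longrightarrow> real n ^ k * cmod (z n) \<le> C" "k > 0"
  shows "z \<longlonglongrightarrow> 0"
proof (rule tendsto_0_norm_le)
  show "\<forall>\<^sub>F n in sequentially. norm (z n) \<le> C / real n"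
  proof (rule eventually_sequentiallyI[of "max 1 n0"])
    fix n assume n: "max 1 n0 \<le> n"
    have "real n * cmod (z n) \<le> real n ^ k * cmod (z n)"
      using n assms(2) by (intro mult_right_mono self_le_power) auto
    also have "\<dots> \<le> C" using assms(1) n by simp
    finally show "norm (z n) \<le> C / real n" using n by (simp add: field_simps)
  qed
  show "(\<lambda>n. C / real n) \<longlonglongrightarrow> 0" by (rule lim_const_over_n)
qed

text \<open>A single exit would already make the values tend to 0 at least as fast as
  \<open>1 / n\<close>.\<close>

lemma zconv_exits:
  assumes "zconv m \<alpha> f" "f r \<noteq> 0"
  shows "exits m r = {}" "exits m (r\<inverse>) = {}"
proof -
  have fin: "finite r" by (rule zconv_finite[OF assms])
  obtain n0 C where D: "\<And>n s. n \<ge> n0 \<Longrightarrow> finite s \<Longrightarrow> card s \<le> card r \<Longrightarrow>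
      real n ^ card (exits m s) * cmod (Z (\<alpha> n) s) \<le> C"
    "\<And>n s. n \<ge> n0 \<Longrightarrow> finite s \<Longrightarrow> card s \<le> card r \<Longrightarrow> real n ^ card (exits m (s\<inverse>)) * cmod (Z (\<alpha> n) s) \<le> C"
    using zconv_decay[OF assms(1), where l = "card r"] by metis
  have *: "card (exits m s) = 0" if "\<And>n. n \<ge> n0 \<Longrightarrow> real n ^ card (exits m s) * cmod (Z (\<alpha> n) r) \<le> C" for s
  proof (rule ccontr)
    assume "card (exits m s) \<noteq> 0"
    then have "(\<lambda>n. Z (\<alpha> n) r) \<longlonglongrightarrow> 0" using that by (intro tendsto_zero_of_decay) auto
    then show False using zconv_lim[OF assms(1) fin] assms(2) LIMSEQ_unique by blast
  qed
  have "card (exits m r) = 0" "card (exits m (r\<inverse>)) = 0"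
    using *[of r] *[of "r\<inverse>"] D fin by blast+
  then show "exits m r = {}" "exits m (r\<inverse>) = {}"
    using fin finite_exits by simp_all
qed

lemma exits_empty_iff: "exits m r = {} \<and> exits m (r\<inverse>) = {} \<longleftrightarrow> Domain r - {..<m} = Range r - {..<m}"
  by (auto simp: exits_def)

lemma zconv_Domain_Range:
  "zconv m \<alpha> f \<Longrightarrow> f r \<noteq> 0 \<Longrightarrow> Domain r - {..<m} = Range r - {..<m}"
  using zconv_exits exits_empty_iff by metis

section \<open>Alternating sums and bounded degree\<close>

lemma sum_alternating_Pow:
  assumes "finite A"
  shows "(\<Sum>Y\<in>Pow A. (-1) ^ card Y) = (if A = {} then 1 else 0 :: complex)"
proof -
  have "(\<Sum>Y\<in>Pow A. (-1) ^ card Y) = (\<Sum>Y\<in>Pow A. (\<Prod>x\<in>Y. -1) * (\<Prod>x\<in>A - Y. 1 :: complex))"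
    by simp
  also have "\<dots> = (\<Prod>x\<in>A. -1 + 1)" by (rule prod_add[OF assms, symmetric])
  also have "\<dots> = (if A = {} then 1 else 0)" using assms by auto
  finally show ?thesis .
qed

text \<open>By inclusion-exclusion the sum is the total coefficient of those elements that extend
  \<open>r\<close> and fix no point of \<open>Y0\<close>. In this form a bound on the degree becomes
  a condition on zeta values.\<close>

lemma zeta_alternating:
  assumes "finite Y0" "\<And>u. u \<in> Poly_Mapping.keys a \<Longrightarrow> r \<subseteq> rel u \<Longrightarrow> \<exists>y\<in>Y0. (y, y) \<in> rel u"
  shows "(\<Sum>Y\<in>Pow Y0. (-1) ^ card Y * zeta rel a (r \<union> Id_on Y)) = 0"
proof -
  have *: "(\<Sum>Y\<in>Pow Y0. if Id_on Y \<subseteq> rel u then (-1) ^ card Y else 0 :: complex) = 0"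
    if u: "u \<in> Poly_Mapping.keys a" "r \<subseteq> rel u" for u
  proof -
    have "(\<Sum>Y\<in>Pow Y0. if Id_on Y \<subseteq> rel u then (-1) ^ card Y else 0 :: complex) =
          (\<Sum>Y\<in>Pow {y \<in> Y0. (y, y) \<in> rel u}. (-1) ^ card Y)"
      using assms(1) by (intro sum.mono_neutral_cong_right) auto
    also have "\<dots> = 0" using assms(2)[OF u] assms(1) by (auto simp: sum_alternating_Pow)
    finally show ?thesis .
  qed
  have "(\<Sum>Y\<in>Pow Y0. (-1) ^ card Y * zeta rel a (r \<union> Id_on Y)) =
     (\<Sum>Y\<in>Pow Y0. \<Sum>u\<in>Poly_Mapping.keys a. (if r \<subseteq> rel u then Poly_Mapping.lookup a u else 0) *
        (if Id_on Y \<subseteq> rel u then (-1) ^ card Y else 0))"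
    by (simp add: zeta_superset[of "Poly_Mapping.keys a"] sum_distrib_left) (intro sum.cong refl, auto)
  also have "\<dots> = (\<Sum>u\<in>Poly_Mapping.keys a. (if r \<subseteq> rel u then Poly_Mapping.lookup a u else 0) *
        (\<Sum>Y\<in>Pow Y0. if Id_on Y \<subseteq> rel u then (-1) ^ card Y else 0))"
    by (subst sum.swap) (simp add: sum_distrib_left)
  also have "\<dots> = 0" using * by (intro sum.neutral) auto
  finally show ?thesis .
qed

definition moved :: "rel2 \<Rightarrow> nat set"
  where "moved r = {i \<in> Domain r. (i, i) \<notin> r}"

text \<open>An element that extends \<open>r\<close> and fixes no point of \<open>Y0\<close> moves
  every point of \<open>Y0 \<union> moved r\<close>, which the degree bound excludes.\<close>

lemma Z_alternating:
  assumes "finite Y0" "\<And>u. u \<in> Poly_Mapping.keys a \<Longrightarrow> perm_deg u \<le> d" "d < card (Y0 \<union> moved r)"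
  shows "(\<Sum>Y\<in>Pow Y0. (-1) ^ card Y * Z a (r \<union> Id_on Y)) = 0"
proof (rule zeta_alternating[OF assms(1)], rule ccontr)
  fix u assume u: "u \<in> Poly_Mapping.keys a" "r \<subseteq> prel u" "\<not> (\<exists>y\<in>Y0. (y, y) \<in> prel u)"
  have "Y0 \<union> moved r \<subseteq> affected u"
  proof
    fix i assume "i \<in> Y0 \<union> moved r"
    then show "i \<in> affected u"
    proof
      assume "i \<in> moved r"
      then obtain j where ij: "(i, j) \<in> r" "(i, i) \<notin> r" by (auto simp: moved_def)
      then have "i = u \<langle>$\<rangle> j" using u(2) by auto
      then show ?thesis using ij by (metis apply_inj in_affected)
    qed (use u(3) in \<open>auto simp: in_affected\<close>)
  qed
  then have "card (Y0 \<union> moved r) \<le> perm_deg u" unfolding perm_deg_def by (rule card_mono[rotated]) simp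
  then show False using assms(2)[OF u(1)] assms(3) by simp
qed

lemma zconv_alternating:
  assumes "zconv m \<alpha> f"
  shows "\<exists>d. \<forall>r Y0. finite r \<longrightarrow> finite Y0 \<longrightarrow> d < card (Y0 \<union> moved r) \<longrightarrow>
           (\<Sum>Y\<in>Pow Y0. (-1) ^ card Y * f (r \<union> Id_on Y)) = 0"
proof -
  obtain d where d: "\<And>n u. n \<ge> 1 \<Longrightarrow> u \<in> Poly_Mapping.keys (\<alpha> n) \<Longrightarrow> perm_deg u \<le> d"
    using zconv_deg[OF assms] by blast
  show ?thesis
  proof (intro exI[of _ d] allI impI)
    fix r :: rel2 and Y0 assume h: "finite r" "finite Y0" "d < card (Y0 \<union> moved r)"
    have lim: "(\<lambda>n. \<Sum>Y\<in>Pow Y0. (-1) ^ card Y * Z (\<alpha> n) (r \<union> Id_on Y)) \<longlonglongrightarrow>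
          (\<Sum>Y\<in>Pow Y0. (-1) ^ card Y * f (r \<union> Id_on Y))"
    proof (intro tendsto_sum tendsto_mult_left zconv_lim[OF assms])
      fix Y assume "Y \<in> Pow Y0"
      then have "finite Y" using h(2) finite_subset by blast
      then have "finite (Id_on Y)" by (auto simp: Id_on_def)
      then show "finite (r \<union> Id_on Y)" using h(1) by simp
    qed
    have "\<forall>\<^sub>F n in sequentially. (\<Sum>Y\<in>Pow Y0. (-1) ^ card Y * Z (\<alpha> n) (r \<union> Id_on Y)) = 0"
      by (rule eventually_sequentiallyI[of 1]) (rule Z_alternating[OF h(2) _ h(3)], use d in auto)
    from LIMSEQ_unique[OF lim tendsto_eventually[OF this]]
    show "(\<Sum>Y\<in>Pow Y0. (-1) ^ card Y * f (r \<union> Id_on Y)) = 0" .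
  qed
qed

section \<open>Products of convergent sequences\<close>

definition injections :: "nat set \<Rightarrow> nat set \<Rightarrow> rel2 set"
  where "injections D Q = {d. one_one d \<and> Domain d = D \<and> Range d \<subseteq> Q}"

lemma finite_injections [simp]: "finite D \<Longrightarrow> finite Q \<Longrightarrow> finite (injections D Q)"
  by (rule finite_subset[of _ "Pow (D \<times> Q)"]) (auto simp: injections_def)

lemma finite_injection:
  assumes "d \<in> injections D Q" "finite D" "finite Q"
  shows "finite d"
proof (rule finite_subset)
  show "d \<subseteq> D \<times> Q" using assms(1) by (auto simp: injections_def)
qed (use assms in simp)

lemma injections_insert:
  assumes "x \<notin> D"
  shows "bij_betw (\<lambda>(q, d). insert (x, q) d) {(q, d). q \<in> Q \<and> d \<in> injections D Q \<and> q \<notin> Range d}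
           (injections (insert x D) Q)"
proof (rule bij_betwI[where g = "\<lambda>d. (THE q. (x, q) \<in> d, d - {x} \<times> UNIV)"])
  let ?T = "{(q, d). q \<in> Q \<and> d \<in> injections D Q \<and> q \<notin> Range d}"
  show "(\<lambda>(q, d). insert (x, q) d) \<in> ?T \<rightarrow> injections (insert x D) Q"
  proof clarify
    fix q d assume h: "q \<in> Q" "d \<in> injections D Q" "q \<notin> Range d"
    then have "one_one (insert (x, q) d)"
      using assms by (auto simp: injections_def one_one_def single_valued_def)
    then show "insert (x, q) d \<in> injections (insert x D) Q" using h by (auto simp: injections_def)
  qed
  have the: "(THE q. (x, q) \<in> d) = q" if "(x, q) \<in> d" "one_one d" for d q
    using that by (meson one_one_eq1 the_equality)
  show "(\<lambda>d. (THE q. (x, q) \<in> d, d - {x} \<times> UNIV)) \<in> injections (insert x D) Q \<rightarrow> ?T"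
  proof
    fix d assume d: "d \<in> injections (insert x D) Q"
    then have oo: "one_one d" by (simp add: injections_def)
    have "x \<in> Domain d" using d by (simp add: injections_def)
    then obtain q where q: "(x, q) \<in> d" by blast
    have "one_one (d - {x} \<times> UNIV)" by (rule one_one_subset[OF oo]) auto
    moreover have "q \<notin> Range (d - {x} \<times> UNIV)" using one_one_eq2[OF oo q] by auto
    moreover have "Domain (d - {x} \<times> UNIV) = D" using d assms by (auto simp: injections_def)
    ultimately show "(THE q. (x, q) \<in> d, d - {x} \<times> UNIV) \<in> ?T"
      using d q by (auto simp: injections_def the[OF q oo])
  qed
  show "(\<lambda>d. (THE q. (x, q) \<in> d, d - {x} \<times> UNIV)) (case p of (q, d) \<Rightarrow> insert (x, q) d) = p" if "p \<in> ?T" for p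
  proof -
    obtain q d where p: "p = (q, d)" "q \<in> Q" "d \<in> injections D Q" "q \<notin> Range d" using \<open>p \<in> ?T\<close> by auto
    have "(x, q') \<notin> d" for q' using p assms by (auto simp: injections_def)
    then show ?thesis using p by auto
  qed
  show "(case (\<lambda>d. (THE q. (x, q) \<in> d, d - {x} \<times> UNIV)) d of (q, d) \<Rightarrow> insert (x, q) d) = d"
    if "d \<in> injections (insert x D) Q" for d
  proof -
    have oo: "one_one d" using that by (simp add: injections_def)
    have "x \<in> Domain d" using that by (simp add: injections_def)
    then obtain q where q: "(x, q) \<in> d" by blast
    have "insert (x, q) (d - {x} \<times> UNIV) = d" using q one_one_eq1[OF oo q] by blast
    then show ?thesis by (simp add: the[OF q oo])
  qed
qed

text \<open>Dropping injectivity only adds nonnegative terms, and over all maps from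
  \<open>D\<close> to \<open>Q\<close> the sum factorizes into one factor for each point of
  \<open>D\<close>.\<close>

lemma sum_injections_le:
  fixes e :: real
  assumes "finite D" "finite Q" "e \<ge> 0"
  shows "(\<Sum>d\<in>injections D Q. e ^ card (Range d - P)) \<le> (\<Sum>q\<in>Q. if q \<in> P then 1 else e) ^ card D"
  using assms(1)
proof (induction D rule: finite_induct)
  case empty
  have "injections {} Q = {{}}" by (auto simp: injections_def one_one_def)
  then show ?case by simp
next
  case (insert x D)
  let ?T = "{(q, d). q \<in> Q \<and> d \<in> injections D Q \<and> q \<notin> Range d}"
  let ?w = "\<lambda>q. if q \<in> P then 1 else e"
  have T: "?T \<subseteq> Q \<times> injections D Q" by auto
  have fin: "finite d" if "d \<in> injections D Q" for d
    using finite_injection[OF that insert.hyps(1) assms(2)] .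
  have "(\<Sum>d\<in>injections (insert x D) Q. e ^ card (Range d - P)) =
        (\<Sum>p\<in>?T. e ^ card (Range (case p of (q, d) \<Rightarrow> insert (x, q) d) - P))"
    by (rule sum.reindex_bij_betw[OF injections_insert[OF insert.hyps(2)], symmetric])
  also have "\<dots> = (\<Sum>(q, d)\<in>?T. ?w q * e ^ card (Range d - P))"
  proof (rule sum.cong[OF refl])
    fix p assume "p \<in> ?T"
    then obtain q d where p: "p = (q, d)" "d \<in> injections D Q" "q \<notin> Range d" by auto
    have "Range (insert (x, q) d) - P = (if q \<in> P then Range d - P else insert q (Range d - P))" by auto
    then show "e ^ card (Range (case p of (q, d) \<Rightarrow> insert (x, q) d) - P) =
        (case p of (q, d) \<Rightarrow> ?w q * e ^ card (Range d - P))"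
      using p fin[OF p(2)] by (simp add: finite_Range)
  qed
  also have "\<dots> \<le> (\<Sum>(q, d)\<in>Q \<times> injections D Q. ?w q * e ^ card (Range d - P))"
    using T assms insert.hyps by (intro sum_mono2) auto
  also have "\<dots> = (\<Sum>q\<in>Q. ?w q) * (\<Sum>d\<in>injections D Q. e ^ card (Range d - P))"
    by (simp add: sum_product sum.cartesian_product)
  also have "\<dots> \<le> (\<Sum>q\<in>Q. ?w q) * (\<Sum>q\<in>Q. ?w q) ^ card D"
    using insert.IH assms(3) by (intro mult_left_mono sum_nonneg) auto
  finally show ?case using insert.hyps by simp
qed

text \<open>The at most \<open>n\<close> values outside of \<open>P\<close> have weight
  \<open>1 / n\<close> each, hence total weight at most 1; this makes the bound independent of
  \<open>n\<close>.\<close>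

lemma sum_injections_bound:
  assumes "finite D" "finite P" "n \<ge> 1"
  shows "(\<Sum>d\<in>injections D ({..<n} \<union> P). (1 / real n) ^ card (Range d - P)) \<le> (real (card P) + 1) ^ card D"
proof -
  have "(\<Sum>q\<in>{..<n} \<union> P. if q \<in> P then 1 else 1 / real n) =
        (\<Sum>q\<in>P. 1) + (\<Sum>q\<in>{..<n} - P. 1 / real n)"
  proof -
    have "(\<Sum>q\<in>{..<n} \<union> P. if q \<in> P then 1 else 1 / real n) =
          (\<Sum>q\<in>P \<union> ({..<n} - P). if q \<in> P then 1 else 1 / real n)"
      by (rule sum.cong) auto
    also have "\<dots> = (\<Sum>q\<in>P. if q \<in> P then 1 else 1 / real n) + (\<Sum>q\<in>{..<n} - P. if q \<in> P then 1 else 1 / real n)"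
      using assms(2) by (intro sum.union_disjoint) auto
    finally show ?thesis by simp
  qed
  also have "\<dots> \<le> real (card P) + real n * (1 / real n)"
    using card_mono[of "{..<n}" "{..<n} - P"] by (simp add: divide_right_mono)
  also have "\<dots> = real (card P) + 1" using assms(3) by simp
  finally have "(\<Sum>q\<in>{..<n} \<union> P. if q \<in> P then 1 else 1 / real n) \<le> real (card P) + 1" .
  then have "(\<Sum>q\<in>{..<n} \<union> P. if q \<in> P then 1 else 1 / real n) ^ card D \<le> (real (card P) + 1) ^ card D"
    by (intro power_mono sum_nonneg) auto
  then show ?thesis using sum_injections_le[of D "{..<n} \<union> P" "1 / real n" P] assms by simp
qed

text \<open>In the limit only those terms of the convolution formula for zeta transforms survive that have
  a nonzero limit; there are finitely many of them.\<close>

definition mul :: "(rel2 \<Rightarrow> complex) \<Rightarrow> (rel2 \<Rightarrow> complex) \<Rightarrow> rel2 \<Rightarrow> complex"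
  where "mul f g r = (if finite r then \<Sum>d | Domain d = Domain r \<and> f d \<noteq> 0. f d * g (d\<inverse> O r) else 0)"

text \<open>Lets each evaluation of \<open>mul\<close> use the finite index set at hand: relations
  with range in a fixed finite set, relations inside of a square, or a single relation.\<close>

lemma mul_eq:
  assumes "finite r" "finite D" "\<And>d. d \<in> D \<Longrightarrow> Domain d = Domain r"
    and "\<And>d. Domain d = Domain r \<Longrightarrow> f d \<noteq> 0 \<Longrightarrow> d \<in> D"
  shows "mul f g r = (\<Sum>d\<in>D. f d * g (d\<inverse> O r))"
proof -
  have "{d. Domain d = Domain r \<and> f d \<noteq> 0} \<subseteq> D" using assms(4) by blast
  moreover have "\<forall>d\<in>D - {d. Domain d = Domain r \<and> f d \<noteq> 0}. f d * g (d\<inverse> O r) = 0"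
    using assms(3) by simp
  ultimately have "(\<Sum>d | Domain d = Domain r \<and> f d \<noteq> 0. f d * g (d\<inverse> O r)) = (\<Sum>d\<in>D. f d * g (d\<inverse> O r))"
    by (rule sum.mono_neutral_left[OF assms(2)])
  then show ?thesis using assms(1) by (simp add: mul_def)
qed

lemma relcomp_converse_bounds:
  assumes "d \<in> injections (Domain r) Q" "finite r"
  shows "Domain (d\<inverse> O r) = Range d" "Range (d\<inverse> O r) \<subseteq> Range r" "finite (d\<inverse> O r)" "card (d\<inverse> O r) \<le> card r"
proof -
  have "Domain d = Domain r" using assms(1) by (simp add: injections_def)
  then show "Domain (d\<inverse> O r) = Range d"
    by (intro subset_antisym subsetI) (blast, metis Domain.DomainI DomainE RangeE converseI relcompI)
  show "Range (d\<inverse> O r) \<subseteq> Range r" by auto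
  have *: "d\<inverse> O r \<subseteq> (\<lambda>(i, k). (THE j. (i, j) \<in> d, k)) ` r"
  proof
    fix p assume "p \<in> d\<inverse> O r"
    then obtain i j k where p: "p = (j, k)" "(i, j) \<in> d" "(i, k) \<in> r" by auto
    then have "(THE j. (i, j) \<in> d) = j"
      using assms(1) by (auto simp: injections_def dest: one_one_eq1 intro!: the_equality)
    then show "p \<in> (\<lambda>(i, k). (THE j. (i, j) \<in> d, k)) ` r" using p by force
  qed
  then show "finite (d\<inverse> O r)" using assms(2) finite_subset by blast
  show "card (d\<inverse> O r) \<le> card r" using surj_card_le[OF assms(2) *] .
qed

text \<open>The set \<open>P\<close> accounts for points of \<open>Domain r\<close> from
  \<open>n\<close> on: elements of \<open>Sn n\<close> fix them, so they reappear in the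
  range.\<close>

lemma Z_conv_injections:
  assumes "Poly_Mapping.keys a \<subseteq> Sn n" "finite r" "Domain r \<subseteq> P" "finite P"
  shows "Z (a \<star> b) r = (\<Sum>d\<in>injections (Domain r) ({..<n} \<union> P). Z a d * Z b (d\<inverse> O r))"
proof (rule Z_conv)
  show "finite (injections (Domain r) ({..<n} \<union> P))"
    using assms by (simp add: finite_Domain)
  fix u assume "u \<in> Poly_Mapping.keys a"
  then have u: "u \<in> Sn n" using assms(1) by auto
  have "j \<in> {..<n} \<union> P" if "(i, j) \<in> prel u \<inter> (Domain r \<times> UNIV)" for i j
    using that SnD[OF u, of j] assms(3) by (cases "j < n") auto
  then have "Range (prel u \<inter> (Domain r \<times> UNIV)) \<subseteq> {..<n} \<union> P" by blast
  moreover have "Domain (prel u \<inter> (Domain r \<times> UNIV)) = Domain r"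
    using Domain_prel[of u] by blast
  moreover have "one_one (prel u \<inter> (Domain r \<times> UNIV))"
    by (rule one_one_subset[OF one_one_prel]) auto
  ultimately show "prel u \<inter> (Domain r \<times> UNIV) \<in> injections (Domain r) ({..<n} \<union> P)"
    by (simp add: injections_def)
qed (auto simp: injections_def)

lemma perm_deg_times: "perm_deg (u * v) \<le> perm_deg u + perm_deg v"
  unfolding perm_deg_def
  by (rule order_trans[OF card_mono card_Un_le]) (simp_all add: affected_times)

text \<open>Intermediate relations \<open>d\<close> with range in the fixed finite set
  \<open>P\<close> contribute termwise limits. If \<open>k\<close> points of the range lie outside
  of \<open>P\<close>, they are exits of \<open>d\<inverse>\<close> and of
  \<open>d\<inverse> O r\<close>, so the term is of order \<open>n ^ (-2 * k)\<close>, whereas only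
  about \<open>n ^ k\<close> such \<open>d\<close> exist; together they contribute
  \<open>O(1 / n)\<close>.\<close>

lemma zconv_mult:
  assumes A: "zconv m \<alpha> f" and B: "zconv m \<beta> g"
  shows "zconv m (\<lambda>n. \<alpha> n \<star> \<beta> n) (mul f g)"
proof -
  obtain d1 where d1: "\<And>n u. n \<ge> 1 \<Longrightarrow> u \<in> Poly_Mapping.keys (\<alpha> n) \<Longrightarrow> perm_deg u \<le> d1"
    using zconv_deg[OF A] by blast
  obtain d2 where d2: "\<And>n u. n \<ge> 1 \<Longrightarrow> u \<in> Poly_Mapping.keys (\<beta> n) \<Longrightarrow> perm_deg u \<le> d2"
    using zconv_deg[OF B] by blast
  have deg: "perm_deg u \<le> d1 + d2" if n: "n \<ge> 1" and u: "u \<in> Poly_Mapping.keys (\<alpha> n \<star> \<beta> n)" for n u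
  proof -
    obtain v w where vw: "u = v * w" "v \<in> Poly_Mapping.keys (\<alpha> n)" "w \<in> Poly_Mapping.keys (\<beta> n)"
      using subsetD[OF keys_conv u] by auto
    show "perm_deg u \<le> d1 + d2"
      using perm_deg_times[of v w] d1[OF n vw(2)] d2[OF n vw(3)] unfolding vw(1) by linarith
  qed
  have cent: "\<forall>\<^sub>F n in sequentially. \<alpha> n \<star> \<beta> n \<in> B_cent m n"
    using zconv_cent[OF A] zconv_cent[OF B] by eventually_elim (rule B_cent_conv)
  have lim: "(\<lambda>n. Z (\<alpha> n \<star> \<beta> n) r) \<longlonglongrightarrow> mul f g r" if r: "finite r" for r
  proof -
    define P where "P = {..<m} \<union> Domain r \<union> Range r"
    have P: "finite P" using r by (simp add: P_def finite_Domain finite_Range)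
    have D: "finite (Domain r)" using r by (simp add: finite_Domain)
    obtain n1 C1 where C1: "C1 \<ge> 0" "n1 \<ge> 1" "\<And>n. n \<ge> n1 \<Longrightarrow> \<alpha> n \<in> B_cent m n"
      "\<And>n s. n \<ge> n1 \<Longrightarrow> finite s \<Longrightarrow> card s \<le> card r \<Longrightarrow> real n ^ card (exits m (s\<inverse>)) * cmod (Z (\<alpha> n) s) \<le> C1"
      using zconv_decay[OF A, where l = "card r"] by metis
    obtain n2 C2 where C2: "C2 \<ge> 0"
      "\<And>n s. n \<ge> n2 \<Longrightarrow> finite s \<Longrightarrow> card s \<le> card r \<Longrightarrow> real n ^ card (exits m s) * cmod (Z (\<beta> n) s) \<le> C2"
      using zconv_decay[OF B, where l = "card r"] by metis
    let ?S = "injections (Domain r) P"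
    let ?I = "\<lambda>n. injections (Domain r) ({..<n} \<union> P)"
    let ?t = "\<lambda>n d. Z (\<alpha> n) d * Z (\<beta> n) (d\<inverse> O r)"
    have sub: "?S \<subseteq> ?I n" for n by (auto simp: injections_def)
    have finI: "finite (?I n)" for n using P D by simp
    have fin: "finite d" if "d \<in> ?I n" for d n
      using finite_injection[OF that D] P by simp
    have main: "(\<lambda>n. \<Sum>d\<in>?S. ?t n d) \<longlonglongrightarrow> (\<Sum>d\<in>?S. f d * g (d\<inverse> O r))"
    proof (intro tendsto_sum tendsto_mult zconv_lim[OF A] zconv_lim[OF B])
      fix d assume d: "d \<in> ?S"
      then show "finite d" using fin sub by blast
      show "finite (d\<inverse> O r)" by (rule relcomp_converse_bounds[OF d r])
    qed
    have small: "norm (\<Sum>d\<in>?I n - ?S. ?t n d) \<le> C1 * C2 * (real (card P) + 1) ^ card (Domain r) / real n"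
      if n: "n \<ge> max n1 n2" for n
    proof -
      have n0: "real n > 0" using n C1(2) by simp
      have "norm (\<Sum>d\<in>?I n - ?S. ?t n d) \<le> (\<Sum>d\<in>?I n - ?S. C1 * C2 / real n * (1 / real n) ^ card (Range d - P))"
      proof (rule sum_norm_le)
        fix d assume d: "d \<in> ?I n - ?S"
        let ?k = "card (Range d - P)"
        have fd: "finite d" using d fin by blast
        have dD: "Domain d = Domain r" and oo: "one_one d" using d by (auto simp: injections_def)
        have dI: "d \<in> ?I n" using d by simp
        note rb = relcomp_converse_bounds[OF dI r]
        have "Range d - P \<noteq> {}" using d by (auto simp: injections_def)
        then have k: "?k \<ge> 1" using fd by (simp add: Suc_le_eq card_gt_0_iff finite_Range)
        have "real n ^ ?k \<le> real n ^ card (exits m (d\<inverse>))"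
          using n C1(2) fd by (intro power_increasing card_mono) (auto simp: exits_def P_def dD finite_Range)
        then have "real n ^ ?k * cmod (Z (\<alpha> n) d) \<le> real n ^ card (exits m (d\<inverse>)) * cmod (Z (\<alpha> n) d)"
          by (rule mult_right_mono) simp
        also have "\<dots> \<le> C1"
          using C1(4)[of n d] n fd card_Domain[OF oo] card_Domain_le[OF r] by (simp add: dD)
        finally have 1: "cmod (Z (\<alpha> n) d) \<le> C1 * (1 / real n) ^ ?k"
          using n0 by (simp add: field_simps power_one_over)
        have "real n ^ ?k \<le> real n ^ card (exits m (d\<inverse> O r))"
          using n C1(2) fd rb d
          by (intro power_increasing card_mono) (auto simp: exits_def P_def rb(1) finite_Range)
        then have "real n ^ ?k * cmod (Z (\<beta> n) (d\<inverse> O r)) \<le> real n ^ card (exits m (d\<inverse> O r)) * cmod (Z (\<beta> n) (d\<inverse> O r))"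
          by (rule mult_right_mono) simp
        also have "\<dots> \<le> C2" using n rb d by (intro C2(2)) auto
        finally have 2: "cmod (Z (\<beta> n) (d\<inverse> O r)) \<le> C2 * (1 / real n) ^ ?k"
          using n0 by (simp add: field_simps power_one_over)
        \<comment> \<open>One of the two factors \<open>(1 / real n) ^ ?k\<close> is weakened to
          \<open>1 / real n\<close> and yields the convergence; the other one is the weight that
          \<open>sum_injections_bound\<close> sums up.\<close>
        have 3: "(1 / real n) ^ ?k \<le> 1 / real n"
          using power_decreasing[OF k, of "1 / real n"] n C1(2) by simp
        have "norm (?t n d) \<le> (C1 * (1 / real n) ^ ?k) * (C2 * (1 / real n) ^ ?k)"
          unfolding norm_mult using 1 2 C1(1) by (intro mult_mono) auto
        also have "\<dots> \<le> (C1 * (1 / real n)) * (C2 * (1 / real n) ^ ?k)"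
          using 3 C1(1) C2(1) by (intro mult_mono) auto
        finally show "norm (?t n d) \<le> C1 * C2 / real n * (1 / real n) ^ ?k" by (simp add: mult_ac)
      qed
      also have "\<dots> \<le> (\<Sum>d\<in>?I n. C1 * C2 / real n * (1 / real n) ^ card (Range d - P))"
        using C1(1) C2(1) finI by (intro sum_mono2) auto
      also have "\<dots> = C1 * C2 / real n * (\<Sum>d\<in>?I n. (1 / real n) ^ card (Range d - P))"
        by (simp add: sum_distrib_left)
      also have "\<dots> \<le> C1 * C2 / real n * (real (card P) + 1) ^ card (Domain r)"
        using sum_injections_bound[OF D P, of n] n C1 C2(1) by (intro mult_left_mono) auto
      finally show ?thesis by simp
    qed
    have rest: "(\<lambda>n. \<Sum>d\<in>?I n - ?S. ?t n d) \<longlonglongrightarrow> 0"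
    proof (rule tendsto_0_norm_le)
      show "\<forall>\<^sub>F n in sequentially. norm (\<Sum>d\<in>?I n - ?S. ?t n d) \<le> C1 * C2 * (real (card P) +
          1) ^ card (Domain r) / real n"
        using small by (rule eventually_sequentiallyI)
      show "(\<lambda>n. C1 * C2 * (real (card P) + 1) ^ card (Domain r) / real n) \<longlonglongrightarrow> 0"
        by (rule lim_const_over_n)
    qed
    have "(\<lambda>n. (\<Sum>d\<in>?S. ?t n d) + (\<Sum>d\<in>?I n - ?S. ?t n d)) \<longlonglongrightarrow> (\<Sum>d\<in>?S. f d * g (d\<inverse> O r)) + 0"
      using main rest by (rule tendsto_add)
    moreover have "\<forall>\<^sub>F n in sequentially. (\<Sum>d\<in>?S. ?t n d) + (\<Sum>d\<in>?I n - ?S. ?t n d) = Z (\<alpha> n \<star> \<beta> n) r"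
    proof (rule eventually_sequentiallyI[of n1])
      fix n assume "n1 \<le> n"
      then have "Z (\<alpha> n \<star> \<beta> n) r = (\<Sum>d\<in>?I n. ?t n d)"
        using C1(3)[of n] P r by (intro Z_conv_injections) (auto simp: B_cent_iff P_def)
      then show "(\<Sum>d\<in>?S. ?t n d) + (\<Sum>d\<in>?I n - ?S. ?t n d) = Z (\<alpha> n \<star> \<beta> n) r"
        using sum.subset_diff[OF sub finI, of "?t n" n] by (simp add: add.commute)
    qed
    ultimately have "(\<lambda>n. Z (\<alpha> n \<star> \<beta> n) r) \<longlonglongrightarrow> (\<Sum>d\<in>?S. f d * g (d\<inverse> O r))"
      by (simp add: Lim_transform_eventually)
    moreover have "mul f g r = (\<Sum>d\<in>?S. f d * g (d\<inverse> O r))"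
    proof (rule mul_eq[OF r])
      fix d assume "Domain d = Domain r" "f d \<noteq> 0"
      then show "d \<in> ?S"
        using zconv_one_one[OF A, of d] zconv_Domain_Range[OF A, of d] by (auto simp: injections_def P_def)
    next
      show "finite ?S" using P D by simp
    qed (auto simp: injections_def)
    ultimately show ?thesis by simp
  qed
  show ?thesis by (rule zconvI[OF cent deg lim]) (simp_all add: mul_def)
qed

lemma zconv_sum:
  "finite I \<Longrightarrow> (\<And>i. i \<in> I \<Longrightarrow> zconv m (\<alpha> i) (f i)) \<Longrightarrow>
    zconv m (\<lambda>n. \<Sum>i\<in>I. \<alpha> i n) (\<lambda>r. \<Sum>i\<in>I. f i r)"
proof (induction I rule: finite_induct)
  case empty
  then show ?case by (simp add: zconv_zero)
next
  case (insert x I)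
  then have "zconv m (\<lambda>n. \<alpha> x n + (\<Sum>i\<in>I. \<alpha> i n)) (\<lambda>r. f x r + (\<Sum>i\<in>I. f i r))"
    by (intro zconv_add) auto
  then show ?case using insert.hyps by simp
qed

section \<open>Averaged transpositions\<close>

lemma perm_times_swap: "h * \<langle>a \<leftrightarrow> b\<rangle> = \<langle>h \<langle>$\<rangle> a \<leftrightarrow> h \<langle>$\<rangle> b\<rangle> * h"
proof (rule perm_eqI)
  fix x
  show "(h * \<langle>a \<leftrightarrow> b\<rangle>) \<langle>$\<rangle> x = (\<langle>h \<langle>$\<rangle> a \<leftrightarrow> h \<langle>$\<rangle> b\<rangle> * h) \<langle>$\<rangle> x"
    by (cases "x = a"; cases "x = b") (simp_all add: apply_times apply_inj)
qed

lemma sum_apply_perm: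
  assumes "h \<in> Sn_stab m n"
  shows "(\<Sum>j\<in>{m..<n}. f (h \<langle>$\<rangle> j)) = (\<Sum>j\<in>{m..<n}. f j)"
proof (rule sum.reindex_bij_betw)
  have sub: "apply h ` {m..<n} \<subseteq> {m..<n}" if h: "h \<in> Sn_stab m n" for h
  proof clarify
    fix j assume j: "j \<in> {m..<n}"
    have "h \<langle>$\<rangle> j < n" using h j Sn_less[of h n j] by (auto simp: Sn_stab_def)
    moreover have "\<not> h \<langle>$\<rangle> j < m"
    proof
      assume "h \<langle>$\<rangle> j < m"
      then have "h \<langle>$\<rangle> (h \<langle>$\<rangle> j) = h \<langle>$\<rangle> j" using h by (simp add: Sn_stab_def)
      then show False using j \<open>h \<langle>$\<rangle> j < m\<close> by (simp add: apply_inj)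
    qed
    ultimately show "h \<langle>$\<rangle> j \<in> {m..<n}" by simp
  qed
  show "bij_betw (apply h) {m..<n} {m..<n}"
    by (rule bij_betwI[where g = "apply (inverse h)"])
      (use sub[OF assms] sub[of "inverse h"] assms in \<open>auto simp: image_subset_iff\<close>)
qed

text \<open>The average of the transpositions of \<open>i\<close> with all points below
  \<open>n\<close>, the case \<open>j = i\<close> being the identity. In the limit it plays the role
  of the diagonal matrix of the semigroup whose only zero on the diagonal is at
  \<open>i\<close>.\<close>

definition eps :: "nat \<Rightarrow> nat \<Rightarrow> (nat perm \<Rightarrow>\<^sub>0 complex)"
  where "eps i n = scale (1 / of_nat n) (\<Sum>j<n. delta \<langle>i \<leftrightarrow> j\<rangle>)"

lemma eps_B_cent:
  assumes "i < m" "m \<le> n"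
  shows "eps i n \<in> B_cent m n"
proof -
  have "(\<Sum>j<n. delta \<langle>i \<leftrightarrow> j\<rangle>) \<in> span_of (Sn n)"
    using assms by (intro span_of_sum span_of_single swap_in_Sn) auto
  moreover have "delta h \<star> (\<Sum>j<n. delta \<langle>i \<leftrightarrow> j\<rangle>) = (\<Sum>j<n. delta \<langle>i \<leftrightarrow> j\<rangle>) \<star> delta h" if h: "h \<in> Sn_stab m n" for h
  proof -
    have hi: "h \<langle>$\<rangle> i = i" using h assms by (simp add: Sn_stab_def)
    have h0: "h \<in> Sn_stab 0 n" using h by (simp add: Sn_stab_def)
    have "delta h \<star> (\<Sum>j<n. delta \<langle>i \<leftrightarrow> j\<rangle>) = (\<Sum>j<n. delta (\<langle>i \<leftrightarrow> h \<langle>$\<rangle> j\<rangle> * h))"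
      by (simp add: conv_sum_right perm_times_swap hi)
    also have "\<dots> = (\<Sum>j<n. delta (\<langle>i \<leftrightarrow> j\<rangle> * h))"
      using sum_apply_perm[OF h0, of "\<lambda>j. delta (\<langle>i \<leftrightarrow> j\<rangle> * h)"] by (simp add: atLeast0LessThan)
    finally show ?thesis by (simp add: conv_sum_left)
  qed
  ultimately have "(\<Sum>j<n. delta \<langle>i \<leftrightarrow> j\<rangle>) \<in> B_cent m n"
    by (simp add: B_cent_iff span_of_def)
  then show ?thesis unfolding eps_def by (rule B_cent_scale)
qed

lemma perm_deg_swap: "perm_deg \<langle>i \<leftrightarrow> j\<rangle> \<le> 2"
  by (cases "i = j") (simp_all add: perm_deg_def affected_swap)

lemma keys_sum_subset:
  fixes f :: "'i \<Rightarrow> ('g \<Rightarrow>\<^sub>0 complex)"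
  shows "Poly_Mapping.keys (sum f I) \<subseteq> (\<Union>i\<in>I. Poly_Mapping.keys (f i))"
proof -
  have "f i \<in> span_of (\<Union>i\<in>I. Poly_Mapping.keys (f i))" if "i \<in> I" for i
    using that by (auto simp: span_of_def)
  then show ?thesis using span_of_sum[of I f] by (simp add: span_of_def)
qed

lemma finite_Field': "finite r \<Longrightarrow> finite (Field r)"
  by (simp add: Field_def finite_Domain finite_Range)

lemma swap_subset_iff:
  assumes "j \<notin> Field r" "j \<noteq> i"
  shows "r \<subseteq> prel \<langle>i \<leftrightarrow> j\<rangle> \<longleftrightarrow> r \<subseteq> Id \<and> i \<notin> Range r"
proof
  assume h: "r \<subseteq> prel \<langle>i \<leftrightarrow> j\<rangle>"
  have *: "x = y \<and> y \<noteq> i" if "(x, y) \<in> r" for x y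
  proof -
    have "x = \<langle>i \<leftrightarrow> j\<rangle> \<langle>$\<rangle> y" "x \<noteq> j" "y \<noteq> j" using h that assms by (auto simp: Field_def)
    then show ?thesis by (cases "y = i") auto
  qed
  then show "r \<subseteq> Id \<and> i \<notin> Range r" by auto
next
  assume h: "r \<subseteq> Id \<and> i \<notin> Range r"
  have "x = \<langle>i \<leftrightarrow> j\<rangle> \<langle>$\<rangle> y" if "(x, y) \<in> r" for x y
  proof -
    have "x = y" "y \<noteq> i" "y \<noteq> j" using h that assms by (auto simp: Field_def)
    then show ?thesis by simp
  qed
  then show "r \<subseteq> prel \<langle>i \<leftrightarrow> j\<rangle>" by auto
qed

text \<open>For \<open>j\<close> outside of the finite set \<open>F\<close> the transposition
  extends \<open>r\<close> exactly if the limit value is 1, by \<open>swap_subset_iff\<close>; the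
  exceptional \<open>j\<close> have total weight \<open>O(1 / n)\<close>.\<close>

lemma zconv_eps:
  assumes "i < m"
  shows "zconv m (eps i) (\<lambda>r. if finite r \<and> r \<subseteq> Id \<and> i \<notin> Range r then 1 else 0)"
proof (rule zconvI[where d = 2])
  show "\<forall>\<^sub>F n in sequentially. eps i n \<in> B_cent m n"
    using eps_B_cent[OF assms] by (rule eventually_sequentiallyI)
  show "perm_deg u \<le> 2" if u: "u \<in> Poly_Mapping.keys (eps i n)" for n u
  proof -
    have "u \<in> Poly_Mapping.keys (\<Sum>j<n. delta \<langle>i \<leftrightarrow> j\<rangle>)"
        using u keys_scale unfolding eps_def by (rule subsetD[rotated])
    from subsetD[OF keys_sum_subset this] obtain j where "u = \<langle>i \<leftrightarrow> j\<rangle>" by auto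
    then show ?thesis using perm_deg_swap by simp
  qed
  fix r :: rel2 assume r: "finite r"
  define F where "F = insert i (Field r)"
  have F: "finite F" using r by (simp add: F_def finite_Field')
  define c where "c = (if r \<subseteq> Id \<and> i \<notin> Range r then 1 else 0 :: complex)"
  let ?t = "\<lambda>j. if r \<subseteq> prel \<langle>i \<leftrightarrow> j\<rangle> then 1 else 0 :: complex"
  have "norm (Z (eps i n) r - c) \<le> real (card F) / real n" if n: "n \<ge> 1" for n
  proof -
    have "Z (eps i n) r - c = (1 / of_nat n) * (\<Sum>j<n. ?t j - c)"
    proof -
      have "Z (eps i n) r = 1 / of_nat n * (\<Sum>j<n. ?t j)"
        by (simp add: eps_def zeta_scale zeta_sum zeta_single)
      moreover have "(\<Sum>j<n. ?t j - c) = (\<Sum>j<n. ?t j) - of_nat n * c"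
        unfolding sum_subtractf by simp
      moreover have "(of_nat n :: complex) \<noteq> 0" using n by simp
      ultimately show ?thesis by (simp add: right_diff_distrib)
    qed
    also have "(\<Sum>j<n. ?t j - c) = (\<Sum>j\<in>{..<n} \<inter> F. ?t j - c)"
      by (rule sum.mono_neutral_right) (auto simp: F_def c_def swap_subset_iff)
    finally have "norm (Z (eps i n) r - c) = 1 / real n * norm (\<Sum>j\<in>{..<n} \<inter> F. ?t j - c)"
      by (simp add: norm_mult norm_divide)
    also have "\<dots> \<le> 1 / real n * (\<Sum>j\<in>{..<n} \<inter> F. 1)"
      by (intro mult_left_mono sum_norm_le) (auto simp: c_def)
    also have "\<dots> \<le> 1 / real n * real (card F)"
      using card_mono[OF F, of "{..<n} \<inter> F"] by (intro mult_left_mono) auto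
    finally show ?thesis by simp
  qed
  then have "\<forall>\<^sub>F n in sequentially. norm (Z (eps i n) r - c) \<le> real (card F) / real n"
    by (rule eventually_sequentiallyI)
  then have "(\<lambda>n. Z (eps i n) r - c) \<longlonglongrightarrow> 0"
    by (rule tendsto_0_norm_le) (rule lim_const_over_n)
  then have "(\<lambda>n. Z (eps i n) r) \<longlonglongrightarrow> c" by (rule LIM_zero_cancel)
  also have "c = (if finite r \<and> r \<subseteq> Id \<and> i \<notin> Range r then 1 else 0)"
    using r by (simp add: c_def)
  finally show "(\<lambda>n. Z (eps i n) r) \<longlonglongrightarrow> (if finite r \<and> r \<subseteq> Id \<and> i \<notin> Range r then 1 else 0)" .
qed auto

lemma zconv_finite_support:
  assumes "zconv m \<alpha> f" "finite r"
  shows "finite {d. Domain d = Domain r \<and> f d \<noteq> 0}"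
proof (rule finite_subset)
  show "{d. Domain d = Domain r \<and> f d \<noteq> 0} \<subseteq> injections (Domain r) ({..<m} \<union> Domain r)"
  proof clarify
    fix d assume d: "Domain d = Domain r" "f d \<noteq> 0"
    then show "d \<in> injections (Domain r) ({..<m} \<union> Domain r)"
      using zconv_one_one[OF assms(1) d(2)] zconv_Domain_Range[OF assms(1) d(2)]
      unfolding injections_def by auto
  qed
qed (use assms in \<open>simp add: finite_Domain\<close>)

abbreviation id_avoiding :: "nat \<Rightarrow> rel2 \<Rightarrow> complex"
  where "id_avoiding i \<equiv> \<lambda>r. if finite r \<and> r \<subseteq> Id \<and> i \<notin> Range r then 1 else 0"

lemma eq_if_converse_relcomp_subset_Id:
  assumes "d\<inverse> O r \<subseteq> Id" "Domain d = Domain r"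
  shows "d = r"
proof (intro equalityI subrelI)
  fix a b assume "(a, b) \<in> r"
  moreover from this obtain b' where "(a, b') \<in> d" using assms(2) by (metis Domain.DomainI DomainE)
  moreover have "b' = b" using assms(1) calculation by auto
  ultimately show "(a, b) \<in> d" by simp
next
  fix a b assume "(a, b) \<in> d"
  moreover from this obtain b' where "(a, b') \<in> r" using assms(2) by (metis Domain.DomainI DomainE)
  moreover have "b = b'" using assms(1) calculation by auto
  ultimately show "(a, b) \<in> r" by simp
qed

text \<open>The second factor is nonzero only if \<open>d\<inverse> O r\<close> is part of the
  identity, which for equal domains means \<open>d = r\<close>. So right multiplication cuts off the
  relations with \<open>i\<close> in the range.\<close>

lemma mul_eps_right:
  assumes "zconv m \<alpha> f"
  shows "mul f (id_avoiding i) r = (if i \<in> Range r then 0 else f r)"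
proof (cases "finite r")
  case True
  let ?S = "{d. Domain d = Domain r \<and> f d \<noteq> 0}"
  let ?c = "if i \<in> Range r then 0 else f r"
  have *: "f d * id_avoiding i (d\<inverse> O r) = (if d = r then ?c else 0)" if d: "d \<in> ?S" for d
  proof (cases "d = r")
    case True
    have "one_one d" using zconv_one_one[OF assms, of d] d by simp
    then have "d\<inverse> O d \<subseteq> Id" by (auto dest: one_one_eq1)
    moreover have "Range (d\<inverse> O d) = Range d" by blast
    moreover have "finite (d\<inverse> O d)" using True \<open>finite r\<close> by simp
    ultimately show ?thesis using True by simp
  next
    case False
    then have "\<not> d\<inverse> O r \<subseteq> Id" using d eq_if_converse_relcomp_subset_Id by blast
    then show ?thesis using False by simp
  qed
  have "mul f (id_avoiding i) r = (\<Sum>d\<in>?S. if d = r then ?c else 0)"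
    unfolding mul_def if_P[OF True] by (rule sum.cong[OF refl *])
  also have "\<dots> = ?c"
    using zconv_finite_support[OF assms True] by (simp add: sum.delta')
  finally show ?thesis .
next
  case False
  then show ?thesis using zconv_infinite[OF assms] by (simp add: mul_def)
qed

text \<open>Only the identity on \<open>Domain r\<close> can occur as the intermediate
  relation.\<close>

lemma mul_eps_left:
  assumes "zconv m \<alpha> f"
  shows "mul (id_avoiding i) f r = (if i \<in> Domain r then 0 else f r)"
proof (cases "finite r")
  case True
  have "mul (id_avoiding i) f r = (\<Sum>d\<in>{Id_on (Domain r)}. id_avoiding i d * f (d\<inverse> O r))"
  proof (rule mul_eq[OF True])
    fix d assume "Domain d = Domain r" "id_avoiding i d \<noteq> 0"
    then have "d \<subseteq> Id" "Domain d = Domain r" by (auto split: if_splits)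
    then show "d \<in> {Id_on (Domain r)}" by (auto simp: Domain_iff)
  qed auto
  moreover have "finite (Id_on (Domain r))"
    using True by (simp add: Id_on_def finite_Domain)
  moreover have "(Id_on (Domain r))\<inverse> O r = r" by auto
  moreover have "Id_on (Domain r) \<subseteq> Id" by auto
  ultimately show ?thesis by simp
next
  case False
  then show ?thesis using zconv_infinite[OF assms] by (simp add: mul_def)
qed

lemma zconv_eps_right:
  assumes "zconv m \<alpha> f" "i < m"
  shows "zconv m (\<lambda>n. \<alpha> n \<star> eps i n) (\<lambda>r. if i \<in> Range r then 0 else f r)"
  using zconv_mult[OF assms(1) zconv_eps[OF assms(2)]] unfolding mul_eps_right[OF assms(1)] .

lemma zconv_eps_left:
  assumes "zconv m \<alpha> f" "i < m"
  shows "zconv m (\<lambda>n. eps i n \<star> \<alpha> n) (\<lambda>r. if i \<in> Domain r then 0 else f r)"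
  using zconv_mult[OF zconv_eps[OF assms(2)] assms(1)] unfolding mul_eps_left[OF assms(1)] .

lemma zconv_restrict_Range:
  assumes "zconv m \<alpha> f" "i < m"
  shows "\<exists>\<beta>. zconv m \<beta> (\<lambda>r. if i \<in> Range r \<longleftrightarrow> p then f r else 0)"
proof (cases p)
  case True
  have "(\<lambda>r. f r - (if i \<in> Range r then 0 else f r)) = (\<lambda>r. if i \<in> Range r \<longleftrightarrow> p then f r else 0)"
    using True by auto
  then show ?thesis using zconv_diff[OF assms(1) zconv_eps_right[OF assms]] by auto
next
  case False
  have "(\<lambda>r. if i \<in> Range r then 0 else f r) = (\<lambda>r. if i \<in> Range r \<longleftrightarrow> p then f r else 0)"
    using False by auto
  then show ?thesis using zconv_eps_right[OF assms] by auto
qed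

text \<open>The limit of \<open>eps i\<close> and its complement are projections that test whether
  \<open>i\<close> lies in the range; one of the two is applied for each
  \<open>i < k\<close>.\<close>

lemma zconv_restrict_Ranges:
  assumes "zconv m \<alpha> f" "k \<le> m"
  shows "\<exists>\<beta>. zconv m \<beta> (\<lambda>r. if \<forall>i<k. i \<in> Range r \<longleftrightarrow> i \<in> J then f r else 0)"
  using assms(2)
proof (induction k)
  case 0
  then show ?case using assms(1) by auto
next
  case (Suc k)
  then obtain \<beta> where "zconv m \<beta> (\<lambda>r. if \<forall>i<k. i \<in> Range r \<longleftrightarrow> i \<in> J then f r else 0)" by auto
  from zconv_restrict_Range[OF this, of k "k \<in> J"] Suc.prems
  have "\<exists>\<beta>. zconv m \<beta> (\<lambda>r. if k \<in> Range r \<longleftrightarrow> k \<in> J then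
      (if \<forall>i<k. i \<in> Range r \<longleftrightarrow> i \<in> J then f r else 0) else 0)" by simp
  moreover have "(\<lambda>r. if k \<in> Range r \<longleftrightarrow> k \<in> J then
      (if \<forall>i<k. i \<in> Range r \<longleftrightarrow> i \<in> J then f r else 0) else 0) =
      (\<lambda>r. if \<forall>i<Suc k. i \<in> Range r \<longleftrightarrow> i \<in> J then f r else 0)"
    by (rule ext) (simp add: less_Suc_eq conj_commute all_conj_distrib imp_disjL flip: imp_conjL, blast?)
  ultimately show ?case by simp
qed

section \<open>Sums over the positions of a point\<close>

text \<open>The transpositions of \<open>m\<close> with the points from \<open>m\<close> on
  represent the cosets of \<open>Sn_stab (Suc m) n\<close> in \<open>Sn_stab m n\<close>. This is
  the limit of the sum of the conjugates by them, for \<open>g\<close> supported on relations that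
  have \<open>m\<close> in domain and range.\<close>

definition sumop :: "nat \<Rightarrow> (rel2 \<Rightarrow> complex) \<Rightarrow> rel2 \<Rightarrow> complex"
  where "sumop m g r = (if finite r then
     \<Sum>i\<in>Domain r - {..<m}. g (mv \<langle>m \<leftrightarrow> i\<rangle> \<langle>m \<leftrightarrow> i\<rangle> r) else 0)"

lemma mv_right_swap_fresh: "m \<notin> Range r \<Longrightarrow> j \<notin> Range r \<Longrightarrow> mv 1 \<langle>m \<leftrightarrow> j\<rangle> r = r"
proof -
  assume "m \<notin> Range r" "j \<notin> Range r"
  then have "(case p of (x, y) \<Rightarrow> (1 \<langle>$\<rangle> x, \<langle>m \<leftrightarrow> j\<rangle> \<langle>$\<rangle> y)) = p" if "p \<in> r" for p
    using that by (cases p) (auto simp: apply_one intro!: apply_swap_same)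
  then show ?thesis unfolding mv_def by (simp add: image_cong[of r r _ "\<lambda>p. p"])
qed

lemma mv_left_swap_fresh: "m \<notin> Domain r \<Longrightarrow> j \<notin> Domain r \<Longrightarrow> mv \<langle>m \<leftrightarrow> j\<rangle> 1 r = r"
proof -
  assume "m \<notin> Domain r" "j \<notin> Domain r"
  then have "(case p of (x, y) \<Rightarrow> (\<langle>m \<leftrightarrow> j\<rangle> \<langle>$\<rangle> x, 1 \<langle>$\<rangle> y)) = p" if "p \<in> r" for p
    using that by (cases p) (auto simp: apply_one intro!: apply_swap_same)
  then show ?thesis unfolding mv_def by (simp add: image_cong[of r r _ "\<lambda>p. p"])
qed

lemma mv_swap_fresh: "m \<notin> Field r \<Longrightarrow> j \<notin> Field r \<Longrightarrow> mv \<langle>m \<leftrightarrow> j\<rangle> \<langle>m \<leftrightarrow> j\<rangle> r = r"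
  using mv_mv[of "\<langle>m \<leftrightarrow> j\<rangle>" 1 1 "\<langle>m \<leftrightarrow> j\<rangle>" r]
  by (simp add: mv_right_swap_fresh mv_left_swap_fresh Field_def)

text \<open>Swapping \<open>m\<close> with a point outside of the range leaves \<open>r\<close>
  alone, so of \<open>n\<close> differences only \<open>card (Range r)\<close> remain. This gains a
  factor \<open>1 / n\<close>.\<close>

lemma Z_eps_right:
  assumes "m \<notin> Range r" "Range r \<subseteq> {..<n}" "n \<ge> 1" "finite r"
  shows "of_nat n * Z (a - a \<star> eps m n) r = (\<Sum>j\<in>Range r. Z a r - Z a (mv 1 \<langle>m \<leftrightarrow> j\<rangle> r))"
proof -
  have "of_nat n * Z (a - a \<star> eps m n) r = (\<Sum>j<n. Z a r - Z a (mv 1 \<langle>m \<leftrightarrow> j\<rangle> r))"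
    using assms(3)
    by (simp add: zeta_diff eps_def conv_scale_right conv_sum_right zeta_scale zeta_sum Z_delta_right sum_subtractf
        right_diff_distrib)
  also have "\<dots> = (\<Sum>j\<in>Range r. Z a r - Z a (mv 1 \<langle>m \<leftrightarrow> j\<rangle> r))"
    using assms by (intro sum.mono_neutral_right) (auto simp: mv_right_swap_fresh)
  finally show ?thesis .
qed

lemma Z_eps_left:
  assumes "m \<notin> Domain r" "Domain r \<subseteq> {..<n}" "n \<ge> 1" "finite r"
  shows "of_nat n * Z (a - eps m n \<star> a) r = (\<Sum>j\<in>Domain r. Z a r - Z a (mv \<langle>m \<leftrightarrow> j\<rangle> 1 r))"
proof -
  have "of_nat n * Z (a - eps m n \<star> a) r = (\<Sum>j<n. Z a r - Z a (mv \<langle>m \<leftrightarrow> j\<rangle> 1 r))"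
    using assms(3)
    by (simp add: zeta_diff eps_def conv_scale_left conv_sum_left zeta_scale zeta_sum Z_delta_left sum_subtractf
        right_diff_distrib)
  also have "\<dots> = (\<Sum>j\<in>Domain r. Z a r - Z a (mv \<langle>m \<leftrightarrow> j\<rangle> 1 r))"
    using assms by (intro sum.mono_neutral_right) (auto simp: mv_left_swap_fresh)
  finally show ?thesis .
qed

text \<open>Compressing by \<open>1 - eps m n\<close> on both sides makes the value at every \<open>r\<close> that avoids \<open>m\<close>
  of order \<open>1 / n\<^sup>2\<close>, so that such values do not contribute to a sum over about \<open>n\<close> positions.\<close>

definition compress :: "nat \<Rightarrow> nat \<Rightarrow> (nat perm \<Rightarrow>\<^sub>0 complex) \<Rightarrow> (nat perm \<Rightarrow>\<^sub>0 complex)"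
  where "compress m n a = (let b = a - a \<star> eps m n in b - eps m n \<star> b)"

lemma Z_compress_bound:
  assumes lim: "\<And>s. finite s \<Longrightarrow> (\<lambda>n. Z (\<alpha> n) s) \<longlonglongrightarrow> g s" and r: "finite r" "m \<notin> Field r"
  shows "\<exists>K n0. \<forall>n\<ge>n0. (real n)\<^sup>2 * cmod (Z (compress m n (\<alpha> n)) r) \<le> K"
proof -
  obtain n0 where n0: "Field r \<subseteq> {..<n0}" using finite_Field'[OF r(1)] finite_nat_iff_bounded by blast
  have mr: "m \<notin> Domain r" "m \<notin> Range r" using r(2) by (auto simp: Field_def)
  let ?w = "\<lambda>n s. \<Sum>j\<in>Range r. Z (\<alpha> n) s - Z (\<alpha> n) (mv 1 \<langle>m \<leftrightarrow> j\<rangle> s)"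
  let ?v = "\<lambda>n. \<Sum>i\<in>Domain r. ?w n r - ?w n (mv \<langle>m \<leftrightarrow> i\<rangle> 1 r)"
  \<comment> \<open>The left factor is expanded by \<open>Z_eps_left\<close>. The left translates
    that arise have the same range as \<open>r\<close>, which avoids \<open>m\<close>, so
    \<open>Z_eps_right\<close> applies to each of them.\<close>
  have eq: "(of_nat n)\<^sup>2 * Z (compress m n (\<alpha> n)) r = ?v n" if n: "n \<ge> max 1 n0" for n
  proof -
    let ?b = "\<alpha> n - \<alpha> n \<star> eps m n"
    have nn: "Domain r \<subseteq> {..<n}" "Range r \<subseteq> {..<n}" "n \<ge> 1" using n0 n by (auto simp: Field_def)
    have b: "of_nat n * Z ?b s = ?w n s" if "Range s = Range r" "finite s" for s
      using Z_eps_right[of m s n "\<alpha> n"] that mr nn by simp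
    have "(of_nat n)\<^sup>2 * Z (compress m n (\<alpha> n)) r = of_nat n * (of_nat n * Z (?b - eps m n \<star> ?b) r)"
      by (simp add: compress_def Let_def power2_eq_square)
    also have "\<dots> = (\<Sum>i\<in>Domain r. of_nat n * Z ?b r - of_nat n * Z ?b (mv \<langle>m \<leftrightarrow> i\<rangle> 1 r))"
      using Z_eps_left[of m r n ?b] mr nn r(1) by (simp add: sum_distrib_left right_diff_distrib)
    also have "\<dots> = ?v n"
      using r(1) by (intro sum.cong refl) (simp add: b Range_mv apply_one)
    finally show ?thesis .
  qed
  have "Bseq ?v"
  proof -
    let ?w' = "\<lambda>s. \<Sum>j\<in>Range r. g s - g (mv 1 \<langle>m \<leftrightarrow> j\<rangle> s)"
    have "?v \<longlonglongrightarrow> (\<Sum>i\<in>Domain r. ?w' r - ?w' (mv \<langle>m \<leftrightarrow> i\<rangle> 1 r))"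
      using r(1) by (intro tendsto_sum tendsto_diff lim) auto
    then show ?thesis by (meson convergentI convergent_imp_Bseq)
  qed
  then obtain K where K: "\<And>n. cmod (?v n) \<le> K" by (auto simp: Bseq_def)
  have "(real n)\<^sup>2 * cmod (Z (compress m n (\<alpha> n)) r) \<le> K" if "n \<ge> max 1 n0" for n
    using K[of n] eq[OF that] by (metis norm_mult norm_of_nat norm_power)
  then show ?thesis by blast
qed

lemma keys_delta_conv_delta:
  assumes "u \<in> Poly_Mapping.keys (delta g \<star> a \<star> delta h)"
  obtains v where "v \<in> Poly_Mapping.keys a" "u = g * v * h"
proof -
  obtain w where w: "w \<in> Poly_Mapping.keys (delta g \<star> a)" "u = w * h"
    using subsetD[OF keys_conv assms] by auto
  obtain v where "v \<in> Poly_Mapping.keys a" "w = g * v"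
    using subsetD[OF keys_conv w(1)] by auto
  then show ?thesis using w that by blast
qed

text \<open>If \<open>h\<close> fixes the points below \<open>m\<close>, then
  \<open>h * \<langle>m \<leftrightarrow> i\<rangle>\<close> is the transposition of
  \<open>m\<close> with the image of \<open>i\<close> times an element that fixes \<open>m\<close>
  as well and hence commutes with \<open>x\<close>. So moving \<open>h\<close> across the sum
  permutes the summands.\<close>

lemma sum_conj_swap_B_cent:
  assumes x: "x \<in> B_cent (Suc m) n" and mn: "m < n"
  shows "(\<Sum>i\<in>{m..<n}. delta \<langle>m \<leftrightarrow> i\<rangle> \<star> x \<star> delta \<langle>m \<leftrightarrow> i\<rangle>) \<in> B_cent m n"
    (is "sum ?f _ \<in> _")
proof -
  have "?f i \<in> span_of (Sn n)" if "i \<in> {m..<n}" for i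
  proof -
    have "\<langle>m \<leftrightarrow> i\<rangle> \<in> Sn n" using that by (intro swap_in_Sn) auto
    then show ?thesis using B_cent_keys[OF x]
      by (auto simp: span_of_def elim!: keys_delta_conv_delta intro!: Sn_mult)
  qed
  then have "sum ?f {m..<n} \<in> span_of (Sn n)" by (rule span_of_sum)
  moreover have "delta h \<star> sum ?f {m..<n} = sum ?f {m..<n} \<star> delta h" if h: "h \<in> Sn_stab m n" for h
  proof -
    have *: "delta h \<star> ?f i = ?f (h \<langle>$\<rangle> i) \<star> delta h" if i: "i \<in> {m..<n}" for i
    proof -
      have hm: "h \<langle>$\<rangle> k = k" if "k < m" for k using h that by (simp add: Sn_stab_def)
      have hi: "h \<langle>$\<rangle> i \<in> {m..<n}"
        using i hm[of "h \<langle>$\<rangle> i"] Sn_less[of h n i] h by (auto simp: Sn_stab_def apply_inj not_less[symmetric])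
      define k where "k = \<langle>m \<leftrightarrow> h \<langle>$\<rangle> i\<rangle> * h * \<langle>m \<leftrightarrow> i\<rangle>"
      have "k \<langle>$\<rangle> j = j" if "j < Suc m" for j
        using that i hi hm[of j] by (cases "j = m") (auto simp: k_def apply_times)
      moreover have "k \<in> Sn n"
        unfolding k_def using i hi h by (intro Sn_mult swap_in_Sn) (auto simp: Sn_stab_def)
      ultimately have k: "k \<in> Sn_stab (Suc m) n" by (simp add: Sn_stab_def)
      have 1: "h * \<langle>m \<leftrightarrow> i\<rangle> = \<langle>m \<leftrightarrow> h \<langle>$\<rangle> i\<rangle> * k"
        by (simp add: k_def mult.assoc[symmetric])
      have 2: "k * \<langle>m \<leftrightarrow> i\<rangle> = \<langle>m \<leftrightarrow> h \<langle>$\<rangle> i\<rangle> * h"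
        by (simp add: k_def mult.assoc)
      have "delta h \<star> ?f i = delta (h * \<langle>m \<leftrightarrow> i\<rangle>) \<star> x \<star> delta \<langle>m \<leftrightarrow> i\<rangle>"
        by (simp flip: conv_assoc)
      also have "\<dots> = delta \<langle>m \<leftrightarrow> h \<langle>$\<rangle> i\<rangle> \<star> (delta k \<star> x) \<star> delta \<langle>m \<leftrightarrow> i\<rangle>"
        unfolding 1 by (simp flip: conv_assoc)
      also have "delta k \<star> x = x \<star> delta k" using x k by (simp add: B_cent_iff)
      also have "delta \<langle>m \<leftrightarrow> h \<langle>$\<rangle> i\<rangle> \<star> (x \<star> delta k) \<star> delta \<langle>m \<leftrightarrow> i\<rangle> =
          delta \<langle>m \<leftrightarrow> h \<langle>$\<rangle> i\<rangle> \<star> x \<star> delta (k * \<langle>m \<leftrightarrow> i\<rangle>)"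
        by (simp add: conv_assoc)
      also have "\<dots> = ?f (h \<langle>$\<rangle> i) \<star> delta h"
        unfolding 2 by (simp add: conv_assoc)
      finally show ?thesis .
    qed
    have "delta h \<star> sum ?f {m..<n} = (\<Sum>i\<in>{m..<n}. ?f (h \<langle>$\<rangle> i) \<star> delta h)"
      unfolding conv_sum_right by (intro sum.cong refl *)
    also have "\<dots> = (\<Sum>i\<in>{m..<n}. ?f i \<star> delta h)"
      by (rule sum_apply_perm[OF h, of "\<lambda>i. ?f i \<star> delta h"])
    finally show ?thesis by (simp add: conv_sum_left)
  qed
  ultimately show ?thesis by (simp add: B_cent_iff span_of_def)
qed

text \<open>The limit function lives on relations with \<open>m\<close> in domain and range, where
  the subtracted products have limit 0; compression changes the sequence but not its limit.\<close>

lemma zconv_compress: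
  assumes "zconv (Suc m) \<alpha> g" "\<And>r. g r \<noteq> 0 \<Longrightarrow> m \<in> Domain r \<and> m \<in> Range r"
  shows "zconv (Suc m) (\<lambda>n. compress m n (\<alpha> n)) g"
proof -
  have "zconv (Suc m) (\<lambda>n. \<alpha> n - \<alpha> n \<star> eps m n) (\<lambda>r. g r - (if m \<in> Range r then 0 else g r))"
    by (intro zconv_diff zconv_eps_right assms(1)) simp
  also have "(\<lambda>r. g r - (if m \<in> Range r then 0 else g r)) = g"
  proof (rule ext)
    fix r show "g r - (if m \<in> Range r then 0 else g r) = g r" using assms(2)[of r] by auto
  qed
  finally have b: "zconv (Suc m) (\<lambda>n. \<alpha> n - \<alpha> n \<star> eps m n) g" .
  have "zconv (Suc m) (\<lambda>n. compress m n (\<alpha> n)) (\<lambda>r. g r - (if m \<in> Domain r then 0 else g r))"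
    unfolding compress_def Let_def by (intro zconv_diff zconv_eps_left b) simp
  also have "(\<lambda>r. g r - (if m \<in> Domain r then 0 else g r)) = g"
  proof (rule ext)
    fix r show "g r - (if m \<in> Domain r then 0 else g r) = g r" using assms(2)[of r] by auto
  qed
  finally show ?thesis .
qed

text \<open>Outside of the finite set \<open>G\<close> all positions \<open>i\<close> give the same
  value, namely the one at a relation \<open>r0\<close> that avoids \<open>m\<close>. There are at
  most \<open>n\<close> of them, and after compression this value is \<open>O(1 / n ^ 2)\<close>.
  What survives are the positions in \<open>G\<close>, that is, finitely many convergent
  terms.\<close>

lemma zconv_sumop:
  assumes A: "zconv (Suc m) \<alpha> g" and g: "\<And>r. g r \<noteq> 0 \<Longrightarrow> m \<in> Domain r \<and> m \<in> Range r"
  shows "\<exists>\<beta>. zconv m \<beta> (sumop m g)"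
proof -
  define x where "x n = compress m n (\<alpha> n)" for n
  have X: "zconv (Suc m) x g" unfolding x_def by (rule zconv_compress[OF A g])
  define \<beta> where "\<beta> n = (\<Sum>i\<in>{m..<n}. delta \<langle>m \<leftrightarrow> i\<rangle> \<star> x n \<star> delta \<langle>m \<leftrightarrow> i\<rangle>)" for n
  let ?s = "\<lambda>i. \<langle>m \<leftrightarrow> i\<rangle>"
  obtain d where d: "\<And>n u. n \<ge> 1 \<Longrightarrow> u \<in> Poly_Mapping.keys (x n) \<Longrightarrow> perm_deg u \<le> d"
    using zconv_deg[OF X] by blast
  have "zconv m \<beta> (sumop m g)"
  proof (rule zconvI)
    have "\<forall>\<^sub>F n in sequentially. m < n" by (rule eventually_gt_at_top)
    then show "\<forall>\<^sub>F n in sequentially. \<beta> n \<in> B_cent m n"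
      using zconv_cent[OF X] unfolding \<beta>_def by eventually_elim (rule sum_conj_swap_B_cent)
    show "perm_deg u \<le> 2 + d + 2" if n: "1 \<le> n" and u: "u \<in> Poly_Mapping.keys (\<beta> n)" for n u
    proof -
      from subsetD[OF keys_sum_subset u[unfolded \<beta>_def]]
      obtain i where "u \<in> Poly_Mapping.keys (delta (?s i) \<star> x n \<star> delta (?s i))" by auto
      then obtain v where v: "v \<in> Poly_Mapping.keys (x n)" "u = ?s i * v * ?s i"
        by (rule keys_delta_conv_delta)
      show ?thesis
        using perm_deg_times[of "?s i * v" "?s i"] perm_deg_times[of "?s i" v] d[OF n v(1)] perm_deg_swap[of m i]
        unfolding v(2) by linarith
    qed
    show "sumop m g r = 0" if "infinite r" for r using that by (simp add: sumop_def)
    fix r :: rel2 assume r: "finite r"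
    define F where "F = Field r"
    have F: "finite F" using r by (simp add: F_def finite_Field')
    obtain n0 where n0: "insert m F \<subseteq> {..<n0}" using F by (metis finite_insert finite_nat_iff_bounded)
    \<comment> \<open>Any position beyond \<open>m\<close> and outside of \<open>F\<close> can serve
      as reference; a transposition in \<open>Sn_stab (Suc m) n\<close> exchanges it with any other
      such position below \<open>n\<close>.\<close>
    define i0 where "i0 = n0"
    have i0: "i0 \<notin> F" "i0 \<noteq> m" "i0 > m" using n0 by (auto simp: i0_def)
    define r0 where "r0 = mv (?s i0) (?s i0) r"
    have zb: "Z (\<beta> n) r = (\<Sum>i\<in>{m..<n}. Z (x n) (mv (?s i) (?s i) r))" for n
      by (simp add: \<beta>_def zeta_sum Z_delta_left Z_delta_right mv_mv)
    have fresh: "\<forall>\<^sub>F n in sequentially. \<forall>i\<in>{m<..<n} - F. Z (x n) (mv (?s i) (?s i) r) = Z (x n) r0"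
      using zconv_cent[OF X] eventually_gt_at_top[of i0]
    proof eventually_elim
      case (elim n)
      show ?case
      proof
        fix i assume i: "i \<in> {m<..<n} - F"
        let ?t = "\<langle>i0 \<leftrightarrow> i\<rangle>"
        have "?t \<in> Sn_stab (Suc m) n" using i i0 elim by (intro swap_in_Sn_stab) auto
        then have "Z (x n) r0 = Z (x n) (mv ?t ?t r0)" using Z_conj[OF elim(1)] by simp
        also have "mv ?t ?t r0 = mv (?s i) (?s i) (mv ?t ?t r)"
        proof -
          have "?t * ?s i0 = \<langle>?t \<langle>$\<rangle> m \<leftrightarrow> ?t \<langle>$\<rangle> i0\<rangle> * ?t" by (rule perm_times_swap)
          also have "?t \<langle>$\<rangle> m = m" using i i0 by (intro apply_swap_same) auto
          finally have "?t * ?s i0 = ?s i * ?t" by simp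
          then show ?thesis by (simp add: r0_def mv_mv)
        qed
        also have "mv ?t ?t r = r" using i i0 by (intro mv_swap_fresh) (auto simp: F_def)
        finally show "Z (x n) (mv (?s i) (?s i) r) = Z (x n) r0" by simp
      qed
    qed
    have mr0: "m \<notin> Field r0"
    proof
      assume "m \<in> Field r0"
      then have "m \<in> apply (?s i0) ` F" by (auto simp: r0_def Field_def Domain_mv Range_mv F_def)
      then obtain y where "y \<in> F" "?s i0 \<langle>$\<rangle> y = m" by (metis imageE)
      then show False using i0 by simp
    qed
    have fr0: "finite r0" using r by (simp add: r0_def)
    obtain K n1 where K: "\<And>n. n \<ge> n1 \<Longrightarrow> (real n)\<^sup>2 * cmod (Z (x n) r0) \<le> K"
      using Z_compress_bound[OF zconv_lim[OF A] fr0 mr0] unfolding x_def by blast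
    define G where "G = insert m F - {..<m}"
    have G: "finite G" using F by (simp add: G_def)
    have split: "\<forall>\<^sub>F n in sequentially. (\<Sum>i\<in>G. Z (x n) (mv (?s i) (?s i) r)) +
        of_nat (card ({m<..<n} - F)) * Z (x n) r0 = Z (\<beta> n) r"
      using fresh eventually_ge_at_top[of n0]
    proof eventually_elim
      case (elim n)
      have sub: "G \<subseteq> {m..<n}" using n0 elim(2) by (auto simp: G_def)
      have "{m..<n} - G = {m<..<n} - F" using n0 elim(2) by (auto simp: G_def)
      then have "(\<Sum>i\<in>{m..<n} - G. Z (x n) (mv (?s i) (?s i) r)) = (\<Sum>i\<in>{m<..<n} - F. Z (x n) r0)"
        using elim(1) by (intro sum.cong) auto
      then show ?case
        unfolding zb using sum.subset_diff[OF sub, of "\<lambda>i. Z (x n) (mv (?s i) (?s i) r)"] by (simp add: add.commute)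
    qed
    have "(\<lambda>n. \<Sum>i\<in>G. Z (x n) (mv (?s i) (?s i) r)) \<longlonglongrightarrow> (\<Sum>i\<in>G. g (mv (?s i) (?s i) r))"
      using r by (intro tendsto_sum zconv_lim[OF X]) simp
    moreover have "(\<lambda>n. of_nat (card ({m<..<n} - F)) * Z (x n) r0) \<longlonglongrightarrow> 0"
    proof (rule tendsto_0_norm_le)
      show "\<forall>\<^sub>F n in sequentially. norm (of_nat (card ({m<..<n} - F)) * Z (x n) r0) \<le> K / real n"
      proof (rule eventually_sequentiallyI[of "max 1 n1"])
        fix n assume n: "max 1 n1 \<le> n"
        have "card ({m<..<n} - F) \<le> card {..<n}" by (rule card_mono) auto
        then have "norm (of_nat (card ({m<..<n} - F)) * Z (x n) r0) \<le> real n * cmod (Z (x n) r0)"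
          by (simp add: norm_mult mult_right_mono)
        also have "\<dots> \<le> K / real n"
          using K[of n] n by (simp add: field_simps power2_eq_square)
        finally show "norm (of_nat (card ({m<..<n} - F)) * Z (x n) r0) \<le> K / real n" .
      qed
    qed (rule lim_const_over_n)
    ultimately have "(\<lambda>n. (\<Sum>i\<in>G. Z (x n) (mv (?s i) (?s i) r)) +
        of_nat (card ({m<..<n} - F)) * Z (x n) r0) \<longlonglongrightarrow> (\<Sum>i\<in>G. g (mv (?s i) (?s i) r)) + 0"
      by (rule tendsto_add)
    from Lim_transform_eventually[OF this split]
    have "(\<lambda>n. Z (\<beta> n) r) \<longlonglongrightarrow> (\<Sum>i\<in>G. g (mv (?s i) (?s i) r)) + 0" .
    also have "(\<Sum>i\<in>G. g (mv (?s i) (?s i) r)) + 0 = sumop m g r"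
    proof -
      \<comment> \<open>Such positions leave \<open>m\<close> outside of the domain of the
        conjugate, where \<open>g\<close> vanishes.\<close>
      have "g (mv (?s i) (?s i) r) = 0" if "i \<notin> Domain r" for i
      proof (rule ccontr)
        assume "g (mv (?s i) (?s i) r) \<noteq> 0"
        then have "m \<in> apply (?s i) ` Domain r" using g by (metis Domain_mv)
        then obtain y where "y \<in> Domain r" "?s i \<langle>$\<rangle> y = m" by (metis imageE)
        then show False using that by simp
      qed
      then have "(\<Sum>i\<in>G. g (mv (?s i) (?s i) r)) = (\<Sum>i\<in>Domain r - {..<m}. g (mv (?s i) (?s i) r))"
        using G by (intro sum.mono_neutral_right) (auto simp: G_def F_def Field_def)
      then show ?thesis using r by (simp add: sumop_def)
    qed
    finally show "(\<lambda>n. Z (\<beta> n) r) \<longlonglongrightarrow> sumop m g r" .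
  qed
  then show ?thesis by blast
qed

section \<open>Every admissible function is a limit\<close>

definition Id_from :: "nat \<Rightarrow> rel2"
  where "Id_from m = {(i, i) | i. m \<le> i}"

lemma in_Id_from [simp]: "(i, j) \<in> Id_from m \<longleftrightarrow> i = j \<and> m \<le> i"
  by (auto simp: Id_from_def)

text \<open>A superposition of the functions that are 1 exactly for
  \<open>s \<subseteq> r \<subseteq> s \<union> Id_from m\<close>: a core \<open>s\<close>, to which
  fixed points from \<open>m\<close> on may be added freely.\<close>

definition expand :: "nat \<Rightarrow> (rel2 \<Rightarrow> complex) \<Rightarrow> rel2 \<Rightarrow> complex"
  where "expand m \<mu> r = (if finite r \<and> one_one r then \<Sum>s | s \<subseteq> r \<and> r - s \<subseteq> Id_from m. \<mu> s else 0)"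

lemma finite_subsets_with: "finite r \<Longrightarrow> finite {s. s \<subseteq> r \<and> Q s}"
  by (rule finite_subset[of _ "Pow r"]) auto

text \<open>Any \<open>w0\<close> in \<open>Sn m\<close> that extends \<open>s\<close> has the
  indicator of \<open>r \<subseteq> prel w0\<close> as its limit. Prescribing which points below
  \<open>m\<close> lie in the range leaves \<open>s\<close> together with fixed points from
  \<open>m\<close> on.\<close>

lemma zconv_corner:
  assumes s: "one_one s" "s \<subseteq> {..<m} \<times> {..<m}"
  shows "\<exists>\<alpha>. zconv m \<alpha> (\<lambda>r. if finite r \<and> s \<subseteq> r \<and> r - s \<subseteq> Id_from m then 1 else 0)"
proof -
  have fs: "finite s" using s(2) finite_subset by blast
  define f where "f j = (THE i. (i, j) \<in> s)" for j
  have f: "f j = i" if "(i, j) \<in> s" for i j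
    unfolding f_def using that one_one_eq2[OF s(1)] by blast
  have inj: "inj_on f (Range s)"
    by (rule inj_onI) (metis RangeE f one_one_eq1[OF s(1)])
  obtain w0 where w0: "\<And>j. j \<in> Range s \<Longrightarrow> w0 \<langle>$\<rangle> j = f j" "affected w0 \<subseteq> Range s \<union> f ` Range s"
    using perm_extend[OF finite_Range[OF fs] inj] by metis
  have "f ` Range s \<subseteq> {..<m}" using f s(2) by fastforce
  moreover have "Range s \<subseteq> {..<m}" using s(2) by auto
  ultimately have "affected w0 \<subseteq> {..<m}" using w0(2) by blast
  then have w: "w0 \<in> Sn m" by (auto simp: Sn_def in_affected subset_iff)
  have sw: "(i, j) \<in> s \<longleftrightarrow> j \<in> Range s \<and> i = w0 \<langle>$\<rangle> j" for i j
  proof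
    assume "(i, j) \<in> s"
    moreover from this have "j \<in> Range s" by blast
    ultimately show "j \<in> Range s \<and> i = w0 \<langle>$\<rangle> j" using w0(1)[of j] f[of i j] by simp
  next
    assume h: "j \<in> Range s \<and> i = w0 \<langle>$\<rangle> j"
    then obtain i' where "(i', j) \<in> s" by blast
    then show "(i, j) \<in> s" using w0(1)[of j] f[of i' j] h by auto
  qed
  obtain \<beta> where "zconv m \<beta> (\<lambda>r. if \<forall>i<m. i \<in> Range r \<longleftrightarrow> i \<in> Range s then
      (if finite r \<and> r \<subseteq> prel w0 then 1 else 0) else 0)"
    using zconv_restrict_Ranges[OF zconv_delta[OF w], of m "Range s"] by blast
  moreover have "(\<lambda>r. if \<forall>i<m. i \<in> Range r \<longleftrightarrow> i \<in> Range s then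
      (if finite r \<and> r \<subseteq> prel w0 then 1 else 0) else 0) =
      (\<lambda>r. if finite r \<and> s \<subseteq> r \<and> r - s \<subseteq> Id_from m then 1 else 0 :: complex)"
  proof (rule ext)
    fix r
    have iff: "(\<forall>i<m. i \<in> Range r \<longleftrightarrow> i \<in> Range s) \<and> r \<subseteq> prel w0 \<longleftrightarrow> s \<subseteq> r \<and> r - s \<subseteq> Id_from m"
    proof safe
      fix i j assume h: "\<forall>i<m. i \<in> Range r \<longleftrightarrow> i \<in> Range s" "r \<subseteq> prel w0"
      { assume ij: "(i, j) \<in> s"
        then have "j < m" using s(2) by auto
        then have "j \<in> Range r" using h(1) ij by blast
        then obtain i' where "(i', j) \<in> r" by blast
        moreover have "i' = w0 \<langle>$\<rangle> j" using h(2) calculation by auto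
        ultimately show "(i, j) \<in> r" using ij sw by auto }
      { assume ij: "(i, j) \<in> r" "(i, j) \<notin> s"
        then have "i = w0 \<langle>$\<rangle> j" using h(2) by auto
        then have "j \<notin> Range s" using sw ij by blast
        then have "\<not> j < m" using h(1) ij(1) by blast
        then show "(i, j) \<in> Id_from m" using \<open>i = w0 \<langle>$\<rangle> j\<close> SnD[OF w, of j] by auto }
    next
      fix i j assume h: "s \<subseteq> r" "r - s \<subseteq> Id_from m"
      { assume ij: "(i, j) \<in> r"
        show "(i, j) \<in> prel w0"
        proof (cases "(i, j) \<in> s")
          case True then show ?thesis using sw by auto
        next
          case False
          then have "i = j" "m \<le> i" using h(2) ij by auto
          then show ?thesis using SnD[OF w, of j] by auto
        qed }
    next
      fix j i assume h: "s \<subseteq> r" "r - s \<subseteq> Id_from m" and ij: "j < m" "(i, j) \<in> r"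
      have "(i, j) \<in> s"
      proof (rule ccontr)
        assume "(i, j) \<notin> s"
        then have "(i, j) \<in> Id_from m" using h ij by auto
        then show False using ij by auto
      qed
      then show "j \<in> Range s" by blast
    qed blast
    have if_and: "(if A then (if F \<and> B then 1 else 0) else 0) = (if F \<and> C then 1 else 0 :: complex)"
      if "A \<and> B \<longleftrightarrow> C" for A B C F using that by auto
    show "(if \<forall>i<m. i \<in> Range r \<longleftrightarrow> i \<in> Range s then
      (if finite r \<and> r \<subseteq> prel w0 then 1 else 0) else 0) = (if finite r \<and> s \<subseteq> r \<and>
          r - s \<subseteq> Id_from m then 1 else 0 :: complex)"
      by (rule if_and[OF iff])
  qed
  ultimately show ?thesis by auto
qed

lemma zconv_expand_corner:
  assumes \<mu>: "\<And>r. \<mu> r \<noteq> 0 \<Longrightarrow> r \<subseteq> {..<m} \<times> {..<m}"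
  shows "\<exists>\<alpha>. zconv m \<alpha> (expand m \<mu>)"
proof -
  define S where "S = {s. one_one s \<and> s \<subseteq> {..<m} \<times> {..<m}}"
  have S: "finite S" by (rule finite_subset[of _ "Pow ({..<m} \<times> {..<m})"]) (auto simp: S_def)
  let ?e = "\<lambda>s r. if finite r \<and> s \<subseteq> r \<and> r - s \<subseteq> Id_from m then 1 else 0 :: complex"
  have "\<forall>s\<in>S. \<exists>\<alpha>. zconv m \<alpha> (?e s)" using zconv_corner by (auto simp: S_def)
  from bchoice[OF this] obtain \<alpha> where \<alpha>: "\<And>s. s \<in> S \<Longrightarrow> zconv m (\<alpha> s) (?e s)" by blast
  have "zconv m (\<lambda>n. \<Sum>s\<in>S. scale (\<mu> s) (\<alpha> s n)) (\<lambda>r. \<Sum>s\<in>S. \<mu> s * ?e s r)"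
    by (intro zconv_sum zconv_scale \<alpha> S)
  moreover have "(\<Sum>s\<in>S. \<mu> s * ?e s r) = expand m \<mu> r" for r
  proof (cases "finite r \<and> one_one r")
    case True
    have "expand m \<mu> r = (\<Sum>s | s \<subseteq> r \<and> r - s \<subseteq> Id_from m. \<mu> s)" using True by (simp add: expand_def)
    also have "\<dots> = (\<Sum>s | s \<in> S \<and> s \<subseteq> r \<and> r - s \<subseteq> Id_from m. \<mu> s)"
      using True one_one_subset by (intro sum.mono_neutral_right finite_subsets_with) (auto simp: S_def dest: \<mu>)
    also have "\<dots> = (\<Sum>s\<in>S. if s \<subseteq> r \<and> r - s \<subseteq> Id_from m then \<mu> s else 0)"
      using S by (simp add: sum.inter_filter)
    also have "\<dots> = (\<Sum>s\<in>S. \<mu> s * ?e s r)" using True by (intro sum.cong) auto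
    finally show ?thesis by simp
  next
    case False
    \<comment> \<open>A finite relation that consists of a core in the square and of fixed points
      from \<open>m\<close> on is one-one, so all summands vanish where \<open>expand\<close> is 0
      by definition.\<close>
    have "?e s r = 0" if "s \<in> S" for s
    proof (rule ccontr)
      assume "?e s r \<noteq> 0"
      then have h: "finite r" "s \<subseteq> r" "r - s \<subseteq> Id_from m" by (auto split: if_splits)
      have oo: "one_one s" and sq: "\<And>i j. (i, j) \<in> s \<Longrightarrow> i < m \<and> j < m" using that by (auto simp: S_def)
      have cs: "(i, j) \<in> s \<or> i = j \<and> m \<le> i" if "(i, j) \<in> r" for i j using h that by auto
      have "one_one r"
      proof (rule one_oneI)
        fix i j j' assume "(i, j) \<in> r" "(i, j') \<in> r"
        then show "j = j'" using cs[of i j] cs[of i j'] one_one_eq1[OF oo, of i j j'] sq[of i j] sq[of i j']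
            by linarith
      next
        fix i i' j assume "(i, j) \<in> r" "(i', j) \<in> r"
        then show "i = i'" using cs[of i j] cs[of i' j] one_one_eq2[OF oo, of i j i'] sq[of i j] sq[of i' j]
            by linarith
      qed
      then show False using h False by simp
    qed
    then show ?thesis unfolding expand_def if_not_P[OF False] by (simp add: sum.neutral)
  qed
  ultimately show ?thesis by auto
qed

lemma mv_subset_iff: "mv h k s \<subseteq> mv h k r \<longleftrightarrow> s \<subseteq> r"
  by (auto simp: subset_iff in_mv) (metis apply_inverse_apply(1))

lemma mv_diff: "mv h k (r - s) = mv h k r - mv h k s"
  by (auto simp: in_mv)

lemma apply_fix_less_iff:
  assumes "\<And>i. i < m \<Longrightarrow> h \<langle>$\<rangle> i = i"
  shows "h \<langle>$\<rangle> i < m \<longleftrightarrow> i < m"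
  using assms[of i] assms[of "h \<langle>$\<rangle> i"] by (auto simp: apply_inj)

lemma card_image_diff_fix:
  assumes "\<And>i. i < m \<Longrightarrow> h \<langle>$\<rangle> i = i"
  shows "card (apply h ` D - {..<m}) = card (D - {..<m})"
proof -
  have "apply h ` D - {..<m} = apply h ` (D - {..<m})"
    using apply_fix_less_iff[OF assms] by auto
  then show ?thesis by (simp add: card_image inj_on_def apply_inj)
qed

text \<open>Conjugation moves \<open>i\<close> to \<open>m\<close>, so the pairs that may be dropped
  are the fixed points from \<open>m\<close> on other than \<open>i\<close>. A subset that drops
  \<open>(i, i)\<close> no longer has \<open>i\<close> in its domain and gets weight 0 anyway;
  therefore one index set can be used for all \<open>i\<close>.\<close>

lemma expand_conj_swap:
  assumes r: "finite r" "one_one r" and i: "i \<in> Domain r" "m \<le> i"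
    and \<mu>: "\<And>h r. finite r \<Longrightarrow> (\<And>i. i < m \<Longrightarrow> h \<langle>$\<rangle> i = i) \<Longrightarrow> \<mu> (mv h h r) = \<mu> r"
  defines "\<mu>' \<equiv> \<lambda>r. if m \<in> Domain r then \<mu> r / of_nat (card (Domain r - {..<m})) else 0"
  shows "expand (Suc m) \<mu>' (mv \<langle>m \<leftrightarrow> i\<rangle> \<langle>m \<leftrightarrow> i\<rangle> r) =
    (\<Sum>t | t \<subseteq> r \<and> r - t \<subseteq> Id_from m. if i \<in> Domain t then \<mu> t / of_nat (card (Domain t - {..<m})) else 0)"
proof -
  let ?h = "\<langle>m \<leftrightarrow> i\<rangle>"
  let ?A = "{t. t \<subseteq> r \<and> (\<forall>a b. (a, b) \<in> r \<longrightarrow> (a, b) \<notin> t \<longrightarrow> a = b \<and> m \<le> a \<and> a \<noteq> i)}"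
  have hm: "?h \<langle>$\<rangle> k = k" if "k < m" for k using that i by (intro apply_swap_same) auto
  have hS: "Suc m \<le> ?h \<langle>$\<rangle> a \<longleftrightarrow> m \<le> a \<and> a \<noteq> i" for a
    using i(2) by (cases "a = m"; cases "a = i") auto
  have cond: "mv ?h ?h r - mv ?h ?h t \<subseteq> Id_from (Suc m) \<longleftrightarrow> (\<forall>a b. (a, b) \<in> r \<longrightarrow> (a, b) \<notin> t \<longrightarrow>
      a = b \<and> m \<le> a \<and> a \<noteq> i)" for t
  proof -
    have "mv ?h ?h r - mv ?h ?h t \<subseteq> Id_from (Suc m) \<longleftrightarrow>
        (\<forall>a b. (a, b) \<in> r \<longrightarrow> (a, b) \<notin> t \<longrightarrow> (?h \<langle>$\<rangle> a, ?h \<langle>$\<rangle> b) \<in> Id_from (Suc m))"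
      unfolding mv_diff[symmetric] by (auto simp: mv_def simp del: in_Id_from)
    moreover have "(?h \<langle>$\<rangle> a, ?h \<langle>$\<rangle> b) \<in> Id_from (Suc m) \<longleftrightarrow> a = b \<and> m \<le> a \<and> a \<noteq> i" for a b
      using hS[of a] by (auto simp: apply_inj)
    ultimately show ?thesis by (simp only:)
  qed
  have bij: "bij_betw (mv ?h ?h) ?A {s. s \<subseteq> mv ?h ?h r \<and> mv ?h ?h r - s \<subseteq> Id_from (Suc m)}"
  proof (rule bij_betwI[where g = "mv ?h ?h"])
    show "mv ?h ?h \<in> ?A \<rightarrow> {s. s \<subseteq> mv ?h ?h r \<and> mv ?h ?h r - s \<subseteq> Id_from (Suc m)}"
      using cond by (auto simp: mv_subset_iff)
    show "mv ?h ?h \<in> {s. s \<subseteq> mv ?h ?h r \<and> mv ?h ?h r - s \<subseteq> Id_from (Suc m)} \<rightarrow> ?A"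
    proof
      fix s assume s: "s \<in> {s. s \<subseteq> mv ?h ?h r \<and> mv ?h ?h r - s \<subseteq> Id_from (Suc m)}"
      have eq: "mv ?h ?h (mv ?h ?h s) = s" by (simp add: mv_mv)
      have "mv ?h ?h s \<subseteq> r" using s mv_subset_iff[of ?h ?h "mv ?h ?h s" r] by (simp add: eq)
      then show "mv ?h ?h s \<in> ?A" using s cond[of "mv ?h ?h s"] by (simp add: eq)
    qed
  qed (simp_all add: mv_mv)
  have "expand (Suc m) \<mu>' (mv ?h ?h r) = (\<Sum>s | s \<subseteq> mv ?h ?h r \<and> mv ?h ?h r - s \<subseteq> Id_from (Suc m). \<mu>' s)"
    using r by (simp add: expand_def)
  also have "\<dots> = (\<Sum>t\<in>?A. \<mu>' (mv ?h ?h t))"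
    by (rule sum.reindex_bij_betw[OF bij, symmetric])
  also have "\<dots> = (\<Sum>t\<in>?A. if i \<in> Domain t then \<mu> t / of_nat (card (Domain t - {..<m})) else 0)"
  proof (rule sum.cong[OF refl])
    fix t assume "t \<in> ?A"
    then have "finite t" using r finite_subset by auto
    then have "\<mu> (mv ?h ?h t) = \<mu> t" using \<mu> hm by blast
    moreover have "m \<in> apply ?h ` Domain t \<longleftrightarrow> i \<in> Domain t"
      by (metis apply_swap_simp(2) apply_swap_eq_iff(1) image_iff)
    ultimately show "\<mu>' (mv ?h ?h t) = (if i \<in> Domain t then \<mu> t / of_nat (card (Domain t - {..<m})) else 0)"
      unfolding \<mu>'_def by (simp add: Domain_mv card_image_diff_fix[OF hm])
  qed
  also have "\<dots> = (\<Sum>t | t \<subseteq> r \<and> r - t \<subseteq> Id_from m.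
      if i \<in> Domain t then \<mu> t / of_nat (card (Domain t - {..<m})) else 0)"
  proof (rule sum.mono_neutral_left)
    show "\<forall>t\<in>{t. t \<subseteq> r \<and> r - t \<subseteq> Id_from m} - ?A.
        (if i \<in> Domain t then \<mu> t / of_nat (card (Domain t - {..<m})) else 0) = 0"
    proof
      fix t assume t: "t \<in> {t. t \<subseteq> r \<and> r - t \<subseteq> Id_from m} - ?A"
      then obtain a b where ab: "(a, b) \<in> r" "(a, b) \<notin> t" "\<not> (a = b \<and> m \<le> a \<and> a \<noteq> i)" by auto
      then have "(a, b) \<in> Id_from m" using t by auto
      then have "a = i" "b = i" using ab by auto
      then have "i \<notin> Domain t" using t ab one_one_eq1[OF r(2)] by blast
      then show "(if i \<in> Domain t then \<mu> t / of_nat (card (Domain t - {..<m})) else 0) = 0" by simp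
    qed
    show "finite {t. t \<subseteq> r \<and> r - t \<subseteq> Id_from m}" by (rule finite_subsets_with[OF r(1)])
  qed auto
  finally show ?thesis .
qed

text \<open>The induction peels off one point \<open>\<ge> m\<close> of the support of \<open>\<mu>\<close> at a time, by means of
  \<open>sumop\<close>; dividing by the number of such points makes up for the choice.\<close>

lemma zconv_expand:
  assumes "\<And>h r. finite r \<Longrightarrow> (\<And>i. i < m \<Longrightarrow> h \<langle>$\<rangle> i = i) \<Longrightarrow> \<mu> (mv h h r) = \<mu> r"
    and "\<And>r. \<mu> r \<noteq> 0 \<Longrightarrow> Domain r - {..<m} = Range r - {..<m}"
    and "\<And>r. finite r \<Longrightarrow> \<mu> r \<noteq> 0 \<Longrightarrow> card (Domain r - {..<m}) \<le> k"
    and "\<And>r. \<mu> r \<noteq> 0 \<Longrightarrow> finite r"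
  shows "\<exists>\<alpha>. zconv m \<alpha> (expand m \<mu>)"
  using assms
proof (induction k arbitrary: m \<mu>)
  case (0 m \<mu>)
  have "r \<subseteq> {..<m} \<times> {..<m}" if "\<mu> r \<noteq> 0" for r
  proof -
    have "finite (Domain r)" using 0(4)[OF that] finite_Domain by blast
    then have "Domain r - {..<m} = {}" using 0(3)[OF 0(4)[OF that] that] by simp
    then show ?thesis using 0(2)[OF that] by auto
  qed
  then show ?case by (rule zconv_expand_corner)
next
  case (Suc k m \<mu>)
  \<comment> \<open>The part of \<open>\<mu>\<close> on relations inside of the corner, where no
    point is left to peel off.\<close>
  define \<mu>0 where "\<mu>0 r = (if Domain r - {..<m} = {} then \<mu> r else 0)" for r
  define \<mu>' where "\<mu>' r = (if m \<in> Domain r then \<mu> r / of_nat (card (Domain r - {..<m})) else 0)" for r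
  let ?g = "expand (Suc m) \<mu>'"
  have "r \<subseteq> {..<m} \<times> {..<m}" if "\<mu>0 r \<noteq> 0" for r
  proof -
    have "\<mu> r \<noteq> 0" "Domain r - {..<m} = {}" using that by (auto simp: \<mu>0_def split: if_splits)
    then show ?thesis using Suc.prems(2)[of r] by auto
  qed
  then obtain \<alpha>0 where \<alpha>0: "zconv m \<alpha>0 (expand m \<mu>0)" using zconv_expand_corner by blast
  have \<mu>'D: "\<mu> r \<noteq> 0 \<and> m \<in> Domain r" if "\<mu>' r \<noteq> 0" for r
    using that by (auto simp: \<mu>'_def split: if_splits)
  have "\<exists>\<alpha>. zconv (Suc m) \<alpha> ?g"
  proof (rule Suc.IH)
    fix h r assume r: "finite (r :: rel2)" and h: "\<And>i. i < Suc m \<Longrightarrow> h \<langle>$\<rangle> i = i"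
    have hm: "h \<langle>$\<rangle> i = i" if "i < m" for i using h that by simp
    have "m \<in> apply h ` Domain r \<longleftrightarrow> m \<in> Domain r"
      using h[of m] by (metis apply_inj image_iff lessI)
    then show "\<mu>' (mv h h r) = \<mu>' r"
      using card_image_diff_fix[of m h "Domain r", OF hm] Suc.prems(1)[OF r hm]
      by (simp add: \<mu>'_def Domain_mv)
  next
    fix r assume "\<mu>' r \<noteq> 0"
    then show "Domain r - {..<Suc m} = Range r - {..<Suc m}"
      using Suc.prems(2)[of r] \<mu>'D[of r] unfolding lessThan_Suc by auto
    show "finite r" using \<mu>'D[OF \<open>\<mu>' r \<noteq> 0\<close>] Suc.prems(4) by blast
  next
    fix r assume r: "finite r" "\<mu>' r \<noteq> 0"
    have "Domain r - {..<m} = insert m (Domain r - {..<Suc m})" using \<mu>'D[OF r(2)] by auto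
    then have "card (Domain r - {..<m}) = Suc (card (Domain r - {..<Suc m}))"
      using r(1) by (simp add: finite_Domain)
    then show "card (Domain r - {..<Suc m}) \<le> k" using Suc.prems(3)[OF r(1)] \<mu>'D[OF r(2)] by simp
  qed
  then obtain \<alpha>' where \<alpha>': "zconv (Suc m) \<alpha>' ?g" by blast
  have "\<exists>\<beta>. zconv m \<beta> (sumop m ?g)"
  proof (rule zconv_sumop[OF \<alpha>'])
    fix r assume "?g r \<noteq> 0"
    then have "(\<Sum>s | s \<subseteq> r \<and> r - s \<subseteq> Id_from (Suc m). \<mu>' s) \<noteq> 0" by (auto simp: expand_def split: if_splits)
    then obtain s where s: "s \<subseteq> r" "\<mu>' s \<noteq> 0" by (auto elim: sum.not_neutral_contains_not_neutral)
    have "m \<in> Domain s" "\<mu> s \<noteq> 0" using \<mu>'D[OF s(2)] by auto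
    then have "m \<in> Domain s \<and> m \<in> Range s" using Suc.prems(2)[of s] by blast
    then show "m \<in> Domain r \<and> m \<in> Range r" using s(1) by auto
  qed
  then obtain \<beta> where \<beta>: "zconv m \<beta> (sumop m ?g)" by blast
  have "expand m \<mu>0 r + sumop m ?g r = expand m \<mu> r" for r
  proof (cases "finite r \<and> one_one r")
    case True
    then have r: "finite r" "one_one r" by auto
    let ?A = "{t. t \<subseteq> r \<and> r - t \<subseteq> Id_from m}"
    let ?D = "\<lambda>t. Domain t - {..<m}"
    have "sumop m ?g r = (\<Sum>i\<in>?D r. \<Sum>t\<in>?A. if i \<in> Domain t then \<mu> t / of_nat (card (?D t)) else 0)"
      unfolding sumop_def if_P[OF r(1)]
    proof (rule sum.cong[OF refl])
      fix i assume i: "i \<in> ?D r"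
      then show "?g (mv \<langle>m \<leftrightarrow> i\<rangle> \<langle>m \<leftrightarrow> i\<rangle> r) = (\<Sum>t\<in>?A. if i \<in> Domain t then \<mu> t / of_nat (card (?D t)) else 0)"
        unfolding \<mu>'_def by (intro expand_conj_swap r Suc.prems(1)) auto
    qed
    also have "\<dots> = (\<Sum>t\<in>?A. \<Sum>i\<in>?D r. if i \<in> Domain t then \<mu> t / of_nat (card (?D t)) else 0)"
      by (rule sum.swap)
    also have "\<dots> = (\<Sum>t\<in>?A. if ?D t = {} then 0 else \<mu> t)"
    proof (rule sum.cong[OF refl])
      fix t assume t: "t \<in> ?A"
      then have sub: "?D t \<subseteq> ?D r" by auto
      have fin: "finite (?D r)" using r(1) by (simp add: finite_Domain)
      have "(\<Sum>i\<in>?D r. if i \<in> Domain t then \<mu> t / of_nat (card (?D t)) else 0) =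
          (\<Sum>i\<in>?D t. \<mu> t / of_nat (card (?D t)))"
        using sub fin by (intro sum.mono_neutral_cong_right) auto
      also have "\<dots> = (if ?D t = {} then 0 else \<mu> t)"
        using finite_subset[OF sub fin] by simp
      finally show "(\<Sum>i\<in>?D r. if i \<in> Domain t then \<mu> t / of_nat (card (?D t)) else 0) = (if ?D t =
          {} then 0 else \<mu> t)" .
    qed
    finally have "sumop m ?g r = (\<Sum>t\<in>?A. if ?D t = {} then 0 else \<mu> t)" .
    moreover have "expand m \<mu>0 r = (\<Sum>t\<in>?A. if ?D t = {} then \<mu> t else 0)"
      using r by (simp add: expand_def \<mu>0_def)
    ultimately have "expand m \<mu>0 r + sumop m ?g r = (\<Sum>t\<in>?A. \<mu> t)"
      by (simp add: sum.distrib[symmetric]) (rule sum.cong, auto)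
    then show ?thesis using r by (simp add: expand_def)
  next
    case False
    have "sumop m ?g r = 0"
    proof (cases "finite r")
      case True
      then have "\<not> one_one r" using False by simp
      then show ?thesis by (simp add: sumop_def expand_def)
    qed (simp add: sumop_def)
    then show ?thesis unfolding expand_def if_not_P[OF False] by simp
  qed
  then have "(\<lambda>r. expand m \<mu>0 r + sumop m ?g r) = expand m \<mu>" by blast
  then show ?case using zconv_add[OF \<alpha>0 \<beta>] by metis
qed

text \<open>A description of the limit functions without sequences: support and invariance come from
  the centralizer conditions, the alternating sums from the bounded degree. Both sides of the
  isomorphism produce such functions, and \<open>admissible_imp_zconv\<close> is the
  converse.\<close>

definition admissible :: "nat \<Rightarrow> (rel2 \<Rightarrow> complex) \<Rightarrow> bool"
  where "admissible m f \<longleftrightarrow>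
    (\<forall>r. f r \<noteq> 0 \<longrightarrow> finite r \<and> one_one r \<and> Domain r - {..<m} = Range r - {..<m}) \<and>
    (\<forall>h r. finite r \<longrightarrow> (\<forall>i<m. h \<langle>$\<rangle> i = i) \<longrightarrow> f (mv h h r) = f r) \<and>
    (\<exists>d. \<forall>r Y0. finite r \<longrightarrow> finite Y0 \<longrightarrow> d < card (Y0 \<union> moved r) \<longrightarrow>
           (\<Sum>Y\<in>Pow Y0. (-1) ^ card Y * f (r \<union> Id_on Y)) = 0)"

lemma zconv_admissible: "zconv m \<alpha> f \<Longrightarrow> admissible m f"
proof -
  assume A: "zconv m \<alpha> f"
  show ?thesis unfolding admissible_def
  proof (intro conjI)
    show "\<forall>r. f r \<noteq> 0 \<longrightarrow> finite r \<and> one_one r \<and> Domain r - {..<m} = Range r - {..<m}"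
      using zconv_finite[OF A] zconv_one_one[OF A] zconv_Domain_Range[OF A] by simp
    show "\<forall>h r. finite r \<longrightarrow> (\<forall>i<m. h \<langle>$\<rangle> i = i) \<longrightarrow> f (mv h h r) = f r"
      using zconv_conj[OF A] by simp
  qed (rule zconv_alternating[OF A])
qed

lemma sum_Pow_superset:
  assumes "finite F" "B \<subseteq> F"
  shows "(\<Sum>A | B \<subseteq> A \<and> A \<subseteq> F. (-1) ^ card A) = (if B = F then (-1) ^ card F else 0 :: complex)"
proof -
  have "bij_betw (\<lambda>X. B \<union> X) (Pow (F - B)) {A. B \<subseteq> A \<and> A \<subseteq> F}"
    by (rule bij_betwI[where g = "\<lambda>A. A - B"]) (use assms in auto)
  from sum.reindex_bij_betw[OF this, of "\<lambda>A. (-1) ^ card A :: complex"]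
  have "(\<Sum>A | B \<subseteq> A \<and> A \<subseteq> F. (-1) ^ card A :: complex) = (\<Sum>X\<in>Pow (F - B). (-1) ^ card (B \<union> X))"
    by simp
  also have "\<dots> = (\<Sum>X\<in>Pow (F - B). (-1) ^ card B * (-1) ^ card X)"
  proof (rule sum.cong[OF refl])
    fix X assume "X \<in> Pow (F - B)"
    then have "finite B" "finite X" "B \<inter> X = {}"
      using assms finite_subset[of B F] finite_subset[of X F] by auto
    then show "(-1) ^ card (B \<union> X) = (-1) ^ card B * ((-1) ^ card X :: complex)"
      by (simp add: card_Un_disjoint power_add)
  qed
  also have "\<dots> = (-1) ^ card B * (if F - B = {} then 1 else 0)"
    using assms by (simp add: sum_distrib_left[symmetric] sum_alternating_Pow)
  finally show ?thesis using assms(2) by auto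
qed

text \<open>The signed sum over subsets is an involution; this is inclusion-exclusion in the form
  that is used for the fixed points of a relation.\<close>

lemma Moebius_Pow:
  fixes G :: "'a set \<Rightarrow> complex"
  assumes "finite F"
  shows "(\<Sum>A\<in>Pow F. (-1) ^ card A * (\<Sum>B\<in>Pow A. (-1) ^ card B * G B)) = G F"
proof -
  have "(\<Sum>A\<in>Pow F. (-1) ^ card A * (\<Sum>B\<in>Pow A. (-1) ^ card B * G B)) =
        (\<Sum>A\<in>Pow F. \<Sum>B\<in>Pow F. if B \<subseteq> A then (-1) ^ card B * G B * (-1) ^ card A else 0)"
  proof (rule sum.cong[OF refl])
    fix A assume A: "A \<in> Pow F"
    have "(\<Sum>B\<in>Pow F. if B \<subseteq> A then (-1) ^ card B * G B * (-1) ^ card A else 0) =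
          (\<Sum>B\<in>Pow A. (-1) ^ card B * G B * (-1) ^ card A)"
      using A assms by (intro sum.mono_neutral_cong_right) auto
    then show "(-1) ^ card A * (\<Sum>B\<in>Pow A. (-1) ^ card B * G B) =
       (\<Sum>B\<in>Pow F. if B \<subseteq> A then (-1) ^ card B * G B * (-1) ^ card A else 0)"
      by (simp add: sum_distrib_left mult_ac)
  qed
  also have "\<dots> = (\<Sum>B\<in>Pow F. \<Sum>A\<in>Pow F. if B \<subseteq> A then (-1) ^ card B * G B * (-1) ^ card A else 0)"
    by (rule sum.swap)
  also have "\<dots> = (\<Sum>B\<in>Pow F. if B = F then G F else 0)"
  proof (rule sum.cong[OF refl])
    fix B assume B: "B \<in> Pow F"
    have "(\<Sum>A\<in>Pow F. if B \<subseteq> A then (-1) ^ card B * G B * (-1) ^ card A else 0) =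
          (\<Sum>A | B \<subseteq> A \<and> A \<subseteq> F. (-1) ^ card B * G B * (-1) ^ card A)"
      using assms by (intro sum.mono_neutral_cong_right) auto
    also have "\<dots> = (-1) ^ card B * G B * (if B = F then (-1) ^ card F else 0)"
      using B assms by (simp add: sum_distrib_left[symmetric] sum_Pow_superset)
    also have "\<dots> = (if B = F then G F else 0)"
      by (simp flip: power_mult_distrib)
    finally show "(\<Sum>A\<in>Pow F. if B \<subseteq> A then (-1) ^ card B * G B * (-1) ^ card A else 0) = (if B =
        F then G F else 0)" .
  qed
  also have "\<dots> = G F" using assms by simp
  finally show ?thesis .
qed

text \<open>Only the fixed points from \<open>m\<close> on are subject to Moebius inversion; the
  rest of \<open>r\<close> is kept. The signed sum that defines \<open>\<mu>\<close> is an instance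
  of the alternating sums in \<open>admissible\<close>, so \<open>\<mu>\<close> vanishes at
  relations with more than \<open>d\<close> points from \<open>m\<close> on in the domain, which is
  the finiteness that \<open>zconv_expand\<close> asks for.\<close>

theorem admissible_imp_zconv:
  assumes "admissible m f"
  shows "\<exists>\<alpha>. zconv m \<alpha> f"
proof -
  have F0: "finite r" "one_one r" "Domain r - {..<m} = Range r - {..<m}" if "f r \<noteq> 0" for r
    using assms that by (auto simp: admissible_def)
  have F1: "f (mv h h r) = f r" if "finite r" "\<And>i. i < m \<Longrightarrow> h \<langle>$\<rangle> i = i" for h r
    using assms that by (auto simp: admissible_def)
  from assms[unfolded admissible_def, THEN conjunct2, THEN conjunct2]
  obtain d where F3: "\<And>r Y0. finite r \<Longrightarrow> finite Y0 \<Longrightarrow> d < card (Y0 \<union> moved r) \<Longrightarrow>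
           (\<Sum>Y\<in>Pow Y0. (-1) ^ card Y * f (r \<union> Id_on Y)) = 0"
    by blast
  define fixp where "fixp r = {i. m \<le> i \<and> (i, i) \<in> r}" for r :: rel2
  define \<mu> where "\<mu> r = (if finite r then (-1) ^ card (fixp r) *
     (\<Sum>B\<in>Pow (fixp r). (-1) ^ card B * f ((r - Id_from m) \<union> Id_on B)) else 0)" for r
  have fin_fixp: "finite (fixp r)" if "finite r" for r
  proof (rule finite_subset)
    show "fixp r \<subseteq> Domain r" by (auto simp: fixp_def)
  qed (use that in \<open>simp add: finite_Domain\<close>)
  have \<mu>_ex: "\<exists>B\<subseteq>fixp r. f ((r - Id_from m) \<union> Id_on B) \<noteq> 0" if "\<mu> r \<noteq> 0" for r
  proof (rule ccontr)
    assume "\<not> ?thesis"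
    then have "(\<Sum>B\<in>Pow (fixp r). (-1) ^ card B * f ((r - Id_from m) \<union> Id_on B)) = 0"
      by (intro sum.neutral) auto
    then have "\<mu> r = 0" unfolding \<mu>_def by (simp only: mult_zero_right if_cancel)
    then show False using that by simp
  qed
  have "\<exists>\<alpha>. zconv m \<alpha> (expand m \<mu>)"
  proof (rule zconv_expand[where k = d])
    show "finite r" if "\<mu> r \<noteq> 0" for r using that by (auto simp: \<mu>_def split: if_splits)
  next
    fix r assume "\<mu> r \<noteq> 0"
    then obtain B where B: "B \<subseteq> fixp r" "f ((r - Id_from m) \<union> Id_on B) \<noteq> 0" using \<mu>_ex by blast
    let ?s = "(r - Id_from m) \<union> Id_on B"
    have DR: "Domain r = Domain ?s \<union> fixp r" "Range r = Range ?s \<union> fixp r"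
      using B(1) by (auto simp: fixp_def Domain_iff Range_iff)
    show "Domain r - {..<m} = Range r - {..<m}"
      unfolding DR Un_Diff F0(3)[OF B(2)] ..
  next
    fix r assume r: "finite r" "\<mu> r \<noteq> 0"
    have "\<not> d < card (fixp r \<union> moved (r - Id_from m))"
    proof
      assume "d < card (fixp r \<union> moved (r - Id_from m))"
      then have "(\<Sum>B\<in>Pow (fixp r). (-1) ^ card B * f ((r - Id_from m) \<union> Id_on B)) = 0"
        using r fin_fixp by (intro F3) auto
      then show False using r by (simp add: \<mu>_def)
    qed
    moreover have "Domain r - {..<m} \<subseteq> fixp r \<union> moved (r - Id_from m)"
    proof
      fix i assume i: "i \<in> Domain r - {..<m}"
      then obtain j where j: "(i, j) \<in> r" by auto
      show "i \<in> fixp r \<union> moved (r - Id_from m)"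
      proof (cases "(i, i) \<in> r")
        case False
        then have "(i, j) \<in> r - Id_from m" using j by auto
        then show ?thesis using False by (auto simp: moved_def)
      qed (use i in \<open>auto simp: fixp_def\<close>)
    qed
    moreover have "finite (fixp r \<union> moved (r - Id_from m))"
      using r fin_fixp by (auto simp: moved_def finite_Domain)
    ultimately show "card (Domain r - {..<m}) \<le> d" using card_mono by (metis not_le order_trans)
  next
    fix h r assume r: "finite (r :: rel2)" and h: "\<And>i. i < m \<Longrightarrow> h \<langle>$\<rangle> i = i"
    note le = apply_fix_less_iff[of m h, OF h]
    have fx: "fixp (mv h h r) = apply h ` fixp r"
    proof (intro equalityI subsetI)
      fix i assume "i \<in> fixp (mv h h r)"
      then have "inverse h \<langle>$\<rangle> i \<in> fixp r"
          using le[of "inverse h \<langle>$\<rangle> i"] by (auto simp: fixp_def in_mv not_less[symmetric])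
      then show "i \<in> apply h ` fixp r" by (metis apply_inverse_apply(2) imageI)
    next
      fix i assume "i \<in> apply h ` fixp r"
      then obtain j where j: "j \<in> fixp r" "i = h \<langle>$\<rangle> j" by blast
      then show "i \<in> fixp (mv h h r)" using le[of j] by (simp add: fixp_def not_less[symmetric])
    qed
    have inj: "inj_on (apply h) S" for S by (auto simp: inj_on_def apply_inj)
    have nf: "mv h h r - Id_from m = mv h h (r - Id_from m)"
    proof -
      have "mv h h (Id_from m) = Id_from m"
      proof (intro equalityI subrelI)
        fix a b assume "(a, b) \<in> mv h h (Id_from m)"
        then have ab: "inverse h \<langle>$\<rangle> a = inverse h \<langle>$\<rangle> b" "m \<le> inverse h \<langle>$\<rangle> a" by (auto simp: in_mv)
        then have "a = b" by (simp add: apply_inj)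
        then show "(a, b) \<in> Id_from m" using le[of "inverse h \<langle>$\<rangle> a"] ab(2) by simp
      next
        fix a b assume "(a, b) \<in> Id_from m"
        then show "(a, b) \<in> mv h h (Id_from m)"
            using le[of "inverse h \<langle>$\<rangle> a"] by (auto simp: in_mv not_less[symmetric])
      qed
      then show ?thesis by (simp add: mv_diff)
    qed
    have "(\<Sum>B\<in>Pow (fixp (mv h h r)). (-1) ^ card B * f ((mv h h r - Id_from m) \<union> Id_on B)) =
          (\<Sum>B\<in>Pow (fixp r). (-1) ^ card B * f ((r - Id_from m) \<union> Id_on B))"
    proof -
      have "bij_betw ((`) (apply h)) (Pow (fixp r)) (Pow (fixp (mv h h r)))"
        unfolding fx by (intro bij_betw_Pow) (simp add: bij_betw_def inj)
      from sum.reindex_bij_betw[OF this, of "\<lambda>B. (-1) ^ card B * f ((mv h h r - Id_from m) \<union> Id_on B)", symmetric]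
      have "(\<Sum>B\<in>Pow (fixp (mv h h r)). (-1) ^ card B * f ((mv h h r - Id_from m) \<union> Id_on B)) =
        (\<Sum>B\<in>Pow (fixp r). (-1) ^ card (apply h ` B) * f ((mv h h r - Id_from m) \<union> Id_on (apply h ` B)))" .
      also have "\<dots> = (\<Sum>B\<in>Pow (fixp r). (-1) ^ card B * f ((r - Id_from m) \<union> Id_on B))"
      proof (rule sum.cong[OF refl])
        fix B assume "B \<in> Pow (fixp r)"
        then have fB: "finite B" using fin_fixp[OF r] finite_subset by blast
        have "(mv h h r - Id_from m) \<union> Id_on (apply h ` B) = mv h h ((r - Id_from m) \<union> Id_on B)"
          unfolding nf by (auto simp: mv_def)
        moreover have "finite ((r - Id_from m) \<union> Id_on B)"
          using r fB by (simp add: Id_on_def)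
        ultimately show "(-1) ^ card (apply h ` B) * f ((mv h h r - Id_from m) \<union> Id_on (apply h ` B)) =
           (-1) ^ card B * f ((r - Id_from m) \<union> Id_on B)"
          using F1[OF _ h] by (simp add: card_image[OF inj])
      qed
      finally show ?thesis .
    qed
    then show "\<mu> (mv h h r) = \<mu> r" using r by (simp add: \<mu>_def fx card_image[OF inj])
  qed
  moreover have "expand m \<mu> r = f r" for r
  proof (cases "finite r \<and> one_one r")
    case True
    then have r: "finite r" "one_one r" by auto
    let ?nf = "r - Id_from m"
    \<comment> \<open>Subsets of \<open>r\<close> that drop only fixed points from \<open>m\<close>
      on correspond to the sets of such fixed points that are kept.\<close>
    have bij: "bij_betw (\<lambda>A. ?nf \<union> Id_on A) (Pow (fixp r)) {s. s \<subseteq> r \<and> r - s \<subseteq> Id_from m}"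
      by (rule bij_betwI[where g = fixp]) (auto simp: fixp_def)
    have fx: "fixp (?nf \<union> Id_on A) = A" "(?nf \<union> Id_on A) - Id_from m = ?nf" if "A \<subseteq> fixp r" for A
      using that by (auto simp: fixp_def)
    have "expand m \<mu> r = (\<Sum>A\<in>Pow (fixp r). \<mu> (?nf \<union> Id_on A))"
      using r sum.reindex_bij_betw[OF bij, of \<mu>] by (simp add: expand_def)
    also have "\<dots> = (\<Sum>A\<in>Pow (fixp r). (-1) ^ card A * (\<Sum>B\<in>Pow A. (-1) ^ card B * f (?nf \<union> Id_on B)))"
    proof (rule sum.cong[OF refl])
      fix A assume A: "A \<in> Pow (fixp r)"
      then have "finite (?nf \<union> Id_on A)" using r fin_fixp[OF r(1)] finite_subset by (auto simp: Id_on_def)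
      then show "\<mu> (?nf \<union> Id_on A) = (-1) ^ card A * (\<Sum>B\<in>Pow A. (-1) ^ card B * f (?nf \<union> Id_on B))"
        using A fx[of A] by (simp add: \<mu>_def)
    qed
    also have "\<dots> = f (?nf \<union> Id_on (fixp r))" by (rule Moebius_Pow[OF fin_fixp[OF r(1)]])
    also have "?nf \<union> Id_on (fixp r) = r" by (auto simp: fixp_def)
    finally show ?thesis .
  next
    case False
    then show ?thesis using F0 unfolding expand_def if_not_P[OF False] by metis
  qed
  ultimately show ?thesis by (metis ext)
qed

section \<open>Partial permutation matrices\<close>

definition mrel :: "nat mat \<Rightarrow> rel2"
  where "mrel A = {(i, j). i < dim_row A \<and> j < dim_col A \<and> A $$ (i, j) = 1}"

definition mat_of :: "nat \<Rightarrow> rel2 \<Rightarrow> nat mat"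
  where "mat_of n r = mat n n (\<lambda>(i, j). if (i, j) \<in> r then 1 else 0)"

abbreviation square :: "nat \<Rightarrow> rel2"
  where "square n \<equiv> {..<n} \<times> {..<n}"

lemma GammaD:
  assumes "u \<in> Gamma n"
  shows "dim_row u = n" "dim_col u = n" "mrel u \<subseteq> square n" "one_one (mrel u)" "mat_of n (mrel u) = u"
proof -
  show d: "dim_row u = n" "dim_col u = n" using assms by (auto simp: Gamma_def)
  show "mrel u \<subseteq> square n" by (auto simp: mrel_def d)
  show "one_one (mrel u)"
    by (rule one_oneI) (use assms in \<open>auto simp: Gamma_def mrel_def d\<close>)
  show "mat_of n (mrel u) = u"
  proof (rule eq_matI)
    fix i j assume "i < dim_row u" "j < dim_col u"
    then have "i < n" "j < n" by (simp_all add: d)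
    moreover have "u $$ (i, j) \<in> {0, 1}" using assms calculation by (auto simp: Gamma_def)
    ultimately show "mat_of n (mrel u) $$ (i, j) = u $$ (i, j)" by (auto simp: mat_of_def mrel_def d)
  qed (simp_all add: mat_of_def d)
qed

lemma mrel_mat_of [simp]: "mrel (mat_of n r) = r \<inter> square n"
  by (auto simp: mrel_def mat_of_def split: if_splits)

lemma mat_of_Gamma: "one_one (r \<inter> square n) \<Longrightarrow> mat_of n r \<in> Gamma n"
  unfolding Gamma_def
  by (auto simp: mat_of_def split: if_splits dest: one_one_eq1 one_one_eq2)

lemma mrel_inj: "u \<in> Gamma n \<Longrightarrow> v \<in> Gamma n \<Longrightarrow> mrel u = mrel v \<Longrightarrow> u = v"
  using GammaD(5) by metis

lemma finite_Gamma: "finite (Gamma n)"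
proof (rule finite_subset)
  show "Gamma n \<subseteq> mat_of n ` Pow (square n)"
    using GammaD(3,5) by (metis PowI image_eqI subsetI)
qed simp

lemma Gamma_mult:
  assumes "u \<in> Gamma n" "v \<in> Gamma n"
  shows "u * v = mat_of n (mrel u O mrel v)"
proof (rule eq_matI)
  note u = GammaD[OF assms(1)] and v = GammaD[OF assms(2)]
  fix i j assume "i < dim_row (mat_of n (mrel u O mrel v))" "j < dim_col (mat_of n (mrel u O mrel v))"
  then have ij: "i < n" "j < n" by (simp_all add: mat_of_def)
  have uv: "(u * v) $$ (i, j) = (\<Sum>k<n. u $$ (i, k) * v $$ (k, j))"
    using ij by (simp add: scalar_prod_def u v atLeast0LessThan)
  have u01: "u $$ (i, k) = (if (i, k) \<in> mrel u then 1 else 0)" if "k < n" for k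
    using assms(1) ij that by (auto simp: Gamma_def mrel_def)
  have v01: "v $$ (k, j) = (if (k, j) \<in> mrel v then 1 else 0)" if "k < n" for k
    using assms(2) ij that by (auto simp: Gamma_def mrel_def)
  show "(u * v) $$ (i, j) = mat_of n (mrel u O mrel v) $$ (i, j)"
  proof (cases "\<exists>k. (i, k) \<in> mrel u")
    case True
    then obtain k0 where k0: "(i, k0) \<in> mrel u" by blast
    then have "k0 < n" using u(3) by auto
    have "(\<Sum>k<n. u $$ (i, k) * v $$ (k, j)) = (\<Sum>k<n. if k = k0 then v $$ (k0, j) else 0)"
    proof (rule sum.cong[OF refl])
      fix k assume "k \<in> {..<n}"
      then have "k < n" by simp
      moreover have "(i, k) \<in> mrel u \<longleftrightarrow> k = k0" using one_one_eq1[OF u(4) k0] k0 by blast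
      ultimately show "u $$ (i, k) * v $$ (k, j) = (if k = k0 then v $$ (k0, j) else 0)"
        by (simp add: u01)
    qed
    also have "\<dots> = (if (k0, j) \<in> mrel v then 1 else 0)" using \<open>k0 < n\<close> by (simp add: v01)
    also have "\<dots> = mat_of n (mrel u O mrel v) $$ (i, j)"
    proof -
      have "(i, j) \<in> mrel u O mrel v \<longleftrightarrow> (k0, j) \<in> mrel v"
        using k0 one_one_eq1[OF u(4) k0] by blast
      then show ?thesis using ij by (simp add: mat_of_def)
    qed
    finally show ?thesis using uv by simp
  next
    case False
    then have "(\<Sum>k<n. u $$ (i, k) * v $$ (k, j)) = 0" by (intro sum.neutral) (auto simp: u01)
    then show ?thesis using False ij uv by (auto simp: mat_of_def)
  qed
qed (use assms in \<open>simp_all add: mat_of_def GammaD\<close>)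

lemma relcomp_square: "r \<subseteq> square n \<Longrightarrow> s \<subseteq> square n \<Longrightarrow> r O s \<subseteq> square n"
  by auto

lemma mrel_mult: "u \<in> Gamma n \<Longrightarrow> v \<in> Gamma n \<Longrightarrow> mrel (u * v) = mrel u O mrel v"
  using relcomp_square[OF GammaD(3) GammaD(3), of u n v] by (simp add: Gamma_mult Int_absorb2)

lemma Gamma_mult_closed: "u \<in> Gamma n \<Longrightarrow> v \<in> Gamma n \<Longrightarrow> u * v \<in> Gamma n"
proof -
  assume uv: "u \<in> Gamma n" "v \<in> Gamma n"
  have "one_one (mrel u O mrel v)" using GammaD(4)[OF uv(1)] GammaD(4)[OF uv(2)] by (rule one_one_relcomp)
  then show ?thesis unfolding Gamma_mult[OF uv] by (intro mat_of_Gamma) (auto intro: one_one_subset)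
qed

lemma delete_last_mat:
  assumes "u \<in> Gamma n"
  shows "delete_last u = mat_of (n - 1) (mrel u)"
proof (rule eq_matI)
  note u = GammaD[OF assms]
  fix i j assume "i < dim_row (mat_of (n - 1) (mrel u))" "j < dim_col (mat_of (n - 1) (mrel u))"
  then have ij: "i < n - 1" "j < n - 1" by (simp_all add: mat_of_def)
  then have "u $$ (i, j) \<in> {0, 1}" using assms by (auto simp: Gamma_def)
  then show "delete_last u $$ (i, j) = mat_of (n - 1) (mrel u) $$ (i, j)"
    using ij by (auto simp: delete_last_def mat_of_def u mrel_def)
qed (use assms in \<open>simp_all add: mat_of_def delete_last_def GammaD\<close>)

lemma mrel_delete_last: "u \<in> Gamma n \<Longrightarrow> mrel (delete_last u) = mrel u \<inter> square (n - 1)"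
  by (simp add: delete_last_mat)

lemma delete_last_Gamma: "u \<in> Gamma n \<Longrightarrow> delete_last u \<in> Gamma (n - 1)"
  unfolding delete_last_mat
  by (rule mat_of_Gamma, rule one_one_subset[OF GammaD(4)]) auto

lemma mat_deg_eq:
  assumes "u \<in> Gamma n"
  shows "mat_deg u = card {i. i < n \<and> (i, i) \<notin> mrel u}"
proof -
  have "u $$ (i, i) = 0 \<longleftrightarrow> (i, i) \<notin> mrel u" if "i < n" for i
  proof -
    have "u $$ (i, i) \<in> {0, 1}" using assms that unfolding Gamma_def by blast
    moreover have "(i, i) \<in> mrel u \<longleftrightarrow> u $$ (i, i) = 1" by (simp add: mrel_def GammaD[OF assms] that)
    ultimately show ?thesis by auto
  qed
  then have "{i. i < n \<and> u $$ (i, i) = 0} = {i. i < n \<and> (i, i) \<notin> mrel u}" by auto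
  then show ?thesis using assms by (simp add: mat_deg_def GammaD)
qed

section \<open>Zeta transform and Moebius inversion on the algebra of \<open>Gamma n\<close>\<close>

abbreviation M :: "(nat mat \<Rightarrow>\<^sub>0 complex) \<Rightarrow> rel2 \<Rightarrow> complex"
  where "M \<equiv> zeta mrel"

lemma M_not_one_one: "a \<in> span_of (Gamma n) \<Longrightarrow> \<not> one_one r \<Longrightarrow> M a r = 0"
proof (rule zeta_eq_0)
  fix u assume "a \<in> span_of (Gamma n)" "\<not> one_one r" "u \<in> Poly_Mapping.keys a"
  then show "\<not> r \<subseteq> mrel u" using one_one_subset[OF GammaD(4), of u n r] by (auto simp: span_of_def)
qed

text \<open>The sign is that of \<open>card r - card (mrel u)\<close>, written as a product. The sum
  may run over all relations in the square, since elements of the semigroup algebra have value 0 at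
  those that are not one-one.\<close>

definition moebius :: "nat \<Rightarrow> (rel2 \<Rightarrow> complex) \<Rightarrow> nat mat \<Rightarrow> complex"
  where "moebius n F u = (\<Sum>r | mrel u \<subseteq> r \<and> r \<subseteq> square n. (-1) ^ card r * (-1) ^ card (mrel u) * F r)"

text \<open>After exchanging the sums, the coefficient at \<open>v\<close> is multiplied by the
  signed number of relations between \<open>mrel u\<close> and \<open>mrel v\<close>, which is 0
  unless the two are equal.\<close>

lemma moebius_zeta:
  assumes a: "a \<in> span_of (Gamma n)" and u: "u \<in> Gamma n"
  shows "moebius n (M a) u = Poly_Mapping.lookup a u"
proof -
  let ?A = "{r. mrel u \<subseteq> r \<and> r \<subseteq> square n}"
  have finA: "finite ?A" by (rule finite_subset[of _ "Pow (square n)"]) auto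
  have fin: "finite (mrel v)" if "v \<in> Gamma n" for v
    using GammaD(3)[OF that] finite_subset by blast
  have kG: "v \<in> Gamma n" if "v \<in> Poly_Mapping.keys a" for v using a that by (auto simp: span_of_def)
  have "moebius n (M a) u = (\<Sum>r\<in>?A. \<Sum>v\<in>Poly_Mapping.keys a. (-1) ^ card r * (-1) ^ card (mrel u) *
      (if r \<subseteq> mrel v then Poly_Mapping.lookup a v else 0))"
    unfolding moebius_def by (simp add: zeta_superset[of "Poly_Mapping.keys a"] sum_distrib_left)
  also have "\<dots> = (\<Sum>v\<in>Poly_Mapping.keys a. \<Sum>r\<in>?A. (-1) ^ card r * (-1) ^ card (mrel u) *
      (if r \<subseteq> mrel v then Poly_Mapping.lookup a v else 0))"
    by (rule sum.swap)
  also have "\<dots> = (\<Sum>v\<in>Poly_Mapping.keys a. if v = u then Poly_Mapping.lookup a u else 0)"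
  proof (rule sum.cong[OF refl])
    fix v assume v: "v \<in> Poly_Mapping.keys a"
    note vG = kG[OF v]
    have "(\<Sum>r\<in>?A. (-1) ^ card r * (-1) ^ card (mrel u) * (if r \<subseteq> mrel v then Poly_Mapping.lookup a v else 0)) =
      (\<Sum>r | mrel u \<subseteq> r \<and> r \<subseteq> mrel v. (-1) ^ card r * (-1) ^ card (mrel u) * Poly_Mapping.lookup a v)"
      using finA GammaD(3)[OF vG] by (intro sum.mono_neutral_cong_right) auto
    also have "\<dots> = (\<Sum>r | mrel u \<subseteq> r \<and> r \<subseteq> mrel v. (-1) ^ card r) * ((-1) ^ card (mrel u) * Poly_Mapping.lookup a v)"
      by (simp add: sum_distrib_right mult.assoc)
    also have "\<dots> = (if v = u then Poly_Mapping.lookup a u else 0)"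
    proof (cases "mrel u \<subseteq> mrel v")
      case True
      have "mrel u = mrel v \<longleftrightarrow> v = u" using mrel_inj[OF u vG] by auto
      moreover have "(-1) ^ k * ((-1) ^ k * x) = x" for k and x :: complex
        by (simp flip: mult.assoc power_mult_distrib)
      ultimately show ?thesis
        using sum_Pow_superset[OF fin[OF vG] True] by auto
    next
      case False
      then have "{r. mrel u \<subseteq> r \<and> r \<subseteq> mrel v} = {}" by auto
      moreover have "v \<noteq> u" using False by auto
      ultimately show ?thesis by (simp only: sum.empty mult_zero_left if_False)
    qed
    finally show "(\<Sum>r\<in>?A. (-1) ^ card r * (-1) ^ card (mrel u) * (if r \<subseteq> mrel v then Poly_Mapping.lookup a v else 0)) =
      (if v = u then Poly_Mapping.lookup a u else 0)" .
  qed
  also have "\<dots> = Poly_Mapping.lookup a u" by (auto simp: in_keys_iff)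
  finally show ?thesis .
qed

lemma moebius_cong: "(\<And>r. r \<subseteq> square n \<Longrightarrow> F r = G r) \<Longrightarrow> moebius n F u = moebius n G u"
  unfolding moebius_def by (intro sum.cong) auto

lemma M_eqI:
  assumes "a \<in> span_of (Gamma n)" "b \<in> span_of (Gamma n)" "\<And>r. r \<subseteq> square n \<Longrightarrow> M a r = M b r"
  shows "a = b"
proof (rule poly_mapping_eqI)
  fix u
  show "Poly_Mapping.lookup a u = Poly_Mapping.lookup b u"
  proof (cases "u \<in> Gamma n")
    case True
    have "moebius n (M a) u = moebius n (M b) u" by (rule moebius_cong[OF assms(3)])
    then show ?thesis by (simp only: moebius_zeta[OF assms(1) True] moebius_zeta[OF assms(2) True])
  next
    case False
    then have "u \<notin> Poly_Mapping.keys a" "u \<notin> Poly_Mapping.keys b" using assms by (auto simp: span_of_def)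
    then show ?thesis by (simp add: in_keys_iff)
  qed
qed

lemma theta_span: "a \<in> span_of (Gamma n) \<Longrightarrow> theta a \<in> span_of (Gamma (n - 1))"
  using keys_lin_ext[of delete_last a] delete_last_Gamma by (fastforce simp: theta_def span_of_def)

lemma M_theta:
  assumes "a \<in> span_of (Gamma n)" "r \<subseteq> square (n - 1)"
  shows "M (theta a) r = M a r"
  unfolding theta_def zeta_lin_ext
proof (rule zeta_cong)
  fix u assume "u \<in> Poly_Mapping.keys a"
  then have "u \<in> Gamma n" using assms(1) by (auto simp: span_of_def)
  then show "r \<subseteq> mrel (delete_last u) \<longleftrightarrow> r \<subseteq> mrel u" using assms(2) by (auto simp: mrel_delete_last)
qed

text \<open>Turns left multiplication by a partial injection into an operation on relations:
  \<open>r\<close> is moved backwards along \<open>H\<close>, provided that no row of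
  \<open>r\<close> gets lost.\<close>

lemma subset_relcomp_left_iff:
  assumes "single_valued H"
  shows "r \<subseteq> H O V \<longleftrightarrow> Domain r \<subseteq> Domain H \<and> H\<inverse> O r \<subseteq> V"
proof
  assume h: "r \<subseteq> H O V"
  have "H\<inverse> O r \<subseteq> V"
  proof
    fix p assume "p \<in> H\<inverse> O r"
    then obtain i j k where p: "p = (j, k)" "(i, j) \<in> H" "(i, k) \<in> r" by auto
    then obtain j' where "(i, j') \<in> H" "(j', k) \<in> V" using h by blast
    then show "p \<in> V" using p assms by (metis single_valuedD)
  qed
  then show "Domain r \<subseteq> Domain H \<and> H\<inverse> O r \<subseteq> V" using h by blast
next
  assume h: "Domain r \<subseteq> Domain H \<and> H\<inverse> O r \<subseteq> V"
  show "r \<subseteq> H O V"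
  proof (rule subrelI)
    fix i k assume ik: "(i, k) \<in> r"
    then obtain j where "(i, j) \<in> H" using h by blast
    moreover have "(j, k) \<in> V" using h ik calculation by blast
    ultimately show "(i, k) \<in> H O V" by blast
  qed
qed

lemma subset_relcomp_right_iff:
  assumes "single_valued (H\<inverse>)"
  shows "r \<subseteq> V O H \<longleftrightarrow> Range r \<subseteq> Range H \<and> r O H\<inverse> \<subseteq> V"
proof -
  have "r \<subseteq> V O H \<longleftrightarrow> r\<inverse> \<subseteq> H\<inverse> O V\<inverse>" by (metis converse_mono converse_relcomp)
  also have "\<dots> \<longleftrightarrow> Domain (r\<inverse>) \<subseteq> Domain (H\<inverse>) \<and> (H\<inverse>)\<inverse> O r\<inverse> \<subseteq> V\<inverse>"
    by (rule subset_relcomp_left_iff[OF assms])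
  also have "\<dots> \<longleftrightarrow> Range r \<subseteq> Range H \<and> r O H\<inverse> \<subseteq> V"
    by (metis Domain_converse converse_mono converse_relcomp converse_converse)
  finally show ?thesis .
qed

lemma M_delta_left:
  assumes "h \<in> Gamma n" "a \<in> span_of (Gamma n)"
  shows "M (delta h \<star> a) r = (if Domain r \<subseteq> Domain (mrel h) then M a ((mrel h)\<inverse> O r) else 0)"
proof -
  have sv: "single_valued (mrel h)" using GammaD(4)[OF assms(1)] by (simp add: one_one_def)
  have *: "r \<subseteq> mrel (h * v) \<longleftrightarrow> Domain r \<subseteq> Domain (mrel h) \<and> (mrel h)\<inverse> O r \<subseteq> mrel v"
    if "v \<in> Poly_Mapping.keys a" for v
  proof -
    have "v \<in> Gamma n" using that assms(2) by (auto simp: span_of_def)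
    then show ?thesis unfolding mrel_mult[OF assms(1) \<open>v \<in> Gamma n\<close>] by (intro subset_relcomp_left_iff[OF sv])
  qed
  show ?thesis
  proof (cases "Domain r \<subseteq> Domain (mrel h)")
    case True
    have "zeta (\<lambda>v. mrel (h * v)) a r = M a ((mrel h)\<inverse> O r)" by (rule zeta_cong) (simp add: * True)
    then show ?thesis using True by (simp add: zeta_delta_left)
  next
    case False
    then show ?thesis unfolding zeta_delta_left using * by (simp add: zeta_eq_0)
  qed
qed

lemma M_delta_right:
  assumes "h \<in> Gamma n" "a \<in> span_of (Gamma n)"
  shows "M (a \<star> delta h) r = (if Range r \<subseteq> Range (mrel h) then M a (r O (mrel h)\<inverse>) else 0)"
proof -
  have sv: "single_valued ((mrel h)\<inverse>)" using GammaD(4)[OF assms(1)] by (simp add: one_one_def)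
  have *: "r \<subseteq> mrel (v * h) \<longleftrightarrow> Range r \<subseteq> Range (mrel h) \<and> r O (mrel h)\<inverse> \<subseteq> mrel v"
    if "v \<in> Poly_Mapping.keys a" for v
  proof -
    have "v \<in> Gamma n" using that assms(2) by (auto simp: span_of_def)
    then show ?thesis unfolding mrel_mult[OF \<open>v \<in> Gamma n\<close> assms(1)] by (intro subset_relcomp_right_iff[OF sv])
  qed
  show ?thesis
  proof (cases "Range r \<subseteq> Range (mrel h)")
    case True
    have "zeta (\<lambda>v. mrel (v * h)) a r = M a (r O (mrel h)\<inverse>)" by (rule zeta_cong) (simp add: * True)
    then show ?thesis using True by (simp add: zeta_delta_right)
  next
    case False
    then show ?thesis unfolding zeta_delta_right using * by (simp add: zeta_eq_0)
  qed
qed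

section \<open>From admissible functions to the algebra A\<close>

text \<open>The relations \<open>H\<inverse> O r\<close> and \<open>r O H\<inverse>\<close> are
  conjugate by a permutation \<open>h\<close> that extends \<open>H\<close>. It fixes the points
  below \<open>m\<close> because \<open>H\<close> does, so the invariance of \<open>f\<close>
  applies.\<close>

lemma commute_aux:
  assumes F0: "\<And>r. f r \<noteq> 0 \<Longrightarrow> Domain r - {..<m} = Range r - {..<m}"
    and F1: "\<And>h r. finite r \<Longrightarrow> (\<And>i. i < m \<Longrightarrow> h \<langle>$\<rangle> i = i) \<Longrightarrow> f (mv h h r) = f r"
    and H: "one_one H" "finite H" "\<And>i. i < m \<Longrightarrow> (i, i) \<in> H"
    and r: "finite r" "Domain r \<subseteq> Domain H" "f (H\<inverse> O r) \<noteq> 0"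
  shows "Range r \<subseteq> Range H \<and> f (r O H\<inverse>) = f (H\<inverse> O r)"
proof -
  define s where "s = H\<inverse> O r"
  have ds: "Domain s - {..<m} = Range s - {..<m}" using F0 r(3) by (simp add: s_def)
  have mH: "{..<m} \<subseteq> Range H" using H(3) by auto
  have Ds: "Domain s \<subseteq> Range H" by (auto simp: s_def)
  \<comment> \<open>The support condition enters here: from \<open>m\<close> on, the range of
    \<open>s\<close> is part of its domain and so within reach of \<open>H\<close>.\<close>
  have Rs: "Range s \<subseteq> Range H" using ds mH Ds by blast
  have rs: "Range r \<subseteq> Range s" using r(2) by (auto simp: s_def) blast
  define g where "g j = (THE i. (i, j) \<in> H)" for j
  have g: "g j = i" if "(i, j) \<in> H" for i j
    unfolding g_def using that one_one_eq2[OF H(1)] by blast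
  have inj: "inj_on g (Range H)"
    by (rule inj_onI) (metis RangeE g one_one_eq1[OF H(1)])
  obtain h where h: "\<And>j. j \<in> Range H \<Longrightarrow> h \<langle>$\<rangle> j = g j"
    using perm_extend[OF finite_Range[OF H(2)] inj] by metis
  have hH: "h \<langle>$\<rangle> j = i" if "(i, j) \<in> H" for i j using h[of j] g that by auto
  have hm: "h \<langle>$\<rangle> i = i" if "i < m" for i using hH H(3) that by blast
  have "mv h h s = r O H\<inverse>"
  proof (intro equalityI subrelI)
    fix a b assume "(a, b) \<in> mv h h s"
    then obtain j k where jk: "(j, k) \<in> s" "a = h \<langle>$\<rangle> j" "b = h \<langle>$\<rangle> k" by (auto simp: mv_def)
    then obtain i where i: "(i, j) \<in> H" "(i, k) \<in> r" by (auto simp: s_def)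
    obtain l where l: "(l, k) \<in> H" using Rs jk(1) by blast
    show "(a, b) \<in> r O H\<inverse>" using i l hH jk by auto
  next
    fix a b assume "(a, b) \<in> r O H\<inverse>"
    then obtain k where k: "(a, k) \<in> r" "(b, k) \<in> H" by auto
    obtain j where j: "(a, j) \<in> H" using r(2) k(1) by blast
    have "(j, k) \<in> s" using j k by (auto simp: s_def)
    moreover have "h \<langle>$\<rangle> j = a" "h \<langle>$\<rangle> k = b" using hH j k by auto
    ultimately show "(a, b) \<in> mv h h s" by (metis in_mv_apply)
  qed
  moreover have "finite s" using r(1) H(2) by (simp add: s_def)
  ultimately have "f (r O H\<inverse>) = f s" using F1[of s h] hm by simp
  then show ?thesis using rs Rs by (auto simp: s_def)
qed

text \<open>If the left side is nonzero, \<open>commute_aux\<close> shows that the right side agrees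
  with it. The reverse implication is the same statement for
  \<open>\<lambda>r. f (r\<inverse>)\<close> and the converse relations.\<close>

lemma commute_iff:
  assumes F0: "\<And>r. f r \<noteq> 0 \<Longrightarrow> Domain r - {..<m} = Range r - {..<m}"
    and F1: "\<And>h r. finite r \<Longrightarrow> (\<And>i. i < m \<Longrightarrow> h \<langle>$\<rangle> i = i) \<Longrightarrow> f (mv h h r) = f r"
    and H: "one_one H" "finite H" "\<And>i. i < m \<Longrightarrow> (i, i) \<in> H" and r: "finite r"
  shows "(if Domain r \<subseteq> Domain H then f (H\<inverse> O r) else 0) = (if Range r \<subseteq> Range H then f (r O H\<inverse>) else 0)"
proof -
  have 1: "Range r \<subseteq> Range H \<and> f (r O H\<inverse>) = f (H\<inverse> O r)" if "Domain r \<subseteq> Domain H" "f (H\<inverse> O r) \<noteq> 0"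
    by (rule commute_aux[OF F0 F1 H r that])
  have 2: "Range (r\<inverse>) \<subseteq> Range (H\<inverse>) \<and> f ((r\<inverse> O (H\<inverse>)\<inverse>)\<inverse>) = f (((H\<inverse>)\<inverse> O r\<inverse>)\<inverse>)"
    if "Range r \<subseteq> Range H" "f (r O H\<inverse>) \<noteq> 0"
  proof (rule commute_aux[where f = "\<lambda>r. f (r\<inverse>)" and m = m])
    show "Domain s - {..<m} = Range s - {..<m}" if "f (s\<inverse>) \<noteq> 0" for s using F0[OF that] by simp
    show "f ((mv h h s)\<inverse>) = f (s\<inverse>)" if "finite s" "\<And>i. i < m \<Longrightarrow> h \<langle>$\<rangle> i = i" for h s
      unfolding mv_converse using that by (intro F1) auto
  qed (use H r that in \<open>auto simp: converse_relcomp\<close>)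
  have 2: "Domain r \<subseteq> Domain H \<and> f (H\<inverse> O r) = f (r O H\<inverse>)"
    if "Range r \<subseteq> Range H" "f (r O H\<inverse>) \<noteq> 0"
    using 2[OF that] by (simp add: converse_relcomp)
  show ?thesis
  proof (cases "Domain r \<subseteq> Domain H \<and> f (H\<inverse> O r) \<noteq> 0")
    case True
    then show ?thesis using 1 by simp
  next
    case False
    then show ?thesis using 2 by (cases "f (r O H\<inverse>) = 0") auto
  qed
qed

lemma Id_on_subset_mrel:
  assumes "h \<in> Gamma_sub m n" "i < m" "m \<le> n"
  shows "(i, i) \<in> mrel h"
  using assms GammaD(1,2)[of h n] by (auto simp: Gamma_sub_def mrel_def)

lemma A_cent_iff:
  "a \<in> A_cent m n \<longleftrightarrow> a \<in> span_of (Gamma n) \<and> (\<forall>h\<in>Gamma_sub m n. delta h \<star> a = a \<star> delta h)"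
  by (simp add: A_cent_def centralizer_def)

lemma Gamma_sub_mono: "m \<le> m' \<Longrightarrow> Gamma_sub m' n \<subseteq> Gamma_sub m n"
  by (auto simp: Gamma_sub_def)

lemma A_cent_mono: "m \<le> m' \<Longrightarrow> A_cent m n \<subseteq> A_cent m' n"
  using Gamma_sub_mono[of m m' n] unfolding A_cent_iff subset_iff by blast

text \<open>The upper left corner of the permutation matrix, which is what repeated deletion of the
  last row and column leaves.\<close>

definition corner :: "nat \<Rightarrow> nat perm \<Rightarrow> nat mat"
  where "corner n g = mat_of n (prel g)"

lemma corner_Gamma: "corner n g \<in> Gamma n"
  unfolding corner_def by (rule mat_of_Gamma, rule one_one_subset[OF one_one_prel]) auto

lemma mat_deg_corner: "mat_deg (corner n g) \<le> perm_deg g"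
  unfolding mat_deg_eq[OF corner_Gamma] perm_deg_def
  by (rule card_mono) (auto simp: corner_def in_affected)

lemma M_corner:
  assumes "r \<subseteq> square n"
  shows "M (lin_ext (corner n) a) r = Z a r"
  unfolding zeta_lin_ext by (rule zeta_cong) (use assms in \<open>auto simp: corner_def\<close>)

lemma lin_ext_corner_span: "lin_ext (corner n) a \<in> span_of (Gamma n)"
  using keys_lin_ext[of "corner n" a] corner_Gamma by (fastforce simp: span_of_def)

definition from_fun :: "(rel2 \<Rightarrow> complex) \<Rightarrow> nat \<Rightarrow> (nat mat \<Rightarrow>\<^sub>0 complex)"
  where "from_fun f n = (\<Sum>u\<in>Gamma n. Poly_Mapping.single u (moebius n f u))"

lemma from_fun_span: "from_fun f n \<in> span_of (Gamma n)"
  unfolding from_fun_def by (intro span_of_sum span_of_single)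

lemma lookup_from_fun: "u \<in> Gamma n \<Longrightarrow> Poly_Mapping.lookup (from_fun f n) u = moebius n f u"
  by (simp add: from_fun_def lookup_sum' lookup_single when_def finite_Gamma)

lemma finite_square_subset: "r \<subseteq> square n \<Longrightarrow> finite r"
  by (rule finite_subset) auto

lemma lookup_corner_tendsto:
  assumes "zconv m \<alpha> f" "u \<in> Gamma n"
  shows "(\<lambda>N. Poly_Mapping.lookup (lin_ext (corner n) (\<alpha> N)) u) \<longlonglongrightarrow> Poly_Mapping.lookup (from_fun f n) u"
proof -
  have eq: "Poly_Mapping.lookup (lin_ext (corner n) (\<alpha> N)) u = moebius n (Z (\<alpha> N)) u" for N
    unfolding moebius_zeta[OF lin_ext_corner_span assms(2), symmetric] by (rule moebius_cong) (rule M_corner)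
  show ?thesis
    unfolding eq lookup_from_fun[OF assms(2)] moebius_def
    by (intro tendsto_sum tendsto_mult tendsto_const zconv_lim[OF assms(1)]) (auto intro: finite_square_subset)
qed

text \<open>Both sides are limits of the same numbers: the corners of \<open>\<alpha> N\<close> have
  the zeta values of \<open>\<alpha> N\<close> inside of the square, and their finitely many
  coefficients converge to those of \<open>from_fun f n\<close>.\<close>

lemma M_from_fun:
  assumes "zconv m \<alpha> f" "r \<subseteq> square n"
  shows "M (from_fun f n) r = f r"
proof -
  have eq: "M a r = (\<Sum>u\<in>Gamma n. if r \<subseteq> mrel u then Poly_Mapping.lookup a u else 0)"
      if "a \<in> span_of (Gamma n)" for a
    using that by (intro zeta_superset) (auto simp: finite_Gamma span_of_def)
  have "(\<lambda>N. M (lin_ext (corner n) (\<alpha> N)) r) \<longlonglongrightarrow> M (from_fun f n) r"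
    unfolding eq[OF lin_ext_corner_span] eq[OF from_fun_span]
  proof (rule tendsto_sum)
    fix u assume "u \<in> Gamma n"
    then show "(\<lambda>N. if r \<subseteq> mrel u then Poly_Mapping.lookup (lin_ext (corner n) (\<alpha> N)) u else 0) \<longlonglongrightarrow>
        (if r \<subseteq> mrel u then Poly_Mapping.lookup (from_fun f n) u else 0)"
      using lookup_corner_tendsto[OF assms(1)] by (cases "r \<subseteq> mrel u") simp_all
  qed
  then show ?thesis
    unfolding M_corner[OF assms(2)]
    using zconv_lim[OF assms(1) finite_square_subset[OF assms(2)]] LIMSEQ_unique by blast
qed

text \<open>Taking a corner does not increase the degree, so coefficients at matrices of larger
  degree vanish before the limit is taken.\<close>

lemma from_fun_deg:
  assumes "zconv m \<alpha> f"
  shows "\<exists>d. \<forall>n. alg_deg mat_deg (from_fun f n) \<le> d"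
proof -
  obtain d where d: "\<And>N u. N \<ge> 1 \<Longrightarrow> u \<in> Poly_Mapping.keys (\<alpha> N) \<Longrightarrow> perm_deg u \<le> d"
    using zconv_deg[OF assms] by blast
  have "mat_deg u \<le> d" if u: "u \<in> Poly_Mapping.keys (from_fun f n)" for n u
  proof (rule ccontr)
    assume large: "\<not> mat_deg u \<le> d"
    have uG: "u \<in> Gamma n" using u from_fun_span[of f n] by (auto simp: span_of_def)
    have "Poly_Mapping.lookup (lin_ext (corner n) (\<alpha> N)) u = 0" if "N \<ge> 1" for N
    proof (rule ccontr)
      assume "Poly_Mapping.lookup (lin_ext (corner n) (\<alpha> N)) u \<noteq> 0"
      then have "u \<in> Poly_Mapping.keys (lin_ext (corner n) (\<alpha> N))" by (simp add: in_keys_iff)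
      from subsetD[OF keys_lin_ext this] obtain g where "g \<in> Poly_Mapping.keys (\<alpha> N)" "u = corner n g" by blast
      then show False using d[OF that] mat_deg_corner[of n g] large by fastforce
    qed
    then have "\<forall>\<^sub>F N in sequentially. Poly_Mapping.lookup (lin_ext (corner n) (\<alpha> N)) u = 0"
      by (rule eventually_sequentiallyI)
    from LIMSEQ_unique[OF lookup_corner_tendsto[OF assms uG] tendsto_eventually[OF this]]
    show False using u by (simp add: in_keys_iff)
  qed
  then show ?thesis by (auto simp: alg_deg_le_iff)
qed

text \<open>Equality in the semigroup algebra may be tested on zeta values, by \<open>M_eqI\<close>.
  Commutation with \<open>Gamma_sub m n\<close> then is \<open>commute_iff\<close>, and
  compatibility with \<open>theta\<close> holds because \<open>f\<close> does not depend on
  \<open>n\<close>.\<close>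

lemma from_fun_A_seqs:
  assumes "zconv m \<alpha> f"
  shows "from_fun f \<in> A_seqs m"
proof -
  let ?a = "from_fun f"
  have adm: "admissible m f" by (rule zconv_admissible[OF assms])
  have "?a n \<in> A_cent m n" if mn: "n \<ge> m" for n
    unfolding A_cent_iff
  proof (intro conjI ballI from_fun_span)
    fix h assume h: "h \<in> Gamma_sub m n"
    then have hG: "h \<in> Gamma n" by (simp add: Gamma_sub_def)
    note hr = GammaD(3,4)[OF hG]
    show "delta h \<star> ?a n = ?a n \<star> delta h"
    proof (rule M_eqI)
      show "delta h \<star> ?a n \<in> span_of (Gamma n)" "?a n \<star> delta h \<in> span_of (Gamma n)"
        using hG from_fun_span Gamma_mult_closed by (auto intro!: span_of_conv span_of_single)
      fix r assume r: "r \<subseteq> square n"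
      have "(mrel h)\<inverse> O r \<subseteq> square n" "r O (mrel h)\<inverse> \<subseteq> square n" using r hr(1) by auto
      then have "M (delta h \<star> ?a n) r = (if Domain r \<subseteq> Domain (mrel h) then f ((mrel h)\<inverse> O r) else 0)"
        "M (?a n \<star> delta h) r = (if Range r \<subseteq> Range (mrel h) then f (r O (mrel h)\<inverse>) else 0)"
        by (simp_all add: M_delta_left[OF hG from_fun_span] M_delta_right[OF hG from_fun_span] M_from_fun[OF assms])
      moreover have "(if Domain r \<subseteq> Domain (mrel h) then f ((mrel h)\<inverse> O r) else 0) =
          (if Range r \<subseteq> Range (mrel h) then f (r O (mrel h)\<inverse>) else 0)"
        using adm hr finite_square_subset r Id_on_subset_mrel[OF h _ mn]
        by (intro commute_iff[where m = m]) (auto simp: admissible_def)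
      ultimately show "M (delta h \<star> ?a n) r = M (?a n \<star> delta h) r" by simp
    qed
  qed
  moreover have "?a (n - 1) = theta (?a n)" for n
  proof (rule M_eqI[of _ "n - 1"])
    show "theta (?a n) \<in> span_of (Gamma (n - 1))" by (intro theta_span from_fun_span)
    fix r assume r: "r \<subseteq> square (n - 1)"
    then have "r \<subseteq> square n" by auto
    then show "M (?a (n - 1)) r = M (theta (?a n)) r"
      using r by (simp add: M_theta[OF from_fun_span] M_from_fun[OF assms])
  qed (rule from_fun_span)
  moreover have "bdd_above ((\<lambda>n. alg_deg mat_deg (?a n)) ` {m..})"
    using from_fun_deg[OF assms] by (auto simp: bdd_above_def)
  ultimately show ?thesis by (simp add: A_seqs_def)
qed

section \<open>Limit functions attached to sequences\<close>

definition limz :: "('g \<Rightarrow> rel2) \<Rightarrow> (nat \<Rightarrow> ('g \<Rightarrow>\<^sub>0 complex)) \<Rightarrow> rel2 \<Rightarrow> complex"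
  where "limz rel x r = (if finite r then lim (\<lambda>n. zeta rel (x n) r) else 0)"

lemma limz_zconv: "zconv m \<alpha> f \<Longrightarrow> limz prel \<alpha> = f"
  using zconv_lim[of m \<alpha> f] zconv_infinite[of m \<alpha> f] by (auto simp: limz_def limI)

lemma limz_eventually:
  assumes "\<And>n r. n \<ge> n0 \<Longrightarrow> r \<subseteq> square n \<Longrightarrow> zeta rel (x n) r = f r" "\<And>r. infinite r \<Longrightarrow> f r = 0"
  shows "limz rel x = f"
proof
  fix r
  show "limz rel x r = f r"
  proof (cases "finite r")
    case True
    then obtain n1 where n1: "Field r \<subseteq> {..<n1}" using finite_Field' finite_nat_iff_bounded by blast
    have "\<forall>\<^sub>F n in sequentially. zeta rel (x n) r = f r"
    proof (rule eventually_sequentiallyI[of "max n0 n1"])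
      fix n assume n: "max n0 n1 \<le> n"
      have "r \<subseteq> square n" using n1 n by (fastforce simp: Field_def)
      then show "zeta rel (x n) r = f r" using n by (intro assms(1)) auto
    qed
    then show ?thesis using True by (simp add: limz_def limI tendsto_eventually)
  qed (simp add: limz_def assms(2))
qed

lemma A_seqs_mono: "m \<le> m' \<Longrightarrow> A_seqs m \<subseteq> A_seqs m'"
proof
  fix a assume h: "m \<le> m'" "a \<in> A_seqs m"
  have "bdd_above ((\<lambda>n. alg_deg mat_deg (a n)) ` {m'..})"
    by (rule bdd_above_mono[of "(\<lambda>n. alg_deg mat_deg (a n)) ` {m..}"]) (use h in \<open>auto simp: A_seqs_def\<close>)
  moreover have "a n \<in> A_cent m' n" if "n \<ge> m'" for n
    using h that A_cent_mono[of m m' n] by (auto simp: A_seqs_def)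
  ultimately show "a \<in> A_seqs m'" using h by (simp add: A_seqs_def)
qed

lemma A_seqs_span: "a \<in> A_seqs m \<Longrightarrow> n \<ge> m \<Longrightarrow> a n \<in> span_of (Gamma n)"
  by (auto simp: A_seqs_def A_cent_iff)

lemma A_seqs_stable:
  assumes "a \<in> A_seqs m" "n \<ge> m" "r \<subseteq> square n"
  shows "M (a (n + k)) r = M (a n) r"
proof (induction k)
  case (Suc k)
  have "a (n + k) = theta (a (n + Suc k))"
    using assms(1,2) unfolding A_seqs_def by (auto dest!: spec[of _ "n + Suc k"])
  moreover have "r \<subseteq> square (n + Suc k - 1)" using assms(3) by auto
  ultimately have "M (a (n + k)) r = M (a (n + Suc k)) r"
    using M_theta[OF A_seqs_span[OF assms(1), of "n + Suc k"], of r] assms(2) by simp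
  then show ?case using Suc by simp
qed simp

lemma limz_A_seqs:
  assumes "a \<in> A_seqs m" "n \<ge> m" "r \<subseteq> square n"
  shows "limz mrel a r = M (a n) r"
proof -
  have "\<forall>\<^sub>F k in sequentially. M (a k) r = M (a n) r"
    by (rule eventually_sequentiallyI[of n]) (metis A_seqs_stable[OF assms] le_add_diff_inverse)
  then show ?thesis using finite_square_subset[OF assms(3)] by (simp add: limz_def limI tendsto_eventually)
qed

lemma ex_square:
  assumes "finite r" "finite X"
  shows "\<exists>n\<ge>m. r \<subseteq> square n \<and> X \<subseteq> {..<n}"
proof -
  obtain n0 where n0: "Field r \<union> X \<subseteq> {..<n0}"
    using assms finite_Field' finite_nat_iff_bounded by (metis finite_UnI)
  show ?thesis
  proof (intro exI[of _ "max m n0"] conjI)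
    show "r \<subseteq> square (max m n0)" using n0 by (fastforce simp: Field_def)
    show "X \<subseteq> {..<max m n0}" using n0 by fastforce
  qed simp
qed

text \<open>Support and invariance are read off from commutation with one well-chosen element of
  \<open>Gamma_sub m n\<close>, in the form \<open>comm\<close>: an idempotent for the support, a
  permutation matrix for the invariance. Bounded degree gives the alternating sums in the same way
  as for permutations.\<close>

lemma A_seqs_admissible:
  assumes a: "a \<in> A_seqs m"
  shows "admissible m (limz mrel a)"
proof -
  let ?f = "limz mrel a"
  have span: "a n \<in> span_of (Gamma n)" if "n \<ge> m" for n using A_seqs_span[OF a that] .
  have comm: "(if Domain r \<subseteq> Domain H then ?f (H\<inverse> O r) else 0) = (if Range r \<subseteq> Range H then ?f (r O H\<inverse>) else 0)"
    if H: "one_one H" "H \<subseteq> square n" "\<And>i. i < m \<Longrightarrow> (i, i) \<in> H" and n: "n \<ge> m" "r \<subseteq> square n" for H r n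
  proof -
    define h where "h = mat_of n H"
    have mh: "mrel h = H" using H(2) by (auto simp: h_def)
    have hG: "h \<in> Gamma n" unfolding h_def using H by (intro mat_of_Gamma one_one_subset[OF H(1)]) auto
    have "h \<in> Gamma_sub m n" using hG H(3) n(1) by (auto simp: Gamma_sub_def h_def mat_of_def)
    then have "delta h \<star> a n = a n \<star> delta h" using a n(1) by (auto simp: A_seqs_def A_cent_iff)
    then have "M (delta h \<star> a n) r = M (a n \<star> delta h) r" by simp
    moreover have "H\<inverse> O r \<subseteq> square n" "r O H\<inverse> \<subseteq> square n" using H(2) n(2) by auto
    ultimately show ?thesis
      unfolding M_delta_left[OF hG span[OF n(1)]] M_delta_right[OF hG span[OF n(1)]] mh
      by (simp only: limz_A_seqs[OF a n(1)])
  qed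
  have ff: "finite r" if "?f r \<noteq> 0" for r using that by (auto simp: limz_def split: if_splits)
  have oo: "one_one r" if nz: "?f r \<noteq> 0" for r
  proof (rule ccontr)
    assume "\<not> one_one r"
    obtain n where n: "n \<ge> m" "r \<subseteq> square n" using ex_square[OF ff[OF nz] finite.emptyI, of m] by blast
    then show False using nz M_not_one_one[OF span[OF n(1)] \<open>\<not> one_one r\<close>] limz_A_seqs[OF a n] by simp
  qed
  have dr: "Domain r - {..<m} = Range r - {..<m}" if nz: "?f r \<noteq> 0" for r
  proof -
    obtain n where n: "n \<ge> m" "r \<subseteq> square n" using ex_square[OF ff[OF nz] finite.emptyI, of m] by blast
    have key: "i \<in> Domain r \<longleftrightarrow> i \<in> Range r" if i: "i \<ge> m" for i
    proof -
      \<comment> \<open>The diagonal idempotent that omits \<open>i\<close>. Commutation with it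
        says that \<open>i\<close> lies in both the domain and the range of \<open>r\<close> or in
        neither of them.\<close>
      define H where "H = Id_on ({..<n} - {i})"
      have H: "one_one H" "H \<subseteq> square n" "\<And>j. j < m \<Longrightarrow> (j, j) \<in> H"
        using i n(1) by (auto simp: H_def intro!: one_oneI)
      have DH: "Domain H = {..<n} - {i}" "Range H = {..<n} - {i}" by (auto simp: H_def)
      have "Domain r \<subseteq> Domain H \<longleftrightarrow> i \<notin> Domain r" "Range r \<subseteq> Range H \<longleftrightarrow> i \<notin> Range r"
        unfolding DH using n(2) by auto
      moreover have "H\<inverse> O r = r" if "i \<notin> Domain r" using that n(2) by (auto simp: H_def)
      moreover have "r O H\<inverse> = r" if "i \<notin> Range r" using that n(2) by (auto simp: H_def)
      ultimately show ?thesis using comm[OF H n] nz by (auto split: if_splits)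
    qed
    show ?thesis
    proof (rule Set.set_eqI)
      fix i show "i \<in> Domain r - {..<m} \<longleftrightarrow> i \<in> Range r - {..<m}"
        using key[of i] by (cases "i < m") simp_all
    qed
  qed
  have inv: "?f (mv h h r) = ?f r" if r: "finite r" and h: "\<And>i. i < m \<Longrightarrow> h \<langle>$\<rangle> i = i" for h r
  proof -
    obtain n0 where n0: "\<And>n. n \<ge> n0 \<Longrightarrow> h \<in> Sn n" using ex_Sn by blast
    obtain n where n: "n \<ge> max m n0" "r \<subseteq> square n" using ex_square[OF r finite.emptyI, of "max m n0"] by blast
    have hS: "h \<in> Sn n" using n0 n(1) by simp
    define H where "H = prel h \<inter> square n"
    have H: "one_one H" "H \<subseteq> square n" "\<And>j. j < m \<Longrightarrow> (j, j) \<in> H"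
      using h n(1) by (auto simp: H_def intro: one_one_subset[OF one_one_prel])
    have DH: "Domain H = {..<n}" "Range H = {..<n}"
    proof -
      have "(h \<langle>$\<rangle> j, j) \<in> H" if "j < n" for j using that Sn_less[OF hS] by (simp add: H_def)
      moreover have "(j, inverse h \<langle>$\<rangle> j) \<in> H" if "j < n" for j
        using that Sn_less[of "inverse h" n] hS by (simp add: H_def)
      ultimately show "Domain H = {..<n}" "Range H = {..<n}" using H(2) by blast+
    qed
    \<comment> \<open>Moving only the rows makes the two sides of \<open>comm\<close> the values at
      \<open>r\<close> and at \<open>mv h h r\<close>.\<close>
    let ?r = "mv h 1 r"
    have sq: "?r \<subseteq> square n" using n(2) Sn_less[OF hS] by (auto simp: mv_def apply_one)
    have "H\<inverse> O ?r = r"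
    proof (intro equalityI subrelI)
      fix x y assume "(x, y) \<in> H\<inverse> O ?r"
      then show "(x, y) \<in> r" by (auto simp: H_def in_mv apply_one perm.inverse_neutral)
    next
      fix x y assume xy: "(x, y) \<in> r"
      then have "(h \<langle>$\<rangle> x, x) \<in> H" using n(2) Sn_less[OF hS] by (auto simp: H_def)
      moreover have "(h \<langle>$\<rangle> x, y) \<in> ?r" using in_mv_apply[of h x 1 y r] xy by (simp add: apply_one)
      ultimately show "(x, y) \<in> H\<inverse> O ?r" by blast
    qed
    moreover have "?r O H\<inverse> = mv h h r"
    proof (intro equalityI subrelI)
      fix x y assume "(x, y) \<in> ?r O H\<inverse>"
      then obtain z where z: "(x, z) \<in> ?r" "y = h \<langle>$\<rangle> z" by (auto simp: H_def)
      then show "(x, y) \<in> mv h h r" by (auto simp: mv_def apply_one)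
    next
      fix x y assume "(x, y) \<in> mv h h r"
      then obtain x' y' where xy: "(x', y') \<in> r" "x = h \<langle>$\<rangle> x'" "y = h \<langle>$\<rangle> y'" by (auto simp: mv_def)
      then have "(y, y') \<in> H" using n(2) Sn_less[OF hS] by (auto simp: H_def)
      moreover have "(x, y') \<in> ?r" using in_mv_apply[of h x' 1 y' r] xy by (simp add: apply_one)
      ultimately show "(x, y) \<in> ?r O H\<inverse>" by blast
    qed
    moreover have "Domain ?r \<subseteq> Domain H" "Range ?r \<subseteq> Range H" unfolding DH using sq by auto
    ultimately show ?thesis using comm[OF H _ sq] n(1) by simp
  qed
  have "bdd_above ((\<lambda>n. alg_deg mat_deg (a n)) ` {m..})" using a by (simp add: A_seqs_def)
  then obtain d where "\<forall>x\<in>(\<lambda>n. alg_deg mat_deg (a n)) ` {m..}. x \<le> d" unfolding bdd_above_def by blast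
  then have d: "mat_deg u \<le> d" if "n \<ge> m" "u \<in> Poly_Mapping.keys (a n)" for n u
    using that alg_deg_le_iff[of mat_deg "a n" d] by simp
  have alt: "(\<Sum>Y\<in>Pow Y0. (-1) ^ card Y * ?f (r \<union> Id_on Y)) = 0"
    if r: "finite r" and Y0: "finite Y0" and card: "d < card (Y0 \<union> moved r)" for r Y0
  proof -
    obtain n where n: "n \<ge> m" "r \<subseteq> square n" "Y0 \<subseteq> {..<n}" using ex_square[OF r Y0, of m] by blast
    have "(\<Sum>Y\<in>Pow Y0. (-1) ^ card Y * M (a n) (r \<union> Id_on Y)) = 0"
    proof (rule zeta_alternating[OF Y0], rule ccontr)
      fix u assume u: "u \<in> Poly_Mapping.keys (a n)" "r \<subseteq> mrel u" "\<not> (\<exists>y\<in>Y0. (y, y) \<in> mrel u)"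
      have uG: "u \<in> Gamma n" using u(1) span[OF n(1)] by (auto simp: span_of_def)
      have "Y0 \<union> moved r \<subseteq> {i. i < n \<and> (i, i) \<notin> mrel u}"
      proof
        fix i assume "i \<in> Y0 \<union> moved r"
        then show "i \<in> {i. i < n \<and> (i, i) \<notin> mrel u}"
        proof
          assume "i \<in> moved r"
          then obtain j where ij: "(i, j) \<in> r" "(i, i) \<notin> r" by (auto simp: moved_def)
          have "(i, i) \<notin> mrel u" using ij u(2) one_one_eq1[OF GammaD(4)[OF uG], of i i j] by auto
          then show ?thesis using ij n(2) by auto
        qed (use u(3) n(3) in auto)
      qed
      then have "card (Y0 \<union> moved r) \<le> mat_deg u"
        unfolding mat_deg_eq[OF uG] by (intro card_mono) auto
      then show False using d[OF n(1) u(1)] card by simp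
    qed
    moreover have "M (a n) (r \<union> Id_on Y) = ?f (r \<union> Id_on Y)" if "Y \<in> Pow Y0" for Y
    proof -
      have "r \<union> Id_on Y \<subseteq> square n" using n(2,3) that by auto
      then show ?thesis using limz_A_seqs[OF a n(1)] by simp
    qed
    ultimately show ?thesis by simp
  qed
  show ?thesis
    unfolding admissible_def using ff oo dr inv alt by blast
qed

text \<open>Membership is settled by zeta values alone: they force the sequence to agree with
  \<open>from_fun f\<close> from \<open>n0\<close> on. Closure under the algebra operations is
  reduced to this criterion.\<close>

lemma A_seqs_of_fun:
  assumes f: "zconv m \<alpha> f" and x: "\<And>n. n \<ge> n0 \<Longrightarrow> x n \<in> span_of (Gamma n)"
    "\<And>n r. n \<ge> n0 \<Longrightarrow> r \<subseteq> square n \<Longrightarrow> M (x n) r = f r"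
  shows "x \<in> (\<Union>m. A_seqs m)" "limz mrel x = f"
proof -
  let ?a = "from_fun f" and ?m = "max m n0"
  have eq: "x n = ?a n" if "n \<ge> n0" for n
    by (rule M_eqI[OF x(1)[OF that] from_fun_span]) (simp add: x(2)[OF that] M_from_fun[OF f])
  have a: "?a \<in> A_seqs ?m" using from_fun_A_seqs[OF f] A_seqs_mono[of m ?m] by auto
  have "(\<lambda>n. alg_deg mat_deg (x n)) ` {?m..} = (\<lambda>n. alg_deg mat_deg (?a n)) ` {?m..}"
    by (rule image_cong) (simp_all add: eq)
  moreover have "x (n - 1) = theta (x n)" if "n > ?m" for n
  proof -
    have "n - 1 \<ge> n0" "n \<ge> n0" using that by auto
    then show ?thesis using a that by (simp add: eq A_seqs_def)
  qed
  ultimately have "x \<in> A_seqs ?m" using a by (simp add: A_seqs_def eq)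
  then show "x \<in> (\<Union>m. A_seqs m)" by blast
  show "limz mrel x = f"
    by (rule limz_eventually[of n0]) (use x zconv_infinite[OF f] in auto)
qed

section \<open>Operations on sequences of matrices\<close>

lemma A_all_zconv:
  assumes "a \<in> (\<Union>m. A_seqs m)"
  shows "\<exists>m \<alpha>. zconv m \<alpha> (limz mrel a)"
proof -
  obtain m where "a \<in> A_seqs m" using assms by blast
  from admissible_imp_zconv[OF A_seqs_admissible[OF this]] show ?thesis by blast
qed

lemma A_all_eventually:
  assumes "a \<in> (\<Union>m. A_seqs m)"
  shows "\<exists>n0. \<forall>n\<ge>n0. a n \<in> span_of (Gamma n) \<and> (\<forall>r\<subseteq>square n. M (a n) r = limz mrel a r)"
proof -
  obtain m where "a \<in> A_seqs m" using assms by blast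
  then show ?thesis using A_seqs_span[of a m] limz_A_seqs[of a m] by (intro exI[of _ m]) simp
qed

text \<open>From some index on, the limit function restricted to the square is the zeta transform of
  the \<open>n\<close>-th term, and it determines this term by \<open>M_eqI\<close>.\<close>

lemma A_equiv_iff: "A_equiv = {(a, b). a \<in> (\<Union>m. A_seqs m) \<and> b \<in> (\<Union>m. A_seqs m) \<and> limz mrel a = limz mrel b}"
proof -
  have "(\<forall>\<^sub>F n in sequentially. a n = b n) \<longleftrightarrow> limz mrel a = limz mrel b"
    if a: "a \<in> (\<Union>m. A_seqs m)" and b: "b \<in> (\<Union>m. A_seqs m)" for a b
  proof
    assume "\<forall>\<^sub>F n in sequentially. a n = b n"
    then obtain n1 where n1: "\<And>n. n \<ge> n1 \<Longrightarrow> a n = b n" unfolding eventually_sequentially by blast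
    obtain n0 where n0: "\<And>n. n \<ge> n0 \<Longrightarrow> b n \<in> span_of (Gamma n) \<and> (\<forall>r\<subseteq>square n. M (b n) r = limz mrel b r)"
      using A_all_eventually[OF b] by blast
    show "limz mrel a = limz mrel b"
      by (rule limz_eventually[of "max n0 n1"]) (use n0 n1 in \<open>auto simp: limz_def\<close>)
  next
    assume eq: "limz mrel a = limz mrel b"
    obtain n0 where n0: "\<And>n. n \<ge> n0 \<Longrightarrow> b n \<in> span_of (Gamma n) \<and> (\<forall>r\<subseteq>square n. M (b n) r = limz mrel b r)"
      using A_all_eventually[OF b] by blast
    obtain n1 where n1: "\<And>n. n \<ge> n1 \<Longrightarrow> a n \<in> span_of (Gamma n) \<and> (\<forall>r\<subseteq>square n. M (a n) r = limz mrel a r)"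
      using A_all_eventually[OF a] by blast
    show "\<forall>\<^sub>F n in sequentially. a n = b n"
      by (rule eventually_sequentiallyI[of "max n0 n1"]) (rule M_eqI, use n0 n1 eq in auto)
  qed
  then show ?thesis unfolding A_equiv_def by blast
qed

lemma A_all_binary:
  assumes a: "a \<in> (\<Union>m. A_seqs m)" and b: "b \<in> (\<Union>m. A_seqs m)"
  obtains m \<alpha> \<beta> n0 where "zconv m \<alpha> (limz mrel a)" "zconv m \<beta> (limz mrel b)" "n0 \<ge> m"
    "\<And>n. n \<ge> n0 \<Longrightarrow> a n \<in> span_of (Gamma n)" "\<And>n. n \<ge> n0 \<Longrightarrow> b n \<in> span_of (Gamma n)"
    "\<And>n r. n \<ge> n0 \<Longrightarrow> r \<subseteq> square n \<Longrightarrow> M (a n) r = limz mrel a r"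
    "\<And>n r. n \<ge> n0 \<Longrightarrow> r \<subseteq> square n \<Longrightarrow> M (b n) r = limz mrel b r"
proof -
  obtain m1 \<alpha> where 1: "zconv m1 \<alpha> (limz mrel a)" using A_all_zconv[OF a] by blast
  obtain m2 \<beta> where 2: "zconv m2 \<beta> (limz mrel b)" using A_all_zconv[OF b] by blast
  obtain n1 where n1: "\<And>n. n \<ge> n1 \<Longrightarrow> a n \<in> span_of (Gamma n) \<and> (\<forall>r\<subseteq>square n. M (a n) r = limz mrel a r)"
    using A_all_eventually[OF a] by blast
  obtain n2 where n2: "\<And>n. n \<ge> n2 \<Longrightarrow> b n \<in> span_of (Gamma n) \<and> (\<forall>r\<subseteq>square n. M (b n) r = limz mrel b r)"
    using A_all_eventually[OF b] by blast
  show ?thesis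
  proof (rule that[of "max m1 m2" \<alpha> \<beta> "max (max m1 m2) (max n1 n2)"])
    show "zconv (max m1 m2) \<alpha> (limz mrel a)" by (rule zconv_mono[OF _ 1]) simp
    show "zconv (max m1 m2) \<beta> (limz mrel b)" by (rule zconv_mono[OF _ 2]) simp
  qed (use n1 n2 in auto)
qed

lemma A_all_add:
  assumes a: "a \<in> (\<Union>m. A_seqs m)" and b: "b \<in> (\<Union>m. A_seqs m)"
  shows "(\<lambda>n. a n + b n) \<in> (\<Union>m. A_seqs m) \<and>
    limz mrel (\<lambda>n. a n + b n) = (\<lambda>r. limz mrel a r + limz mrel b r)"
proof -
  obtain m \<alpha> \<beta> n0 where h: "zconv m \<alpha> (limz mrel a)" "zconv m \<beta> (limz mrel b)" "n0 \<ge> m"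
    "\<And>n. n \<ge> n0 \<Longrightarrow> a n \<in> span_of (Gamma n)" "\<And>n. n \<ge> n0 \<Longrightarrow> b n \<in> span_of (Gamma n)"
    "\<And>n r. n \<ge> n0 \<Longrightarrow> r \<subseteq> square n \<Longrightarrow> M (a n) r = limz mrel a r"
    "\<And>n r. n \<ge> n0 \<Longrightarrow> r \<subseteq> square n \<Longrightarrow> M (b n) r = limz mrel b r"
    using A_all_binary[OF a b] by metis
  show ?thesis
    by (rule conjI; rule A_seqs_of_fun[OF zconv_add[OF h(1,2)], of n0])
       (simp_all add: h(4-7) span_of_add zeta_add)
qed

lemma A_all_scale:
  assumes a: "a \<in> (\<Union>m. A_seqs m)"
  shows "(\<lambda>n. scale c (a n)) \<in> (\<Union>m. A_seqs m) \<and> limz mrel (\<lambda>n. scale c (a n)) = (\<lambda>r. c * limz mrel a r)"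
proof -
  obtain m \<alpha> where 1: "zconv m \<alpha> (limz mrel a)" using A_all_zconv[OF a] by blast
  obtain n1 where n1: "\<And>n. n \<ge> n1 \<Longrightarrow> a n \<in> span_of (Gamma n) \<and> (\<forall>r\<subseteq>square n. M (a n) r = limz mrel a r)"
    using A_all_eventually[OF a] by blast
  show ?thesis
    by (rule conjI; rule A_seqs_of_fun[OF zconv_scale[OF 1, of c], of n1])
       (simp_all add: n1 span_of_scale zeta_scale)
qed

lemma A_all_zero: "(\<lambda>n. 0) \<in> (\<Union>m. A_seqs m)" "limz mrel (\<lambda>n. 0) = (\<lambda>r. 0)"
  by (rule A_seqs_of_fun[OF zconv_zero, of 0]; simp add: span_of_0)+

lemma one_mat_Gamma: "1\<^sub>m n \<in> Gamma n" and mrel_one_mat: "mrel (1\<^sub>m n) = Id_on {..<n}"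
  by (auto simp: Gamma_def mrel_def split: if_splits)

lemma A_all_one:
  "(\<lambda>n. delta (1\<^sub>m n)) \<in> (\<Union>m. A_seqs m) \<and>
   limz mrel (\<lambda>n. delta (1\<^sub>m n)) = (\<lambda>r. if finite r \<and> r \<subseteq> prel 1 then 1 else 0)"
proof -
  have 1: "zconv 0 (\<lambda>n. delta 1) (\<lambda>r. if finite r \<and> r \<subseteq> prel 1 then 1 else 0)"
    by (rule zconv_delta) simp
  have 2: "M (delta (1\<^sub>m n)) r = (if finite r \<and> r \<subseteq> prel 1 then 1 else 0)" if "r \<subseteq> square n" for n r
  proof -
    have "r \<subseteq> Id_on {..<n} \<longleftrightarrow> r \<subseteq> prel 1" using that by (auto simp: prel_one)
    then show ?thesis using finite_square_subset[OF that] by (simp add: zeta_single mrel_one_mat)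
  qed
  show ?thesis
    by (rule conjI; rule A_seqs_of_fun[OF 1, of 0]) (simp_all add: 2 span_of_single one_mat_Gamma)
qed

text \<open>No limit is involved inside of the square: for \<open>n \<ge> m\<close> the support
  condition confines every relevant \<open>d\<close> to the square, so the convolution formula for
  the \<open>n\<close>-th terms already is the sum that defines \<open>mul\<close>.\<close>

lemma A_all_mult:
  assumes a: "a \<in> (\<Union>m. A_seqs m)" and b: "b \<in> (\<Union>m. A_seqs m)"
  shows "(\<lambda>n. a n \<star> b n) \<in> (\<Union>m. A_seqs m) \<and>
    limz mrel (\<lambda>n. a n \<star> b n) = mul (limz mrel a) (limz mrel b)"
proof -
  obtain m \<alpha> \<beta> n0 where h: "zconv m \<alpha> (limz mrel a)" "zconv m \<beta> (limz mrel b)" "n0 \<ge> m"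
    "\<And>n. n \<ge> n0 \<Longrightarrow> a n \<in> span_of (Gamma n)" "\<And>n. n \<ge> n0 \<Longrightarrow> b n \<in> span_of (Gamma n)"
    "\<And>n r. n \<ge> n0 \<Longrightarrow> r \<subseteq> square n \<Longrightarrow> M (a n) r = limz mrel a r"
    "\<And>n r. n \<ge> n0 \<Longrightarrow> r \<subseteq> square n \<Longrightarrow> M (b n) r = limz mrel b r"
    using A_all_binary[OF a b] by metis
  have prod: "M (a n \<star> b n) r = mul (limz mrel a) (limz mrel b) r" if n: "n \<ge> n0" and r: "r \<subseteq> square n" for n r
  proof -
    let ?D = "injections (Domain r) {..<n}"
    have fr: "finite r" by (rule finite_square_subset[OF r])
    have Dr: "Domain r \<subseteq> {..<n}" using r by auto
    have finD: "finite ?D" using fr by (simp add: finite_Domain)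
    have ka: "\<And>u. u \<in> Poly_Mapping.keys (a n) \<Longrightarrow> u \<in> Gamma n" and kb: "\<And>u. u \<in> Poly_Mapping.keys (b n) \<Longrightarrow> u \<in> Gamma n"
      using h(4,5)[OF n] by (auto simp: span_of_def)
    have "M (a n \<star> b n) r = (\<Sum>d\<in>?D. M (a n) d * M (b n) (d\<inverse> O r))"
    proof (rule zeta_conv)
      fix u assume u: "u \<in> Poly_Mapping.keys (a n)"
      note g = GammaD[OF ka[OF u]]
      show "single_valued (mrel u)" using g(4) by (simp add: one_one_def)
      assume "Domain r \<subseteq> Domain (mrel u)"
      then have "Domain (mrel u \<inter> Domain r \<times> UNIV) = Domain r" by blast
      moreover have "one_one (mrel u \<inter> Domain r \<times> UNIV)" by (rule one_one_subset[OF g(4)]) auto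
      moreover have "Range (mrel u \<inter> Domain r \<times> UNIV) \<subseteq> {..<n}" using g(3) by auto
      ultimately show "mrel u \<inter> Domain r \<times> UNIV \<in> ?D" by (simp add: injections_def)
    next
      fix u v assume "u \<in> Poly_Mapping.keys (a n)" "v \<in> Poly_Mapping.keys (b n)"
      then show "mrel (u * v) = mrel u O mrel v" by (intro mrel_mult[OF ka kb])
    next
      show "Domain d = Domain r" if "d \<in> ?D" for d using that by (simp add: injections_def)
    qed (rule finD)
    also have "\<dots> = (\<Sum>d\<in>?D. limz mrel a d * limz mrel b (d\<inverse> O r))"
    proof (rule sum.cong[OF refl])
      fix d assume "d \<in> ?D"
      then have "Domain d \<subseteq> {..<n}" "Range d \<subseteq> {..<n}" using Dr by (auto simp: injections_def)
      then have "d \<subseteq> square n" by auto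
      moreover from this have "d\<inverse> O r \<subseteq> square n" using r by auto
      ultimately show "M (a n) d * M (b n) (d\<inverse> O r) = limz mrel a d * limz mrel b (d\<inverse> O r)"
        using h(6,7)[OF n] by simp
    qed
    also have "\<dots> = mul (limz mrel a) (limz mrel b) r"
    proof (rule mul_eq[symmetric, OF fr finD])
      fix d assume d: "Domain d = Domain r" "limz mrel a d \<noteq> 0"
      have "Domain d - {..<m} = Range d - {..<m}" by (rule zconv_Domain_Range[OF h(1) d(2)])
      \<comment> \<open>Points of the range below \<open>m\<close> are in the square because
        \<open>m \<le> n0\<close>, and the others belong to \<open>Domain r\<close>.\<close>
      then have "Range d \<subseteq> {..<n}" using d(1) Dr h(3) n
          by (auto simp: set_eq_iff subset_iff)
            (metis lessThan_iff less_le_trans linorder_not_le Domain.DomainI Range.RangeI)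
      then show "d \<in> ?D" using d zconv_one_one[OF h(1) d(2)] by (simp add: injections_def)
    qed (auto simp: injections_def)
    finally show ?thesis .
  qed
  show ?thesis
    by (rule conjI; rule A_seqs_of_fun[OF zconv_mult[OF h(1,2)], of n0])
       (simp_all add: prod h(4,5) span_of_conv Gamma_mult_closed)
qed

lemma A_all_image: "limz mrel ` (\<Union>m. A_seqs m) = {f. \<exists>m \<alpha>. zconv m \<alpha> f}"
proof (intro equalityI subsetI)
  fix f assume "f \<in> limz mrel ` (\<Union>m. A_seqs m)"
  then show "f \<in> {f. \<exists>m \<alpha>. zconv m \<alpha> f}" using A_all_zconv by auto
next
  fix f assume "f \<in> {f. \<exists>m \<alpha>. zconv m \<alpha> f}"
  then obtain m \<alpha> where f: "zconv m \<alpha> f" by blast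
  have "from_fun f \<in> (\<Union>m. A_seqs m)" "limz mrel (from_fun f) = f"
    by (rule A_seqs_of_fun[OF f, of 0]; simp add: from_fun_span M_from_fun[OF f])+
  then show "f \<in> limz mrel ` (\<Union>m. A_seqs m)" by (metis image_eqI)
qed

section \<open>Algebras of sequences in terms of limit functions\<close>

abbreviation (input) unit_fun :: "rel2 \<Rightarrow> complex"
  where "unit_fun \<equiv> \<lambda>r. if finite r \<and> r \<subseteq> prel 1 then 1 else 0"

text \<open>The situation common to both sides: the equivalence is the kernel of
  \<open>\<Phi>\<close>, and \<open>\<Phi>\<close> carries the component-wise operations to those of
  a space \<open>F\<close> of functions. Two sequence algebras with the same \<open>F\<close> are
  then isomorphic.\<close>

locale seq_rep =
  fixes C :: "(nat \<Rightarrow> ('g::times \<Rightarrow>\<^sub>0 complex)) set" and R u and \<Phi> :: "(nat \<Rightarrow> ('g \<Rightarrow>\<^sub>0 complex)) \<Rightarrow> rel2 \<Rightarrow> complex"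
    and F :: "(rel2 \<Rightarrow> complex) set"
  assumes R: "R = {(a, b). a \<in> C \<and> b \<in> C \<and> \<Phi> a = \<Phi> b}"
    and image: "\<Phi> ` C = F"
    and mult: "\<And>a b. a \<in> C \<Longrightarrow> b \<in> C \<Longrightarrow> (\<lambda>n. a n \<star> b n) \<in> C \<and> \<Phi> (\<lambda>n. a n \<star> b n) = mul (\<Phi> a) (\<Phi> b)"
    and add: "\<And>a b. a \<in> C \<Longrightarrow> b \<in> C \<Longrightarrow> (\<lambda>n. a n + b n) \<in> C \<and> \<Phi> (\<lambda>n. a n + b n) = (\<lambda>r. \<Phi> a r + \<Phi> b r)"
    and scale: "\<And>c a. a \<in> C \<Longrightarrow> (\<lambda>n. scale c (a n)) \<in> C \<and> \<Phi> (\<lambda>n. scale c (a n)) = (\<lambda>r. c * \<Phi> a r)"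
    and one: "(\<lambda>n. delta (u n)) \<in> C \<and> \<Phi> (\<lambda>n. delta (u n)) = unit_fun"
    and zero: "(\<lambda>n. 0) \<in> C \<and> \<Phi> (\<lambda>n. 0) = (\<lambda>r. 0)"
begin

definition cls :: "(rel2 \<Rightarrow> complex) \<Rightarrow> (nat \<Rightarrow> ('g \<Rightarrow>\<^sub>0 complex)) set"
  where "cls f = {a \<in> C. \<Phi> a = f}"

lemma R_image: "a \<in> C \<Longrightarrow> R `` {a} = cls (\<Phi> a)"
  by (auto simp: R cls_def)

lemma cls_ex: "f \<in> F \<Longrightarrow> \<exists>a\<in>C. \<Phi> a = f"
  using image by blast

lemma cls_inj: "f \<in> F \<Longrightarrow> cls f = cls g \<Longrightarrow> f = g"
  using cls_ex[of f] by (auto simp: cls_def)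

lemma carrier_eq: "carrier (seq_algebra C R u) = cls ` F"
proof -
  have "C // R = (\<lambda>a. cls (\<Phi> a)) ` C"
    unfolding quotient_def using R_image by auto
  then show ?thesis by (simp add: seq_algebra_def image_image flip: image)
qed

lemma mult_cls:
  assumes "f \<in> F" "g \<in> F"
  shows "cls f \<otimes>\<^bsub>seq_algebra C R u\<^esub> cls g = cls (mul f g)"
proof -
  have "R `` {\<lambda>n. a n \<star> b n} = cls (mul f g)" if "a \<in> cls f" "b \<in> cls g" for a b
    using that mult[of a b] R_image by (simp add: cls_def)
  moreover have "cls f \<noteq> {}" "cls g \<noteq> {}" using assms cls_ex by (auto simp: cls_def)
  ultimately show ?thesis by (simp add: seq_algebra_def)
qed

lemma add_cls:
  assumes "f \<in> F" "g \<in> F"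
  shows "cls f \<oplus>\<^bsub>seq_algebra C R u\<^esub> cls g = cls (\<lambda>r. f r + g r)"
proof -
  have "R `` {\<lambda>n. a n + b n} = cls (\<lambda>r. f r + g r)" if "a \<in> cls f" "b \<in> cls g" for a b
    using that add[of a b] R_image by (simp add: cls_def)
  moreover have "cls f \<noteq> {}" "cls g \<noteq> {}" using assms cls_ex by (auto simp: cls_def)
  ultimately show ?thesis by (simp add: seq_algebra_def)
qed

lemma smult_cls:
  assumes "f \<in> F"
  shows "c \<odot>\<^bsub>seq_algebra C R u\<^esub> cls f = cls (\<lambda>r. c * f r)"
proof -
  have "R `` {\<lambda>n. Defs.scale c (a n)} = cls (\<lambda>r. c * f r)" if "a \<in> cls f" for a
    using that scale[of a c] R_image by (simp add: cls_def)
  moreover have "cls f \<noteq> {}" using assms cls_ex by (auto simp: cls_def)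
  ultimately show ?thesis by (simp add: seq_algebra_def)
qed

lemma one_cls: "\<one>\<^bsub>seq_algebra C R u\<^esub> = cls unit_fun"
  using one R_image by (simp add: seq_algebra_def)

lemma zero_cls: "\<zero>\<^bsub>seq_algebra C R u\<^esub> = cls (\<lambda>r. 0)"
  using zero R_image by (simp add: seq_algebra_def)

lemma F_closed:
  "f \<in> F \<Longrightarrow> g \<in> F \<Longrightarrow> mul f g \<in> F" "f \<in> F \<Longrightarrow> g \<in> F \<Longrightarrow> (\<lambda>r. f r + g r) \<in> F"
  "f \<in> F \<Longrightarrow> (\<lambda>r. c * f r) \<in> F" "unit_fun \<in> F" "(\<lambda>r. 0) \<in> F"
proof -
  have img: "\<Phi> a \<in> F" if "a \<in> C" for a using that image by blast
  show "mul f g \<in> F" if fg: "f \<in> F" "g \<in> F"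
  proof -
    obtain a b where "a \<in> C" "\<Phi> a = f" "b \<in> C" "\<Phi> b = g" using fg cls_ex by metis
    then show ?thesis using mult[of a b] img by metis
  qed
  show "(\<lambda>r. f r + g r) \<in> F" if fg: "f \<in> F" "g \<in> F"
  proof -
    obtain a b where "a \<in> C" "\<Phi> a = f" "b \<in> C" "\<Phi> b = g" using fg cls_ex by metis
    then show ?thesis using add[of a b] img by metis
  qed
  show "(\<lambda>r. c * f r) \<in> F" if fF: "f \<in> F"
  proof -
    obtain a where "a \<in> C" "\<Phi> a = f" using cls_ex[OF fF] by blast
    then show ?thesis using scale[of a c] img by metis
  qed
  show "unit_fun \<in> F" using one img by metis
  show "(\<lambda>r. 0) \<in> F" using zero img by metis
qed

end

lemma cring_complex_field: "cring complex_field"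
proof (rule cringI)
  show "abelian_group complex_field"
    by (rule abelian_groupI) (auto simp: complex_field_def algebra_simps intro: exI[of _ "- x" for x])
  show "comm_monoid complex_field"
    by (rule comm_monoidI) (auto simp: complex_field_def)
qed (auto simp: complex_field_def algebra_simps)

locale fun_algebra = seq_rep +
  assumes mul_assoc: "f \<in> F \<Longrightarrow> g \<in> F \<Longrightarrow> k \<in> F \<Longrightarrow> mul (mul f g) k = mul f (mul g k)"
    and mul_one: "f \<in> F \<Longrightarrow> mul unit_fun f = f" "f \<in> F \<Longrightarrow> mul f unit_fun = f"
    and mul_add: "f \<in> F \<Longrightarrow> g \<in> F \<Longrightarrow> k \<in> F \<Longrightarrow> mul (\<lambda>r. f r + g r) k = (\<lambda>r. mul f k r + mul g k r)"
      "f \<in> F \<Longrightarrow> g \<in> F \<Longrightarrow> k \<in> F \<Longrightarrow> mul k (\<lambda>r. f r + g r) = (\<lambda>r. mul k f r + mul k g r)"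
    and mul_scale: "f \<in> F \<Longrightarrow> g \<in> F \<Longrightarrow> mul (\<lambda>r. c * f r) g = (\<lambda>r. c * mul f g r)"
      "f \<in> F \<Longrightarrow> g \<in> F \<Longrightarrow> mul f (\<lambda>r. c * g r) = (\<lambda>r. c * mul f g r)"
begin

lemma assoc_algebra: "assoc_algebra (seq_algebra C R u)"
proof -
  let ?S = "seq_algebra C R u"
  have el: "\<exists>f\<in>F. X = cls f" if "X \<in> carrier ?S" for X using that carrier_eq by auto
  have mem: "cls f \<in> carrier ?S" if "f \<in> F" for f using that carrier_eq by simp
  note simps = mult_cls add_cls smult_cls one_cls zero_cls F_closed mem
  have ag: "abelian_group ?S"
  proof (rule abelian_groupI)
    fix X assume "X \<in> carrier ?S"
    then obtain f where f: "f \<in> F" "X = cls f" using el by blast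
    show "\<exists>Y\<in>carrier ?S. Y \<oplus>\<^bsub>?S\<^esub> X = \<zero>\<^bsub>?S\<^esub>"
      using f F_closed(3)[of f "-1"] by (intro bexI[of _ "cls (\<lambda>r. -1 * f r)"]) (simp_all add: simps)
  qed (auto dest!: el simp: simps add_ac)
  have mon: "monoid ?S"
    by (rule monoidI) (auto dest!: el simp: simps mul_assoc mul_one)
  have "ring ?S"
    by (rule ringI[OF ag mon]) (auto dest!: el simp: simps mul_add)
  moreover have "module complex_field ?S"
    by (rule moduleI[OF cring_complex_field ag])
      (auto dest!: el simp: simps complex_field_def algebra_simps)
  moreover have "(c \<odot>\<^bsub>?S\<^esub> X) \<otimes>\<^bsub>?S\<^esub> Y = c \<odot>\<^bsub>?S\<^esub> (X \<otimes>\<^bsub>?S\<^esub> Y) \<and>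
       X \<otimes>\<^bsub>?S\<^esub> (c \<odot>\<^bsub>?S\<^esub> Y) = c \<odot>\<^bsub>?S\<^esub> (X \<otimes>\<^bsub>?S\<^esub> Y)" if "X \<in> carrier ?S" "Y \<in> carrier ?S" for c X Y
  proof -
    obtain f g where "f \<in> F" "X = cls f" "g \<in> F" "Y = cls g" using el \<open>X \<in> carrier ?S\<close> \<open>Y \<in> carrier ?S\<close> by metis
    then show ?thesis by (simp add: simps mul_scale)
  qed
  ultimately show ?thesis by (simp add: assoc_algebra_def)
qed

end

text \<open>Each class is sent to the class with the same limit function.\<close>

lemma seq_rep_iso:
  assumes 1: "seq_rep C1 R1 u1 \<Phi>1 F" and 2: "seq_rep C2 R2 u2 \<Phi>2 F"
  shows "\<exists>h. h \<in> algebra_iso (seq_algebra C1 R1 u1) (seq_algebra C2 R2 u2)"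
proof -
  interpret A: seq_rep C1 R1 u1 \<Phi>1 F by (rule 1)
  interpret B: seq_rep C2 R2 u2 \<Phi>2 F by (rule 2)
  let ?S = "seq_algebra C1 R1 u1" and ?T = "seq_algebra C2 R2 u2"
  define h where "h X = B.cls (inv_into F A.cls X)" for X
  have inj: "inj_on A.cls F" "inj_on B.cls F"
    using A.cls_inj B.cls_inj by (auto simp: inj_on_def)
  have h: "h (A.cls f) = B.cls f" if "f \<in> F" for f
    using that inj(1) by (simp add: h_def)
  have el: "\<exists>f\<in>F. X = A.cls f" if "X \<in> carrier ?S" for X using that A.carrier_eq by auto
  note simps = A.mult_cls A.add_cls A.smult_cls A.one_cls B.mult_cls B.add_cls B.smult_cls B.one_cls A.F_closed h
  have "h \<in> ring_iso ?S ?T"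
  proof (rule ring_iso_memI)
    show "h X \<in> carrier ?T" if "X \<in> carrier ?S" for X
      using el[OF that] B.carrier_eq by (auto simp: h)
    show "h (X \<otimes>\<^bsub>?S\<^esub> Y) = h X \<otimes>\<^bsub>?T\<^esub> h Y" if "X \<in> carrier ?S" "Y \<in> carrier ?S" for X Y
      using el[OF that(1)] el[OF that(2)] by (auto simp: simps)
    show "h (X \<oplus>\<^bsub>?S\<^esub> Y) = h X \<oplus>\<^bsub>?T\<^esub> h Y" if "X \<in> carrier ?S" "Y \<in> carrier ?S" for X Y
      using el[OF that(1)] el[OF that(2)] by (auto simp: simps)
    show "h \<one>\<^bsub>?S\<^esub> = \<one>\<^bsub>?T\<^esub>" by (simp add: simps)
    have "bij_betw A.cls F (carrier ?S)" "bij_betw B.cls F (carrier ?T)"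
      using inj by (simp_all add: bij_betw_def A.carrier_eq B.carrier_eq)
    then have "bij_betw (B.cls \<circ> inv_into F A.cls) (carrier ?S) (carrier ?T)"
      using bij_betw_trans[OF bij_betw_inv_into] by blast
    then show "bij_betw h (carrier ?S) (carrier ?T)" by (simp add: h_def[abs_def] comp_def)
  qed
  moreover have "h (c \<odot>\<^bsub>?S\<^esub> X) = c \<odot>\<^bsub>?T\<^esub> h X" if "X \<in> carrier ?S" for c X
    using el[OF that] by (auto simp: simps)
  ultimately show ?thesis by (auto simp: algebra_iso_def)
qed

lemma centralizer_seq_rep:
  "seq_rep (\<Union>m. A_seqs m) A_equiv (\<lambda>n. 1\<^sub>m n) (limz mrel) {f. \<exists>m \<alpha>. zconv m \<alpha> f}"
  by (rule seq_rep.intro; intro A_equiv_iff A_all_image A_all_mult A_all_add A_all_scale A_all_one conjI A_all_zero; assumption)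

text \<open>After passing to a common \<open>m\<close>, both sides of each law are limits of the
  same sequence in the group algebra. This also supplies the ring laws for the sequences of
  matrices.\<close>

lemma mul_laws:
  fixes f g k
  assumes f: "\<exists>m \<alpha>. zconv m \<alpha> f" and g: "\<exists>m \<alpha>. zconv m \<alpha> g" and k: "\<exists>m \<alpha>. zconv m \<alpha> k"
  shows "mul (mul f g) k = mul f (mul g k)" "mul unit_fun f = f" "mul f unit_fun = f"
    "mul (\<lambda>r. f r + g r) k = (\<lambda>r. mul f k r + mul g k r)" "mul k (\<lambda>r. f r + g r) = (\<lambda>r. mul k f r + mul k g r)"
    "mul (\<lambda>r. c * f r) g = (\<lambda>r. c * mul f g r)" "mul f (\<lambda>r. c * g r) = (\<lambda>r. c * mul f g r)"
proof -
  obtain m1 \<alpha> where 1: "zconv m1 \<alpha> f" using f by blast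
  obtain m2 \<beta> where 2: "zconv m2 \<beta> g" using g by blast
  obtain m3 \<gamma> where 3: "zconv m3 \<gamma> k" using k by blast
  let ?m = "m1 + m2 + m3"
  have a: "zconv ?m \<alpha> f" and b: "zconv ?m \<beta> g" and c: "zconv ?m \<gamma> k"
    by (rule zconv_mono[OF _ 1], simp, rule zconv_mono[OF _ 2], simp, rule zconv_mono[OF _ 3], simp)
  have one: "zconv ?m (\<lambda>n. delta 1) unit_fun" by (rule zconv_delta) simp
  have uniq: "x = y" if "zconv ?m \<delta> x" "zconv ?m \<delta>' y" "\<And>n. \<delta> n = \<delta>' n" for x y \<delta> \<delta>'
    using limz_zconv[OF that(1)] limz_zconv[OF that(2)] that(3) by (metis ext)
  show "mul (mul f g) k = mul f (mul g k)"
    by (rule uniq[OF zconv_mult[OF zconv_mult[OF a b] c] zconv_mult[OF a zconv_mult[OF b c]]]) (rule conv_assoc)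
  show "mul unit_fun f = f" by (rule uniq[OF zconv_mult[OF one a] a]) (rule conv_one_left)
  show "mul f unit_fun = f" by (rule uniq[OF zconv_mult[OF a one] a]) (rule conv_one_right)
  show "mul (\<lambda>r. f r + g r) k = (\<lambda>r. mul f k r + mul g k r)"
    by (rule uniq[OF zconv_mult[OF zconv_add[OF a b] c] zconv_add[OF zconv_mult[OF a c] zconv_mult[OF b c]]])
       (rule conv_add_left)
  show "mul k (\<lambda>r. f r + g r) = (\<lambda>r. mul k f r + mul k g r)"
    by (rule uniq[OF zconv_mult[OF c zconv_add[OF a b]] zconv_add[OF zconv_mult[OF c a] zconv_mult[OF c b]]])
       (rule conv_add_right)
  show "mul (\<lambda>r. c * f r) g = (\<lambda>r. c * mul f g r)" for c
    by (rule uniq[OF zconv_mult[OF zconv_scale[OF a] b] zconv_scale[OF zconv_mult[OF a b]]]) (rule conv_scale_left)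
  show "mul f (\<lambda>r. c * g r) = (\<lambda>r. c * mul f g r)" for c
    by (rule uniq[OF zconv_mult[OF a zconv_scale[OF b]] zconv_scale[OF zconv_mult[OF a b]]]) (rule conv_scale_right)
qed

lemma fun_algebra_of_seq_rep:
  assumes "seq_rep C R u \<Phi> {f. \<exists>m \<alpha>. zconv m \<alpha> f}"
  shows "assoc_algebra (seq_algebra C R u)"
proof -
  interpret seq_rep C R u \<Phi> "{f. \<exists>m \<alpha>. zconv m \<alpha> f}" by (rule assms)
  interpret fun_algebra C R u \<Phi> "{f. \<exists>m \<alpha>. zconv m \<alpha> f}"
    by unfold_locales (simp_all only: mem_Collect_eq mul_laws)
  show ?thesis by (rule assoc_algebra)
qed

section \<open>The spaces \<open>H_T\<close>\<close>

definition nsq :: "(nat perm \<Rightarrow>\<^sub>0 complex) \<Rightarrow> real"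
  where "nsq x = (\<Sum>g\<in>Poly_Mapping.keys x. (cmod (Poly_Mapping.lookup x g))\<^sup>2)"

lemma norm_pi_sq: "(norm_pi x)\<^sup>2 = nsq x"
  by (simp add: norm_pi_def nsq_def sum_nonneg)

lemma nsq_nonneg [simp]: "nsq x \<ge> 0"
  by (simp add: nsq_def sum_nonneg)

lemma nsq_superset:
  assumes "finite A" "Poly_Mapping.keys x \<subseteq> A"
  shows "nsq x = (\<Sum>g\<in>A. (cmod (Poly_Mapping.lookup x g))\<^sup>2)"
  unfolding nsq_def using assms by (intro sum.mono_neutral_left) (auto simp: in_keys_iff)

lemma nsq_0 [simp]: "nsq 0 = 0"
  by (simp add: nsq_def)

lemma nsq_add_le: "nsq (x + y) \<le> 2 * nsq x + 2 * nsq y"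
proof -
  let ?A = "Poly_Mapping.keys x \<union> Poly_Mapping.keys y"
  have "(cmod (a + b))\<^sup>2 \<le> 2 * (cmod a)\<^sup>2 + 2 * (cmod b)\<^sup>2" for a b
  proof -
    have "(cmod (a + b))\<^sup>2 \<le> (cmod a + cmod b)\<^sup>2" by (intro power_mono norm_triangle_ineq) simp
    also have "\<dots> \<le> 2 * (cmod a)\<^sup>2 + 2 * (cmod b)\<^sup>2"
      using sum_squares_bound[of "cmod a" "cmod b"] by (simp add: power2_sum)
    finally show ?thesis .
  qed
  then have "(\<Sum>g\<in>?A. (cmod (Poly_Mapping.lookup (x + y) g))\<^sup>2) \<le>
      (\<Sum>g\<in>?A. 2 * (cmod (Poly_Mapping.lookup x g))\<^sup>2 + 2 * (cmod (Poly_Mapping.lookup y g))\<^sup>2)"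
    by (intro sum_mono) (simp add: lookup_add)
  then show ?thesis
    using keys_add[of x y]
    by (simp add: nsq_superset[of ?A] sum.distrib sum_distrib_left)
qed

lemma nsq_scale: "nsq (scale c x) = (cmod c)\<^sup>2 * nsq x"
  using keys_scale[of c x]
  by (simp add: nsq_superset[of "Poly_Mapping.keys x"] norm_mult power_mult_distrib sum_distrib_left)

lemma lookup_le_nsq: "(cmod (Poly_Mapping.lookup x g))\<^sup>2 \<le> nsq x"
proof (cases "g \<in> Poly_Mapping.keys x")
  case True
  show ?thesis unfolding nsq_def
    by (rule member_le_sum[OF True]) auto
next
  case False
  then show ?thesis by (simp add: in_keys_iff)
qed

lemma row_group_subset: "row_group lam \<subseteq> Sn (sum_list lam)"
  and col_group_subset: "col_group lam \<subseteq> Sn (sum_list lam)"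
  by (auto simp: row_group_def col_group_def)

lemma young_symmetrizer_span: "young_symmetrizer lam \<in> span_of (Sn (sum_list lam))"
  unfolding young_symmetrizer_def
proof (rule span_of_conv)
  show "(\<Sum>p\<in>row_group lam. delta p) \<in> span_of (Sn (sum_list lam))"
    using row_group_subset[of lam] by (intro span_of_sum span_of_single) auto
  show "(\<Sum>q\<in>col_group lam. Poly_Mapping.single q (of_int (sign (apply q)))) \<in> span_of (Sn (sum_list lam))"
    using col_group_subset[of lam] by (intro span_of_sum span_of_single) auto
qed (rule Sn_mult)

lemma H_pi_iff: "x \<in> H_pi lam \<longleftrightarrow> (\<exists>y\<in>span_of (Sn (sum_list lam)). x = y \<star> young_symmetrizer lam)"
  by (auto simp: H_pi_def)

lemma H_pi_span: "x \<in> H_pi lam \<Longrightarrow> x \<in> span_of (Sn (sum_list lam))"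
  unfolding H_pi_def using young_symmetrizer_span Sn_mult by (auto intro!: span_of_conv)

lemma H_pi_add: "x \<in> H_pi lam \<Longrightarrow> y \<in> H_pi lam \<Longrightarrow> x + y \<in> H_pi lam"
proof -
  assume "x \<in> H_pi lam" "y \<in> H_pi lam"
  then obtain a b where "a \<in> span_of (Sn (sum_list lam))" "x = a \<star> young_symmetrizer lam"
    "b \<in> span_of (Sn (sum_list lam))" "y = b \<star> young_symmetrizer lam" by (auto simp: H_pi_iff)
  then show ?thesis unfolding H_pi_iff by (intro bexI[of _ "a + b"]) (simp_all add: conv_add_left span_of_add)
qed

lemma H_pi_scale: "x \<in> H_pi lam \<Longrightarrow> scale c x \<in> H_pi lam"
  unfolding H_pi_iff by (elim bexE) (rule bexI[OF _ span_of_scale], auto simp: conv_scale_left)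

lemma H_pi_0: "0 \<in> H_pi lam"
  unfolding H_pi_iff by (rule bexI[OF _ span_of_0]) simp

lemma H_pi_sum: "(\<And>i. i \<in> I \<Longrightarrow> f i \<in> H_pi lam) \<Longrightarrow> sum f I \<in> H_pi lam"
  by (induction I rule: infinite_finite_induct) (simp_all add: H_pi_0 H_pi_add)

lemma H_pi_rep: "s \<in> Sn (sum_list lam) \<Longrightarrow> x \<in> H_pi lam \<Longrightarrow> delta s \<star> x \<in> H_pi lam"
proof -
  assume s: "s \<in> Sn (sum_list lam)" and "x \<in> H_pi lam"
  then obtain y where y: "x = y \<star> young_symmetrizer lam" "y \<in> span_of (Sn (sum_list lam))"
    by (auto simp: H_pi_def)
  have "delta s \<star> x = (delta s \<star> y) \<star> young_symmetrizer lam" by (simp add: y conv_assoc)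
  moreover have "delta s \<star> y \<in> span_of (Sn (sum_list lam))"
    using y s by (intro span_of_conv span_of_single Sn_mult)
  ultimately show ?thesis unfolding H_pi_def by blast
qed

section \<open>Points of \<open>Omega l\<close> as injections\<close>

definition relw :: "inf_mat \<Rightarrow> rel2"
  where "relw w = {(i, j). w i j = 1}"

lemma OmegaD:
  assumes "w \<in> Omega l"
  shows "one_one (relw w)" "Domain (relw w) = {..<l}" "finite (relw w)"
proof -
  have w: "\<And>i j. i \<ge> l \<Longrightarrow> w i j = 0" "\<And>i. i < l \<Longrightarrow> \<exists>!j. w i j = 1"
    "\<And>i i' j. w i j = 1 \<Longrightarrow> w i' j = 1 \<Longrightarrow> i = i'"
    using assms unfolding Omega_def by blast+
  have lt: "i < l" if "w i j = 1" for i j using w(1)[of i j] that by (metis not_le zero_neq_one)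
  show oo: "one_one (relw w)"
  proof (rule one_oneI)
    fix i j j' assume "(i, j) \<in> relw w" "(i, j') \<in> relw w"
    then have "w i j = 1" "w i j' = 1" by (simp_all add: relw_def)
    then show "j = j'" using w(2)[OF lt[of i j]] by blast
  next
    fix i i' j assume "(i, j) \<in> relw w" "(i', j) \<in> relw w"
    then show "i = i'" using w(3)[of i j i'] by (simp add: relw_def)
  qed
  show D: "Domain (relw w) = {..<l}"
  proof (intro equalityI subsetI)
    fix i assume "i \<in> Domain (relw w)"
    then show "i \<in> {..<l}" using lt by (auto simp: relw_def)
  next
    fix i assume "i \<in> {..<l}"
    then obtain j where "w i j = 1" using w(2)[of i] by auto
    then show "i \<in> Domain (relw w)" by (auto simp: relw_def)
  qed
  have "relw w \<subseteq> (\<lambda>i. (i, THE j. (i, j) \<in> relw w)) ` {..<l}"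
  proof
    fix p assume p: "p \<in> relw w"
    obtain i j where ij: "p = (i, j)" by force
    have "i \<in> Domain (relw w)" using p ij by auto
    then have "i < l" using D by simp
    moreover have "(THE j. (i, j) \<in> relw w) = j" using p ij one_one_eq1[OF oo] by blast
    ultimately show "p \<in> (\<lambda>i. (i, THE j. (i, j) \<in> relw w)) ` {..<l}" using ij by force
  qed
  then show "finite (relw w)" by (rule finite_subset) simp
qed

definition of_rel :: "rel2 \<Rightarrow> inf_mat"
  where "of_rel r = (\<lambda>i j. if (i, j) \<in> r then 1 else 0)"

lemma relw_of_rel [simp]: "relw (of_rel r) = r"
  by (auto simp: relw_def of_rel_def split: if_splits)

lemma of_rel_relw: "w \<in> Omega l \<Longrightarrow> of_rel (relw w) = w"
proof (intro ext)
  fix i j assume "w \<in> Omega l"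
  then have "w i j \<in> {0, 1}" unfolding Omega_def by blast
  then show "of_rel (relw w) i j = w i j" by (auto simp: of_rel_def relw_def)
qed

lemma of_rel_Omega:
  assumes "one_one r" "Domain r = {..<l}"
  shows "of_rel r \<in> Omega l"
proof -
  have eq1: "of_rel r i j = 1 \<longleftrightarrow> (i, j) \<in> r" for i j by (simp add: of_rel_def)
  have "\<exists>!j. of_rel r i j = 1" if "i < l" for i
  proof -
    have "i \<in> Domain r" using assms(2) that by simp
    then obtain j where "(i, j) \<in> r" by blast
    then show ?thesis unfolding eq1 using one_one_eq1[OF assms(1)] by blast
  qed
  moreover have "of_rel r i j = 0" if "i \<ge> l" for i j
  proof -
    have "i \<notin> Domain r" using assms(2) that by simp
    then show ?thesis by (auto simp: of_rel_def)
  qed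
  moreover have "i = i'" if "of_rel r i j = 1 \<and> of_rel r i' j = 1" for i i' j
    using that one_one_eq2[OF assms(1)] unfolding eq1 by blast
  moreover have "of_rel r i j \<in> {0, 1}" for i j by (simp add: of_rel_def)
  ultimately show ?thesis unfolding Omega_def mem_Collect_eq by blast
qed

lemma relw_inj: "w \<in> Omega l \<Longrightarrow> w' \<in> Omega l \<Longrightarrow> relw w = relw w' \<Longrightarrow> w = w'"
  using of_rel_relw by metis

lemma mat_prod_right: "mat_prod w (perm_mat g) = (\<lambda>i j. w i (g \<langle>$\<rangle> j))"
proof (intro ext)
  fix i j
  have "(\<lambda>k. w i k * (if g \<langle>$\<rangle> j = k then 1 else 0)) = (\<lambda>k. if k = g \<langle>$\<rangle> j then w i k else 0)" by auto
  then show "mat_prod w (perm_mat g) i j = w i (g \<langle>$\<rangle> j)"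
    unfolding mat_prod_def perm_mat_def by (simp only: Sum_any.delta)
qed

lemma mat_prod_left: "mat_prod (perm_mat s) w = (\<lambda>i j. w (inverse s \<langle>$\<rangle> i) j)"
proof (intro ext)
  fix i j
  have "(\<lambda>k. (if s \<langle>$\<rangle> k = i then 1 else 0) * w k j) = (\<lambda>k. if k = inverse s \<langle>$\<rangle> i then w k j else 0)"
    by (rule ext) (simp add: apply_eq_iff_inverse')
  then show "mat_prod (perm_mat s) w i j = w (inverse s \<langle>$\<rangle> i) j"
    unfolding mat_prod_def perm_mat_def by (simp only: Sum_any.delta)
qed

lemma relw_right: "relw (mat_prod w (perm_mat g)) = relw w O prel g"
  by (auto simp: mat_prod_right relw_def)

lemma in_prel_relcomp: "(i, j) \<in> prel s O r \<longleftrightarrow> (inverse s \<langle>$\<rangle> i, j) \<in> r"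
proof
  assume "(inverse s \<langle>$\<rangle> i, j) \<in> r"
  moreover have "(i, inverse s \<langle>$\<rangle> i) \<in> prel s" by simp
  ultimately show "(i, j) \<in> prel s O r" by blast
qed auto

lemma relw_left: "relw (mat_prod (perm_mat s) w) = prel s O relw w"
  by (intro equalityI subrelI) (simp_all only: in_prel_relcomp, simp_all add: mat_prod_left relw_def)

lemma mat_prod_right_inverse [simp]:
  "mat_prod (mat_prod w (perm_mat g)) (perm_mat (inverse g)) = w"
  "mat_prod (mat_prod w (perm_mat (inverse g))) (perm_mat g) = w"
  by (simp_all add: mat_prod_right)

lemma mat_prod_left_inverse [simp]:
  "mat_prod (perm_mat (inverse g)) (mat_prod (perm_mat g) w) = w"
  "mat_prod (perm_mat g) (mat_prod (perm_mat (inverse g)) w) = w"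
  by (simp_all add: mat_prod_left)

lemma Omega_iff: "w \<in> Omega l \<longleftrightarrow> one_one (relw w) \<and> Domain (relw w) = {..<l} \<and> (\<forall>i j. w i j \<in> {0, 1})"
proof
  assume w: "w \<in> Omega l"
  have "\<forall>i j. w i j \<in> {0, 1}" using w unfolding Omega_def by blast
  then show "one_one (relw w) \<and> Domain (relw w) = {..<l} \<and> (\<forall>i j. w i j \<in> {0, 1})" using OmegaD[OF w] by blast
next
  assume h: "one_one (relw w) \<and> Domain (relw w) = {..<l} \<and> (\<forall>i j. w i j \<in> {0, 1})"
  then have "of_rel (relw w) \<in> Omega l" using of_rel_Omega by blast
  moreover have "of_rel (relw w) = w"
  proof (intro ext)
    fix i j
    have "w i j \<in> {0, 1}" using h by blast
    then show "of_rel (relw w) i j = w i j" by (auto simp: of_rel_def relw_def)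
  qed
  ultimately show "w \<in> Omega l" by simp
qed

lemma Omega_right1: "w \<in> Omega l \<Longrightarrow> mat_prod w (perm_mat g) \<in> Omega l"
proof -
  assume w: "w \<in> Omega l"
  have "Domain (relw w O prel g) = Domain (relw w)"
  proof (intro equalityI subsetI)
    fix i assume "i \<in> Domain (relw w)"
    then obtain j where "(i, j) \<in> relw w" by blast
    moreover have "(j, inverse g \<langle>$\<rangle> j) \<in> prel g" by simp
    ultimately show "i \<in> Domain (relw w O prel g)" by blast
  qed blast
  moreover have "one_one (relw w O prel g)" using w by (intro one_one_relcomp) (auto simp: Omega_iff)
  ultimately show ?thesis using w unfolding Omega_iff relw_right by (auto simp: mat_prod_right)
qed

lemma Omega_right [simp]: "mat_prod w (perm_mat g) \<in> Omega l \<longleftrightarrow> w \<in> Omega l"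
  using Omega_right1[of w l g] Omega_right1[of "mat_prod w (perm_mat g)" l "inverse g"] by auto

lemma Omega_left1: "w \<in> Omega l \<Longrightarrow> s \<in> Sn l \<Longrightarrow> mat_prod (perm_mat s) w \<in> Omega l"
proof -
  assume w: "w \<in> Omega l" and s: "s \<in> Sn l"
  have "Domain (prel s O relw w) = {..<l}"
  proof -
    have "i \<in> Domain (prel s O relw w) \<longleftrightarrow> inverse s \<langle>$\<rangle> i \<in> Domain (relw w)" for i
      unfolding Domain_iff in_prel_relcomp ..
    then show ?thesis using OmegaD(2)[OF w] Sn_less[of "inverse s" l] s by auto
  qed
  moreover have "one_one (prel s O relw w)" using w by (intro one_one_relcomp) (auto simp: Omega_iff)
  ultimately show ?thesis using w unfolding Omega_iff relw_left by (auto simp: mat_prod_left)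
qed

lemma bij_Omega_right: "bij_betw (\<lambda>w. mat_prod w (perm_mat g)) (Omega l) (Omega l)"
  by (rule bij_betwI[where g = "\<lambda>w. mat_prod w (perm_mat (inverse g))"]) auto

section \<open>Vectors and strong limits\<close>

lemma H_T_iff: "\<phi> \<in> H_T lam \<longleftrightarrow> (\<forall>w. w \<notin> Omega (sum_list lam) \<longrightarrow> \<phi> w = 0) \<and>
     (\<forall>w\<in>Omega (sum_list lam). \<phi> w \<in> H_pi lam) \<and>
     (\<lambda>w. nsq (\<phi> w)) summable_on Omega (sum_list lam) \<and>
     (\<forall>s\<in>Sn (sum_list lam). \<forall>w\<in>Omega (sum_list lam). \<phi> (mat_prod (perm_mat s) w) = delta s \<star> \<phi> w)"
  by (simp add: H_T_def norm_pi_sq pi_rep_def)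

lemma norm_T_eq: "norm_T lam \<phi> = sqrt (\<Sum>\<^sub>\<infinity>w\<in>Omega (sum_list lam). nsq (\<phi> w))"
  by (simp add: norm_T_def norm_pi_sq)

lemma nsq_summable_add:
  assumes "(\<lambda>w. nsq (\<phi> w)) summable_on A" "(\<lambda>w. nsq (\<psi> w)) summable_on A"
  shows "(\<lambda>w. nsq (\<phi> w + \<psi> w)) summable_on A"
proof (rule summable_on_comparison_test)
  show "(\<lambda>w. 2 * nsq (\<phi> w) + 2 * nsq (\<psi> w)) summable_on A"
    using assms by (intro summable_on_add summable_on_cmult_right)
qed (simp_all add: nsq_add_le)

lemma H_T_add:
  assumes "\<phi> \<in> H_T lam" "\<psi> \<in> H_T lam"
  shows "(\<lambda>w. \<phi> w + \<psi> w) \<in> H_T lam"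
  using assms unfolding H_T_iff by (auto simp: H_pi_add nsq_summable_add conv_add_right)

lemma H_T_scale:
  assumes "\<phi> \<in> H_T lam"
  shows "(\<lambda>w. scale c (\<phi> w)) \<in> H_T lam"
  using assms unfolding H_T_iff
  by (auto simp: H_pi_scale nsq_scale conv_scale_right intro: summable_on_cmult_right)

lemma H_T_0: "(\<lambda>w. 0) \<in> H_T lam"
  unfolding H_T_iff by (auto simp: H_pi_0)

lemma H_T_sum: "(\<And>i. i \<in> I \<Longrightarrow> \<phi> i \<in> H_T lam) \<Longrightarrow> (\<lambda>w. \<Sum>i\<in>I. \<phi> i w) \<in> H_T lam"
  by (induction I rule: infinite_finite_induct) (simp_all add: H_T_0 H_T_add)

lemma H_T_diff: "\<phi> \<in> H_T lam \<Longrightarrow> \<psi> \<in> H_T lam \<Longrightarrow> (\<lambda>w. \<phi> w - \<psi> w) \<in> H_T lam"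
  using H_T_add[of \<phi> lam "\<lambda>w. scale (-1) (\<psi> w)"] H_T_scale[of \<psi> lam "-1"] by simp

lemma H_T_T_rep:
  assumes "\<phi> \<in> H_T lam"
  shows "T_rep g \<phi> \<in> H_T lam"
proof -
  let ?O = "Omega (sum_list lam)"
  have sm: "(\<lambda>w. nsq (\<phi> w)) summable_on ?O" using assms by (simp add: H_T_iff)
  have "(\<lambda>w. nsq (\<phi> (mat_prod w (perm_mat g)))) summable_on ?O"
    using summable_on_reindex_bij_betw[OF bij_Omega_right, of "\<lambda>w. nsq (\<phi> w)"] sm by blast
  moreover have "mat_prod (mat_prod (perm_mat s) w) (perm_mat g) =
      mat_prod (perm_mat s) (mat_prod w (perm_mat g))" for s w
    by (simp add: mat_prod_left mat_prod_right)
  ultimately show ?thesis using assms unfolding H_T_iff T_rep_def by simp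
qed

lemma H_T_T_alg: "\<phi> \<in> H_T lam \<Longrightarrow> T_alg a \<phi> \<in> H_T lam"
  unfolding T_alg_def by (intro H_T_sum H_T_scale H_T_T_rep)

lemma lookup_le_norm_T:
  assumes "\<phi> \<in> H_T lam"
  shows "cmod (Poly_Mapping.lookup (\<phi> w) g) \<le> norm_T lam \<phi>"
proof (cases "w \<in> Omega (sum_list lam)")
  case True
  have sm: "(\<lambda>w. nsq (\<phi> w)) summable_on Omega (sum_list lam)" using assms by (simp add: H_T_iff)
  have "nsq (\<phi> w) = (\<Sum>\<^sub>\<infinity>w\<in>{w}. nsq (\<phi> w))" by simp
  also have "\<dots> \<le> (\<Sum>\<^sub>\<infinity>w\<in>Omega (sum_list lam). nsq (\<phi> w))"
    using sm True by (intro infsum_mono2) auto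
  finally have "(cmod (Poly_Mapping.lookup (\<phi> w) g))\<^sup>2 \<le> (\<Sum>\<^sub>\<infinity>w\<in>Omega (sum_list lam). nsq (\<phi> w))"
    using lookup_le_nsq[of "\<phi> w" g] by linarith
  then show ?thesis unfolding norm_T_eq by (rule real_le_rsqrt)
next
  case False
  then have "\<phi> w = 0" using assms by (simp add: H_T_iff)
  then show ?thesis by (simp add: norm_T_eq infsum_nonneg)
qed

lemma sot_limit_pointwise:
  assumes "sot_limit lam \<alpha> A" "\<phi> \<in> H_T lam"
  shows "(\<lambda>n. Poly_Mapping.lookup (T_alg (\<alpha> n) \<phi> w) g) \<longlonglongrightarrow> Poly_Mapping.lookup (A \<phi> w) g"
proof -
  have "A \<in> bounded_ops lam" using assms(1) by (simp only: sot_limit_def)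
  then have A: "A \<phi> \<in> H_T lam" using assms(2) unfolding bounded_ops_def by blast
  have lim: "(\<lambda>n. norm_T lam (\<lambda>w. T_alg (\<alpha> n) \<phi> w - A \<phi> w)) \<longlonglongrightarrow> 0"
    using assms by (simp add: sot_limit_def)
  have "(\<lambda>n. Poly_Mapping.lookup (T_alg (\<alpha> n) \<phi> w) g - Poly_Mapping.lookup (A \<phi> w) g) \<longlonglongrightarrow> 0"
  proof (rule tendsto_0_norm_le[OF _ lim], rule eventuallyI)
    fix n
    have "(\<lambda>w. T_alg (\<alpha> n) \<phi> w - A \<phi> w) \<in> H_T lam" by (intro H_T_diff H_T_T_alg assms A)
    from lookup_le_norm_T[OF this, of w g]
    show "norm (Poly_Mapping.lookup (T_alg (\<alpha> n) \<phi> w) g - Poly_Mapping.lookup (A \<phi> w) g) \<le>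
      norm_T lam (\<lambda>w. T_alg (\<alpha> n) \<phi> w - A \<phi> w)" by (simp add: lookup_minus)
  qed
  then show ?thesis by (rule LIM_zero_cancel)
qed

text \<open>On \<open>H_T lam\<close> a strong limit is determined by coordinates, and elsewhere
  both operators are undefined by extensionality. This justifies the definite description in
  \<open>T_bar\<close>.\<close>

lemma sot_limit_unique:
  assumes "sot_limit lam \<alpha> A" "sot_limit lam \<alpha> B"
  shows "A = B"
proof
  fix \<phi>
  show "A \<phi> = B \<phi>"
  proof (cases "\<phi> \<in> H_T lam")
    case True
    have "Poly_Mapping.lookup (A \<phi> w) g = Poly_Mapping.lookup (B \<phi> w) g" for w g
      using sot_limit_pointwise[OF assms(1) True] sot_limit_pointwise[OF assms(2) True] LIMSEQ_unique by blast
    then show ?thesis by (intro ext poly_mapping_eqI)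
  next
    case False
    have "A \<in> bounded_ops lam" "B \<in> bounded_ops lam" using assms by (simp_all only: sot_limit_def)
    then have AB: "A \<in> H_T lam \<rightarrow>\<^sub>E H_T lam" "B \<in> H_T lam \<rightarrow>\<^sub>E H_T lam"
      unfolding bounded_ops_def by blast+
    show ?thesis unfolding PiE_arb[OF AB(1) False] PiE_arb[OF AB(2) False] ..
  qed
qed

lemma T_bar_eq: "sot_limit lam \<alpha> A \<Longrightarrow> T_bar lam \<alpha> = A"
  unfolding T_bar_def by (rule the_equality) (auto intro: sot_limit_unique)

section \<open>Kernel operators\<close>

lemma weighted_square_sum_le:
  fixes k y :: "'i \<Rightarrow> real"
  assumes "\<And>i. i \<in> I \<Longrightarrow> k i \<ge> 0"
  shows "(\<Sum>i\<in>I. k i * y i)\<^sup>2 \<le> (\<Sum>i\<in>I. k i) * (\<Sum>i\<in>I. k i * (y i)\<^sup>2)"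
proof -
  have "(\<Sum>i\<in>I. k i * y i)\<^sup>2 = (\<Sum>i\<in>I. \<Sum>j\<in>I. (k i * k j) * (y i * y j))"
    by (simp add: power2_eq_square sum_product mult_ac)
  also have "\<dots> \<le> (\<Sum>i\<in>I. \<Sum>j\<in>I. (k i * k j) * (((y i)\<^sup>2 + (y j)\<^sup>2) / 2))"
  proof (intro sum_mono mult_left_mono)
    fix i j assume "i \<in> I" "j \<in> I"
    show "y i * y j \<le> ((y i)\<^sup>2 + (y j)\<^sup>2) / 2"
      using sum_squares_bound[of "y i" "y j"] by simp
    show "0 \<le> k i * k j" using assms \<open>i \<in> I\<close> \<open>j \<in> I\<close> by simp
  qed
  also have "\<dots> = ((\<Sum>i\<in>I. \<Sum>j\<in>I. k j * (k i * (y i)\<^sup>2)) + (\<Sum>i\<in>I. \<Sum>j\<in>I. k i * (k j * (y j)\<^sup>2))) / 2"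
    by (simp add: sum.distrib[symmetric] sum_divide_distrib algebra_simps add_divide_distrib)
  also have "(\<Sum>i\<in>I. \<Sum>j\<in>I. k j * (k i * (y i)\<^sup>2)) = (\<Sum>i\<in>I. \<Sum>j\<in>I. k i * (k j * (y j)\<^sup>2))"
    by (rule sum.swap)
  also have "(\<Sum>i\<in>I. \<Sum>j\<in>I. k i * (k j * (y j)\<^sup>2)) = (\<Sum>i\<in>I. k i) * (\<Sum>i\<in>I. k i * (y i)\<^sup>2)"
    by (simp add: sum_product)
  finally show ?thesis by simp
qed

lemma weighted_norm_square_le:
  fixes K x :: "'i \<Rightarrow> complex"
  shows "(cmod (\<Sum>i\<in>I. K i * x i))\<^sup>2 \<le> (\<Sum>i\<in>I. cmod (K i)) * (\<Sum>i\<in>I. cmod (K i) * (cmod (x i))\<^sup>2)"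
proof -
  have "cmod (\<Sum>i\<in>I. K i * x i) \<le> (\<Sum>i\<in>I. cmod (K i) * cmod (x i))"
    by (rule sum_norm_le) (simp add: norm_mult)
  then have "(cmod (\<Sum>i\<in>I. K i * x i))\<^sup>2 \<le> (\<Sum>i\<in>I. cmod (K i) * cmod (x i))\<^sup>2"
    by (intro power_mono) auto
  also have "\<dots> \<le> (\<Sum>i\<in>I. cmod (K i)) * (\<Sum>i\<in>I. cmod (K i) * (cmod (x i))\<^sup>2)"
    by (rule weighted_square_sum_le) simp
  finally show ?thesis .
qed

lemma schur_test:
  fixes K :: "'i \<Rightarrow> 'j \<Rightarrow> complex" and x :: "'j \<Rightarrow> complex"
  assumes "S \<ge> 0" "\<And>w. w \<in> W \<Longrightarrow> (\<Sum>v\<in>V. cmod (K w v)) \<le> S" "\<And>v. v \<in> V \<Longrightarrow> (\<Sum>w\<in>W. cmod (K w v)) \<le> S"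
  shows "(\<Sum>w\<in>W. (cmod (\<Sum>v\<in>V. K w v * x v))\<^sup>2) \<le> S\<^sup>2 * (\<Sum>v\<in>V. (cmod (x v))\<^sup>2)"
proof -
  have "(\<Sum>w\<in>W. (cmod (\<Sum>v\<in>V. K w v * x v))\<^sup>2) \<le> (\<Sum>w\<in>W. S * (\<Sum>v\<in>V. cmod (K w v) * (cmod (x v))\<^sup>2))"
  proof (rule sum_mono)
    fix w assume "w \<in> W"
    show "(cmod (\<Sum>v\<in>V. K w v * x v))\<^sup>2 \<le> S * (\<Sum>v\<in>V. cmod (K w v) * (cmod (x v))\<^sup>2)"
      by (rule order_trans[OF weighted_norm_square_le], rule mult_right_mono[OF assms(2)[OF \<open>w \<in> W\<close>]])
         (simp add: sum_nonneg)
  qed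
  also have "\<dots> = S * (\<Sum>w\<in>W. \<Sum>v\<in>V. cmod (K w v) * (cmod (x v))\<^sup>2)" by (simp add: sum_distrib_left)
  also have "(\<Sum>w\<in>W. \<Sum>v\<in>V. cmod (K w v) * (cmod (x v))\<^sup>2) = (\<Sum>v\<in>V. \<Sum>w\<in>W. cmod (K w v) * (cmod (x v))\<^sup>2)"
    by (rule sum.swap)
  also have "\<dots> = (\<Sum>v\<in>V. (\<Sum>w\<in>W. cmod (K w v)) * (cmod (x v))\<^sup>2)" by (simp add: sum_distrib_right)
  also have "S * \<dots> \<le> S * (\<Sum>v\<in>V. S * (cmod (x v))\<^sup>2)"
    using assms by (intro mult_left_mono sum_mono mult_right_mono) auto
  also have "\<dots> = S\<^sup>2 * (\<Sum>v\<in>V. (cmod (x v))\<^sup>2)" by (simp add: power2_eq_square sum_distrib_left mult.assoc)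
  finally show ?thesis .
qed

text \<open>In contrast to the Schur test this involves the sums of squares in the columns of the
  kernel. They become small for the kernels in question, and the factor \<open>card V\<close> is
  harmless for vectors of fixed finite support.\<close>

lemma finite_kernel_square_le:
  fixes K :: "'i \<Rightarrow> 'j \<Rightarrow> complex" and x :: "'j \<Rightarrow> complex"
  shows "(\<Sum>w\<in>W. (cmod (\<Sum>v\<in>V. K w v * x v))\<^sup>2) \<le>
    real (card V) * (\<Sum>v\<in>V. (\<Sum>w\<in>W. (cmod (K w v))\<^sup>2) * (cmod (x v))\<^sup>2)"
proof -
  have "(cmod (\<Sum>v\<in>V. K w v * x v))\<^sup>2 \<le> real (card V) * (\<Sum>v\<in>V. (cmod (K w v))\<^sup>2 * (cmod (x v))\<^sup>2)" for w
    using weighted_norm_square_le[of "\<lambda>v. 1" "\<lambda>v. K w v * x v" V] by (simp add: norm_mult power_mult_distrib)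
  then have "(\<Sum>w\<in>W. (cmod (\<Sum>v\<in>V. K w v * x v))\<^sup>2) \<le>
     (\<Sum>w\<in>W. real (card V) * (\<Sum>v\<in>V. (cmod (K w v))\<^sup>2 * (cmod (x v))\<^sup>2))" by (rule sum_mono)
  also have "\<dots> = real (card V) * (\<Sum>w\<in>W. \<Sum>v\<in>V. (cmod (K w v))\<^sup>2 * (cmod (x v))\<^sup>2)"
    by (simp add: sum_distrib_left)
  also have "(\<Sum>w\<in>W. \<Sum>v\<in>V. (cmod (K w v))\<^sup>2 * (cmod (x v))\<^sup>2) = (\<Sum>v\<in>V. (\<Sum>w\<in>W. (cmod (K w v))\<^sup>2) * (cmod (x v))\<^sup>2)"
    by (subst sum.swap) (simp add: sum_distrib_right)
  finally show ?thesis .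
qed

lemma nsq_kernel_sum:
  assumes A: "finite A" "\<And>v. v \<in> V \<Longrightarrow> Poly_Mapping.keys (\<phi> v) \<subseteq> A"
  shows "nsq (\<Sum>v\<in>V. scale (K v) (\<phi> v)) = (\<Sum>g\<in>A. (cmod (\<Sum>v\<in>V. K v * Poly_Mapping.lookup (\<phi> v) g))\<^sup>2)"
proof -
  have "(\<Sum>v\<in>V. scale (K v) (\<phi> v)) \<in> span_of A"
    using A by (intro span_of_sum span_of_scale) (auto simp: span_of_def)
  then have "Poly_Mapping.keys (\<Sum>v\<in>V. scale (K v) (\<phi> v)) \<subseteq> A" by (simp add: span_of_def)
  then show ?thesis by (simp add: nsq_superset[OF A(1)] lookup_sum')
qed

lemma schur_test_nsq:
  assumes A: "finite A" "\<And>v. v \<in> V \<Longrightarrow> Poly_Mapping.keys (\<phi> v) \<subseteq> A"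
    and "S \<ge> 0" "\<And>w. w \<in> W \<Longrightarrow> (\<Sum>v\<in>V. cmod (K w v)) \<le> S" "\<And>v. v \<in> V \<Longrightarrow> (\<Sum>w\<in>W. cmod (K w v)) \<le> S"
  shows "(\<Sum>w\<in>W. nsq (\<Sum>v\<in>V. scale (K w v) (\<phi> v))) \<le> S\<^sup>2 * (\<Sum>v\<in>V. nsq (\<phi> v))"
proof -
  have "(\<Sum>w\<in>W. nsq (\<Sum>v\<in>V. scale (K w v) (\<phi> v))) =
      (\<Sum>g\<in>A. \<Sum>w\<in>W. (cmod (\<Sum>v\<in>V. K w v * Poly_Mapping.lookup (\<phi> v) g))\<^sup>2)"
    by (simp add: nsq_kernel_sum[OF A] sum.swap[of _ A W])
  also have "\<dots> \<le> (\<Sum>g\<in>A. S\<^sup>2 * (\<Sum>v\<in>V. (cmod (Poly_Mapping.lookup (\<phi> v) g))\<^sup>2))"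
    using assms(3-5) by (intro sum_mono schur_test)
  also have "\<dots> = S\<^sup>2 * (\<Sum>v\<in>V. \<Sum>g\<in>A. (cmod (Poly_Mapping.lookup (\<phi> v) g))\<^sup>2)"
    by (subst sum.swap) (simp add: sum_distrib_left)
  also have "(\<Sum>v\<in>V. \<Sum>g\<in>A. (cmod (Poly_Mapping.lookup (\<phi> v) g))\<^sup>2) = (\<Sum>v\<in>V. nsq (\<phi> v))"
    by (intro sum.cong refl nsq_superset[symmetric] A)
  finally show ?thesis .
qed

lemma finite_kernel_nsq_le:
  assumes A: "finite A" "\<And>v. v \<in> V \<Longrightarrow> Poly_Mapping.keys (\<phi> v) \<subseteq> A"
  shows "(\<Sum>w\<in>W. nsq (\<Sum>v\<in>V. scale (K w v) (\<phi> v))) \<le>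
    real (card V) * (\<Sum>v\<in>V. (\<Sum>w\<in>W. (cmod (K w v))\<^sup>2) * nsq (\<phi> v))"
proof -
  have "(\<Sum>w\<in>W. nsq (\<Sum>v\<in>V. scale (K w v) (\<phi> v))) =
      (\<Sum>g\<in>A. \<Sum>w\<in>W. (cmod (\<Sum>v\<in>V. K w v * Poly_Mapping.lookup (\<phi> v) g))\<^sup>2)"
    by (simp add: nsq_kernel_sum[OF A] sum.swap[of _ A W])
  also have "\<dots> \<le> (\<Sum>g\<in>A. real (card V) * (\<Sum>v\<in>V. (\<Sum>w\<in>W. (cmod (K w v))\<^sup>2) * (cmod (Poly_Mapping.lookup (\<phi> v) g))\<^sup>2))"
    by (intro sum_mono finite_kernel_square_le)
  also have "\<dots> = real (card V) * (\<Sum>v\<in>V. \<Sum>g\<in>A. (\<Sum>w\<in>W. (cmod (K w v))\<^sup>2) * (cmod (Poly_Mapping.lookup (\<phi> v) g))\<^sup>2)"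
    by (subst sum.swap) (simp add: sum_distrib_left)
  also have "(\<Sum>v\<in>V. \<Sum>g\<in>A. (\<Sum>w\<in>W. (cmod (K w v))\<^sup>2) * (cmod (Poly_Mapping.lookup (\<phi> v) g))\<^sup>2) =
     (\<Sum>v\<in>V. (\<Sum>w\<in>W. (cmod (K w v))\<^sup>2) * nsq (\<phi> v))"
    using A by (intro sum.cong refl) (simp add: nsq_superset[OF A(1)] sum_distrib_left)
  finally show ?thesis .
qed

text \<open>The partial injection that \<open>g\<close> has to extend in order to carry
  \<open>w\<close> to \<open>v\<close>, see \<open>mat_prod_eq_iff_link\<close>.\<close>

definition link :: "inf_mat \<Rightarrow> inf_mat \<Rightarrow> rel2"
  where "link w v = (relw w)\<inverse> O relw v"

lemma link_converse: "(link w v)\<inverse> = link v w"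
  by (simp add: link_def converse_relcomp)

lemma linkD:
  assumes "w \<in> Omega l" "v \<in> Omega l"
  shows "one_one (link w v)" "Domain (link w v) = Range (relw w)" "Range (link w v) = Range (relw v)"
    "finite (link w v)" "card (link w v) = l"
proof -
  note w = OmegaD[OF assms(1)] and v = OmegaD[OF assms(2)]
  show oo: "one_one (link w v)" unfolding link_def using w v by (intro one_one_relcomp) auto
  show D: "Domain (link w v) = Range (relw w)"
  proof (intro equalityI subsetI)
    fix j assume "j \<in> Range (relw w)"
    then obtain i where i: "(i, j) \<in> relw w" by blast
    then have "i \<in> Domain (relw v)" using w(2) v(2) by blast
    then show "j \<in> Domain (link w v)" using i by (auto simp: link_def)
  qed (auto simp: link_def)
  show "Range (link w v) = Range (relw v)"
  proof (intro equalityI subsetI)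
    fix j assume "j \<in> Range (relw v)"
    then obtain i where i: "(i, j) \<in> relw v" by blast
    then have "i \<in> Domain (relw w)" using w(2) v(2) by blast
    then show "j \<in> Range (link w v)" using i by (auto simp: link_def)
  qed (auto simp: link_def)
  show "finite (link w v)" using w v by (simp add: link_def)
  have "card (link w v) = card (Range (relw w))" using card_Domain[OF oo] D by simp
  also have "\<dots> = card (Domain (relw w))" using card_Range[OF w(1)] card_Domain[OF w(1)] by simp
  finally show "card (link w v) = l" using w(2) by simp
qed

lemma relw_link:
  assumes "w \<in> Omega l" "v \<in> Omega l"
  shows "relw w O link w v = relw v"
proof (intro equalityI subrelI)
  note w = OmegaD[OF assms(1)] and v = OmegaD[OF assms(2)]
  fix i j assume "(i, j) \<in> relw w O link w v"
  then obtain k i' where "(i, k) \<in> relw w" "(i', k) \<in> relw w" "(i', j) \<in> relw v" by (auto simp: link_def)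
  then show "(i, j) \<in> relw v" using one_one_eq2[OF w(1)] by blast
next
  note w = OmegaD[OF assms(1)] and v = OmegaD[OF assms(2)]
  fix i j assume ij: "(i, j) \<in> relw v"
  then have "i \<in> Domain (relw w)" using w(2) v(2) by blast
  then show "(i, j) \<in> relw w O link w v" using ij by (auto simp: link_def)
qed

lemma link_inj: "w \<in> Omega l \<Longrightarrow> v \<in> Omega l \<Longrightarrow> v' \<in> Omega l \<Longrightarrow> link w v = link w v' \<Longrightarrow> v = v'"
  using relw_link relw_inj by metis

text \<open>This invariance is the reason why operators whose kernel depends on the link only
  preserve equivariance.\<close>

lemma link_left:
  assumes "s \<in> Sn l"
  shows "link (mat_prod (perm_mat s) w) (mat_prod (perm_mat s) v) = link w v"
proof (intro equalityI subrelI)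
  fix j k assume "(j, k) \<in> link (mat_prod (perm_mat s) w) (mat_prod (perm_mat s) v)"
  then obtain i where "(i, j) \<in> prel s O relw w" "(i, k) \<in> prel s O relw v"
    unfolding link_def relw_left by blast
  then show "(j, k) \<in> link w v" unfolding in_prel_relcomp link_def by blast
next
  fix j k assume "(j, k) \<in> link w v"
  then obtain i where i: "(i, j) \<in> relw w" "(i, k) \<in> relw v" by (auto simp: link_def)
  then have "(s \<langle>$\<rangle> i, j) \<in> prel s O relw w" "(s \<langle>$\<rangle> i, k) \<in> prel s O relw v"
    by (simp_all add: in_prel_relcomp)
  then show "(j, k) \<in> link (mat_prod (perm_mat s) w) (mat_prod (perm_mat s) v)"
    unfolding link_def relw_left by blast
qed

lemma mat_prod_eq_iff_link:
  assumes "w \<in> Omega l" "v \<in> Omega l"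
  shows "mat_prod w (perm_mat g) = v \<longleftrightarrow> link w v \<subseteq> prel g"
proof
  note w = OmegaD[OF assms(1)] and v = OmegaD[OF assms(2)]
  assume "mat_prod w (perm_mat g) = v"
  then have "relw v = relw w O prel g" using relw_right by metis
  then show "link w v \<subseteq> prel g" using one_one_eq1[OF w(1)] by (auto simp: link_def)
next
  assume h: "link w v \<subseteq> prel g"
  have sub: "relw v \<subseteq> relw (mat_prod w (perm_mat g))"
    unfolding relw_right relw_link[OF assms, symmetric] using h by blast
  have "mat_prod w (perm_mat g) \<in> Omega l" using assms by simp
  note u = OmegaD[OF this]
  have "relw (mat_prod w (perm_mat g)) \<subseteq> relw v"
  proof (rule subrelI)
    fix i j assume ij: "(i, j) \<in> relw (mat_prod w (perm_mat g))"
    then have "i \<in> Domain (relw v)" using u(2) OmegaD(2)[OF assms(2)] by blast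
    then obtain j' where j': "(i, j') \<in> relw v" by blast
    then have "(i, j') \<in> relw (mat_prod w (perm_mat g))" using sub by blast
    then show "(i, j) \<in> relw v" using one_one_eq1[OF u(1) ij] j' by blast
  qed
  then show "mat_prod w (perm_mat g) = v"
    using sub assms by (intro relw_inj[of _ l]) auto
qed

definition row_supp :: "nat \<Rightarrow> (rel2 \<Rightarrow> complex) \<Rightarrow> inf_mat \<Rightarrow> inf_mat set"
  where "row_supp l k w = {v \<in> Omega l. k (link w v) \<noteq> 0}"

text \<open>The sum runs over the support of a row only, which is finite both for \<open>Z a\<close>
  and for limit functions; so no infinite sum of vectors occurs.\<close>

definition kop :: "nat \<Rightarrow> (rel2 \<Rightarrow> complex) \<Rightarrow> T_vec \<Rightarrow> T_vec"
  where "kop l k \<phi> w = (if w \<in> Omega l then \<Sum>v\<in>row_supp l k w. scale (k (link w v)) (\<phi> v) else 0)"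

lemma kop_eq:
  assumes "w \<in> Omega l" "finite V" "V \<subseteq> Omega l" "row_supp l k w \<subseteq> V"
  shows "kop l k \<phi> w = (\<Sum>v\<in>V. scale (k (link w v)) (\<phi> v))"
  unfolding kop_def using assms
  by (simp, intro sum.mono_neutral_left) (auto simp: row_supp_def)

lemma row_supp_Z_finite: "w \<in> Omega l \<Longrightarrow> row_supp l (Z a) w \<subseteq> (\<lambda>g. mat_prod w (perm_mat g)) ` Poly_Mapping.keys a"
proof
  fix v assume w: "w \<in> Omega l" and v: "v \<in> row_supp l (Z a) w"
  then have "v \<in> Omega l" "Z a (link w v) \<noteq> 0" by (auto simp: row_supp_def)
  then obtain g where "g \<in> Poly_Mapping.keys a" "link w v \<subseteq> prel g" using zeta_eq_0[of a "link w v" prel] by blast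
  then show "v \<in> (\<lambda>g. mat_prod w (perm_mat g)) ` Poly_Mapping.keys a"
  proof (intro image_eqI)
    show "v = mat_prod w (perm_mat g)"
      using mat_prod_eq_iff_link[OF w \<open>v \<in> Omega l\<close>, of g] \<open>link w v \<subseteq> prel g\<close> by simp
  qed (rule \<open>g \<in> Poly_Mapping.keys a\<close>)
qed

text \<open>The vector \<open>\<phi> v\<close> is multiplied by the sum of the coefficients of
  \<open>a\<close> at all \<open>g\<close> that carry \<open>w\<close> to \<open>v\<close>, and
  these are the \<open>g\<close> that extend \<open>link w v\<close>.\<close>

lemma T_alg_kop:
  assumes \<phi>: "\<phi> \<in> H_T lam"
  shows "T_alg a \<phi> = kop (sum_list lam) (Z a) \<phi>"
proof
  fix w
  let ?l = "sum_list lam"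
  show "T_alg a \<phi> w = kop ?l (Z a) \<phi> w"
  proof (cases "w \<in> Omega ?l")
    case True
    let ?V = "(\<lambda>g. mat_prod w (perm_mat g)) ` Poly_Mapping.keys a"
    have V: "finite ?V" "?V \<subseteq> Omega ?l" using True by auto
    have "kop ?l (Z a) \<phi> w = (\<Sum>v\<in>?V. scale (Z a (link w v)) (\<phi> v))"
      by (rule kop_eq[OF True V row_supp_Z_finite[OF True]])
    also have "\<dots> = (\<Sum>v\<in>?V. \<Sum>g\<in>Poly_Mapping.keys a. if mat_prod w (perm_mat g) =
        v then scale (Poly_Mapping.lookup a g) (\<phi> v) else 0)"
    proof (rule sum.cong[OF refl])
      fix v assume "v \<in> ?V"
      then have v: "v \<in> Omega ?l" using V by blast
      have "scale (Z a (link w v)) (\<phi> v) =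
          (\<Sum>g\<in>Poly_Mapping.keys a. scale (if link w v \<subseteq> prel g then Poly_Mapping.lookup a g else 0) (\<phi> v))"
        by (simp add: zeta_superset[of "Poly_Mapping.keys a"] alg.scale_sum_left)
      also have "\<dots> = (\<Sum>g\<in>Poly_Mapping.keys a. if mat_prod w (perm_mat g) =
          v then scale (Poly_Mapping.lookup a g) (\<phi> v) else 0)"
        by (intro sum.cong refl) (simp add: mat_prod_eq_iff_link[OF True v])
      finally show "scale (Z a (link w v)) (\<phi> v) =
         (\<Sum>g\<in>Poly_Mapping.keys a. if mat_prod w (perm_mat g) =
             v then scale (Poly_Mapping.lookup a g) (\<phi> v) else 0)" .
    qed
    also have "\<dots> = (\<Sum>g\<in>Poly_Mapping.keys a. \<Sum>v\<in>?V. if mat_prod w (perm_mat g) =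
        v then scale (Poly_Mapping.lookup a g) (\<phi> v) else 0)"
      by (rule sum.swap)
    also have "\<dots> = T_alg a \<phi> w"
      unfolding T_alg_def T_rep_def using V(1) by (intro sum.cong refl) simp
    finally show ?thesis by simp
  next
    case False
    then have "T_alg a \<phi> \<in> H_T lam" using H_T_T_alg[OF \<phi>] by blast
    then show ?thesis using False by (simp add: kop_def H_T_iff)
  qed
qed

definition bounded_kernel :: "nat \<Rightarrow> real \<Rightarrow> (rel2 \<Rightarrow> complex) \<Rightarrow> bool"
  where "bounded_kernel l S k \<longleftrightarrow> S \<ge> 0 \<and> (\<forall>w\<in>Omega l. finite (row_supp l k w) \<and>
     (\<forall>V\<subseteq>Omega l. finite V \<longrightarrow> (\<Sum>v\<in>V. cmod (k (link w v))) \<le> S \<and> (\<Sum>v\<in>V. cmod (k (link v w))) \<le> S))"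

text \<open>Finitely many rows meet only finitely many columns, so the Schur test for finite sums
  suffices.\<close>

lemma kop_finite_bound:
  assumes k: "bounded_kernel l S k" and W: "finite W" "W \<subseteq> Omega l"
    and \<phi>: "\<And>v. v \<in> Omega l \<Longrightarrow> \<phi> v \<in> span_of (Sn l)"
  shows "\<exists>V. finite V \<and> V \<subseteq> Omega l \<and> (\<Sum>w\<in>W. nsq (kop l k \<phi> w)) \<le> S\<^sup>2 * (\<Sum>v\<in>V. nsq (\<phi> v))"
proof -
  define V where "V = (\<Union>w\<in>W. row_supp l k w)"
  have V: "finite V" "V \<subseteq> Omega l"
    using k W by (auto simp: V_def bounded_kernel_def row_supp_def)
  have "(\<Sum>w\<in>W. nsq (kop l k \<phi> w)) = (\<Sum>w\<in>W. nsq (\<Sum>v\<in>V. scale (k (link w v)) (\<phi> v)))"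
  proof (rule sum.cong[OF refl])
    fix w assume "w \<in> W"
    then show "nsq (kop l k \<phi> w) = nsq (\<Sum>v\<in>V. scale (k (link w v)) (\<phi> v))"
      using V W by (subst kop_eq[of w l V]) (auto simp: V_def)
  qed
  also have "\<dots> \<le> S\<^sup>2 * (\<Sum>v\<in>V. nsq (\<phi> v))"
  proof (rule schur_test_nsq[OF finite_Sn])
    show "Poly_Mapping.keys (\<phi> v) \<subseteq> Sn l" if "v \<in> V" for v using \<phi>[of v] that V by (auto simp: span_of_def)
    show "S \<ge> 0" using k by (simp add: bounded_kernel_def)
    show "(\<Sum>v\<in>V. cmod (k (link w v))) \<le> S" if "w \<in> W" for w
      using k V W that unfolding bounded_kernel_def by blast
    show "(\<Sum>w\<in>W. cmod (k (link w v))) \<le> S" if "v \<in> V" for v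
      using k V W that unfolding bounded_kernel_def by blast
  qed
  finally show ?thesis using V by blast
qed

lemma nsq_finite_le_infsum:
  "(\<lambda>w. nsq (\<phi> w)) summable_on A \<Longrightarrow> finite V \<Longrightarrow> V \<subseteq> A \<Longrightarrow> (\<Sum>v\<in>V. nsq (\<phi> v)) \<le> (\<Sum>\<^sub>\<infinity>w\<in>A. nsq (\<phi> w))"
  by (rule finite_sum_le_infsum) auto

lemma kop_summable:
  assumes k: "bounded_kernel l S k" and sm: "(\<lambda>w. nsq (\<phi> w)) summable_on Omega l"
    and \<phi>: "\<And>v. v \<in> Omega l \<Longrightarrow> \<phi> v \<in> span_of (Sn l)"
  shows "(\<lambda>w. nsq (kop l k \<phi> w)) summable_on Omega l"
    and "(\<Sum>\<^sub>\<infinity>w\<in>Omega l. nsq (kop l k \<phi> w)) \<le> S\<^sup>2 * (\<Sum>\<^sub>\<infinity>w\<in>Omega l. nsq (\<phi> w))"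
proof -
  have le: "(\<Sum>w\<in>W. nsq (kop l k \<phi> w)) \<le> S\<^sup>2 * (\<Sum>\<^sub>\<infinity>w\<in>Omega l. nsq (\<phi> w))" if W: "finite W" "W \<subseteq> Omega l" for W
  proof -
    have "\<exists>V. finite V \<and> V \<subseteq> Omega l \<and> (\<Sum>w\<in>W. nsq (kop l k \<phi> w)) \<le> S\<^sup>2 * (\<Sum>v\<in>V. nsq (\<phi> v))"
      by (rule kop_finite_bound[OF k W \<phi>])
    then obtain V where V: "finite V" "V \<subseteq> Omega l" "(\<Sum>w\<in>W. nsq (kop l k \<phi> w)) \<le> S\<^sup>2 * (\<Sum>v\<in>V. nsq (\<phi> v))"
      by (elim exE conjE)
    have "S\<^sup>2 * (\<Sum>v\<in>V. nsq (\<phi> v)) \<le> S\<^sup>2 * (\<Sum>\<^sub>\<infinity>w\<in>Omega l. nsq (\<phi> w))"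
      by (intro mult_left_mono nsq_finite_le_infsum sm V) simp
    then show ?thesis using V(3) by linarith
  qed
  show 1: "(\<lambda>w. nsq (kop l k \<phi> w)) summable_on Omega l"
  proof (rule nonneg_bdd_above_summable_on)
    show "bdd_above (sum (\<lambda>w. nsq (kop l k \<phi> w)) ` {F. F \<subseteq> Omega l \<and> finite F})"
      by (rule bdd_aboveI[where M = "S\<^sup>2 * (\<Sum>\<^sub>\<infinity>w\<in>Omega l. nsq (\<phi> w))"]) (use le in blast)
  qed simp
  show "(\<Sum>\<^sub>\<infinity>w\<in>Omega l. nsq (kop l k \<phi> w)) \<le> S\<^sup>2 * (\<Sum>\<^sub>\<infinity>w\<in>Omega l. nsq (\<phi> w))"
    by (rule infsum_le_finite_sums[OF 1 le])
qed

lemma H_T_span: "\<phi> \<in> H_T lam \<Longrightarrow> v \<in> Omega (sum_list lam) \<Longrightarrow> \<phi> v \<in> span_of (Sn (sum_list lam))"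
  by (auto simp: H_T_iff intro: H_pi_span)

lemma kop_H_T:
  assumes k: "bounded_kernel (sum_list lam) S k" and \<phi>: "\<phi> \<in> H_T lam"
  shows "kop (sum_list lam) k \<phi> \<in> H_T lam"
proof -
  let ?l = "sum_list lam" let ?m = "\<lambda>s. mat_prod (perm_mat s)"
  have "kop ?l k \<phi> w \<in> H_pi lam" if "w \<in> Omega ?l" for w
    using \<phi> that by (auto simp: kop_def H_T_iff row_supp_def intro!: H_pi_sum H_pi_scale)
  moreover have "(\<lambda>w. nsq (kop ?l k \<phi> w)) summable_on Omega ?l"
    using \<phi> by (intro kop_summable(1)[OF k]) (auto simp: H_T_iff intro: H_pi_span)
  moreover have "kop ?l k \<phi> (?m s w) = delta s \<star> kop ?l k \<phi> w" if s: "s \<in> Sn ?l" and w: "w \<in> Omega ?l" for s w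
  proof -
    have "bij_betw (?m s) (row_supp ?l k w) (row_supp ?l k (?m s w))"
    proof (rule bij_betwI[where g = "?m (inverse s)"])
      show "?m s \<in> row_supp ?l k w \<rightarrow> row_supp ?l k (?m s w)"
        using s by (auto simp: row_supp_def link_left[OF s] Omega_left1)
      show "?m (inverse s) \<in> row_supp ?l k (?m s w) \<rightarrow> row_supp ?l k w"
      proof
        fix v assume v: "v \<in> row_supp ?l k (?m s w)"
        have "link w (?m (inverse s) v) = link (?m s w) v"
          using link_left[OF s, of w "?m (inverse s) v"] by simp
        then show "?m (inverse s) v \<in> row_supp ?l k w"
          using v s by (auto simp: row_supp_def intro: Omega_left1)
      qed
    qed auto
    from sum.reindex_bij_betw[OF this, of "\<lambda>v. scale (k (link (?m s w) v)) (\<phi> v)"]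
    have "kop ?l k \<phi> (?m s w) = (\<Sum>v\<in>row_supp ?l k w. scale (k (link w v)) (\<phi> (?m s v)))"
      using w s by (simp add: kop_def Omega_left1 link_left[OF s])
    also have "\<dots> = (\<Sum>v\<in>row_supp ?l k w. scale (k (link w v)) (delta s \<star> \<phi> v))"
      using \<phi> s by (intro sum.cong refl) (auto simp: H_T_iff row_supp_def)
    also have "\<dots> = delta s \<star> kop ?l k \<phi> w"
      using w by (simp add: kop_def conv_sum_right conv_scale_right)
    finally show ?thesis .
  qed
  ultimately show ?thesis unfolding H_T_iff by (simp add: kop_def)
qed

lemma norm_T_kop:
  assumes k: "bounded_kernel (sum_list lam) S k" and \<phi>: "\<phi> \<in> H_T lam"
  shows "norm_T lam (kop (sum_list lam) k \<phi>) \<le> S * norm_T lam \<phi>"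
proof -
  have "(\<lambda>w. nsq (\<phi> w)) summable_on Omega (sum_list lam)" using \<phi> by (simp add: H_T_iff)
  from kop_summable(2)[OF k this H_T_span[OF \<phi>]]
  have "norm_T lam (kop (sum_list lam) k \<phi>) \<le> sqrt (S\<^sup>2 * (\<Sum>\<^sub>\<infinity>w\<in>Omega (sum_list lam). nsq (\<phi> w)))"
    unfolding norm_T_eq by (intro real_sqrt_le_mono) auto
  also have "\<dots> = S * norm_T lam \<phi>" using k by (simp add: norm_T_eq real_sqrt_mult bounded_kernel_def)
  finally show ?thesis .
qed

lemma kop_bounded_op:
  assumes k: "bounded_kernel (sum_list lam) S k"
  shows "restrict (kop (sum_list lam) k) (H_T lam) \<in> bounded_ops lam"
proof -
  let ?l = "sum_list lam"
  have "kop ?l k (\<lambda>w. \<phi> w + \<psi> w) = (\<lambda>w. kop ?l k \<phi> w + kop ?l k \<psi> w)" for \<phi> \<psi>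
    by (rule ext) (simp add: kop_def scale_add_right sum.distrib)
  moreover have "kop ?l k (\<lambda>w. scale c (\<phi> w)) = (\<lambda>w. scale c (kop ?l k \<phi> w))" for c \<phi>
    by (rule ext) (simp add: kop_def scale_sum mult.commute)
  moreover have "\<exists>K. \<forall>\<phi>\<in>H_T lam. norm_T lam (restrict (kop ?l k) (H_T lam) \<phi>) \<le> K * norm_T lam \<phi>"
    using norm_T_kop[OF k] by (intro exI[of _ S]) simp
  ultimately show ?thesis
    unfolding bounded_ops_def using kop_H_T[OF k] H_T_add H_T_scale by simp
qed

lemma inj_on_link: "w \<in> Omega l \<Longrightarrow> V \<subseteq> Omega l \<Longrightarrow> inj_on (link w) V"
  by (rule inj_onI) (use link_inj[of w l] in blast)

text \<open>Decay in the number of points that the range of \<open>r\<close> has in addition to its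
  domain and \<open>{..<m}\<close>, together with the information that these points lie below
  \<open>n\<close>. The two balance each other in row sums.\<close>

definition decaying :: "nat \<Rightarrow> nat \<Rightarrow> nat \<Rightarrow> real \<Rightarrow> (rel2 \<Rightarrow> complex) \<Rightarrow> bool"
  where "decaying m l n C k \<longleftrightarrow> (\<forall>r. finite r \<longrightarrow> card r \<le> l \<longrightarrow> k r \<noteq> 0 \<longrightarrow>
     real n ^ card (exits m (r\<inverse>)) * cmod (k r) \<le> C \<and> exits m (r\<inverse>) \<subseteq> {..<n})"

lemma decaying_link:
  assumes k: "decaying m l n C k" and w: "w \<in> Omega l" "v \<in> Omega l" and n: "n \<ge> 1" and nz: "k (link w v) \<noteq> 0"
  defines "P \<equiv> {..<m} \<union> Range (relw w)"
  shows "link w v \<in> injections (Range (relw w)) ({..<n} \<union> P)"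
    "cmod (k (link w v)) \<le> C * (1 / real n) ^ card (Range (link w v) - P)"
proof -
  note L = linkD[OF w]
  have ex: "exits m ((link w v)\<inverse>) = Range (link w v) - P"
    by (auto simp: exits_def P_def L(2))
  have h: "real n ^ card (Range (link w v) - P) * cmod (k (link w v)) \<le> C" "Range (link w v) - P \<subseteq> {..<n}"
    using k L(4,5) nz unfolding decaying_def ex[symmetric] by blast+
  show "link w v \<in> injections (Range (relw w)) ({..<n} \<union> P)"
    using h(2) L(1,2) by (auto simp: injections_def)
  show "cmod (k (link w v)) \<le> C * (1 / real n) ^ card (Range (link w v) - P)"
    using h(1) n by (simp add: field_simps power_one_over)
qed

lemma card_Range_relw: "w \<in> Omega l \<Longrightarrow> card (Range (relw w)) = l"
  using card_Range[OF OmegaD(1)] card_Domain[OF OmegaD(1)] OmegaD(2) by (metis card_lessThan)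

text \<open>Since \<open>link w\<close> is injective, the row sum is dominated by a sum over
  injections with weight \<open>1 / n\<close> for each new point, which
  \<open>sum_injections_bound\<close> controls uniformly in \<open>w\<close> and
  \<open>n\<close>.\<close>

lemma decaying_row:
  assumes k: "decaying m l n C k" and w: "w \<in> Omega l" and n: "n \<ge> 1" and C: "C \<ge> 0"
    and V: "finite V" "V \<subseteq> Omega l"
  shows "(\<Sum>v\<in>V. cmod (k (link w v))) \<le> C * (real (m + l) + 1) ^ l"
    and "finite (row_supp l k w)"
proof -
  define D where "D = Range (relw w)"
  define P where "P = {..<m} \<union> D"
  let ?I = "injections D ({..<n} \<union> P)"
  have D: "finite D" "card D = l" using OmegaD(3)[OF w] card_Range_relw[OF w] by (simp_all add: D_def finite_Range)
  have P: "finite P" "card P \<le> m + l" using D card_Un_le[of "{..<m}" D] by (simp_all add: P_def)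
  have finI: "finite ?I" using D P by simp
  have mem: "link w v \<in> ?I" "cmod (k (link w v)) \<le> C * (1 / real n) ^ card (Range (link w v) - P)"
    if "v \<in> Omega l" "k (link w v) \<noteq> 0" for v
    using decaying_link[OF k w that(1) n that(2)] by (simp_all add: D_def P_def)
  define V0 where "V0 = {v \<in> V. k (link w v) \<noteq> 0}"
  have V0: "V0 \<subseteq> Omega l" "link w ` V0 \<subseteq> ?I" using mem(1) V by (auto simp: V0_def)
  have "(\<Sum>v\<in>V. cmod (k (link w v))) = (\<Sum>v\<in>V0. cmod (k (link w v)))"
    using V by (intro sum.mono_neutral_right) (auto simp: V0_def)
  also have "\<dots> \<le> (\<Sum>v\<in>V0. C * (1 / real n) ^ card (Range (link w v) - P))"
    using mem(2) V by (intro sum_mono) (auto simp: V0_def)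
  also have "\<dots> = (\<Sum>d\<in>link w ` V0. C * (1 / real n) ^ card (Range d - P))"
    using inj_on_link[OF w V0(1)] by (simp add: sum.reindex)
  also have "\<dots> \<le> (\<Sum>d\<in>?I. C * (1 / real n) ^ card (Range d - P))"
    using finI V0(2) C by (intro sum_mono2) auto
  also have "\<dots> = C * (\<Sum>d\<in>?I. (1 / real n) ^ card (Range d - P))" by (simp add: sum_distrib_left)
  also have "\<dots> \<le> C * (real (card P) + 1) ^ card D"
    using C sum_injections_bound[OF D(1) P(1) n] by (intro mult_left_mono)
  also have "\<dots> \<le> C * (real (m + l) + 1) ^ l"
    using C P(2) unfolding D(2) by (intro mult_left_mono power_mono) auto
  finally show "(\<Sum>v\<in>V. cmod (k (link w v))) \<le> C * (real (m + l) + 1) ^ l" .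
  have "link w ` row_supp l k w \<subseteq> ?I" using mem(1) by (auto simp: row_supp_def)
  then have "finite (link w ` row_supp l k w)" using finI finite_subset by blast
  moreover have "inj_on (link w) (row_supp l k w)" using w by (intro inj_on_link) (auto simp: row_supp_def)
  ultimately show "finite (row_supp l k w)" using finite_imageD by blast
qed

text \<open>Squaring doubles the decay, so that relations with at least one new point contribute
  \<open>O(1 / n)\<close> in total. The others form a finite set that does not depend on
  \<open>n\<close> and are accessible to pointwise convergence.\<close>

lemma decaying_row_square:
  assumes k: "decaying m l n C k" and w: "w \<in> Omega l" and n: "n \<ge> 1" and C: "C \<ge> 0"
    and V: "finite V" "V \<subseteq> Omega l"
  shows "(\<Sum>v\<in>V. (cmod (k (link w v)))\<^sup>2) \<le>
     (\<Sum>d\<in>injections (Range (relw w)) ({..<m} \<union> Range (relw w)). (cmod (k d))\<^sup>2) + C\<^sup>2 * (real (m + l) +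
         1) ^ l / real n"
proof -
  define D where "D = Range (relw w)"
  define P where "P = {..<m} \<union> D"
  let ?I = "injections D ({..<n} \<union> P)" and ?J = "injections D P"
  have D: "finite D" "card D = l" using OmegaD(3)[OF w] card_Range_relw[OF w] by (simp_all add: D_def finite_Range)
  have P: "finite P" "card P \<le> m + l" using D card_Un_le[of "{..<m}" D] by (simp_all add: P_def)
  have finI: "finite ?I" and finJ: "finite ?J" using D P by simp_all
  have mem: "link w v \<in> ?I" "cmod (k (link w v)) \<le> C * (1 / real n) ^ card (Range (link w v) - P)"
    if "v \<in> Omega l" "k (link w v) \<noteq> 0" for v
    using decaying_link[OF k w that(1) n that(2)] by (simp_all add: D_def P_def)
  let ?t = "\<lambda>v. (cmod (k (link w v)))\<^sup>2"
  define V1 where "V1 = {v \<in> V. link w v \<in> ?J}"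
  define V2 where "V2 = {v \<in> V. k (link w v) \<noteq> 0 \<and> link w v \<notin> ?J}"
  have "(\<Sum>v\<in>V. ?t v) = (\<Sum>v\<in>V1 \<union> V2. ?t v)"
    using V by (intro sum.mono_neutral_right) (auto simp: V1_def V2_def)
  also have "\<dots> = (\<Sum>v\<in>V1. ?t v) + (\<Sum>v\<in>V2. ?t v)"
    using V by (intro sum.union_disjoint) (auto simp: V1_def V2_def)
  also have "(\<Sum>v\<in>V1. ?t v) = (\<Sum>d\<in>link w ` V1. (cmod (k d))\<^sup>2)"
    using inj_on_link[OF w, of V1] V by (simp add: sum.reindex V1_def subset_iff)
  also have "\<dots> \<le> (\<Sum>d\<in>?J. (cmod (k d))\<^sup>2)"
    using finJ by (intro sum_mono2) (auto simp: V1_def)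
  also have "(\<Sum>v\<in>V2. ?t v) \<le> (\<Sum>v\<in>V2. C\<^sup>2 / real n * (1 / real n) ^ card (Range (link w v) - P))"
  proof (rule sum_mono)
    fix v assume v: "v \<in> V2"
    then have v': "v \<in> Omega l" "k (link w v) \<noteq> 0" "link w v \<notin> ?J" using V by (auto simp: V2_def)
    let ?c = "card (Range (link w v) - P)"
    have "Range (link w v) - P \<noteq> {}" using mem(1)[OF v'(1,2)] v'(3) by (auto simp: injections_def)
    then have c: "?c \<ge> 1"
      using linkD(4)[OF w v'(1)] by (simp add: Suc_le_eq card_gt_0_iff finite_Range)
    have "?t v \<le> (C * (1 / real n) ^ ?c) * (C * (1 / real n) ^ ?c)"
      unfolding power2_eq_square using mem(2)[OF v'(1,2)] C by (intro mult_mono) auto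
    also have "\<dots> \<le> (C * (1 / real n)) * (C * (1 / real n) ^ ?c)"
      using power_decreasing[OF c, of "1 / real n"] n C by (intro mult_right_mono mult_left_mono) auto
    finally show "?t v \<le> C\<^sup>2 / real n * (1 / real n) ^ ?c" by (simp add: power2_eq_square mult_ac)
  qed
  also have "\<dots> = (\<Sum>d\<in>link w ` V2. C\<^sup>2 / real n * (1 / real n) ^ card (Range d - P))"
    using inj_on_link[OF w, of V2] V by (simp add: sum.reindex V2_def subset_iff)
  also have "\<dots> \<le> (\<Sum>d\<in>?I. C\<^sup>2 / real n * (1 / real n) ^ card (Range d - P))"
    using finI mem(1) V by (intro sum_mono2) (auto simp: V2_def)
  also have "\<dots> = C\<^sup>2 / real n * (\<Sum>d\<in>?I. (1 / real n) ^ card (Range d - P))" by (simp add: sum_distrib_left)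
  also have "\<dots> \<le> C\<^sup>2 / real n * (real (card P) + 1) ^ card D"
    using sum_injections_bound[OF D(1) P(1) n] by (intro mult_left_mono) auto
  also have "\<dots> \<le> C\<^sup>2 / real n * (real (m + l) + 1) ^ l"
    using P(2) unfolding D(2) by (intro mult_left_mono power_mono) auto
  finally show ?thesis by (simp add: D_def P_def)
qed

lemma bounded_kernel_decaying:
  assumes "decaying m l n C k" "decaying m l n C (\<lambda>r. k (r\<inverse>))" "n \<ge> 1" "C \<ge> 0"
  shows "bounded_kernel l (C * (real (m + l) + 1) ^ l) k"
  unfolding bounded_kernel_def
proof (intro conjI ballI allI impI)
  show "0 \<le> C * (real (m + l) + 1) ^ l" using assms(4) by simp
  fix w assume w: "w \<in> Omega l"
  show "finite (row_supp l k w)" by (rule decaying_row(2)[OF assms(1) w assms(3,4), of "{}"]) auto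
  fix V assume V: "V \<subseteq> Omega l" "finite V"
  show "(\<Sum>v\<in>V. cmod (k (link w v))) \<le> C * (real (m + l) + 1) ^ l"
    by (rule decaying_row(1)[OF assms(1) w assms(3,4) V(2,1)])
  show "(\<Sum>v\<in>V. cmod (k (link v w))) \<le> C * (real (m + l) + 1) ^ l"
    using decaying_row(1)[OF assms(2) w assms(3,4) V(2,1)] by (simp add: link_converse)
qed

lemma kop_diff:
  assumes "finite (row_supp l k w)" "finite (row_supp l k' w)"
  shows "kop l k \<phi> w - kop l k' \<phi> w = kop l (\<lambda>r. k r - k' r) \<phi> w"
proof (cases "w \<in> Omega l")
  case True
  let ?V = "row_supp l k w \<union> row_supp l k' w"
  have V: "finite ?V" "?V \<subseteq> Omega l" using assms by (auto simp: row_supp_def)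
  have "kop l k \<phi> w - kop l k' \<phi> w = (\<Sum>v\<in>?V. scale (k (link w v)) (\<phi> v)) - (\<Sum>v\<in>?V. scale (k' (link w v)) (\<phi> v))"
    by (simp add: kop_eq[OF True V])
  also have "\<dots> = (\<Sum>v\<in>?V. scale (k (link w v) - k' (link w v)) (\<phi> v))"
    by (simp add: sum_subtractf alg.scale_left_diff_distrib)
  also have "\<dots> = kop l (\<lambda>r. k r - k' r) \<phi> w"
    by (rule kop_eq[OF True V, symmetric]) (auto simp: row_supp_def)
  finally show ?thesis .
qed (simp add: kop_def)

text \<open>A vector is split into its restriction to a finite set \<open>F\<close> and a small
  tail. The tail is controlled by the uniform Schur bound, and for \<open>F\<close> the column sums
  of squares tend to 0.\<close>

lemma norm_T_kop_tendsto_0: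
  assumes dec: "\<And>n. n \<ge> n0 \<Longrightarrow> decaying m (sum_list lam) n C (k n)"
      "\<And>n. n \<ge> n0 \<Longrightarrow> decaying m (sum_list lam) n C (\<lambda>r. k n (r\<inverse>))"
    and n0: "n0 \<ge> 1" and C: "C \<ge> 0" and lim: "\<And>r. finite r \<Longrightarrow> (\<lambda>n. k n r) \<longlonglongrightarrow> 0"
    and \<phi>: "\<phi> \<in> H_T lam"
  shows "(\<lambda>n. norm_T lam (kop (sum_list lam) (k n) \<phi>)) \<longlonglongrightarrow> 0"
proof -
  define l where "l = sum_list lam"
  define S where "S = C * (real (m + l) + 1) ^ l"
  have bk: "bounded_kernel l S (k n)" if "n \<ge> n0" for n
    unfolding S_def using dec[OF that] n0 that C by (intro bounded_kernel_decaying[of m l n]) (auto simp: l_def)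
  have sm: "(\<lambda>w. nsq (\<phi> w)) summable_on Omega l" using \<phi> by (simp add: H_T_iff l_def)
  have span: "\<phi> v \<in> span_of (Sn l)" if "v \<in> Omega l" for v using H_T_span[OF \<phi>] that by (simp add: l_def)
  let ?N = "\<Sum>\<^sub>\<infinity>w\<in>Omega l. nsq (\<phi> w)"
  let ?I = "\<lambda>n. \<Sum>\<^sub>\<infinity>w\<in>Omega l. nsq (kop l (k n) \<phi> w)"
  \<comment> \<open>A bound for the sum of squares in column \<open>v\<close>; columns are rows of
    the transposed kernel, hence the converse relations.\<close>
  define b where "b n v = (\<Sum>d\<in>injections (Range (relw v)) ({..<m} \<union> Range (relw v)). (cmod (k n (d\<inverse>)))\<^sup>2) +
      C\<^sup>2 * (real (m + l) + 1) ^ l / real n" for n v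
  have b_lim: "(\<lambda>n. b n v) \<longlonglongrightarrow> 0" if v: "v \<in> Omega l" for v
  proof -
    have fin: "finite (d\<inverse>)" if "d \<in> injections (Range (relw v)) ({..<m} \<union> Range (relw v))" for d
      using finite_injection[OF that] OmegaD(3)[OF v] by (simp add: finite_Range)
    have "(\<lambda>n. \<Sum>d\<in>injections (Range (relw v)) ({..<m} \<union> Range (relw v)). (cmod (k n (d\<inverse>)))\<^sup>2) \<longlonglongrightarrow>
       (\<Sum>d\<in>injections (Range (relw v)) ({..<m} \<union> Range (relw v)). (cmod 0)\<^sup>2)"
      by (intro tendsto_sum tendsto_power tendsto_norm lim fin)
    from tendsto_add[OF this lim_const_over_n[of "C\<^sup>2 * (real (m + l) + 1) ^ l"]]
    show ?thesis by (simp add: b_def)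
  qed
  have main: "?I n \<le> 2 * (real (card F) * (\<Sum>v\<in>F. b n v * nsq (\<phi> v))) + 2 * (S\<^sup>2 * e)"
    if n: "n \<ge> n0" and F: "finite F" "F \<subseteq> Omega l" "?N - (\<Sum>v\<in>F. nsq (\<phi> v)) \<le> e" for n F e
  proof (rule infsum_le_finite_sums)
    show "(\<lambda>w. nsq (kop l (k n) \<phi> w)) summable_on Omega l" by (rule kop_summable(1)[OF bk[OF n] sm span])
    fix W assume W: "finite W" "W \<subseteq> Omega l"
    define \<phi>F where "\<phi>F w = (if w \<in> F then \<phi> w else 0)" for w
    define \<phi>R where "\<phi>R w = (if w \<in> F then 0 else \<phi> w)" for w
    have "\<phi> w = \<phi>F w + \<phi>R w" for w by (simp add: \<phi>F_def \<phi>R_def)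
    then have split: "kop l (k n) \<phi> w = kop l (k n) \<phi>F w + kop l (k n) \<phi>R w" for w
      by (simp add: kop_def scale_add_right sum.distrib)
    have "(\<Sum>w\<in>W. nsq (kop l (k n) \<phi> w)) \<le> (\<Sum>w\<in>W. 2 * nsq (kop l (k n) \<phi>F w) + 2 * nsq (kop l (k n) \<phi>R w))"
      unfolding split by (intro sum_mono nsq_add_le)
    also have "\<dots> = 2 * (\<Sum>w\<in>W. nsq (kop l (k n) \<phi>F w)) + 2 * (\<Sum>w\<in>W. nsq (kop l (k n) \<phi>R w))"
      by (simp add: sum.distrib sum_distrib_left)
    also have "(\<Sum>w\<in>W. nsq (kop l (k n) \<phi>F w)) \<le> real (card F) * (\<Sum>v\<in>F. b n v * nsq (\<phi> v))"
    proof -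
      have "kop l (k n) \<phi>F w = (\<Sum>v\<in>F. scale (k n (link w v)) (\<phi> v))" if "w \<in> W" for w
      proof -
        have w: "w \<in> Omega l" using W that by blast
        have fr: "finite (row_supp l (k n) w)" using bk[OF n] w by (simp add: bounded_kernel_def)
        have "kop l (k n) \<phi>F w = (\<Sum>v\<in>F \<union> row_supp l (k n) w. scale (k n (link w v)) (\<phi>F v))"
          using F fr by (intro kop_eq[OF w]) (auto simp: row_supp_def)
        also have "\<dots> = (\<Sum>v\<in>F. scale (k n (link w v)) (\<phi> v))"
          using F(1) fr by (intro sum.mono_neutral_cong_right) (auto simp: \<phi>F_def)
        finally show ?thesis .
      qed
      then have "(\<Sum>w\<in>W. nsq (kop l (k n) \<phi>F w)) = (\<Sum>w\<in>W. nsq (\<Sum>v\<in>F. scale (k n (link w v)) (\<phi> v)))" by simp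
      also have "\<dots> \<le> real (card F) * (\<Sum>v\<in>F. (\<Sum>w\<in>W. (cmod (k n (link w v)))\<^sup>2) * nsq (\<phi> v))"
        using span F by (intro finite_kernel_nsq_le[OF finite_Sn[of l]]) (auto simp: span_of_def)
      also have "\<dots> \<le> real (card F) * (\<Sum>v\<in>F. b n v * nsq (\<phi> v))"
      proof (intro mult_left_mono sum_mono mult_right_mono)
        fix v assume "v \<in> F"
        then have v: "v \<in> Omega l" using F by blast
        show "(\<Sum>w\<in>W. (cmod (k n (link w v)))\<^sup>2) \<le> b n v"
          using decaying_row_square[OF dec(2)[OF n, folded l_def] v _ C W] n n0 by (simp add: b_def link_converse)
      qed auto
      finally show ?thesis .
    qed
    also have "(\<Sum>w\<in>W. nsq (kop l (k n) \<phi>R w)) \<le> S\<^sup>2 * e"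
    proof -
      have "\<exists>V. finite V \<and> V \<subseteq> Omega l \<and> (\<Sum>w\<in>W. nsq (kop l (k n) \<phi>R w)) \<le> S\<^sup>2 * (\<Sum>v\<in>V. nsq (\<phi>R v))"
        by (rule kop_finite_bound[OF bk[OF n] W]) (auto simp: \<phi>R_def span span_of_0)
      then obtain V where V: "finite V" "V \<subseteq> Omega l" "(\<Sum>w\<in>W. nsq (kop l (k n) \<phi>R w)) \<le> S\<^sup>2 * (\<Sum>v\<in>V. nsq (\<phi>R v))"
        by (elim exE conjE)
      have "(\<Sum>v\<in>V. nsq (\<phi>R v)) = (\<Sum>v\<in>V - F. nsq (\<phi> v))"
        using V(1) by (intro sum.mono_neutral_cong_right) (auto simp: \<phi>R_def)
      also have "\<dots> = (\<Sum>v\<in>V \<union> F. nsq (\<phi> v)) - (\<Sum>v\<in>F. nsq (\<phi> v))"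
        using sum_diff[of "V \<union> F" F "\<lambda>v. nsq (\<phi> v)"] V(1) F(1) by (simp add: Un_Diff)
      also have "\<dots> \<le> ?N - (\<Sum>v\<in>F. nsq (\<phi> v))"
        using nsq_finite_le_infsum[OF sm, of "V \<union> F"] V F by simp
      also have "\<dots> \<le> e" by (rule F(3))
      finally have "S\<^sup>2 * (\<Sum>v\<in>V. nsq (\<phi>R v)) \<le> S\<^sup>2 * e" by (intro mult_left_mono) auto
      then show ?thesis using V(3) by linarith
    qed
    finally show "(\<Sum>w\<in>W. nsq (kop l (k n) \<phi> w)) \<le> 2 * (real (card F) * (\<Sum>v\<in>F. b n v * nsq (\<phi> v))) + 2 * (S\<^sup>2 * e)"
      by simp
  qed
  have "?I \<longlonglongrightarrow> 0"
  proof (rule order_tendstoI)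
    fix a :: real assume "a < 0"
    moreover have "?I n \<ge> 0" for n by (rule infsum_nonneg) simp
    ultimately show "\<forall>\<^sub>F n in sequentially. a < ?I n" by (intro always_eventually allI) (metis less_le_trans)
  next
    fix a :: real assume a: "0 < a"
    \<comment> \<open>With this choice the tail contributes at most \<open>a / 2\<close>, and the
      part on \<open>F\<close> eventually less than \<open>a / 4\<close>; adding 1 avoids division
      by 0.\<close>
    define e where "e = a / 4 / (S\<^sup>2 + 1)"
    have S1: "S\<^sup>2 + 1 > 0" by (simp add: add_nonneg_pos)
    have e: "e > 0" using a S1 by (simp add: e_def)
    have eS: "2 * (S\<^sup>2 * e) < a / 2 + a / 4"
    proof -
      have "S\<^sup>2 * e \<le> (S\<^sup>2 + 1) * e" using e by (intro mult_right_mono) auto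
      also have "\<dots> = a / 4"
      proof -
        have "S\<^sup>2 + 1 \<noteq> 0" using S1 by linarith
        then show ?thesis unfolding e_def by (metis nonzero_mult_div_cancel_left times_divide_eq_right)
      qed
      finally show ?thesis using a by linarith
    qed
    obtain F where F: "finite F" "F \<subseteq> Omega l" "dist (\<Sum>v\<in>F. nsq (\<phi> v)) ?N \<le> e"
      using infsum_finite_approximation[OF sm e] by blast
    then have F3: "?N - (\<Sum>v\<in>F. nsq (\<phi> v)) \<le> e" by (simp add: dist_real_def)
    have "(\<lambda>n. 2 * (real (card F) * (\<Sum>v\<in>F. b n v * nsq (\<phi> v)))) \<longlonglongrightarrow> 2 * (real (card F) * (\<Sum>v\<in>F. 0 * nsq (\<phi> v)))"
      using F(2) by (intro tendsto_mult tendsto_const tendsto_sum b_lim) auto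
    moreover have "2 * (real (card F) * (\<Sum>v\<in>F. 0 * nsq (\<phi> v))) < a / 4" using a by simp
    ultimately have "\<forall>\<^sub>F n in sequentially. 2 * (real (card F) * (\<Sum>v\<in>F. b n v * nsq (\<phi> v))) < a / 4"
      by (rule order_tendstoD(2))
    then show "\<forall>\<^sub>F n in sequentially. ?I n < a"
      using eventually_ge_at_top[of n0]
    proof eventually_elim
      case (elim n)
      then show ?case using main[OF elim(2) F(1,2) F3] eS by linarith
    qed
  qed
  then have "(\<lambda>n. sqrt (?I n)) \<longlonglongrightarrow> sqrt 0" by (rule tendsto_real_sqrt)
  then show ?thesis by (simp add: norm_T_eq l_def)
qed

text \<open>Elements of \<open>Sn n\<close> fix the points from \<open>n\<close> on, and a fixed
  point of an extension of \<open>r\<close> lies in both its domain and its range or in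
  neither.\<close>

lemma Z_exits_subset:
  assumes "a \<in> B_cent m n" "Z a r \<noteq> 0"
  shows "exits m r \<subseteq> {..<n}" "exits m (r\<inverse>) \<subseteq> {..<n}"
proof -
  obtain g where g: "g \<in> Poly_Mapping.keys a" "r \<subseteq> prel g" using assms(2) zeta_eq_0[of a r prel] by blast
  have gS: "g \<in> Sn n" using B_cent_keys[OF assms(1) g(1)] .
  show "exits m r \<subseteq> {..<n}"
  proof
    fix i assume i: "i \<in> exits m r"
    then obtain j where j: "(i, j) \<in> r" by (auto simp: exits_def)
    then have "i = g \<langle>$\<rangle> j" using g(2) by auto
    moreover have "j \<noteq> i" using i j by (auto simp: exits_def)
    ultimately show "i \<in> {..<n}" using SnD[OF gS, of j] Sn_less[OF gS, of j] by (cases "j < n") auto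
  qed
  show "exits m (r\<inverse>) \<subseteq> {..<n}"
  proof
    fix j assume i: "j \<in> exits m (r\<inverse>)"
    then obtain i where j: "(i, j) \<in> r" by (auto simp: exits_def)
    then have "i = g \<langle>$\<rangle> j" using g(2) by auto
    moreover have "j \<noteq> i" using i j by (auto simp: exits_def)
    ultimately show "j \<in> {..<n}" using SnD[OF gS, of j] by (cases "j < n") auto
  qed
qed

text \<open>The difference \<open>Z (\<alpha> n) r - f r\<close> is a decaying kernel with constant
  \<open>2 * C\<close> and tends to 0 pointwise, so \<open>norm_T_kop_tendsto_0\<close> applies to
  it.\<close>

theorem zconv_sot_limit:
  assumes A: "zconv m \<alpha> f"
  shows "sot_limit lam \<alpha> (restrict (kop (sum_list lam) f) (H_T lam))"
proof -
  define l where "l = sum_list lam"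
  obtain n0 C where C: "C \<ge> 0" "n0 \<ge> 1" "\<And>n. n \<ge> n0 \<Longrightarrow> \<alpha> n \<in> B_cent m n"
    "\<And>n r. n \<ge> n0 \<Longrightarrow> finite r \<Longrightarrow> card r \<le> l \<Longrightarrow> real n ^ card (exits m r) * cmod (Z (\<alpha> n) r) \<le> C"
    "\<And>n r. n \<ge> n0 \<Longrightarrow> finite r \<Longrightarrow> card r \<le> l \<Longrightarrow> real n ^ card (exits m (r\<inverse>)) * cmod (Z (\<alpha> n) r) \<le> C"
    using zconv_decay[OF A, where l = l] by metis
  have f0: "exits m r = {} \<and> exits m (r\<inverse>) = {}" if "f r \<noteq> 0" for r using zconv_exits[OF A that] by blast
  have fC: "cmod (f r) \<le> C" if r: "finite r" "card r \<le> l" for r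
  proof (rule LIMSEQ_le_const2[OF tendsto_norm[OF zconv_lim[OF A r(1)]]])
    have "cmod (Z (\<alpha> n) r) \<le> C" if n: "n \<ge> n0" for n
    proof -
      have "1 \<le> real n ^ card (exits m r)" using n C(2) by (intro one_le_power) simp
      then have "cmod (Z (\<alpha> n) r) \<le> real n ^ card (exits m r) * cmod (Z (\<alpha> n) r)"
        by (metis mult_right_mono mult_1 norm_ge_zero)
      then show ?thesis using C(4)[OF n r] by linarith
    qed
    then show "\<exists>N. \<forall>n\<ge>N. cmod (Z (\<alpha> n) r) \<le> C" by blast
  qed
  \<comment> \<open>There are no exits on the support of \<open>f\<close>, so the bound
    \<open>C\<close> alone gives the decay, for every \<open>n\<close>.\<close>
  have fdec: "decaying m l n C f" "decaying m l n C (\<lambda>r. f (r\<inverse>))" for n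
    unfolding decaying_def using f0 fC by (auto simp: card_inverse)
  have fb: "bounded_kernel l (C * (real (m + l) + 1) ^ l) f"
    by (rule bounded_kernel_decaying[OF fdec, of 1]) (use C in auto)
  let ?k = "\<lambda>n r. Z (\<alpha> n) r - f r"
  have kdec: "decaying m l n (2 * C) (?k n)" "decaying m l n (2 * C) (\<lambda>r. ?k n (r\<inverse>))" if n: "n \<ge> n0" for n
  proof -
    have *: "real n ^ card (exits m s) * cmod (?k n r) \<le> 2 * C \<and> exits m s \<subseteq> {..<n}"
      if r: "finite r" "card r \<le> l" "?k n r \<noteq> 0" and s: "s = r \<or> s = r\<inverse>" for r s
    proof (cases "f r = 0")
      case True
      then have "Z (\<alpha> n) r \<noteq> 0" using r(3) by simp
      then show ?thesis
        using s Z_exits_subset[OF C(3)[OF n]] C(4,5)[OF n r(1,2)] C(1) True by auto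
    next
      case False
      then have ex: "exits m s = {}" using f0 s by auto
      have "cmod (Z (\<alpha> n) r) \<le> C" using C(4)[OF n r(1,2)] f0[OF False] by simp
      then have "cmod (?k n r) \<le> 2 * C"
        using fC[OF r(1,2)] norm_triangle_ineq4[of "Z (\<alpha> n) r" "f r"] by linarith
      then show ?thesis by (simp add: ex)
    qed
    show "decaying m l n (2 * C) (?k n)" unfolding decaying_def using * by blast
    show "decaying m l n (2 * C) (\<lambda>r. ?k n (r\<inverse>))" unfolding decaying_def
    proof (intro allI impI)
      fix r :: rel2 assume "finite r" "card r \<le> l" "?k n (r\<inverse>) \<noteq> 0"
      then show "real n ^ card (exits m (r\<inverse>)) * cmod (?k n (r\<inverse>)) \<le> 2 * C \<and> exits m (r\<inverse>) \<subseteq> {..<n}"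
        by (intro *) (auto simp: card_inverse)
    qed
  qed
  have "(\<lambda>n. norm_T lam (\<lambda>w. T_alg (\<alpha> n) \<phi> w - restrict (kop l f) (H_T lam) \<phi> w)) \<longlonglongrightarrow> 0" if \<phi>: "\<phi> \<in> H_T lam" for \<phi>
  proof -
    have eq: "(\<lambda>w. T_alg (\<alpha> n) \<phi> w - restrict (kop l f) (H_T lam) \<phi> w) = kop l (?k n) \<phi>" for n
    proof
      fix w
      show "T_alg (\<alpha> n) \<phi> w - restrict (kop l f) (H_T lam) \<phi> w = kop l (?k n) \<phi> w"
      proof (cases "w \<in> Omega l")
        case True
        have "finite (row_supp l (Z (\<alpha> n)) w)"
          by (rule finite_subset[OF row_supp_Z_finite[OF True]]) simp
        moreover have "finite (row_supp l f w)" using fb True by (simp add: bounded_kernel_def)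
        ultimately show ?thesis using \<phi> by (simp add: T_alg_kop[OF \<phi>] kop_diff flip: l_def)
      next
        case False
        then show ?thesis using \<phi> by (simp add: T_alg_kop[OF \<phi>] kop_def flip: l_def)
      qed
    qed
    show ?thesis unfolding eq unfolding l_def
    proof (rule norm_T_kop_tendsto_0[where m = m and C = "2 * C", OF _ _ C(2) _ _ \<phi>])
      show "(\<lambda>n. ?k n r) \<longlonglongrightarrow> 0" if "finite r" for r
        using zconv_lim[OF A that] by (simp add: LIM_zero)
    qed (use kdec C(1) in \<open>auto simp: l_def\<close>)
  qed
  moreover have "restrict (kop l f) (H_T lam) \<in> bounded_ops lam"
    unfolding l_def by (rule kop_bounded_op) (use fb in \<open>simp add: l_def\<close>)
  ultimately show ?thesis unfolding sot_limit_def l_def by blast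
qed

section \<open>Conjugacy classes of the symmetric group\<close>

definition orbits :: "nat \<Rightarrow> nat perm \<Rightarrow> nat set set"
  where "orbits l g = Perm.orbit g ` {..<l}"

text \<open>Fixed points below \<open>l\<close> count as parts 1, so that the parts add up to
  \<open>l\<close>; the reversal gives the order that Young diagrams require.\<close>

definition cycle_type :: "nat \<Rightarrow> nat perm \<Rightarrow> nat list"
  where "cycle_type l g = rev (sorted_list_of_multiset (image_mset card (mset_set (orbits l g))))"

definition partitions :: "nat \<Rightarrow> nat list set"
  where "partitions l = {lam \<in> young_diagrams. sum_list lam = l}"

lemma orbit_subset_Sn: "g \<in> Sn l \<Longrightarrow> x < l \<Longrightarrow> Perm.orbit g x \<subseteq> {..<l}"
proof -
  assume g: "g \<in> Sn l" and x: "x < l"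
  have "(g ^ n) \<langle>$\<rangle> x < l" for n
    using x by (induction n) (simp_all add: apply_times Sn_less[OF g] apply_one)
  then show ?thesis by (auto simp: Perm.orbit_def)
qed

lemma orbits_partition:
  assumes g: "g \<in> Sn l"
  shows "finite (orbits l g)" "\<Union> (orbits l g) = {..<l}" "disjoint (orbits l g)" "\<And>Ob. Ob \<in> orbits l g \<Longrightarrow>
      finite Ob \<and> Ob \<noteq> {}"
proof -
  show "finite (orbits l g)" by (simp add: orbits_def)
  show "\<Union> (orbits l g) = {..<l}"
    using orbit_subset_Sn[OF g] in_orbit_self[of _ g] by (auto simp: orbits_def)
  show "disjoint (orbits l g)"
    unfolding orbits_def by (auto simp: disjoint_def) (metis IntI Perm.orbit_equiv empty_iff)+
qed (auto simp: orbits_def)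

lemma cycle_type_partition:
  assumes g: "g \<in> Sn l"
  shows "cycle_type l g \<in> partitions l"
proof -
  note o = orbits_partition[OF g]
  let ?M = "image_mset card (mset_set (orbits l g))"
  have "sum_list (cycle_type l g) = sum_mset ?M"
    unfolding cycle_type_def sum_list_rev by (metis mset_sorted_list_of_multiset sum_mset_sum_list)
  also have "\<dots> = (\<Sum>Ob\<in>orbits l g. card Ob)" by (simp add: sum_unfold_sum_mset)
  also have "\<dots> = card (\<Union> (orbits l g))"
    using o by (intro card_Union_disjoint[symmetric]) auto
  finally have "sum_list (cycle_type l g) = l" by (simp add: o(2))
  moreover have "sorted_wrt (\<ge>) (cycle_type l g)"
    unfolding cycle_type_def sorted_wrt_rev by simp
  moreover have "0 \<notin> set (cycle_type l g)"
    using o(1,4) by (auto simp: cycle_type_def)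
  ultimately show ?thesis by (simp add: partitions_def young_diagrams_def)
qed

lemma bij_of_image_mset_eq:
  assumes "finite A" "finite B" "image_mset f (mset_set A) = image_mset f' (mset_set B)"
  shows "\<exists>h. bij_betw h A B \<and> (\<forall>a\<in>A. f' (h a) = f a)"
  using assms
proof (induction A arbitrary: B rule: finite_induct)
  case empty
  then have "B = {}" by (metis finite_set_mset image_mset_is_empty_iff mset_set_empty_iff image_mset_empty mset_set.empty)
  then show ?case by (auto simp: bij_betw_def)
next
  case (insert a A)
  have "f a \<in># image_mset f' (mset_set B)" using insert by (simp flip: insert.prems(2))
  then obtain b where b: "b \<in> B" "f' b = f a" using insert.prems(1) by auto
  have "mset_set B = add_mset b (mset_set (B - {b}))"
    using b insert.prems(1) by (simp add: mset_set.remove)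
  then have "image_mset f (mset_set A) = image_mset f' (mset_set (B - {b}))"
    using insert b by simp
  then obtain h where h: "bij_betw h A (B - {b})" "\<forall>a\<in>A. f' (h a) = f a"
    using insert.IH[of "B - {b}"] insert.prems(1) by auto
  let ?h = "h(a := b)"
  have "bij_betw ?h A (B - {b})"
    using h(1) by (rule bij_betw_cong[THEN iffD1, rotated]) (use insert.hyps in auto)
  moreover have "bij_betw ?h {a} {b}" by (simp add: bij_betw_def)
  ultimately have "bij_betw ?h (A \<union> {a}) ((B - {b}) \<union> {b})"
    by (rule bij_betw_combine) auto
  moreover have "(B - {b}) \<union> {b} = B" "A \<union> {a} = insert a A" using b by auto
  ultimately have bij: "bij_betw ?h (insert a A) B" by simp
  have "\<forall>x\<in>insert a A. f' (?h x) = f x" using h(2) b by simp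
  with bij show ?case by blast
qed

text \<open>Orbits are matched by size, and \<open>w\<close> carries the \<open>n\<close>-th iterate
  of a base point under \<open>g\<close> to the \<open>n\<close>-th iterate of the corresponding
  base point under \<open>h\<close>. The result depends on \<open>n\<close> only modulo the common
  length of the two orbits.\<close>

lemma conjugate_of_cycle_type:
  assumes g: "g \<in> Sn l" and h: "h \<in> Sn l" and eq: "cycle_type l g = cycle_type l h"
  shows "\<exists>w\<in>Sn l. w * g * inverse w = h"
proof -
  have "image_mset card (mset_set (orbits l g)) = image_mset card (mset_set (orbits l h))"
    using eq unfolding cycle_type_def by (metis mset_sorted_list_of_multiset rev_is_rev_conv)
  then obtain \<Phi> where \<Phi>: "bij_betw \<Phi> (orbits l g) (orbits l h)" "\<And>Ob. Ob \<in> orbits l g \<Longrightarrow> card (\<Phi> Ob) = card Ob"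
    using bij_of_image_mset_eq[OF orbits_partition(1)[OF g] orbits_partition(1)[OF h]] by blast
  have orb: "Perm.orbit g x \<in> orbits l g" if "x < l" for x using that by (simp add: orbits_def)
  have rep: "Min Ob \<in> Ob" if "Ob \<in> orbits l g \<or> Ob \<in> orbits l h" for Ob
    using that orbits_partition(4)[OF g] orbits_partition(4)[OF h] by (auto intro!: Min_in)
  have orbit_rep: "Perm.orbit k (Min Ob) = Ob" if "Ob \<in> orbits l k" "k = g \<or> k = h" for k Ob
  proof -
    have "Min Ob \<in> Ob" using rep that by auto
    moreover have "\<exists>x. Ob = Perm.orbit k x" using that by (auto simp: orbits_def)
    ultimately show ?thesis using Perm.orbit_equiv by metis
  qed
  \<comment> \<open>The base point of the orbit of \<open>x\<close>; \<open>r'\<close> below is that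
    of the matched orbit of \<open>h\<close>.\<close>
  define r where "r x = Min (Perm.orbit g x)" for x
  define r' where "r' x = Min (\<Phi> (Perm.orbit g x))" for x
  define w where "w x = (h ^ (SOME n. (g ^ n) \<langle>$\<rangle> (r x) = x)) \<langle>$\<rangle> (r' x)" for x
  have \<Phi>o: "\<Phi> (Perm.orbit g x) \<in> orbits l h" if "x < l" for x
    using \<Phi>(1) orb[OF that] by (auto simp: bij_betw_def)
  have ord: "Perm.order g (r x) = Perm.order h (r' x)" if "x < l" for x
  proof -
    have "Perm.orbit g (r x) = Perm.orbit g x" using orbit_rep[OF orb[OF that]] by (simp add: r_def)
    moreover have "Perm.orbit h (r' x) = \<Phi> (Perm.orbit g x)" using orbit_rep[OF \<Phi>o[OF that]] by (simp add: r'_def)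
    ultimately show ?thesis using \<Phi>(2)[OF orb[OF that]] by (simp only: Perm.order_def o_apply)
  qed
  have ex: "\<exists>n. (g ^ n) \<langle>$\<rangle> (r x) = x" if "x < l" for x
  proof -
    have "x \<in> Perm.orbit g (r x)" using orbit_rep[OF orb[OF that]] in_orbit_self[of x g] by (simp add: r_def)
    then show ?thesis using Perm.in_orbitE by metis
  qed
  have w: "w x = (h ^ n) \<langle>$\<rangle> (r' x)" if x: "x < l" and n: "(g ^ n) \<langle>$\<rangle> (r x) = x" for x n
  proof -
    let ?k = "SOME n. (g ^ n) \<langle>$\<rangle> (r x) = x"
    have "(g ^ ?k) \<langle>$\<rangle> (r x) = x" using ex[OF x] by (rule someI_ex)
    then have "(g ^ ?k) \<langle>$\<rangle> (r x) = (g ^ n) \<langle>$\<rangle> (r x)" using n by simp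
    then have "(h ^ ?k) \<langle>$\<rangle> (r' x) = (h ^ n) \<langle>$\<rangle> (r' x)" by (simp add: apply_power_eq_iff ord[OF x])
    then show ?thesis by (simp add: w_def)
  qed
  have w_orbit: "w x \<in> \<Phi> (Perm.orbit g x)" if x: "x < l" for x
  proof -
    obtain n where "(g ^ n) \<langle>$\<rangle> (r x) = x" using ex[OF x] by blast
    then have "w x \<in> Perm.orbit h (r' x)" using w[OF x] by simp
    then show ?thesis using orbit_rep[OF \<Phi>o[OF x]] by (simp add: r'_def)
  qed
  have w_less: "w x < l" if x: "x < l" for x
    using w_orbit[OF x] \<Phi>o[OF x] orbits_partition(2)[OF h] by blast
  have inj: "inj_on w {..<l}"
  proof (rule inj_onI)
    fix x y assume "x \<in> {..<l}" "y \<in> {..<l}" and wxy: "w x = w y"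
    then have xy: "x < l" "y < l" by auto
    have "\<Phi> (Perm.orbit g x) = \<Phi> (Perm.orbit g y)"
      using orbits_partition(3)[OF h] \<Phi>o[OF xy(1)] \<Phi>o[OF xy(2)] w_orbit[OF xy(1)] w_orbit[OF xy(2)] wxy
      unfolding disjoint_def by (metis IntI empty_iff)
    then have o: "Perm.orbit g x = Perm.orbit g y"
      using \<Phi>(1) orb[OF xy(1)] orb[OF xy(2)] by (auto simp: bij_betw_def inj_on_def)
    obtain n k where n: "(g ^ n) \<langle>$\<rangle> (r x) = x" and k: "(g ^ k) \<langle>$\<rangle> (r y) = y" using ex xy by metis
    have rr: "r x = r y" "r' x = r' y" by (simp_all add: r_def r'_def o)
    have "(h ^ n) \<langle>$\<rangle> (r' x) = (h ^ k) \<langle>$\<rangle> (r' x)" using w[OF xy(1) n] w[OF xy(2) k] wxy rr by simp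
    then have "n mod Perm.order g (r x) = k mod Perm.order g (r x)"
      unfolding ord[OF xy(1)] by (rule apply_power_eq_iff[THEN iffD1])
    then have "(g ^ n) \<langle>$\<rangle> (r x) = (g ^ k) \<langle>$\<rangle> (r x)" by (rule apply_power_eq_iff[THEN iffD2])
    then show "x = y" unfolding n unfolding rr(1) k .
  qed
  have "\<exists>W. (\<forall>x\<in>{..<l}. W \<langle>$\<rangle> x = w x) \<and> affected W \<subseteq> {..<l} \<union> w ` {..<l}"
    by (rule perm_extend[OF finite_lessThan inj]) (intro exI conjI ballI)
  then obtain W where W: "\<forall>x\<in>{..<l}. W \<langle>$\<rangle> x = w x" "affected W \<subseteq> {..<l} \<union> w ` {..<l}"
    by (elim exE conjE)
  have "affected W \<subseteq> {..<l}" using W(2) w_less by auto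
  then have WS: "W \<in> Sn l" by (auto simp: Sn_def in_affected subset_iff)
  have "W * g = h * W"
  proof (rule perm_eqI)
    fix x
    show "(W * g) \<langle>$\<rangle> x = (h * W) \<langle>$\<rangle> x"
    proof (cases "x < l")
      case True
      obtain n where n: "(g ^ n) \<langle>$\<rangle> (r x) = x" using ex[OF True] by blast
      have gx: "g \<langle>$\<rangle> x < l" using True Sn_less[OF g] by simp
      have rg: "r (g \<langle>$\<rangle> x) = r x" "r' (g \<langle>$\<rangle> x) = r' x" by (simp_all add: r_def r'_def)
      have "(g ^ Suc n) \<langle>$\<rangle> (r (g \<langle>$\<rangle> x)) = g \<langle>$\<rangle> x" using n rg by (simp add: apply_times)
      then have "w (g \<langle>$\<rangle> x) = (h ^ Suc n) \<langle>$\<rangle> (r' x)" using w[OF gx] rg by metis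
      also have "\<dots> = h \<langle>$\<rangle> (w x)" using w[OF True n] by (simp add: apply_times)
      finally show ?thesis using True gx W(1) by (simp add: apply_times)
    next
      case False
      then show ?thesis using SnD[OF g] SnD[OF h] SnD[OF WS] by (simp add: apply_times)
    qed
  qed
  then have "W * g * inverse W = h" by (simp add: mult.assoc)
  then show ?thesis using WS by blast
qed

text \<open>An element and its inverse have the same orbits. Class functions are therefore invariant
  under inversion, which \<open>young_class_square\<close> uses.\<close>

lemma conjugate_inverse: "g \<in> Sn l \<Longrightarrow> \<exists>w\<in>Sn l. w * g * inverse w = inverse g"
  by (rule conjugate_of_cycle_type) (simp_all add: cycle_type_def orbits_def)

section \<open>Boxes of Young diagrams\<close>

lemma sum_take_mono: "i \<le> j \<Longrightarrow> sum_list (take i lam) \<le> sum_list (take j (lam :: nat list))"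
proof -
  assume "i \<le> j"
  then have "take j lam = take i lam @ take (j - i) (drop i lam)" by (metis le_add_diff_inverse take_add)
  then show ?thesis by simp
qed

text \<open>Replaces the least element in the definition of \<open>box_row\<close> by a comparison
  with partial sums of the row lengths.\<close>

lemma box_row_less_iff:
  assumes "k < sum_list lam"
  shows "box_row lam k < r \<longleftrightarrow> k < sum_list (take r lam)"
proof
  have ex: "k < sum_list (take (Suc (length lam)) lam)" using assms by simp
  have B: "k < sum_list (take (Suc (box_row lam k)) lam)"
    unfolding box_row_def by (rule LeastI[of "\<lambda>r. k < sum_list (take (Suc r) lam)", OF ex])
  assume "box_row lam k < r"
  then have "Suc (box_row lam k) \<le> r" by simp
  from sum_take_mono[OF this, of lam] B show "k < sum_list (take r lam)" by linarith
next
  assume h: "k < sum_list (take r lam)"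
  then obtain r' where r': "r = Suc r'" by (cases r) auto
  have "box_row lam k \<le> r'" unfolding box_row_def using h by (intro Least_le) (simp add: r')
  then show "box_row lam k < r" using r' by simp
qed

lemma box_decomp:
  assumes k: "k < sum_list lam"
  shows "box_row lam k < length lam" "box_col lam k < lam ! box_row lam k"
    "k = sum_list (take (box_row lam k) lam) + box_col lam k"
proof -
  let ?r = "box_row lam k"
  show r: "?r < length lam" using box_row_less_iff[OF k, of "length lam"] k by simp
  have "k < sum_list (take (Suc ?r) lam)" using box_row_less_iff[OF k, of "Suc ?r"] by simp
  also have "\<dots> = sum_list (take ?r lam) + lam ! ?r" using r by (simp add: take_Suc_conv_app_nth)
  finally have 1: "k < sum_list (take ?r lam) + lam ! ?r" .
  have 2: "sum_list (take ?r lam) \<le> k" using box_row_less_iff[OF k, of ?r] by simp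
  show "box_col lam k < lam ! ?r" "k = sum_list (take ?r lam) + box_col lam k"
    using 1 2 by (simp_all add: box_col_def)
qed

lemma box_inj: "j < sum_list lam \<Longrightarrow> k < sum_list lam \<Longrightarrow> box_row lam j = box_row lam k \<Longrightarrow>
    box_col lam j = box_col lam k \<Longrightarrow> j = k"
  using box_decomp(3) by metis

lemma box_exists:
  assumes "r < length lam" "c < lam ! r"
  shows "\<exists>k<sum_list lam. box_row lam k = r \<and> box_col lam k = c"
proof -
  let ?k = "sum_list (take r lam) + c"
  have S: "sum_list (take (Suc r) lam) = sum_list (take r lam) + lam ! r"
    using assms(1) by (simp add: take_Suc_conv_app_nth)
  have k: "?k < sum_list (take (Suc r) lam)" using S assms(2) by simp
  have kl: "?k < sum_list lam" using k sum_take_mono[of "Suc r" "length lam" lam] assms(1) by simp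
  have "box_row lam ?k < Suc r" using box_row_less_iff[OF kl] k by blast
  moreover have "\<not> box_row lam ?k < r" using box_row_less_iff[OF kl, of r] by simp
  ultimately have "box_row lam ?k = r" by simp
  moreover from this have "box_col lam ?k = c" by (simp add: box_col_def)
  ultimately show ?thesis using kl by blast
qed

lemma column_initial:
  assumes lam: "lam \<in> young_diagrams" and k: "k < sum_list lam" and r: "r \<le> box_row lam k"
  shows "\<exists>j<sum_list lam. box_row lam j = r \<and> box_col lam j = box_col lam k"
proof (rule box_exists)
  note b = box_decomp[OF k]
  show rl: "r < length lam" using r b(1) by simp
  have "lam ! box_row lam k \<le> lam ! r"
  proof (cases "r = box_row lam k")
    case False
    then show ?thesis using lam r b(1) by (auto simp: young_diagrams_def sorted_wrt_iff_nth_less)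
  qed simp
  then show "box_col lam k < lam ! r" using b(2) by simp
qed

text \<open>By hypothesis each column of \<open>mu\<close> receives at most one point from each row
  of \<open>lam\<close>. From the first \<open>r\<close> rows it receives at most \<open>r\<close>
  points, and at most as many as it has boxes; the minimum of the two is the number of its boxes in
  the first \<open>r\<close> rows of \<open>mu\<close>. Summation over the columns gives the
  claim.\<close>

lemma dominance:
  assumes mu: "mu \<in> partitions l" and lam: "sum_list lam = l" and w: "w \<in> Sn l"
    and inj: "inj_on (\<lambda>i. (box_row lam i, box_col mu (w \<langle>$\<rangle> i))) {..<l}"
  shows "sum_list (take r lam) \<le> sum_list (take r mu)"
proof -
  have mu': "mu \<in> young_diagrams" "sum_list mu = l" using mu by (auto simp: partitions_def)
  define A where "A c = {i. i < l \<and> box_row lam i < r \<and> box_col mu (w \<langle>$\<rangle> i) = c}" for c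
  define B where "B c = {x. x < l \<and> box_row mu x < r \<and> box_col mu x = c}" for c
  define X where "X c = {x. x < l \<and> box_col mu x = c}" for c
  have fin: "finite (A c)" "finite (B c)" "finite (X c)" for c by (auto simp: A_def B_def X_def)
  have AB: "card (A c) \<le> card (B c)" for c
  proof -
    have injA: "inj_on (box_row lam) (A c)"
      using inj by (auto simp: inj_on_def A_def)
    have Ar: "card (A c) \<le> r"
    proof -
      have "box_row lam ` A c \<subseteq> {..<r}" by (auto simp: A_def)
      from card_mono[OF _ this] show ?thesis using card_image[OF injA] by simp
    qed
    have AX: "card (A c) \<le> card (X c)"
    proof (rule card_inj_on_le[of "apply w"])
      show "apply w ` A c \<subseteq> X c" using Sn_less[OF w] by (auto simp: A_def X_def)
    qed (auto simp: inj_on_def apply_inj fin)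
    have injX: "inj_on (box_row mu) (X c)" using box_inj[of _ mu] mu'(2) by (auto simp: inj_on_def X_def)
    define R where "R = box_row mu ` X c"
    have cR: "card R = card (X c)" unfolding R_def by (rule card_image[OF injX])
    \<comment> \<open>A column occupies an initial segment \<open>R\<close> of rows, so its first
      \<open>r\<close> rows contain at least \<open>min r (card R)\<close> of its boxes.\<close>
    have down: "s \<in> R" if "t \<in> R" "s \<le> t" for s t
    proof -
      have "\<exists>x. x < l \<and> box_col mu x = c \<and> t = box_row mu x" using that(1) by (auto simp: R_def X_def)
      then have "\<exists>y<l. box_row mu y = s \<and> box_col mu y = c"
        using column_initial[OF mu'(1), of _ s] mu'(2) that(2) by auto
      then show ?thesis by (force simp: R_def X_def)
    qed
    have Rr: "R \<inter> {..<r} = box_row mu ` B c" by (auto simp: R_def X_def B_def)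
    have "card (B c) = card (R \<inter> {..<r})"
      unfolding Rr by (rule card_image[symmetric], rule inj_on_subset[OF injX]) (auto simp: B_def X_def)
    moreover have "min r (card R) \<le> card (R \<inter> {..<r})"
    proof (cases "{..<r} \<subseteq> R")
      case True
      then have "R \<inter> {..<r} = {..<r}" by auto
      then show ?thesis by simp
    next
      case False
      then obtain s where "s < r" "s \<notin> R" by auto
      then have "R \<subseteq> {..<r}" using down by (metis lessThan_iff less_trans linorder_not_less subsetI)
      then have "R \<inter> {..<r} = R" by auto
      then show ?thesis by simp
    qed
    ultimately show ?thesis using Ar AX cR by simp
  qed
  have count: "card {i. i < sum_list nu \<and> box_row nu i < r} = sum_list (take r nu)" for nu
  proof -
    have "sum_list (take r nu) \<le> sum_list nu" by (metis append_take_drop_id le_add1 sum_list_append)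
    then have "{i. i < sum_list nu \<and> box_row nu i < r} = {..<sum_list (take r nu)}"
      using box_row_less_iff[of _ nu r] by auto
    then show ?thesis by simp
  qed
  define C where "C = box_col mu ` {..<l}"
  have C: "finite C" by (simp add: C_def)
  have "sum_list (take r lam) = card (\<Union>c\<in>C. A c)"
  proof -
    have "{i. i < l \<and> box_row lam i < r} = (\<Union>c\<in>C. A c)"
      using Sn_less[OF w] by (auto simp: A_def C_def)
    then show ?thesis using count[of lam] lam by simp
  qed
  also have "\<dots> = (\<Sum>c\<in>C. card (A c))"
    using C fin by (intro card_UN_disjoint) (auto simp: A_def)
  also have "\<dots> \<le> (\<Sum>c\<in>C. card (B c))" by (rule sum_mono) (rule AB)
  also have "\<dots> = card (\<Union>c\<in>C. B c)"
    using C fin by (intro card_UN_disjoint[symmetric]) (auto simp: B_def)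
  also have "(\<Union>c\<in>C. B c) = {i. i < l \<and> box_row mu i < r}" by (auto simp: B_def C_def)
  also have "card \<dots> = sum_list (take r mu)" using count[of mu] mu'(2) by simp
  finally show ?thesis .
qed

text \<open>The first partial sums give equal heads; the absence of 0 excludes that one list ends
  before the other.\<close>

lemma eq_of_partial_sums:
  fixes a b :: "nat list"
  assumes "\<And>r. sum_list (take r a) = sum_list (take r b)" "0 \<notin> set a" "0 \<notin> set b"
  shows "a = b"
  using assms
proof (induction a arbitrary: b)
  case Nil
  have "b = []"
  proof (cases b)
    case (Cons x xs)
    then show ?thesis using Nil(1)[of 1] Nil(3) by simp
  qed simp
  then show ?case by simp
next
  case (Cons x a)
  obtain y c where b: "b = y # c"
  proof (cases b)
    case Nil
    then show ?thesis using Cons.prems(1)[of 1] Cons.prems(2) by simp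
  qed (use that in blast)
  have xy: "x = y" using Cons.prems(1)[of 1] b by simp
  have "sum_list (take r a) = sum_list (take r c)" for r
    using Cons.prems(1)[of "Suc r"] b xy by simp
  then have "a = c" using Cons.IH[of c] Cons.prems(2,3) b by simp
  then show ?case using b xy by simp
qed

lemma finite_partitions: "finite (partitions l)"
proof (rule finite_subset)
  have len: "length lam \<le> sum_list lam" if "0 \<notin> set lam" for lam :: "nat list"
    using that by (induction lam) auto
  show "partitions l \<subseteq> {xs. set xs \<subseteq> {..l} \<and> length xs \<le> l}"
    using len member_le_sum_list by (fastforce simp: partitions_def young_diagrams_def)
  show "finite {xs. set xs \<subseteq> {..l} \<and> length xs \<le> l}" by (rule finite_lists_length_le) simp
qed

section \<open>Young symmetrizers\<close>

definition row_sum :: "nat list \<Rightarrow> (nat perm \<Rightarrow>\<^sub>0 complex)"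
  where "row_sum lam = (\<Sum>p\<in>row_group lam. delta p)"

definition col_sum :: "nat list \<Rightarrow> (nat perm \<Rightarrow>\<^sub>0 complex)"
  where "col_sum lam = (\<Sum>q\<in>col_group lam. Poly_Mapping.single q (of_int (sign (apply q))))"

lemma young_symmetrizer_eq: "young_symmetrizer lam = row_sum lam \<star> col_sum lam"
  by (simp add: young_symmetrizer_def row_sum_def col_sum_def)

lemma row_sum_span: "row_sum lam \<in> span_of (Sn (sum_list lam))"
  unfolding row_sum_def using row_group_subset[of lam] by (intro span_of_sum span_of_single) auto

lemma col_sum_span: "col_sum lam \<in> span_of (Sn (sum_list lam))"
  unfolding col_sum_def using col_group_subset[of lam] by (intro span_of_sum span_of_single) auto

lemma permutation_apply: "permutation (apply (g :: nat perm))"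
proof -
  have "apply g permutes affected g"
  proof (rule bij_imp_permutes)
    show "bij_betw (apply g) (affected g) (affected g)"
    proof (rule bij_betwI[where g = "apply (inverse g)"])
      show "apply (inverse g) \<in> affected g \<rightarrow> affected g"
        by (auto simp: in_affected) (metis apply_inverse_apply(2))
    qed (auto simp: in_affected apply_inj)
  qed (auto simp: in_affected)
  then show ?thesis using finite_affected permutation_permutes by blast
qed

lemma sign_times: "sign (apply (g * h)) = sign (apply (g :: nat perm)) * sign (apply h)"
proof -
  have "apply (g * h) = apply g \<circ> apply h" by (rule ext) (simp add: apply_times)
  then show ?thesis by (simp add: sign_compose permutation_apply)
qed

lemma sign_swap: "i \<noteq> j \<Longrightarrow> sign (apply \<langle>i \<leftrightarrow> j\<rangle>) = -1" for i j :: nat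
proof -
  assume "i \<noteq> j"
  moreover have "apply \<langle>i \<leftrightarrow> j\<rangle> = Transposition.transpose i j"
    by (rule ext) (auto simp: Transposition.transpose_def)
  ultimately show ?thesis by (simp add: sign_swap_id)
qed

lemma row_group_mult: "g \<in> row_group lam \<Longrightarrow> h \<in> row_group lam \<Longrightarrow> g * h \<in> row_group lam"
  by (auto simp: row_group_def Sn_mult apply_times Sn_less)

lemma col_group_mult: "g \<in> col_group lam \<Longrightarrow> h \<in> col_group lam \<Longrightarrow> g * h \<in> col_group lam"
  by (auto simp: col_group_def Sn_mult apply_times Sn_less)

lemma swap_row_group:
  "i < sum_list lam \<Longrightarrow> j < sum_list lam \<Longrightarrow> box_row lam i = box_row lam j \<Longrightarrow> \<langle>i \<leftrightarrow> j\<rangle> \<in> row_group lam"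
  unfolding row_group_def by (auto simp: swap_in_Sn) (metis apply_swap_same apply_swap_simp)

lemma swap_col_group:
  "i < sum_list lam \<Longrightarrow> j < sum_list lam \<Longrightarrow> box_col lam i = box_col lam j \<Longrightarrow> \<langle>i \<leftrightarrow> j\<rangle> \<in> col_group lam"
  unfolding col_group_def by (auto simp: swap_in_Sn) (metis apply_swap_same apply_swap_simp)

lemma row_sum_swap:
  assumes "\<langle>i \<leftrightarrow> j\<rangle> \<in> row_group lam"
  shows "row_sum lam \<star> delta \<langle>i \<leftrightarrow> j\<rangle> = row_sum lam" "delta \<langle>i \<leftrightarrow> j\<rangle> \<star> row_sum lam = row_sum lam"
proof -
  have "bij_betw (\<lambda>p. p * \<langle>i \<leftrightarrow> j\<rangle>) (row_group lam) (row_group lam)"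
    by (rule bij_betwI[where g = "\<lambda>p. p * \<langle>i \<leftrightarrow> j\<rangle>"]) (auto simp: row_group_mult assms mult.assoc)
  from sum.reindex_bij_betw[OF this, of delta] show "row_sum lam \<star> delta \<langle>i \<leftrightarrow> j\<rangle> = row_sum lam"
    by (simp add: row_sum_def conv_sum_left)
  have "bij_betw (\<lambda>p. \<langle>i \<leftrightarrow> j\<rangle> * p) (row_group lam) (row_group lam)"
    by (rule bij_betwI[where g = "\<lambda>p. \<langle>i \<leftrightarrow> j\<rangle> * p"]) (auto simp: row_group_mult assms mult.assoc[symmetric])
  from sum.reindex_bij_betw[OF this, of delta] show "delta \<langle>i \<leftrightarrow> j\<rangle> \<star> row_sum lam = row_sum lam"
    by (simp add: row_sum_def conv_sum_right)
qed

lemma col_sum_swap: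
  assumes "\<langle>i \<leftrightarrow> j\<rangle> \<in> col_group lam" "i \<noteq> j"
  shows "col_sum lam \<star> delta \<langle>i \<leftrightarrow> j\<rangle> = - col_sum lam" "delta \<langle>i \<leftrightarrow> j\<rangle> \<star> col_sum lam = - col_sum lam"
proof -
  let ?f = "\<lambda>q. Poly_Mapping.single q (of_int (sign (apply q))) :: nat perm \<Rightarrow>\<^sub>0 complex"
  have f: "Poly_Mapping.single (q * \<langle>i \<leftrightarrow> j\<rangle>) (of_int (sign (apply q))) = - ?f (q * \<langle>i \<leftrightarrow> j\<rangle>)"
    "Poly_Mapping.single (\<langle>i \<leftrightarrow> j\<rangle> * q) (of_int (sign (apply q))) = - ?f (\<langle>i \<leftrightarrow> j\<rangle> * q)" for q
    by (simp_all add: sign_times sign_swap[OF assms(2)] flip: single_uminus)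
  have "bij_betw (\<lambda>p. p * \<langle>i \<leftrightarrow> j\<rangle>) (col_group lam) (col_group lam)"
    by (rule bij_betwI[where g = "\<lambda>p. p * \<langle>i \<leftrightarrow> j\<rangle>"]) (auto simp: col_group_mult assms mult.assoc)
  from sum.reindex_bij_betw[OF this, of ?f] show "col_sum lam \<star> delta \<langle>i \<leftrightarrow> j\<rangle> = - col_sum lam"
    by (simp add: col_sum_def conv_sum_left f sum_negf)
  have "bij_betw (\<lambda>p. \<langle>i \<leftrightarrow> j\<rangle> * p) (col_group lam) (col_group lam)"
    by (rule bij_betwI[where g = "\<lambda>p. \<langle>i \<leftrightarrow> j\<rangle> * p"]) (auto simp: col_group_mult assms mult.assoc[symmetric])
  from sum.reindex_bij_betw[OF this, of ?f] show "delta \<langle>i \<leftrightarrow> j\<rangle> \<star> col_sum lam = - col_sum lam"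
    by (simp add: col_sum_def conv_sum_right f sum_negf)
qed

lemma poly_mapping_eq_neg: "a = - a \<Longrightarrow> a = 0" for a :: "nat perm \<Rightarrow>\<^sub>0 complex"
proof -
  assume a: "a = - a"
  have "Poly_Mapping.lookup a x = - Poly_Mapping.lookup a x" for x by (subst a) simp
  then show ?thesis by (intro poly_mapping_eqI) simp
qed

text \<open>The transposition of \<open>i\<close> and \<open>j\<close> changes the sign of
  \<open>col_sum mu\<close>; moved across \<open>w\<close> it becomes a row permutation of
  \<open>lam\<close> and is absorbed by \<open>row_sum lam\<close>. So the product equals its
  negative.\<close>

lemma row_col_vanish:
  assumes "sum_list lam = l" "sum_list mu = l" "w \<in> Sn l" "i < l" "j < l" "i \<noteq> j"
    and "box_row lam (w \<langle>$\<rangle> i) = box_row lam (w \<langle>$\<rangle> j)" "box_col mu i = box_col mu j"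
  shows "row_sum lam \<star> delta w \<star> col_sum mu = 0"
proof (rule poly_mapping_eq_neg)
  have R: "\<langle>w \<langle>$\<rangle> i \<leftrightarrow> w \<langle>$\<rangle> j\<rangle> \<in> row_group lam" using assms by (intro swap_row_group) (auto simp: Sn_less)
  have C: "\<langle>i \<leftrightarrow> j\<rangle> \<in> col_group mu" using assms by (intro swap_col_group) auto
  have "row_sum lam \<star> delta w \<star> col_sum mu = row_sum lam \<star> delta (\<langle>w \<langle>$\<rangle> i \<leftrightarrow> w \<langle>$\<rangle> j\<rangle> * w) \<star> col_sum mu"
    using row_sum_swap(1)[OF R] by (metis conv_assoc conv_single_single mult_1_right)
  also have "\<dots> = row_sum lam \<star> delta w \<star> (delta \<langle>i \<leftrightarrow> j\<rangle> \<star> col_sum mu)"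
    using conv_single_single[of w 1 "\<langle>i \<leftrightarrow> j\<rangle>" 1]
        by (simp add: conv_assoc flip: perm_times_swap) (simp flip: conv_assoc)
  finally show "row_sum lam \<star> delta w \<star> col_sum mu = - (row_sum lam \<star> delta w \<star> col_sum mu)"
    by (simp add: col_sum_swap(2)[OF C assms(6)] conv_uminus_right)
qed

lemma col_row_vanish:
  assumes "sum_list lam = l" "sum_list mu = l" "w \<in> Sn l" "i < l" "j < l" "i \<noteq> j"
    and "box_col lam (w \<langle>$\<rangle> i) = box_col lam (w \<langle>$\<rangle> j)" "box_row mu i = box_row mu j"
  shows "col_sum lam \<star> delta w \<star> row_sum mu = 0"
proof (rule poly_mapping_eq_neg)
  have ne: "w \<langle>$\<rangle> i \<noteq> w \<langle>$\<rangle> j" using assms(6) by (simp add: apply_inj)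
  have C: "\<langle>w \<langle>$\<rangle> i \<leftrightarrow> w \<langle>$\<rangle> j\<rangle> \<in> col_group lam" using assms by (intro swap_col_group) (auto simp: Sn_less)
  have R: "\<langle>i \<leftrightarrow> j\<rangle> \<in> row_group mu" using assms by (intro swap_row_group) auto
  have "col_sum lam \<star> delta w \<star> row_sum mu = col_sum lam \<star> delta w \<star> (delta \<langle>i \<leftrightarrow> j\<rangle> \<star> row_sum mu)"
    by (simp only: row_sum_swap(2)[OF R])
  also have "\<dots> = col_sum lam \<star> delta \<langle>w \<langle>$\<rangle> i \<leftrightarrow> w \<langle>$\<rangle> j\<rangle> \<star> delta w \<star> row_sum mu"
    using conv_single_single[of w 1 "\<langle>i \<leftrightarrow> j\<rangle>" 1]
      conv_single_single[of "\<langle>w \<langle>$\<rangle> i \<leftrightarrow> w \<langle>$\<rangle> j\<rangle>" 1 w 1]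
    by (metis conv_assoc perm_times_swap)
  finally show "col_sum lam \<star> delta w \<star> row_sum mu = - (col_sum lam \<star> delta w \<star> row_sum mu)"
    by (simp only: col_sum_swap(1)[OF C ne] conv_uminus_left)
qed

lemma partition_eqI:
  assumes "lam \<in> partitions l" "mu \<in> partitions l"
    and "\<And>r. sum_list (take r lam) \<le> sum_list (take r mu)" "\<And>r. sum_list (take r mu) \<le> sum_list (take r lam)"
  shows "lam = mu"
  using assms by (intro eq_of_partial_sums) (auto simp: partitions_def young_diagrams_def le_antisym)

lemma conv_vanish:
  fixes a b y :: "nat perm \<Rightarrow>\<^sub>0 complex"
  assumes y: "y \<in> span_of G" and 0: "\<And>w. w \<in> G \<Longrightarrow> a \<star> delta w \<star> b = 0"
  shows "a \<star> y \<star> b = 0"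
proof -
  have "a \<star> y \<star> b = (\<Sum>w\<in>Poly_Mapping.keys y. scale (Poly_Mapping.lookup y w) (a \<star> delta w \<star> b))"
    by (simp add: conv_eq_right[of a y] conv_sum_left conv_scale_left)
  also have "\<dots> = 0"
    using y 0 by (intro sum.neutral ballI) (auto simp: span_of_def)
  finally show ?thesis .
qed

text \<open>If products of both kinds, row sum with column sum and column sum with row sum, were
  nonzero for some group elements in between, then \<open>dominance\<close> would hold in both
  directions and the diagrams would be equal.\<close>

lemma young_symmetrizer_orthogonal:
  assumes lam: "lam \<in> partitions l" and mu: "mu \<in> partitions l" and ne: "lam \<noteq> mu" and w: "w \<in> Sn l"
  shows "young_symmetrizer lam \<star> delta w \<star> young_symmetrizer mu = 0"
proof -
  have s: "sum_list lam = l" "sum_list mu = l" using lam mu by (simp_all add: partitions_def)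
  have "(\<forall>v\<in>Sn l. row_sum lam \<star> delta v \<star> col_sum mu = 0) \<or> (\<forall>v\<in>Sn l. col_sum lam \<star> delta v \<star> row_sum mu = 0)"
  proof (rule ccontr)
    assume "\<not> ?thesis"
    then obtain v u where v: "v \<in> Sn l" "row_sum lam \<star> delta v \<star> col_sum mu \<noteq> 0"
      and u: "u \<in> Sn l" "col_sum lam \<star> delta u \<star> row_sum mu \<noteq> 0" by blast
    have "inj_on (\<lambda>i. (box_row lam i, box_col mu (inverse v \<langle>$\<rangle> i))) {..<l}"
    proof (rule inj_onI, rule ccontr)
      fix i j assume ij: "i \<in> {..<l}" "j \<in> {..<l}" "i \<noteq> j"
        "(box_row lam i, box_col mu (inverse v \<langle>$\<rangle> i)) = (box_row lam j, box_col mu (inverse v \<langle>$\<rangle> j))"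
      have "row_sum lam \<star> delta v \<star> col_sum mu = 0"
        using ij v(1) by (intro row_col_vanish[OF s v(1), of "inverse v \<langle>$\<rangle> i" "inverse v \<langle>$\<rangle> j"])
          (simp_all add: Sn_less[of "inverse v" l] apply_inj)
      then show False using v by simp
    qed
    from dominance[OF mu s(1) _ this] have le: "sum_list (take r lam) \<le> sum_list (take r mu)" for r
      using v(1) by simp
    have "inj_on (\<lambda>i. (box_row mu i, box_col lam (u \<langle>$\<rangle> i))) {..<l}"
      using u col_row_vanish[OF s u(1)] by (auto simp: inj_on_def)
    from dominance[OF lam s(2) u(1) this] have "sum_list (take r mu) \<le> sum_list (take r lam)" for r .
    with le partition_eqI[OF lam mu] ne show False by blast
  qed
  \<comment> \<open>In the first case the bracket is treated as an arbitrary element between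
    \<open>row_sum lam\<close> and \<open>col_sum mu\<close>; in the second case the bracket itself
    is 0.\<close>
  then have "row_sum lam \<star> (col_sum lam \<star> delta w \<star> row_sum mu) \<star> col_sum mu = 0"
  proof
    assume *: "\<forall>v\<in>Sn l. row_sum lam \<star> delta v \<star> col_sum mu = 0"
    show ?thesis
    proof (rule conv_vanish[where G = "Sn l"])
      show "col_sum lam \<star> delta w \<star> row_sum mu \<in> span_of (Sn l)"
        using col_sum_span[of lam] row_sum_span[of mu] w s
        by (intro span_of_conv span_of_single Sn_mult) auto
    qed (use * in blast)
  qed (use w in simp)
  then show ?thesis by (simp add: young_symmetrizer_eq conv_assoc)
qed

lemma row_col_group_Int:
  assumes "p \<in> row_group lam" "inverse p \<in> col_group lam"
  shows "p = 1"
proof (rule perm_eqI)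
  fix k
  have S: "p \<in> Sn (sum_list lam)" using assms(1) by (simp add: row_group_def)
  show "p \<langle>$\<rangle> k = 1 \<langle>$\<rangle> k"
  proof (cases "k < sum_list lam")
    case True
    have pk: "p \<langle>$\<rangle> k < sum_list lam" using True Sn_less[OF S] by simp
    have "box_row lam (p \<langle>$\<rangle> k) = box_row lam k" using assms(1) True by (simp add: row_group_def)
    moreover have "box_col lam (inverse p \<langle>$\<rangle> (p \<langle>$\<rangle> k)) = box_col lam (p \<langle>$\<rangle> k)"
      using assms(2) pk unfolding col_group_def by blast
    ultimately have "p \<langle>$\<rangle> k = k" by (intro box_inj[OF pk True]) simp_all
    then show ?thesis by (simp add: apply_one)
  next
    case False
    then show ?thesis using SnD[OF S] by (simp add: apply_one)
  qed
qed

lemma lookup_young_symmetrizer: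
  "Poly_Mapping.lookup (young_symmetrizer lam) x =
     (\<Sum>p\<in>row_group lam. \<Sum>q\<in>col_group lam. if p * q = x then of_int (sign (apply q)) else 0)"
  by (subst sum.swap) (simp add: young_symmetrizer_def conv_sum_left conv_sum_right lookup_sum' lookup_single when_def)

text \<open>A row permutation that is inverse to a column permutation preserves rows and columns and
  hence is the identity; so a single pair contributes, with sign 1.\<close>

lemma young_symmetrizer_1: "Poly_Mapping.lookup (young_symmetrizer lam) 1 = 1"
proof -
  let ?R = "row_group lam" and ?C = "col_group lam"
  have fin: "finite ?R" "finite ?C"
    by (rule finite_subset[OF row_group_subset finite_Sn], rule finite_subset[OF col_group_subset finite_Sn])
  have one: "1 \<in> ?R" "1 \<in> ?C" by (simp_all add: row_group_def col_group_def apply_one)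
  have inner: "(\<Sum>q\<in>?C. if p * q = 1 then of_int (sign (apply q)) else 0) = (if p = 1 then 1 else 0 :: complex)"
    if p: "p \<in> ?R" for p
  proof (cases "p = 1")
    case True
    then show ?thesis using fin one by (simp add: sign_identity)
  next
    case False
    have "p * q \<noteq> 1" if "q \<in> ?C" for q
    proof
      assume "p * q = 1"
      then have "q = inverse p" by (metis perm.inverse_unique)
      then show False using row_col_group_Int[OF p] that False by simp
    qed
    then show ?thesis using False by (intro trans[OF sum.neutral]) auto
  qed
  have "Poly_Mapping.lookup (young_symmetrizer lam) 1 = (\<Sum>p\<in>?R. if p = 1 then 1 else 0)"
    unfolding lookup_young_symmetrizer by (rule sum.cong[OF refl inner])
  then show ?thesis using fin one by simp
qed

section \<open>Class functions\<close>

text \<open>For \<open>lam\<close> of size \<open>l\<close> this is, up to a nonzero factor, the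
  central idempotent that belongs to \<open>lam\<close>.\<close>

definition young_class :: "nat \<Rightarrow> nat list \<Rightarrow> (nat perm \<Rightarrow>\<^sub>0 complex)"
  where "young_class l lam = (\<Sum>w\<in>Sn l. delta w \<star> young_symmetrizer lam \<star> delta (inverse w))"

lemma lookup_young_class:
  "Poly_Mapping.lookup (young_class l lam) x =
      (\<Sum>w\<in>Sn l. Poly_Mapping.lookup (young_symmetrizer lam) (inverse w * x * w))"
  by (simp add: young_class_def lookup_sum' lookup_conv_delta_left lookup_conv_delta_right mult.assoc)

lemma bij_Sn_mult: "h \<in> Sn l \<Longrightarrow> bij_betw (\<lambda>w. h * w) (Sn l) (Sn l)"
  by (rule bij_betwI[where g = "\<lambda>w. inverse h * w"]) (auto simp: Sn_mult mult.assoc[symmetric])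

lemma young_class_conj:
  assumes h: "h \<in> Sn l"
  shows "Poly_Mapping.lookup (young_class l lam) (h * x * inverse h) = Poly_Mapping.lookup (young_class l lam) x"
proof -
  have "inverse (h * w) * (h * x * inverse h) * (h * w) = inverse w * x * w" for w
    by (simp add: mult.assoc) (simp flip: mult.assoc)
  with sum.reindex_bij_betw[OF bij_Sn_mult[OF h],
      of "\<lambda>w. Poly_Mapping.lookup (young_symmetrizer lam) (inverse w * (h * x * inverse h) * w)"]
  show ?thesis by (simp add: lookup_young_class)
qed

lemma young_class_span:
  assumes "sum_list lam = l"
  shows "young_class l lam \<in> span_of (Sn l)"
  unfolding young_class_def using young_symmetrizer_span[of lam] assms
  by (intro span_of_sum span_of_conv span_of_single Sn_mult) auto

lemma young_class_real: "Poly_Mapping.lookup (young_class l lam) x \<in> \<real>"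
  unfolding lookup_young_class lookup_young_symmetrizer by (intro sum_in_Reals) auto

lemma young_class_orthogonal:
  assumes lam: "lam \<in> partitions l" and mu: "mu \<in> partitions l" and ne: "lam \<noteq> mu"
  shows "young_class l lam \<star> young_class l mu = 0"
proof -
  have "(delta w \<star> young_symmetrizer lam \<star> delta (inverse w)) \<star> (delta v \<star> young_symmetrizer mu \<star> delta (inverse v)) = 0"
    if "w \<in> Sn l" "v \<in> Sn l" for w v
  proof -
    have "(delta w \<star> young_symmetrizer lam \<star> delta (inverse w)) \<star> (delta v \<star> young_symmetrizer mu \<star> delta (inverse v)) =
       delta w \<star> (young_symmetrizer lam \<star> (delta (inverse w) \<star> delta v) \<star> young_symmetrizer mu) \<star> delta (inverse v)"
      by (simp only: conv_assoc)
    also have "\<dots> = 0"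
      using young_symmetrizer_orthogonal[OF lam mu ne, of "inverse w * v"] that by (simp add: Sn_mult)
    finally show ?thesis .
  qed
  then show ?thesis by (simp add: young_class_def conv_sum_left conv_sum_right)
qed

text \<open>The coefficients are real and invariant under inversion, so the coefficient of the
  square at 1 is a sum of squares, among them the positive square of
  \<open>card (Sn l)\<close>.\<close>

lemma young_class_square:
  assumes lam: "lam \<in> partitions l"
  shows "young_class l lam \<star> young_class l lam \<noteq> 0"
proof -
  let ?z = "young_class l lam"
  have S: "?z \<in> span_of (Sn l)" using lam by (intro young_class_span) (simp add: partitions_def)
  have inv: "Poly_Mapping.lookup ?z (inverse u) = Poly_Mapping.lookup ?z u" if "u \<in> Sn l" for u
    using conjugate_inverse[OF that] young_class_conj by metis
  have "Poly_Mapping.lookup (?z \<star> ?z) 1 =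
      (\<Sum>u\<in>Poly_Mapping.keys ?z. Poly_Mapping.lookup ?z u * Poly_Mapping.lookup ?z (inverse u))"
    by (simp add: conv_eq_left[of ?z ?z] lookup_sum' lookup_conv_delta_left)
  also have "\<dots> = (\<Sum>u\<in>Poly_Mapping.keys ?z. complex_of_real ((Re (Poly_Mapping.lookup ?z u))\<^sup>2))"
  proof (rule sum.cong[OF refl])
    fix u assume "u \<in> Poly_Mapping.keys ?z"
    then have "u \<in> Sn l" using S by (auto simp: span_of_def)
    moreover have "Poly_Mapping.lookup ?z u = complex_of_real (Re (Poly_Mapping.lookup ?z u))"
      using young_class_real[of l lam u] by simp
    ultimately show "Poly_Mapping.lookup ?z u * Poly_Mapping.lookup ?z (inverse u) =
        complex_of_real ((Re (Poly_Mapping.lookup ?z u))\<^sup>2)"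
      by (metis inv of_real_power power2_eq_square)
  qed
  also have "\<dots> = complex_of_real (\<Sum>u\<in>Poly_Mapping.keys ?z. (Re (Poly_Mapping.lookup ?z u))\<^sup>2)" by simp
  finally have eq: "Poly_Mapping.lookup (?z \<star> ?z) 1 = \<dots>" .
  have one: "Poly_Mapping.lookup ?z 1 = of_nat (card (Sn l))"
    by (simp add: lookup_young_class young_symmetrizer_1)
  have "card (Sn l) \<noteq> 0" using finite_Sn[of l] Sn_one[of l] by (metis card_eq_0_iff empty_iff)
  then have pos: "(Re (Poly_Mapping.lookup ?z 1))\<^sup>2 > 0" and k: "1 \<in> Poly_Mapping.keys ?z"
    by (simp_all add: one in_keys_iff)
  have "(\<Sum>u\<in>Poly_Mapping.keys ?z. (Re (Poly_Mapping.lookup ?z u))\<^sup>2) > 0"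
    using pos by (intro sum_pos2[OF finite_keys k]) auto
  then have "Poly_Mapping.lookup (?z \<star> ?z) 1 \<noteq> 0" unfolding eq by (simp only: of_real_eq_0_iff)
  then show ?thesis by auto
qed

text \<open>Multiplication by one member annihilates all the others, while its square is
  nonzero.\<close>

lemma young_class_independent:
  "inj_on (young_class l) (partitions l)" "\<not> alg.dependent (young_class l ` partitions l)"
proof -
  show inj: "inj_on (young_class l) (partitions l)"
    using young_class_orthogonal young_class_square by (metis inj_onI)
  show "\<not> alg.dependent (young_class l ` partitions l)"
  proof (rule alg.independent_if_scalars_zero)
    show "finite (young_class l ` partitions l)" using finite_partitions by simp
  next
    fix f x assume 0: "(\<Sum>x\<in>young_class l ` partitions l. scale (f x) x) = 0" and "x \<in> young_class l ` partitions l"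
    then obtain mu where mu: "mu \<in> partitions l" "x = young_class l mu" by blast
    have "(\<Sum>x\<in>young_class l ` partitions l. scale (f x) x) =
        (\<Sum>lam\<in>partitions l. scale (f (young_class l lam)) (young_class l lam))"
      by (simp add: sum.reindex[OF inj])
    then have "0 = (\<Sum>lam\<in>partitions l. scale (f (young_class l lam)) (young_class l lam \<star> x))"
      using 0 conv_sum_left[of "\<lambda>lam. scale (f (young_class l lam)) (young_class l lam)" "partitions l" x]
      by (simp add: conv_scale_left)
    also have "\<dots> = (\<Sum>lam\<in>partitions l. if lam = mu then scale (f x) (x \<star> x) else 0)"
      using mu by (intro sum.cong refl) (auto simp: young_class_orthogonal)
    also have "\<dots> = scale (f x) (x \<star> x)" using mu finite_partitions by simp
    finally have z: "scale (f x) (x \<star> x) = 0" by simp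
    obtain g where g: "Poly_Mapping.lookup (x \<star> x) g \<noteq> 0"
      using young_class_square[OF mu(1)] mu(2) by (metis poly_mapping_eqI lookup_zero)
    have "f x * Poly_Mapping.lookup (x \<star> x) g = 0" using z by (metis lookup_scale lookup_zero)
    then show "f x = 0" using g by simp
  qed
qed

definition class_sum :: "nat \<Rightarrow> nat list \<Rightarrow> (nat perm \<Rightarrow>\<^sub>0 complex)"
  where "class_sum l t = (\<Sum>g | g \<in> Sn l \<and> cycle_type l g = t. delta g)"

text \<open>Elements of the same cycle type are conjugate, so a class function is a function of the
  cycle type.\<close>

lemma class_function_span:
  assumes a: "a \<in> span_of (Sn l)"
    and inv: "\<And>g w. g \<in> Sn l \<Longrightarrow> w \<in> Sn l \<Longrightarrow> Poly_Mapping.lookup a (w * g * inverse w) = Poly_Mapping.lookup a g"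
  shows "a \<in> alg.span (class_sum l ` partitions l)"
proof -
  have "\<exists>c. \<forall>g\<in>Sn l. Poly_Mapping.lookup a g = c (cycle_type l g)"
  proof -
    have "Poly_Mapping.lookup a g = Poly_Mapping.lookup a h"
      if "g \<in> Sn l" "h \<in> Sn l" "cycle_type l g = cycle_type l h" for g h
      using conjugate_of_cycle_type[OF that] inv that(1) by metis
    then have "\<forall>g\<in>Sn l. Poly_Mapping.lookup a g =
        (\<lambda>t. Poly_Mapping.lookup a (SOME h. h \<in> Sn l \<and> cycle_type l h = t)) (cycle_type l g)"
      by (metis (mono_tags, lifting) someI_ex)
    then show ?thesis by (rule exI[of _ "\<lambda>t. Poly_Mapping.lookup a (SOME h. h \<in> Sn l \<and> cycle_type l h = t)"])
  qed
  then obtain c where c: "\<And>g. g \<in> Sn l \<Longrightarrow> Poly_Mapping.lookup a g = c (cycle_type l g)" by blast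
  have "a = (\<Sum>t\<in>partitions l. scale (c t) (class_sum l t))"
  proof (rule poly_mapping_eqI)
    fix x
    have fin: "finite {g. g \<in> Sn l \<and> cycle_type l g = t}" for t using finite_Sn[of l] by simp
    have L: "Poly_Mapping.lookup (class_sum l t) x = (if x \<in> Sn l \<and> cycle_type l x = t then 1 else 0)" for t
      using fin by (simp add: class_sum_def lookup_sum' lookup_single when_def)
    show "Poly_Mapping.lookup a x = Poly_Mapping.lookup (\<Sum>t\<in>partitions l. scale (c t) (class_sum l t)) x"
    proof (cases "x \<in> Sn l")
      case True
      have "Poly_Mapping.lookup (\<Sum>t\<in>partitions l. scale (c t) (class_sum l t)) x =
         (\<Sum>t\<in>partitions l. if t = cycle_type l x then c t else 0)"
        using True by (auto simp: lookup_sum' L intro!: sum.cong)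
      then show ?thesis using c[OF True] cycle_type_partition[OF True] finite_partitions by simp
    next
      case False
      then have "Poly_Mapping.lookup a x = 0" using a by (auto simp: span_of_def in_keys_iff)
      then show ?thesis using False by (simp add: lookup_sum' L)
    qed
  qed
  then show ?thesis by (metis (no_types, lifting) alg.span_base alg.span_scale alg.span_sum imageI)
qed

text \<open>There are at most as many conjugacy classes as partitions, so the independent family
  \<^const>\<open>young_class\<close> spans the class functions.\<close>

theorem delta_one_young_class:
  "\<exists>k. delta 1 = (\<Sum>lam\<in>partitions l. scale (k lam) (young_class l lam))"
proof -
  let ?S = "young_class l ` partitions l" and ?T = "class_sum l ` partitions l"
  have T: "finite ?T" using finite_partitions by simp
  have cT: "card ?T \<le> card ?S"
    using card_image_le[OF finite_partitions] card_image[OF young_class_independent(1)] by metis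
  have ST: "?S \<subseteq> alg.span ?T"
  proof
    fix x assume "x \<in> ?S"
    then obtain lam where "sum_list lam = l" "x = young_class l lam" by (auto simp: partitions_def)
    then show "x \<in> alg.span ?T"
      using young_class_conj young_class_span by (intro class_function_span) auto
  qed
  have "w * g * inverse w = 1 \<longleftrightarrow> g = 1" for w g :: "nat perm"
  proof
    assume "w * g * inverse w = 1"
    then have "inverse w * (w * g * inverse w) * w = 1" by simp
    then show "g = 1" by (simp add: mult.assoc) (simp flip: mult.assoc)
  qed simp
  then have 1: "delta 1 \<in> alg.span ?T"
    by (intro class_function_span span_of_single) (auto simp: lookup_single when_def)
  have "delta 1 \<in> alg.span ?S"
  \<comment> \<open>Otherwise adjoining \<open>delta 1\<close> would give an independent family in
    the span of the class sums with more members than there are class sums.\<close>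
  proof (rule ccontr)
    assume n: "delta 1 \<notin> alg.span ?S"
    then have "\<not> alg.dependent (insert (delta 1) ?S)"
      using young_class_independent(2) by (rule alg.independent_insertI)
    from alg.independent_span_bound[OF T this] have "card (insert (delta 1) ?S) \<le> card ?T" using ST 1 by simp
    moreover have "delta 1 \<notin> ?S" using n alg.span_base by blast
    ultimately show False using cT finite_partitions by simp
  qed
  then obtain k where "delta 1 = (\<Sum>x\<in>?S. scale (k x) x)"
    using alg.span_finite[of ?S] finite_partitions by auto
  then have "delta 1 = (\<Sum>lam\<in>partitions l. scale (k (young_class l lam)) (young_class l lam))"
    by (simp add: sum.reindex[OF young_class_independent(1)])
  then show ?thesis by (rule exI[of _ "\<lambda>lam. k (young_class l lam)"])
qed

section \<open>Recovering the zeta transform from the representations\<close>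

text \<open>The equivariant function on the orbit of \<open>v\<close> with value \<open>x\<close> at
  \<open>v\<close>; for \<open>v\<close> in \<open>Omega l\<close> the left action on the orbit is
  free, so at most one summand is nonzero.\<close>

definition orbit_vec :: "nat \<Rightarrow> inf_mat \<Rightarrow> (nat perm \<Rightarrow>\<^sub>0 complex) \<Rightarrow> T_vec"
  where "orbit_vec l v x u = (\<Sum>s\<in>Sn l. if u = mat_prod (perm_mat s) v then delta s \<star> x else 0)"

lemma orbit_vec_H_T:
  assumes x: "x \<in> H_pi lam" and v: "v \<in> Omega (sum_list lam)"
  shows "orbit_vec (sum_list lam) v x \<in> H_T lam"
proof -
  let ?l = "sum_list lam"
  let ?f = "orbit_vec ?l v x"
  let ?X = "(\<lambda>s. mat_prod (perm_mat s) v) ` Sn ?l"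
  have X: "?X \<subseteq> Omega ?l" using Omega_left1[OF v] by auto
  have zero: "?f u = 0" if "u \<notin> ?X" for u
    unfolding orbit_vec_def using that by (intro sum.neutral) auto
  have "?f u \<in> H_pi lam" for u
    unfolding orbit_vec_def by (intro H_pi_sum) (auto simp: H_pi_0 intro: H_pi_rep x)
  moreover have "(\<lambda>u. nsq (?f u)) summable_on Omega ?l"
  proof (rule summable_on_cong_neutral[THEN iffD1])
    show "(\<lambda>u. nsq (?f u)) summable_on ?X" using finite_Sn by (intro summable_on_finite) simp
  qed (use X zero in auto)
  moreover have "?f (mat_prod (perm_mat t) u) = delta t \<star> ?f u" if t: "t \<in> Sn ?l" for t u
  proof -
    have eq: "mat_prod (perm_mat t) u = mat_prod (perm_mat (t * s)) v \<longleftrightarrow> u = mat_prod (perm_mat s) v" for s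
    proof -
      have "mat_prod (perm_mat (t * s)) v = mat_prod (perm_mat t) (mat_prod (perm_mat s) v)"
        by (simp add: mat_prod_left apply_times)
      then show ?thesis using mat_prod_left_inverse(1)[of t] by metis
    qed
    have "?f (mat_prod (perm_mat t) u) =
        (\<Sum>s\<in>Sn ?l. if mat_prod (perm_mat t) u = mat_prod (perm_mat (t * s)) v then delta (t * s) \<star> x else 0)"
      unfolding orbit_vec_def by (rule sum.reindex_bij_betw[OF bij_Sn_mult[OF t], symmetric])
    also have "\<dots> = (\<Sum>s\<in>Sn ?l. delta t \<star> (if u = mat_prod (perm_mat s) v then delta s \<star> x else 0))"
      unfolding eq by (intro sum.cong refl) (simp flip: conv_assoc)
    finally show ?thesis by (simp add: orbit_vec_def conv_sum_right)
  qed
  moreover have "?f u = 0" if "u \<notin> Omega ?l" for u using that X by (intro zero) blast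
  ultimately show ?thesis unfolding H_T_iff by blast
qed

text \<open>All values of the zeta transform at links from \<open>w\<close> to the orbit of
  \<open>v\<close> are gathered in one element of the group algebra, which acts on \<open>x\<close>
  by multiplication.\<close>

lemma T_alg_orbit_vec:
  assumes w: "w \<in> Omega l" and v: "v \<in> Omega l"
  shows "T_alg a (orbit_vec l v x) w = (\<Sum>s\<in>Sn l. scale (Z a (link w (mat_prod (perm_mat s) v))) (delta s)) \<star> x"
proof -
  have "T_alg a (orbit_vec l v x) w = (\<Sum>g\<in>Poly_Mapping.keys a. \<Sum>s\<in>Sn l.
      scale (if link w (mat_prod (perm_mat s) v) \<subseteq> prel g then Poly_Mapping.lookup a g else 0) (delta s \<star> x))"
    unfolding T_alg_def T_rep_def orbit_vec_def scale_sum
    by (intro sum.cong refl) (simp add: mat_prod_eq_iff_link[OF w Omega_left1[OF v]])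
  also have "\<dots> = (\<Sum>s\<in>Sn l. scale (Z a (link w (mat_prod (perm_mat s) v))) (delta s \<star> x))"
    by (subst sum.swap) (simp add: zeta_superset[of "Poly_Mapping.keys a"] alg.scale_sum_left)
  finally show ?thesis by (simp add: conv_sum_left conv_scale_left)
qed

text \<open>Enumerate the pairs of \<open>r\<close>; \<open>w\<close> lists their first and
  \<open>v\<close> their second components.\<close>

lemma ex_link:
  assumes "finite r" "one_one r" "card r = l"
  shows "\<exists>w v. w \<in> Omega l \<and> v \<in> Omega l \<and> link w v = r"
proof -
  obtain e where e: "bij_betw e {..<l} r"
    using ex_bij_betw_nat_finite[OF assms(1)] assms(3) atLeast0LessThan by metis
  have er: "(fst (e i), snd (e i)) \<in> r" if "i < l" for i using e that by (auto simp: bij_betw_def)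
  have inj: "i = j" if "i < l" "j < l" "e i = e j" for i j using e that by (auto simp: bij_betw_def inj_on_def)
  define p where "p f = {(i, f (e i) :: nat) | i. i < l}" for f
  have "one_one (p fst)"
  proof (rule one_oneI)
    fix i i' j assume "(i, j) \<in> p fst" "(i', j) \<in> p fst"
    then have i: "i < l" "i' < l" "fst (e i) = fst (e i')" by (auto simp: p_def)
    then have "snd (e i) = snd (e i')" using er[OF i(1)] er[OF i(2)] one_one_eq1[OF assms(2)] by metis
    then show "i = i'" using inj i by (simp add: prod_eq_iff)
  qed (auto simp: p_def)
  moreover have "one_one (p snd)"
  proof (rule one_oneI)
    fix i i' j assume "(i, j) \<in> p snd" "(i', j) \<in> p snd"
    then have i: "i < l" "i' < l" "snd (e i) = snd (e i')" by (auto simp: p_def)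
    then have "fst (e i) = fst (e i')" using er[OF i(1)] er[OF i(2)] one_one_eq2[OF assms(2)] by metis
    then show "i = i'" using inj i by (simp add: prod_eq_iff)
  qed (auto simp: p_def)
  moreover have "Domain (p f) = {..<l}" for f by (auto simp: p_def)
  ultimately have "of_rel (p fst) \<in> Omega l" "of_rel (p snd) \<in> Omega l" by (simp_all add: of_rel_Omega)
  moreover have "link (of_rel (p fst)) (of_rel (p snd)) = r"
  proof -
    have "link (of_rel (p fst)) (of_rel (p snd)) = {(fst (e i), snd (e i)) | i. i < l}"
      unfolding link_def relw_of_rel p_def by blast
    also have "\<dots> = e ` {..<l}" by auto
    finally have "link (of_rel (p fst)) (of_rel (p snd)) = e ` {..<l}" .
    then show ?thesis using e by (simp add: bij_betw_def)
  qed
  ultimately show ?thesis by blast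
qed

text \<open>The element \<open>y\<close> has coefficient \<open>Z a r\<close> at 1, and its products
  with \<open>delta s \<star> young_symmetrizer lam\<close> are values of operators at orbit
  vectors, by \<open>T_alg_orbit_vec\<close>. The remaining factor \<open>delta (inverse s)\<close>
  of a conjugate only shifts the coefficient from 1 to \<open>s\<close>.\<close>

lemma Z_eq_T_alg:
  assumes "finite r" "one_one r" "card r = l"
  shows "\<exists>w v k. w \<in> Omega l \<and> v \<in> Omega l \<and> (\<forall>a. Z a r = (\<Sum>lam\<in>partitions l. \<Sum>s\<in>Sn l.
    k lam * Poly_Mapping.lookup (T_alg a (orbit_vec l v (delta s \<star> young_symmetrizer lam)) w) s))"
proof -
  obtain w v where wv: "w \<in> Omega l" "v \<in> Omega l" "link w v = r"
    using ex_link[OF assms] by blast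
  obtain k where k: "delta 1 = (\<Sum>lam\<in>partitions l. scale (k lam) (young_class l lam))"
    using delta_one_young_class by blast
  have "Z a r = (\<Sum>lam\<in>partitions l. \<Sum>s\<in>Sn l.
    k lam * Poly_Mapping.lookup (T_alg a (orbit_vec l v (delta s \<star> young_symmetrizer lam)) w) s)" for a
  proof -
    define y where "y = (\<Sum>s\<in>Sn l. scale (Z a (link w (mat_prod (perm_mat s) v))) (delta s))"
    have "mat_prod (perm_mat 1) v = v" by (simp add: mat_prod_left apply_one)
    then have "Z a r = Poly_Mapping.lookup y 1"
      using finite_Sn[of l] wv(3) by (simp add: y_def lookup_sum' lookup_single when_def if_distrib cong: if_cong)
    also have "y = y \<star> (\<Sum>lam\<in>partitions l. scale (k lam) (young_class l lam))"
      by (simp flip: k)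
    also have "\<dots> = (\<Sum>lam\<in>partitions l. \<Sum>s\<in>Sn l.
        scale (k lam) (y \<star> (delta s \<star> young_symmetrizer lam) \<star> delta (inverse s)))"
      by (simp add: young_class_def conv_sum_right conv_scale_right scale_sum conv_assoc)
    also have "Poly_Mapping.lookup \<dots> 1 = (\<Sum>lam\<in>partitions l. \<Sum>s\<in>Sn l.
        k lam * Poly_Mapping.lookup (y \<star> (delta s \<star> young_symmetrizer lam)) s)"
      by (simp add: lookup_sum' lookup_conv_delta_right)
    finally show ?thesis by (simp add: T_alg_orbit_vec[OF wv(1,2)] y_def)
  qed
  then show ?thesis using wv by blast
qed

lemma orbit_vec_symmetrizer_H_T:
  assumes "lam \<in> partitions l" "s \<in> Sn l" "v \<in> Omega l"
  shows "orbit_vec l v (delta s \<star> young_symmetrizer lam) \<in> H_T lam"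
proof -
  have l: "sum_list lam = l" using assms(1) by (simp add: partitions_def)
  have "delta s \<star> young_symmetrizer lam \<in> H_pi lam"
    unfolding H_pi_iff using assms(2) l by (intro bexI[of _ "delta s"] refl span_of_single) simp
  from orbit_vec_H_T[OF this] show ?thesis using l assms(3) by simp
qed

text \<open>The limit depends on the operators only, which makes \<^const>\<open>limz\<close> respect the equivalence.\<close>

lemma sot_Z_tendsto:
  assumes A: "\<And>lam. lam \<in> young_diagrams \<Longrightarrow> sot_limit lam \<alpha> (A lam)" and r: "finite r" "one_one r"
  shows "\<exists>c. \<forall>\<beta>. (\<forall>lam\<in>young_diagrams. sot_limit lam \<beta> (A lam)) \<longrightarrow> (\<lambda>n. Z (\<beta> n) r) \<longlonglongrightarrow> c"
proof -
  obtain w v k where wv: "w \<in> Omega (card r)" "v \<in> Omega (card r)"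
      and Z: "\<And>a. Z a r = (\<Sum>lam\<in>partitions (card r). \<Sum>s\<in>Sn (card r).
    k lam * Poly_Mapping.lookup (T_alg a (orbit_vec (card r) v (delta s \<star> young_symmetrizer lam)) w) s)"
    using Z_eq_T_alg[OF r refl] by (elim exE conjE) blast
  have "(\<lambda>n. Z (\<beta> n) r) \<longlonglongrightarrow> (\<Sum>lam\<in>partitions (card r). \<Sum>s\<in>Sn (card r).
      k lam * Poly_Mapping.lookup (A lam (orbit_vec (card r) v (delta s \<star> young_symmetrizer lam)) w) s)"
    if "\<forall>lam\<in>young_diagrams. sot_limit lam \<beta> (A lam)" for \<beta>
    unfolding Z
  proof (intro tendsto_sum tendsto_mult tendsto_const sot_limit_pointwise)
    fix lam s assume ls: "lam \<in> partitions (card r)" "s \<in> Sn (card r)"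
    show "sot_limit lam \<beta> (A lam)" using that ls(1) by (simp add: partitions_def)
    show "orbit_vec (card r) v (delta s \<star> young_symmetrizer lam) \<in> H_T lam"
      by (rule orbit_vec_symmetrizer_H_T[OF ls wv(2)])
  qed
  then show ?thesis by blast
qed

section \<open>The virtual group algebra\<close>

lemma limz_tendsto:
  assumes "\<And>lam. lam \<in> young_diagrams \<Longrightarrow> sot_limit lam \<alpha> (A lam)" "finite r"
  shows "(\<lambda>n. Z (\<alpha> n) r) \<longlonglongrightarrow> limz prel \<alpha> r"
proof (cases "one_one r")
  case True
  obtain c where "(\<lambda>n. Z (\<alpha> n) r) \<longlonglongrightarrow> c" using sot_Z_tendsto[OF assms True] assms(1) by blast
  then show ?thesis using assms(2) by (simp add: limz_def limI)
next
  case False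
  then show ?thesis using assms(2) by (simp add: limz_def Z_not_one_one limI)
qed

text \<open>One direction recovers the limits of zeta values from the operator limits by
  \<open>limz_tendsto\<close>; the other is \<open>zconv_sot_limit\<close>.\<close>

lemma convergent_seqs_iff: "\<alpha> \<in> convergent_seqs \<longleftrightarrow> (\<exists>m f. zconv m \<alpha> f)"
proof
  assume c: "\<alpha> \<in> convergent_seqs"
  obtain m where m: "\<forall>\<^sub>F n in sequentially. \<alpha> n \<in> B_cent m n" using c unfolding convergent_seqs_def by blast
  obtain d where d: "\<And>n. n \<ge> 1 \<Longrightarrow> alg_deg perm_deg (\<alpha> n) \<le> d"
    using c unfolding convergent_seqs_def bdd_above_def by auto
  have "\<forall>lam\<in>young_diagrams. \<exists>A. sot_limit lam \<alpha> A" using c unfolding convergent_seqs_def by blast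
  then obtain A where A: "\<And>lam. lam \<in> young_diagrams \<Longrightarrow> sot_limit lam \<alpha> (A lam)" by metis
  have "zconv m \<alpha> (limz prel \<alpha>)"
  proof (rule zconvI[OF m])
    show "perm_deg u \<le> d" if "n \<ge> 1" "u \<in> Poly_Mapping.keys (\<alpha> n)" for n u
      using d[OF that(1)] that(2) by (simp add: alg_deg_le_iff)
    show "(\<lambda>n. Z (\<alpha> n) r) \<longlonglongrightarrow> limz prel \<alpha> r" if "finite r" for r
      by (rule limz_tendsto[OF A that])
  qed (simp add: limz_def)
  then show "\<exists>m f. zconv m \<alpha> f" by blast
next
  assume "\<exists>m f. zconv m \<alpha> f"
  then obtain m f where z: "zconv m \<alpha> f" by blast
  obtain d where d: "\<And>n u. n \<ge> 1 \<Longrightarrow> u \<in> Poly_Mapping.keys (\<alpha> n) \<Longrightarrow> perm_deg u \<le> d"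
    using zconv_deg[OF z] by blast
  have "\<forall>\<^sub>F n in sequentially. \<alpha> n \<in> span_of (Sn n)"
    using zconv_cent[OF z] by eventually_elim (simp add: B_cent_def centralizer_def)
  moreover have "bdd_above ((\<lambda>n. alg_deg perm_deg (\<alpha> n)) ` {1..})"
    by (rule bdd_aboveI[where M = d]) (use d in \<open>auto simp: alg_deg_le_iff\<close>)
  ultimately show "\<alpha> \<in> convergent_seqs"
    unfolding convergent_seqs_def using zconv_cent[OF z] zconv_sot_limit[OF z] by blast
qed

lemma convergent_equiv_iff:
  "convergent_equiv = {(\<alpha>, \<beta>). \<alpha> \<in> convergent_seqs \<and> \<beta> \<in> convergent_seqs \<and> limz prel \<alpha> = limz prel \<beta>}"
proof -
  have "(\<forall>lam\<in>young_diagrams. T_bar lam \<alpha> = T_bar lam \<beta>) \<longleftrightarrow> limz prel \<alpha> = limz prel \<beta>"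
    if a: "\<alpha> \<in> convergent_seqs" and b: "\<beta> \<in> convergent_seqs" for \<alpha> \<beta>
  proof
    assume eq: "\<forall>lam\<in>young_diagrams. T_bar lam \<alpha> = T_bar lam \<beta>"
    have sot: "sot_limit lam \<gamma> (T_bar lam \<gamma>)" if "\<gamma> \<in> convergent_seqs" "lam \<in> young_diagrams" for \<gamma> lam
    proof -
      have "\<exists>A. sot_limit lam \<gamma> A" using that unfolding convergent_seqs_def by blast
      then show ?thesis using T_bar_eq by metis
    qed
    show "limz prel \<alpha> = limz prel \<beta>"
    proof
      fix r
      show "limz prel \<alpha> r = limz prel \<beta> r"
      proof (cases "finite r \<and> one_one r")
        case True
        \<comment> \<open>The constant serves every sequence with the operator limits of
          \<open>\<alpha>\<close>, and hence both of the given ones.\<close>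
        have "\<exists>c. \<forall>\<gamma>. (\<forall>lam\<in>young_diagrams. sot_limit lam \<gamma> (T_bar lam \<alpha>)) \<longrightarrow> (\<lambda>n. Z (\<gamma> n) r) \<longlonglongrightarrow> c"
          using True by (intro sot_Z_tendsto[of \<alpha>] sot[OF a]) auto
        then obtain c where c: "\<And>\<gamma>. \<forall>lam\<in>young_diagrams. sot_limit lam \<gamma> (T_bar lam \<alpha>) \<Longrightarrow> (\<lambda>n. Z (\<gamma> n) r) \<longlonglongrightarrow> c"
          by blast
        have "(\<lambda>n. Z (\<alpha> n) r) \<longlonglongrightarrow> c" by (rule c) (use sot[OF a] in blast)
        moreover have "(\<lambda>n. Z (\<beta> n) r) \<longlonglongrightarrow> c" by (rule c) (use sot[OF b] eq in auto)
        ultimately show ?thesis by (simp add: limz_def limI)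
      next
        case False
        then show ?thesis by (auto simp: limz_def Z_not_one_one)
      qed
    qed
  next
    assume eq: "limz prel \<alpha> = limz prel \<beta>"
    obtain m f m' f' where z: "zconv m \<alpha> f" "zconv m' \<beta> f'" using a b by (auto simp: convergent_seqs_iff)
    then have "f = f'" using eq by (simp add: limz_zconv)
    then show "\<forall>lam\<in>young_diagrams. T_bar lam \<alpha> = T_bar lam \<beta>"
      using T_bar_eq[OF zconv_sot_limit[OF z(1)]] T_bar_eq[OF zconv_sot_limit[OF z(2)]] by simp
  qed
  then show ?thesis unfolding convergent_equiv_def by blast
qed

lemma virtual_seq_rep:
  "seq_rep convergent_seqs convergent_equiv (\<lambda>n. 1) (limz prel) {f. \<exists>m \<alpha>. zconv m \<alpha> f}"
proof (rule seq_rep.intro)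
  let ?C = convergent_seqs
  show "convergent_equiv = {(a, b). a \<in> ?C \<and> b \<in> ?C \<and> limz prel a = limz prel b}"
    by (rule convergent_equiv_iff)
  show "limz prel ` ?C = {f. \<exists>m \<alpha>. zconv m \<alpha> f}"
  proof (intro equalityI subsetI)
    fix f assume "f \<in> {f. \<exists>m \<alpha>. zconv m \<alpha> f}"
    then obtain m \<alpha> where z: "zconv m \<alpha> f" by blast
    then have "\<alpha> \<in> ?C" using convergent_seqs_iff by blast
    then show "f \<in> limz prel ` ?C" using limz_zconv[OF z] by (metis imageI)
  next
    fix f assume "f \<in> limz prel ` ?C"
    then obtain \<alpha> m g where "f = limz prel \<alpha>" "zconv m \<alpha> g" by (auto simp: convergent_seqs_iff)
    then have "zconv m \<alpha> f" using limz_zconv by metis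
    then show "f \<in> {f. \<exists>m \<alpha>. zconv m \<alpha> f}" by blast
  qed
  have two: "\<exists>m. zconv m a (limz prel a) \<and> zconv m b (limz prel b)" if ab: "a \<in> ?C" "b \<in> ?C" for a b
  proof -
    obtain m f m' f' where z: "zconv m a f" "zconv m' b f'" using ab by (auto simp: convergent_seqs_iff)
    then have "zconv (max m m') a f" "zconv (max m m') b f'"
        using zconv_mono by (meson max.cobounded1 max.cobounded2)+
    then show ?thesis using limz_zconv by metis
  qed
  have I: "x \<in> ?C \<and> limz prel x = f" if "zconv m x f" for m x f
    using that limz_zconv convergent_seqs_iff by blast
  show "(\<lambda>n. a n \<star> b n) \<in> ?C \<and> limz prel (\<lambda>n. a n \<star> b n) = mul (limz prel a) (limz prel b)"
    if ab: "a \<in> ?C" "b \<in> ?C" for a b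
    using two[OF ab] by (elim exE conjE) (rule I[OF zconv_mult])
  show "(\<lambda>n. a n + b n) \<in> ?C \<and> limz prel (\<lambda>n. a n + b n) = (\<lambda>r. limz prel a r + limz prel b r)"
    if ab: "a \<in> ?C" "b \<in> ?C" for a b
    using two[OF ab] by (elim exE conjE) (rule I[OF zconv_add])
  show "(\<lambda>n. scale c (a n)) \<in> ?C \<and> limz prel (\<lambda>n. scale c (a n)) = (\<lambda>r. c * limz prel a r)" if a: "a \<in> ?C" for c a
    using two[OF a a] by (elim exE conjE) (rule I[OF zconv_scale])
  show "(\<lambda>n. delta 1) \<in> ?C \<and> limz prel (\<lambda>n. delta 1) = unit_fun"
    by (rule I[OF zconv_delta[of 1 0]]) simp
  show "(\<lambda>n. 0) \<in> ?C \<and> limz prel (\<lambda>n. 0) = (\<lambda>r. 0)" by (rule I[OF zconv_zero])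
qed

theorem theorem1p1:
  shows "assoc_algebra virtual_group_algebra \<and> assoc_algebra centralizer_algebra \<and>
         (\<exists>h. h \<in> algebra_iso virtual_group_algebra centralizer_algebra)"
  unfolding virtual_group_algebra_def centralizer_algebra_def
  using fun_algebra_of_seq_rep[OF virtual_seq_rep] fun_algebra_of_seq_rep[OF centralizer_seq_rep]
    seq_rep_iso[OF virtual_seq_rep centralizer_seq_rep] by blast

end
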